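(* Let $M$ be a $3$-dimensional smooth manifold and let $(\eta_1,\Omega_1)$, $(\eta_2,\Omega_2)$ be cosymplectic structures on $M$. On $M\times\mathbb{R}$, with $t$ the coordinate on $\mathbb{R}$, put $\omega_i:=dt\wedge\eta_i+\Omega_i$ for $i=1,2$, and orient $M\times\mathbb{R}$ by $dt\wedge\eta_1\wedge\Omega_1$. Then: (a) $(\omega_1,\omega_2)$ is a conformal symplectic couple on $M\times\mathbb{R}$ if and only if $\{(\eta_1,\Omega_1),(\eta_2,\Omega_2)\}$ is a taut cosymplectic circle on $M$. (b) If $\{(\eta_1,\Omega_1),(\eta_2,\Omega_2)\}$ is a taut cosymplectic circle on $M$, then there is a unique complex structure $J$ on $M\times\mathbb{R}$ such that the nowhere vanishing forms of type $(2,0)$ with respect to $J$ are precisely the forms $\tilde\omega_1+i\tilde\omega_2$, where $(\tilde\omega_1,\tilde\omega_2)$ is any conformal couple equivalent to $(\omega_1,\omega_2)$. Moreover, $J$ is the unique endomorphism of $T(M\times\mathbb{R})$ such that $i_X\omega_1=i_{JX}\omega_2$ for every $X\in T(M\times\mathbb{R})$.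
   Context: A cosymplectic structure on a $3$-manifold $M$ is a pair $(\eta,\Omega)$ with $\eta$ a closed $1$-form and $\Omega$ a closed $2$-form such that $\eta\wedge\Omega$ is a volume form. Two cosymplectic structures $(\eta_1,\Omega_1)$, $(\eta_2,\Omega_2)$ generate a cosymplectic circle if $(\lambda_1\eta_1+\lambda_2\eta_2,\lambda_1\Omega_1+\lambda_2\Omega_2)$ is a cosymplectic structure for all $(\lambda_1,\lambda_2)\in\mathbb{S}^1$; the circle is taut if the $3$-form $(\lambda_1\eta_1+\lambda_2\eta_2)\wedge(\lambda_1\Omega_1+\lambda_2\Omega_2)$ is the same for all $(\lambda_1,\lambda_2)\in\mathbb{S}^1$. On an oriented $4$-manifold, a pair $(\omega_1,\omega_2)$ of nondegenerate $2$-forms is a couple if $\omega_1\wedge\omega_2\equiv 0$ and $\omega_1^2,\omega_2^2$ are volume forms defining the positive orientation; it is a conformal couple if in addition $\omega_1^2=\omega_2^2$. A (conformal) couple is called symplectic if $\omega_1$ and $\omega_2$ are symplectic. Two couples are equivalent if at every point they span the same oriented plane of nondegenerate $2$-forms. *)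

theory Defs
  imports "HOL-Analysis.Analysis"
begin

section \<open>Smooth functions on open subsets of Euclidean spaces\<close>

primrec Ck_on ::
  "nat \<Rightarrow> 'e::euclidean_space set \<Rightarrow> ('e \<Rightarrow> 'b::real_normed_vector) \<Rightarrow> bool"
where
  "Ck_on 0 S f \<longleftrightarrow> continuous_on S f"
| "Ck_on (Suc k) S f \<longleftrightarrow>
     (\<forall>x\<in>S. f differentiable (at x)) \<and>
     (\<forall>v. Ck_on k S (\<lambda>x. frechet_derivative f (at x) v))"

text \<open>Only meaningful for open \<open>S\<close>.\<close>

definition smooth_on :: "'e::euclidean_space set \<Rightarrow> ('e \<Rightarrow> 'b::real_normed_vector) \<Rightarrow> bool"
  where "smooth_on S f \<longleftrightarrow> (\<forall>k. Ck_on k S f)"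


section \<open>Smooth manifolds\<close>

text \<open>A chart is a pair of its domain and a coordinate map (whose values outside the domain are
  irrelevant).\<close>

type_synonym ('a, 'e) chart = "'a set \<times> ('a \<Rightarrow> 'e)"

abbreviation cinv :: "('a, 'e) chart \<Rightarrow> 'e \<Rightarrow> 'a"
  where "cinv c \<equiv> inv_into (fst c) (snd c)"

definition is_chart :: "'a topology \<Rightarrow> ('a, 'e::euclidean_space) chart \<Rightarrow> bool"
  where "is_chart X c \<longleftrightarrow>
    openin X (fst c) \<and> open (snd c ` fst c) \<and>
    homeomorphic_map (subtopology X (fst c)) (top_of_set (snd c ` fst c)) (snd c)"

definition smooth_compat ::
  "('a, 'e::euclidean_space) chart \<Rightarrow> ('a, 'f::euclidean_space) chart \<Rightarrow> bool"
  where "smooth_compat c d \<longleftrightarrow>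
    smooth_on (snd c ` (fst c \<inter> fst d)) (snd d \<circ> cinv c) \<and>
    smooth_on (snd d ` (fst c \<inter> fst d)) (snd c \<circ> cinv d)"

text \<open>A smooth manifold of dimension \<open>DIM('e)\<close>, given by a topology and a smooth atlas. The atlas
  is not required to be maximal.\<close>

definition smooth_manifold :: "'a topology \<Rightarrow> ('a, 'e::euclidean_space) chart set \<Rightarrow> bool"
  where "smooth_manifold X A \<longleftrightarrow>
    Hausdorff_space X \<and> second_countable X \<and>
    \<Union>(fst ` A) = topspace X \<and>
    (\<forall>c\<in>A. is_chart X c) \<and>
    (\<forall>c\<in>A. \<forall>d\<in>A. smooth_compat c d)"

definition pts :: "('a, 'e) chart set \<Rightarrow> 'a set"
  where "pts A = \<Union>(fst ` A)"

definition prod_atlas ::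
  "('a, 'e) chart set \<Rightarrow> ('b, 'f) chart set \<Rightarrow> ('a \<times> 'b, 'e \<times> 'f) chart set"
  where "prod_atlas A B = {(fst c \<times> fst d, map_prod (snd c) (snd d)) | c d. c \<in> A \<and> d \<in> B}"

definition line_atlas :: "(real, real) chart set"
  where "line_atlas = {(UNIV, id)}"


section \<open>Tangent vectors and differentials\<close>

text \<open>A tangent vector at \<open>p\<close> is the family of its coordinate vectors in the charts around \<open>p\<close>, related
  by the Jacobians of the coordinate changes, and extended by \<open>0\<close> to all other arguments.\<close>

type_synonym ('a, 'e) tvec = "('a, 'e) chart \<Rightarrow> 'e"

definition trans_deriv ::
  "('a, 'e::euclidean_space) chart \<Rightarrow> ('a, 'e) chart \<Rightarrow> 'a \<Rightarrow> 'e \<Rightarrow> 'e"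
  where "trans_deriv c d p = frechet_derivative (snd d \<circ> cinv c) (at (snd c p))"

definition tangent_space ::
  "('a, 'e::euclidean_space) chart set \<Rightarrow> 'a \<Rightarrow> ('a, 'e) tvec set"
  where "tangent_space A p = {u.
    (\<forall>c\<in>A. \<forall>d\<in>A. p \<in> fst c \<inter> fst d \<longrightarrow> u d = trans_deriv c d p (u c)) \<and>
    (\<forall>c. c \<notin> A \<or> p \<notin> fst c \<longrightarrow> u c = 0)}"

text \<open>The tangent vector at \<open>p\<close> whose coordinate vector in the chart \<open>c\<close> is \<open>e\<close>.\<close>

definition coord_vec ::
  "('a, 'e::euclidean_space) chart set \<Rightarrow> ('a, 'e) chart \<Rightarrow> 'a \<Rightarrow> 'e \<Rightarrow> ('a, 'e) tvec"
  where "coord_vec A c p e = (\<lambda>d. if d \<in> A \<and> p \<in> fst d then trans_deriv c d p e else 0)"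

definition tzero :: "('a, 'e::euclidean_space) tvec"
  where "tzero = (\<lambda>c. 0)"

definition tcomb ::
  "real \<Rightarrow> ('a, 'e::euclidean_space) tvec \<Rightarrow> real \<Rightarrow> ('a, 'e) tvec \<Rightarrow> ('a, 'e) tvec"
  where "tcomb a u b w = (\<lambda>c. a *\<^sub>R u c + b *\<^sub>R w c)"

text \<open>The differential at \<open>p\<close> of a map \<open>f\<close> into a normed space, applied to \<open>u\<close>. For a smooth atlas
  and \<open>u\<close> tangent at \<open>p\<close>, the choice of the chart does not matter.\<close>

definition differential ::
  "('a, 'e::euclidean_space) chart set \<Rightarrow> ('a \<Rightarrow> 'b::real_normed_vector) \<Rightarrow> 'a
    \<Rightarrow> ('a, 'e) tvec \<Rightarrow> 'b"
  where "differential A f p u =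
    (let c = (SOME c. c \<in> A \<and> p \<in> fst c)
     in frechet_derivative (f \<circ> cinv c) (at (snd c p)) (u c))"

definition tangent_map ::
  "('a, 'e::euclidean_space) chart set \<Rightarrow> ('b, 'f::euclidean_space) chart set \<Rightarrow> ('a \<Rightarrow> 'b)
    \<Rightarrow> 'a \<Rightarrow> ('a, 'e) tvec \<Rightarrow> ('b, 'f) tvec"
  where "tangent_map A B f p u =
    (\<lambda>d. if d \<in> B \<and> f p \<in> fst d then differential A (snd d \<circ> f) p u else 0)"


section \<open>Differential forms\<close>

text \<open>A form takes a point \<open>p\<close> and a sequence \<open>v\<close> of tangent vectors at \<open>p\<close>; a \<open>k\<close>-form only looks at
  \<open>v 0, \<dots>, v (k - 1)\<close>. Values at other points and on non-tangent arguments are irrelevant, and so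
  equality of forms is \<open>form_eq\<close>.\<close>

type_synonym ('a, 'e, 'b) form = "'a \<Rightarrow> (nat \<Rightarrow> ('a, 'e) tvec) \<Rightarrow> 'b"

definition tuples ::
  "('a, 'e::euclidean_space) chart set \<Rightarrow> nat \<Rightarrow> 'a \<Rightarrow> (nat \<Rightarrow> ('a, 'e) tvec) set"
  where "tuples A k p = {v. \<forall>i<k. v i \<in> tangent_space A p}"

definition form_eq ::
  "('a, 'e::euclidean_space) chart set \<Rightarrow> nat \<Rightarrow> ('a, 'e, 'b) form \<Rightarrow> ('a, 'e, 'b) form \<Rightarrow> bool"
  where "form_eq A k \<alpha> \<beta> \<longleftrightarrow> (\<forall>p\<in>pts A. \<forall>v\<in>tuples A k p. \<alpha> p v = \<beta> p v)"

definition alternating_at ::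
  "('a, 'e::euclidean_space) chart set \<Rightarrow> nat \<Rightarrow> ('a, 'e, 'b::real_normed_vector) form \<Rightarrow> 'a \<Rightarrow> bool"
  where "alternating_at A k \<alpha> p \<longleftrightarrow>
    (\<forall>v\<in>tuples A k p. \<forall>i<k. \<forall>u\<in>tangent_space A p. \<forall>w\<in>tangent_space A p. \<forall>a b.
       \<alpha> p (v(i := tcomb a u b w)) = a *\<^sub>R \<alpha> p (v(i := u)) + b *\<^sub>R \<alpha> p (v(i := w))) \<and>
    (\<forall>v\<in>tuples A k p. \<forall>i j. i < j \<and> j < k \<and> v i = v j \<longrightarrow> \<alpha> p v = 0) \<and>
    (\<forall>v\<in>tuples A k p. \<forall>v'. (\<forall>i<k. v i = v' i) \<longrightarrow> \<alpha> p v = \<alpha> p v')"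

text \<open>The expression of a form in the coordinates of a chart \<open>c\<close>: a form on the open set
  \<open>snd c ` fst c\<close> of the model space.\<close>

definition local_form ::
  "('a, 'e::euclidean_space) chart set \<Rightarrow> ('a, 'e) chart \<Rightarrow> ('a, 'e, 'b) form
    \<Rightarrow> 'e \<Rightarrow> (nat \<Rightarrow> 'e) \<Rightarrow> 'b"
  where "local_form A c \<alpha> x e = \<alpha> (cinv c x) (\<lambda>i. coord_vec A c (cinv c x) (e i))"

definition smooth_form ::
  "('a, 'e::euclidean_space) chart set \<Rightarrow> nat \<Rightarrow> ('a, 'e, 'b::real_normed_vector) form \<Rightarrow> bool"
  where "smooth_form A k \<alpha> \<longleftrightarrow>
    (\<forall>p\<in>pts A. alternating_at A k \<alpha> p) \<and>
    (\<forall>c\<in>A. \<forall>e. smooth_on (snd c ` fst c) (\<lambda>x. local_form A c \<alpha> x e))"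

text \<open>The exterior derivative of a \<open>k\<close>-form on an open subset of a Euclidean space:
  \<open>d\<alpha>(e\<^sub>0, \<dots>, e\<^sub>k) = \<Sum>\<^sub>i (-1)\<^sup>i D(\<alpha>(e\<^sub>0, \<dots>, e\<^sub>i omitted, \<dots>, e\<^sub>k)) e\<^sub>i\<close>.\<close>

definition ext_deriv ::
  "nat \<Rightarrow> ('e::euclidean_space \<Rightarrow> (nat \<Rightarrow> 'e) \<Rightarrow> real) \<Rightarrow> 'e \<Rightarrow> (nat \<Rightarrow> 'e) \<Rightarrow> real"
  where "ext_deriv k \<alpha> x e =
    (\<Sum>i\<le>k. (-1) ^ i *
       frechet_derivative (\<lambda>y. \<alpha> y (\<lambda>j. if j < i then e j else e (Suc j))) (at x) (e i))"

definition closed_form ::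
  "('a, 'e::euclidean_space) chart set \<Rightarrow> nat \<Rightarrow> ('a, 'e, real) form \<Rightarrow> bool"
  where "closed_form A k \<alpha> \<longleftrightarrow>
    (\<forall>c\<in>A. \<forall>x\<in>snd c ` fst c. \<forall>e. ext_deriv k (local_form A c \<alpha>) x e = 0)"

text \<open>Wedge product of a \<open>k\<close>-form and an \<open>l\<close>-form, normalised so that
  \<open>(\<alpha> \<and> \<beta>)(u, w) = \<alpha>(u)\<beta>(w) - \<alpha>(w)\<beta>(u)\<close> for 1-forms.\<close>

definition wedge ::
  "nat \<Rightarrow> nat \<Rightarrow> ('a, 'e, real) form \<Rightarrow> ('a, 'e, real) form \<Rightarrow> ('a, 'e, real) form"
  where "wedge k l \<alpha> \<beta> = (\<lambda>p v.
    (\<Sum>\<sigma> | \<sigma> permutes {..<k + l}.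
       of_int (sign \<sigma>) * \<alpha> p (\<lambda>i. v (\<sigma> i)) * \<beta> p (\<lambda>i. v (\<sigma> (k + i))))
    / (fact k * fact l))"

definition lin_comb ::
  "real \<Rightarrow> ('a, 'e, real) form \<Rightarrow> real \<Rightarrow> ('a, 'e, real) form \<Rightarrow> ('a, 'e, real) form"
  where "lin_comb a \<alpha> b \<beta> = (\<lambda>p v. a * \<alpha> p v + b * \<beta> p v)"

definition pullback ::
  "('a, 'e::euclidean_space) chart set \<Rightarrow> ('b, 'f::euclidean_space) chart set \<Rightarrow> ('a \<Rightarrow> 'b)
    \<Rightarrow> ('b, 'f, real) form \<Rightarrow> ('a, 'e, real) form"
  where "pullback A B f \<alpha> = (\<lambda>p v. \<alpha> (f p) (\<lambda>i. tangent_map A B f p (v i)))"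

definition nowhere_vanishing ::
  "('a, 'e::euclidean_space) chart set \<Rightarrow> nat \<Rightarrow> ('a, 'e, 'b::zero) form \<Rightarrow> bool"
  where "nowhere_vanishing A k \<alpha> \<longleftrightarrow> (\<forall>p\<in>pts A. \<exists>v\<in>tuples A k p. \<alpha> p v \<noteq> 0)"

definition volume_form ::
  "('a, 'e::euclidean_space) chart set \<Rightarrow> ('a, 'e, real) form \<Rightarrow> bool"
  where "volume_form A \<mu> \<longleftrightarrow> smooth_form A DIM('e) \<mu> \<and> nowhere_vanishing A DIM('e) \<mu>"

text \<open>The volume form \<open>\<nu>\<close> defines the same orientation as the volume form \<open>\<mu>\<close>.\<close>

definition positive_wrt ::
  "('a, 'e::euclidean_space) chart set \<Rightarrow> ('a, 'e, real) form \<Rightarrow> ('a, 'e, real) form \<Rightarrow> bool"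
  where "positive_wrt A \<mu> \<nu> \<longleftrightarrow>
    (\<forall>p\<in>pts A. \<forall>v\<in>tuples A DIM('e) p. 0 < \<mu> p v \<longrightarrow> 0 < \<nu> p v)"


section \<open>Cosymplectic circles\<close>

definition cosymplectic ::
  "('a, real ^ 3) chart set \<Rightarrow> ('a, real ^ 3, real) form \<Rightarrow> ('a, real ^ 3, real) form \<Rightarrow> bool"
  where "cosymplectic A \<eta> \<Omega> \<longleftrightarrow>
    smooth_form A 1 \<eta> \<and> closed_form A 1 \<eta> \<and>
    smooth_form A 2 \<Omega> \<and> closed_form A 2 \<Omega> \<and>
    volume_form A (wedge 1 2 \<eta> \<Omega>)"

definition cosymplectic_circle ::
  "('a, real ^ 3) chart set \<Rightarrow> ('a, real ^ 3, real) form \<Rightarrow> ('a, real ^ 3, real) form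
    \<Rightarrow> ('a, real ^ 3, real) form \<Rightarrow> ('a, real ^ 3, real) form \<Rightarrow> bool"
  where "cosymplectic_circle A \<eta>1 \<Omega>1 \<eta>2 \<Omega>2 \<longleftrightarrow>
    (\<forall>a b. a\<^sup>2 + b\<^sup>2 = 1 \<longrightarrow> cosymplectic A (lin_comb a \<eta>1 b \<eta>2) (lin_comb a \<Omega>1 b \<Omega>2))"

definition taut_cosymplectic_circle ::
  "('a, real ^ 3) chart set \<Rightarrow> ('a, real ^ 3, real) form \<Rightarrow> ('a, real ^ 3, real) form
    \<Rightarrow> ('a, real ^ 3, real) form \<Rightarrow> ('a, real ^ 3, real) form \<Rightarrow> bool"
  where "taut_cosymplectic_circle A \<eta>1 \<Omega>1 \<eta>2 \<Omega>2 \<longleftrightarrow>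
    cosymplectic_circle A \<eta>1 \<Omega>1 \<eta>2 \<Omega>2 \<and>
    (\<forall>a b a' b'. a\<^sup>2 + b\<^sup>2 = 1 \<and> a'\<^sup>2 + b'\<^sup>2 = 1 \<longrightarrow>
       form_eq A 3 (wedge 1 2 (lin_comb a \<eta>1 b \<eta>2) (lin_comb a \<Omega>1 b \<Omega>2))
                   (wedge 1 2 (lin_comb a' \<eta>1 b' \<eta>2) (lin_comb a' \<Omega>1 b' \<Omega>2)))"


section \<open>Couples of 2-forms\<close>

definition nondegenerate ::
  "('a, 'e::euclidean_space) chart set \<Rightarrow> ('a, 'e, real) form \<Rightarrow> bool"
  where "nondegenerate A \<omega> \<longleftrightarrow>
    (\<forall>p\<in>pts A. \<forall>u\<in>tangent_space A p.
       u \<noteq> tzero \<longrightarrow> (\<exists>w\<in>tangent_space A p. \<omega> p (case_nat u (\<lambda>_. w)) \<noteq> 0))"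

definition symplectic ::
  "('a, 'e::euclidean_space) chart set \<Rightarrow> ('a, 'e, real) form \<Rightarrow> bool"
  where "symplectic A \<omega> \<longleftrightarrow> smooth_form A 2 \<omega> \<and> closed_form A 2 \<omega> \<and> nondegenerate A \<omega>"

text \<open>Couples on a manifold modelled on a 4-dimensional space \<open>'e\<close> and oriented by the volume
  form \<open>\<mu>\<close>.\<close>

definition couple ::
  "('a, 'e::euclidean_space) chart set \<Rightarrow> ('a, 'e, real) form
    \<Rightarrow> ('a, 'e, real) form \<Rightarrow> ('a, 'e, real) form \<Rightarrow> bool"
  where "couple A \<mu> \<omega>1 \<omega>2 \<longleftrightarrow>
    smooth_form A 2 \<omega>1 \<and> nondegenerate A \<omega>1 \<and>
    smooth_form A 2 \<omega>2 \<and> nondegenerate A \<omega>2 \<and>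
    form_eq A 4 (wedge 2 2 \<omega>1 \<omega>2) (\<lambda>p v. 0) \<and>
    volume_form A (wedge 2 2 \<omega>1 \<omega>1) \<and> positive_wrt A \<mu> (wedge 2 2 \<omega>1 \<omega>1) \<and>
    volume_form A (wedge 2 2 \<omega>2 \<omega>2) \<and> positive_wrt A \<mu> (wedge 2 2 \<omega>2 \<omega>2)"

definition conformal_couple ::
  "('a, 'e::euclidean_space) chart set \<Rightarrow> ('a, 'e, real) form
    \<Rightarrow> ('a, 'e, real) form \<Rightarrow> ('a, 'e, real) form \<Rightarrow> bool"
  where "conformal_couple A \<mu> \<omega>1 \<omega>2 \<longleftrightarrow>
    couple A \<mu> \<omega>1 \<omega>2 \<and> form_eq A 4 (wedge 2 2 \<omega>1 \<omega>1) (wedge 2 2 \<omega>2 \<omega>2)"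

definition conformal_symplectic_couple ::
  "('a, 'e::euclidean_space) chart set \<Rightarrow> ('a, 'e, real) form
    \<Rightarrow> ('a, 'e, real) form \<Rightarrow> ('a, 'e, real) form \<Rightarrow> bool"
  where "conformal_symplectic_couple A \<mu> \<omega>1 \<omega>2 \<longleftrightarrow>
    conformal_couple A \<mu> \<omega>1 \<omega>2 \<and> symplectic A \<omega>1 \<and> symplectic A \<omega>2"

text \<open>Spanning the same oriented plane at every point: the two ordered bases of the plane are
  related by a matrix of positive determinant (depending on the point).\<close>

definition equivalent_couples ::
  "('a, 'e::euclidean_space) chart set \<Rightarrow> ('a, 'e, real) form \<Rightarrow> ('a, 'e, real) form
    \<Rightarrow> ('a, 'e, real) form \<Rightarrow> ('a, 'e, real) form \<Rightarrow> bool"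
  where "equivalent_couples A \<alpha>1 \<alpha>2 \<beta>1 \<beta>2 \<longleftrightarrow>
    (\<forall>p\<in>pts A. \<exists>a b c d. 0 < a * d - b * c \<and>
       (\<forall>v\<in>tuples A 2 p. \<alpha>1 p v = lin_comb a \<beta>1 b \<beta>2 p v \<and> \<alpha>2 p v = lin_comb c \<beta>1 d \<beta>2 p v))"


section \<open>Complex structures\<close>

type_synonym ('a, 'e) endo = "'a \<Rightarrow> ('a, 'e) tvec \<Rightarrow> ('a, 'e) tvec"

definition endomorphism ::
  "('a, 'e::euclidean_space) chart set \<Rightarrow> ('a, 'e) endo \<Rightarrow> bool"
  where "endomorphism A J \<longleftrightarrow>
    (\<forall>p\<in>pts A. \<forall>u\<in>tangent_space A p. J p u \<in> tangent_space A p) \<and>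
    (\<forall>p\<in>pts A. \<forall>u\<in>tangent_space A p. \<forall>w\<in>tangent_space A p. \<forall>a b.
       J p (tcomb a u b w) = tcomb a (J p u) b (J p w)) \<and>
    (\<forall>c\<in>A. \<forall>e. smooth_on (snd c ` fst c)
       (\<lambda>x. J (cinv c x) (coord_vec A c (cinv c x) e) c))"

definition endo_eq ::
  "('a, 'e::euclidean_space) chart set \<Rightarrow> ('a, 'e) endo \<Rightarrow> ('a, 'e) endo \<Rightarrow> bool"
  where "endo_eq A J K \<longleftrightarrow> (\<forall>p\<in>pts A. \<forall>u\<in>tangent_space A p. J p u = K p u)"

definition almost_complex ::
  "('a, 'e::euclidean_space) chart set \<Rightarrow> ('a, 'e) endo \<Rightarrow> bool"
  where "almost_complex A J \<longleftrightarrow> endomorphism A J \<and>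
    (\<forall>p\<in>pts A. \<forall>u\<in>tangent_space A p. \<forall>c. J p (J p u) c = - u c)"

text \<open>A complex chart of the smooth manifold in whose coordinates \<open>J\<close> is multiplication by \<open>\<i>\<close>.
  Transition maps between such charts are holomorphic.\<close>

definition holomorphic_chart ::
  "'a topology \<Rightarrow> ('a, 'e::euclidean_space) chart set \<Rightarrow> ('a, 'e) endo
    \<Rightarrow> ('a, complex ^ 'n) chart \<Rightarrow> bool"
  where "holomorphic_chart X A J z \<longleftrightarrow>
    is_chart X z \<and> (\<forall>c\<in>A. smooth_compat c z) \<and>
    (\<forall>p\<in>fst z. \<forall>u\<in>tangent_space A p.
       differential A (snd z) p (J p u) = \<i> *s differential A (snd z) p u)"

text \<open>A complex structure on a (real) 4-manifold: an almost complex structure that is induced by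
  an atlas of complex charts with holomorphic transition maps.\<close>

definition complex_structure ::
  "'a topology \<Rightarrow> ('a, 'e::euclidean_space) chart set \<Rightarrow> ('a, 'e) endo \<Rightarrow> bool"
  where "complex_structure X A J \<longleftrightarrow> almost_complex A J \<and>
    (\<forall>p\<in>pts A. \<exists>z :: ('a, complex ^ 2) chart. p \<in> fst z \<and> holomorphic_chart X A J z)"

text \<open>A complex 2-form is of type \<open>(2,0)\<close> if its complex bilinear extension vanishes as soon as one
  argument is of type \<open>(0,1)\<close>, i.e. of the form \<open>u + \<i> J u\<close>.\<close>

definition type_2_0 ::
  "('a, 'e::euclidean_space) chart set \<Rightarrow> ('a, 'e) endo \<Rightarrow> ('a, 'e, complex) form \<Rightarrow> bool"
  where "type_2_0 A J \<alpha> \<longleftrightarrow> smooth_form A 2 \<alpha> \<and>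
    (\<forall>p\<in>pts A. \<forall>u\<in>tangent_space A p. \<forall>w\<in>tangent_space A p.
       \<alpha> p (case_nat u (\<lambda>_. w)) + \<i> * \<alpha> p (case_nat (J p u) (\<lambda>_. w)) = 0)"

definition complex_form ::
  "('a, 'e, real) form \<Rightarrow> ('a, 'e, real) form \<Rightarrow> ('a, 'e, complex) form"
  where "complex_form \<alpha> \<beta> = (\<lambda>p v. complex_of_real (\<alpha> p v) + \<i> * complex_of_real (\<beta> p v))"

text \<open>The nowhere vanishing forms of type \<open>(2,0)\<close> are precisely the forms \<open>\<alpha>1 + \<i> \<alpha>2\<close> with
  \<open>(\<alpha>1, \<alpha>2)\<close> a conformal couple equivalent to \<open>(\<omega>1, \<omega>2)\<close>.\<close>

definition forms_2_0_from_couple ::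
  "('a, 'e::euclidean_space) chart set \<Rightarrow> ('a, 'e, real) form
    \<Rightarrow> ('a, 'e, real) form \<Rightarrow> ('a, 'e, real) form \<Rightarrow> ('a, 'e) endo \<Rightarrow> bool"
  where "forms_2_0_from_couple A \<mu> \<omega>1 \<omega>2 J \<longleftrightarrow>
    (\<forall>\<alpha>. smooth_form A 2 \<alpha> \<longrightarrow>
       (type_2_0 A J \<alpha> \<and> nowhere_vanishing A 2 \<alpha> \<longleftrightarrow>
        (\<exists>\<alpha>1 \<alpha>2. conformal_couple A \<mu> \<alpha>1 \<alpha>2 \<and> equivalent_couples A \<alpha>1 \<alpha>2 \<omega>1 \<omega>2 \<and>
                  form_eq A 2 \<alpha> (complex_form \<alpha>1 \<alpha>2))))"

definition interior_prod ::
  "('a, 'e) tvec \<Rightarrow> ('a, 'e, 'b) form \<Rightarrow> ('a, 'e, 'b) form"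
  where "interior_prod u \<alpha> = (\<lambda>p v. \<alpha> p (case_nat u v))"

text \<open>The condition \<open>i\<^sub>u \<omega>1 = i\<^bsub>J u\<^esub> \<omega>2\<close> for all tangent vectors \<open>u\<close>.\<close>

definition intertwines ::
  "('a, 'e::euclidean_space) chart set \<Rightarrow> ('a, 'e, real) form \<Rightarrow> ('a, 'e, real) form
    \<Rightarrow> ('a, 'e) endo \<Rightarrow> bool"
  where "intertwines A \<omega>1 \<omega>2 J \<longleftrightarrow>
    (\<forall>p\<in>pts A. \<forall>u\<in>tangent_space A p. \<forall>v\<in>tuples A 1 p.
       interior_prod u \<omega>1 p v = interior_prod (J p u) \<omega>2 p v)"


section \<open>Forms on the product with the real line\<close>

definition cyl :: "('a, real ^ 3) chart set \<Rightarrow> ('a \<times> real, (real ^ 3) \<times> real) chart set"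
  where "cyl A = prod_atlas A line_atlas"

definition dt :: "('a, real ^ 3) chart set \<Rightarrow> ('a \<times> real, (real ^ 3) \<times> real, real) form"
  where "dt A = (\<lambda>p v. differential (cyl A) snd p (v 0))"

abbreviation lift ::
  "('a, real ^ 3) chart set \<Rightarrow> ('a, real ^ 3, real) form
    \<Rightarrow> ('a \<times> real, (real ^ 3) \<times> real, real) form"
  where "lift A \<alpha> \<equiv> pullback (cyl A) A fst \<alpha>"

definition cyl_form ::
  "('a, real ^ 3) chart set \<Rightarrow> ('a, real ^ 3, real) form \<Rightarrow> ('a, real ^ 3, real) form
    \<Rightarrow> ('a \<times> real, (real ^ 3) \<times> real, real) form"
  where "cyl_form A \<eta> \<Omega> = lin_comb 1 (wedge 1 1 (dt A) (lift A \<eta>)) 1 (lift A \<Omega>)"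

definition cyl_orientation ::
  "('a, real ^ 3) chart set \<Rightarrow> ('a, real ^ 3, real) form \<Rightarrow> ('a, real ^ 3, real) form
    \<Rightarrow> ('a \<times> real, (real ^ 3) \<times> real, real) form"
  where "cyl_orientation A \<eta> \<Omega> = wedge 1 3 (dt A) (wedge 1 2 (lift A \<eta>) (lift A \<Omega>))"

end

theory Submission
  imports Defs
begin

text \<open>In a chart of \<open>M\<close>, \<open>\<eta>i\<close> becomes a covector \<open>ni\<close> and \<open>\<Omega>i = Vi \<bullet> cross3\<close> a vector \<open>Vi\<close>.
  Both the conformal couple condition and tautness amount to \<open>n1 \<bullet> V1 = n2 \<bullet> V2\<close> and
  \<open>n1 \<bullet> V2 = - (n2 \<bullet> V1)\<close>. Under it \<open>\<omega>1 + \<i> \<omega>2\<close> is pointwise decomposable and complex bilinear for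
  \<open>J = \<omega>2\<inverse> \<omega>1\<close>, and every complex bilinear 2-form is a complex multiple of it; this gives both
  uniqueness claims. For integrability, take locally \<open>df = \<eta>1 + \<i> \<eta>2\<close>. If also
  \<open>\<Omega>1 + \<i> \<Omega>2 = df \<and> dh\<close>, then \<open>\<omega>1 + \<i> \<omega>2 = df \<and> d(h - t)\<close>, so \<open>(f, h - t)\<close> are holomorphic
  coordinates. To find \<open>h\<close>, use \<open>Re f\<close> and \<open>Im f\<close> as two coordinates on \<open>M\<close>: integration along the
  third one reduces the problem to an inhomogeneous Cauchy--Riemann equation in the plane, which
  the Cauchy transform solves. No Newlander--Nirenberg theorem is needed.\<close>

section \<open>Calculus of smooth functions\<close>

text \<open>Write \<open>\<eta> = \<eta>1 + \<i> \<eta>2\<close> and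
  \<open>\<Omega> = \<Omega>1 + \<i> \<Omega>2\<close>. The two pointwise equations are the real and
  the imaginary part of \<open>\<eta> \<and> \<Omega> = 0\<close>. Hence, where
  \<open>\<eta> = df\<close>, the form \<open>\<Omega>\<close> is divisible by \<open>df\<close>,
  and the problem is to choose an exact quotient \<open>dh\<close>. In coordinates with
  \<open>f = y1 + \<i> y2\<close> the equation \<open>\<Omega> = df \<and> dh\<close> prescribes
  only the partial derivative \<open>h_3\<close> and the combination \<open>h_1 + \<i> h_2\<close>,
  twice the d-bar derivative of \<open>h\<close> in the plane; \<open>d\<Omega> = 0\<close> is the
  compatibility condition of these two prescriptions. The data are merely smooth, so the d-bar
  equation needs an integral formula, and this is why parameter integrals and cutoffs are developed
  first. Independence of the coordinates comes for free:
  \<open>n1 \<bullet> V1 = - det (n1, n2, d (Im h))\<close>, so \<open>Re f\<close>,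
  \<open>Im f\<close>, \<open>Im h\<close> are coordinates on \<open>M\<close>, and the remaining
  real coordinate \<open>Re h - t\<close> brings in \<open>t\<close>.\<close>

lemma frechet_derivative_eqI: "(f has_derivative f') (at x) \<Longrightarrow> frechet_derivative f (at x) = f'"
  using frechet_derivative_at by metis

lemma differentiable_transform_open:
  assumes "open S" "x \<in> S" "\<And>y. y \<in> S \<Longrightarrow> f y = g y" "f differentiable (at x)"
  shows "g differentiable (at x)" "frechet_derivative g (at x) = frechet_derivative f (at x)"
proof -
  have "(f has_derivative frechet_derivative f (at x)) (at x)"
    using assms(4) frechet_derivative_works by blast
  then have *: "(g has_derivative frechet_derivative f (at x)) (at x)"
    using assms(1-3) has_derivative_transform_within_open by blast
  show "g differentiable (at x)" using * differentiable_def by blast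
  show "frechet_derivative g (at x) = frechet_derivative f (at x)"
    by (rule frechet_derivative_eqI[OF *])
qed

text \<open>\<open>frechet_derivative\<close> chooses among all derivatives at the point, and
  functions that agree near it offer the same set to choose from. So the equality also covers points
  where neither function is differentiable.\<close>

lemma frechet_derivative_cong_open:
  assumes "open S" "x \<in> S" "\<And>y. y \<in> S \<Longrightarrow> f y = g y"
  shows "frechet_derivative f (at x) = frechet_derivative g (at x)"
proof -
  have "(f has_derivative f') (at x) \<longleftrightarrow> (g has_derivative f') (at x)" for f'
    using assms has_derivative_transform_within_open[of f f' x UNIV S g]
      has_derivative_transform_within_open[of g f' x UNIV S f] by auto
  then show ?thesis unfolding frechet_derivative_def by presburger
qed

lemma Ck_on_cong:
  assumes "open S" "\<And>x. x \<in> S \<Longrightarrow> f x = g x"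
  shows "Ck_on k S f \<longleftrightarrow> Ck_on k S g"
  using assms(2)
proof (induction k arbitrary: f g)
  case 0
  then show ?case using continuous_on_cong by force
next
  case (Suc k)
  have d: "f differentiable (at x) \<longleftrightarrow> g differentiable (at x)"
    "frechet_derivative f (at x) = frechet_derivative g (at x)" if "x \<in> S" for x
    using differentiable_transform_open[OF assms(1) that, of f g]
      differentiable_transform_open[OF assms(1) that, of g f] Suc.prems
      frechet_derivative_cong_open[OF assms(1) that, of f g] by metis+
  have "Ck_on k S (\<lambda>x. frechet_derivative f (at x) v) \<longleftrightarrow> Ck_on k S (\<lambda>x. frechet_derivative g (at x) v)" for v
    by (rule Suc.IH) (simp add: d)
  then show ?case using d by auto
qed

text \<open>Trades the chosen \<open>frechet_derivative\<close> in \<open>Ck_on\<close> for any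
  derivative that can be written down. The closure rules below are inductions on the order through
  this rule.\<close>

lemma Ck_on_SucI:
  assumes "open S" "\<And>x. x \<in> S \<Longrightarrow> (f has_derivative f' x) (at x)"
    "\<And>v. Ck_on k S (\<lambda>x. f' x v)"
  shows "Ck_on (Suc k) S f"
proof -
  have "Ck_on k S (\<lambda>x. frechet_derivative f (at x) v)" for v
    using assms(3) Ck_on_cong[OF assms(1), of "\<lambda>x. frechet_derivative f (at x) v" "\<lambda>x. f' x v"]
    by (simp add: frechet_derivative_eqI[OF assms(2)])
  then show ?thesis using assms(2) by (auto simp: differentiable_def)
qed

lemma Ck_on_SucD:
  assumes "Ck_on (Suc k) S f"
  shows "x \<in> S \<Longrightarrow> (f has_derivative frechet_derivative f (at x)) (at x)"
    "Ck_on k S (\<lambda>x. frechet_derivative f (at x) v)"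
  using assms by (simp_all flip: frechet_derivative_works)

lemma Ck_on_subset:
  assumes "Ck_on k S f" "T \<subseteq> S"
  shows "Ck_on k T f"
  using assms
proof (induction k arbitrary: f)
  case 0 then show ?case using continuous_on_subset by auto
next
  case (Suc k) then show ?case by (auto simp: subset_iff)
qed

lemma Ck_on_continuous: "Ck_on k S f \<Longrightarrow> continuous_on S f"
  by (cases k) (auto intro!: continuous_at_imp_continuous_on differentiable_imp_continuous_within)

lemma Ck_on_Suc: "Ck_on (Suc k) S f \<Longrightarrow> Ck_on k S f"
proof (induction k arbitrary: f)
  case 0 then show ?case using Ck_on_continuous[of "Suc 0"] by auto
next
  case (Suc k)
  then show ?case by (metis Ck_on.simps(2))
qed

lemma Ck_on_const: "Ck_on k S (\<lambda>x. c)"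
proof (induction k arbitrary: c)
  case (Suc k) then show ?case by (simp add: frechet_derivative_const)
qed auto

lemma Ck_on_bounded_linear:
  assumes "open S" "bounded_linear L" "Ck_on k S f"
  shows "Ck_on k S (\<lambda>x. L (f x))"
  using assms(3)
proof (induction k arbitrary: f)
  case 0 then show ?case
    using assms(2) by (auto intro: bounded_linear.continuous_on)
next
  case (Suc k)
  show ?case
    by (rule Ck_on_SucI[OF assms(1) bounded_linear.has_derivative[OF assms(2)]])
      (use Suc in \<open>auto intro: Ck_on_SucD\<close>)
qed

lemma Ck_on_id: "open S \<Longrightarrow> Ck_on k S (\<lambda>x. x)"
proof (induction k)
  case (Suc k) show ?case
    by (rule Ck_on_SucI[OF Suc.prems has_derivative_ident]) (rule Ck_on_const)
qed auto

lemma Ck_on_add: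
  assumes "open S" "Ck_on k S f" "Ck_on k S g"
  shows "Ck_on k S (\<lambda>x. f x + g x)"
  using assms(2,3)
proof (induction k arbitrary: f g)
  case 0 then show ?case by (auto intro: continuous_intros)
next
  case (Suc k)
  show ?case
    by (rule Ck_on_SucI[OF assms(1) has_derivative_add[OF Ck_on_SucD(1) Ck_on_SucD(1)]])
      (use Suc in \<open>auto intro: Ck_on_SucD\<close>)
qed

lemma Ck_on_bilinear:
  assumes "open S" "bounded_bilinear P" "Ck_on k S f" "Ck_on k S g"
  shows "Ck_on k S (\<lambda>x. P (f x) (g x))"
  using assms(3,4)
proof (induction k arbitrary: f g)
  case 0 then show ?case by (auto intro: bounded_bilinear.continuous_on[OF assms(2)])
next
  case (Suc k)
  show ?case
  proof (rule Ck_on_SucI[OF assms(1) bounded_bilinear.FDERIV[OF assms(2) Ck_on_SucD(1) Ck_on_SucD(1)]])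
    show "Ck_on k S (\<lambda>x. P (f x) (frechet_derivative g (at x) v) + P (frechet_derivative f (at x) v) (g x))" for v
      using Suc.prems by (intro Ck_on_add[OF assms(1)] Suc.IH Ck_on_SucD) (auto intro!: Ck_on_Suc[of k] simp del: Ck_on.simps)
  qed (use Suc in auto)
qed

lemma Ck_on_sum:
  assumes "open S" "\<And>i. i \<in> I \<Longrightarrow> Ck_on k S (f i)"
  shows "Ck_on k S (\<lambda>x. \<Sum>i\<in>I. f i x)"
  using assms(2)
  by (induction I rule: infinite_finite_induct) (auto intro: Ck_on_const Ck_on_add[OF assms(1)])

lemma linear_Basis_expand:
  assumes "linear L"
  shows "L v = (\<Sum>b\<in>Basis. (v \<bullet> b) *\<^sub>R L b)"
proof -
  have "L v = L (\<Sum>b\<in>Basis. (v \<bullet> b) *\<^sub>R b)" by (simp add: euclidean_representation)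
  then show ?thesis by (simp add: linear_sum[OF assms] linear_scale[OF assms])
qed

text \<open>The chain rule applies the derivative of \<open>g\<close> to a vector that moves with
  \<open>x\<close>, while the induction hypothesis speaks of fixed directions. Expanding that vector
  in the basis turns the derivative into a sum of products of functions of order
  \<open>k\<close>.\<close>

lemma Ck_on_compose:
  assumes "open S" "open T" "\<And>x. x \<in> S \<Longrightarrow> f x \<in> T" "Ck_on k S f" "Ck_on k T g"
  shows "Ck_on k S (\<lambda>x. g (f x))"
  using assms(4,5)
proof (induction k arbitrary: g)
  case 0 then show ?case using assms(3)
    by (auto intro: continuous_on_compose2)
next
  case (Suc k)
  have k: "Ck_on k S f" using Suc.prems(1) by (rule Ck_on_Suc)
  have lin: "linear (frechet_derivative g (at (f x)))" if "x \<in> S" for x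
    using Ck_on_SucD(1)[OF Suc.prems(2)] assms(3) that has_derivative_linear by blast
  show ?case
  proof (rule Ck_on_SucI[OF assms(1)])
    show "((\<lambda>x. g (f x)) has_derivative (\<lambda>v. \<Sum>b\<in>Basis. (frechet_derivative f (at x) v \<bullet> b) *\<^sub>R frechet_derivative g (at (f x)) b)) (at x)"
      if "x \<in> S" for x
      using diff_chain_at[OF Ck_on_SucD(1)[OF Suc.prems(1) that] Ck_on_SucD(1)[OF Suc.prems(2) assms(3)[OF that]]]
      by (simp add: o_def flip: linear_Basis_expand[OF lin[OF that]])
    show "Ck_on k S (\<lambda>x. \<Sum>b\<in>Basis. (frechet_derivative f (at x) v \<bullet> b) *\<^sub>R frechet_derivative g (at (f x)) b)" for v
      by (intro Ck_on_sum[OF assms(1)] Ck_on_bilinear[OF assms(1) bounded_bilinear_scaleR]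
          Ck_on_bounded_linear[OF assms(1) bounded_linear_inner_left] Suc.IH k Ck_on_SucD(2)
          Suc.prems)
  qed
qed

lemma has_derivative_real_inverse:
  "(x::real) \<noteq> 0 \<Longrightarrow> (inverse has_derivative (\<lambda>v. - (inverse x * inverse x) * v)) (at x)"
  by (rule has_derivative_eq_rhs[OF has_derivative_inverse'[of x]]) auto

text \<open>The derivative of \<open>inverse\<close> is a polynomial in \<open>inverse\<close>
  itself, so the induction feeds on its own hypothesis.\<close>

lemma Ck_on_real_inverse: "Ck_on k (- {0::real}) inverse"
proof (induction k)
  case 0 then show ?case by (auto intro!: continuous_intros)
next
  case (Suc k)
  have o: "open (- {0::real})" by auto
  show ?case
  proof (rule Ck_on_SucI[OF o has_derivative_real_inverse])
    show "Ck_on k (- {0}) (\<lambda>x. - (inverse x * inverse x) * v)" for v :: real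
      using Ck_on_bounded_linear[OF o bounded_linear_mult_left[of "- v"]
          Ck_on_bilinear[OF o bounded_bilinear_mult Suc Suc]] by (simp add: mult.commute)
  qed auto
qed

section \<open>Closure properties of smooth functions\<close>

lemma smooth_onD: "smooth_on S f \<Longrightarrow> Ck_on k S f"
  by (simp add: smooth_on_def)

lemma smooth_on_cong:
  "open S \<Longrightarrow> (\<And>x. x \<in> S \<Longrightarrow> f x = g x) \<Longrightarrow> smooth_on S f \<longleftrightarrow> smooth_on S g"
  unfolding smooth_on_def using Ck_on_cong by blast

lemma smooth_on_subset: "smooth_on S f \<Longrightarrow> T \<subseteq> S \<Longrightarrow> smooth_on T f"
  unfolding smooth_on_def using Ck_on_subset by blast

lemma smooth_on_has_derivative:
  "smooth_on S f \<Longrightarrow> x \<in> S \<Longrightarrow> (f has_derivative frechet_derivative f (at x)) (at x)"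
  using smooth_onD Ck_on_SucD(1) by blast

lemma smooth_on_derivative: "smooth_on S f \<Longrightarrow> smooth_on S (\<lambda>x. frechet_derivative f (at x) v)"
  unfolding smooth_on_def using Ck_on_SucD(2) by blast

lemma smooth_on_continuous: "smooth_on S f \<Longrightarrow> continuous_on S f"
  using smooth_onD Ck_on_continuous by blast

lemma smooth_onI_derivative:
  assumes "open S" "\<And>x. x \<in> S \<Longrightarrow> (f has_derivative f' x) (at x)" "\<And>v. smooth_on S (\<lambda>x. f' x v)"
  shows "smooth_on S f"
  unfolding smooth_on_def using Ck_on_SucI[OF assms(1,2)] assms(3) Ck_on_Suc smooth_on_def by blast

lemma smooth_on_local:
  assumes "\<And>x. x \<in> S \<Longrightarrow> \<exists>T. open T \<and> x \<in> T \<and> smooth_on T f"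
  shows "smooth_on S f"
proof -
  have "Ck_on k S f" if "\<And>x. x \<in> S \<Longrightarrow> \<exists>T. open T \<and> x \<in> T \<and> Ck_on k T f" for k
    using that
  proof (induction k arbitrary: f)
    case 0
    then show ?case
      using continuous_on_eq_continuous_at
      by (auto intro!: continuous_at_imp_continuous_on)
  next
    case (Suc k)
    then show ?case
      by (auto) (metis)+
  qed
  then show ?thesis using assms unfolding smooth_on_def by blast
qed

lemma smooth_on_const: "smooth_on S (\<lambda>x. c)"
  by (simp add: smooth_on_def Ck_on_const)

lemma smooth_on_id: "open S \<Longrightarrow> smooth_on S (\<lambda>x. x)"
  by (simp add: smooth_on_def Ck_on_id)

lemma smooth_on_bounded_linear:
  "open S \<Longrightarrow> bounded_linear L \<Longrightarrow> smooth_on S f \<Longrightarrow> smooth_on S (\<lambda>x. L (f x))"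
  by (simp add: smooth_on_def Ck_on_bounded_linear)

lemma smooth_on_bilinear:
  "open S \<Longrightarrow> bounded_bilinear P \<Longrightarrow> smooth_on S f \<Longrightarrow> smooth_on S g \<Longrightarrow> smooth_on S (\<lambda>x. P (f x) (g x))"
  by (simp add: smooth_on_def Ck_on_bilinear)

lemma smooth_on_add:
  "open S \<Longrightarrow> smooth_on S f \<Longrightarrow> smooth_on S g \<Longrightarrow> smooth_on S (\<lambda>x. f x + g x)"
  by (simp add: smooth_on_def Ck_on_add)

lemma smooth_on_minus: "open S \<Longrightarrow> smooth_on S f \<Longrightarrow> smooth_on S (\<lambda>x. - f x)"
  by (rule smooth_on_bounded_linear[OF _ bounded_linear_minus[OF bounded_linear_ident]])

lemma smooth_on_diff:
  "open S \<Longrightarrow> smooth_on S f \<Longrightarrow> smooth_on S g \<Longrightarrow> smooth_on S (\<lambda>x. f x - g x)"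
  using smooth_on_add[of S f "\<lambda>x. - g x"] smooth_on_minus[of S g] by simp

lemma smooth_on_scaleR:
  "open S \<Longrightarrow> smooth_on S f \<Longrightarrow> smooth_on S g \<Longrightarrow> smooth_on S (\<lambda>x. f x *\<^sub>R g x)"
  by (rule smooth_on_bilinear[OF _ bounded_bilinear_scaleR])

lemma smooth_on_mult:
  fixes f g :: "_ \<Rightarrow> 'b::real_normed_algebra"
  shows "open S \<Longrightarrow> smooth_on S f \<Longrightarrow> smooth_on S g \<Longrightarrow> smooth_on S (\<lambda>x. f x * g x)"
  by (rule smooth_on_bilinear[OF _ bounded_bilinear_mult])

lemma smooth_on_inner:
  fixes f g :: "_ \<Rightarrow> 'b::real_inner"
  shows "open S \<Longrightarrow> smooth_on S f \<Longrightarrow> smooth_on S g \<Longrightarrow> smooth_on S (\<lambda>x. f x \<bullet> g x)"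
  by (rule smooth_on_bilinear[OF _ bounded_bilinear_inner])

lemma smooth_on_sum:
  "open S \<Longrightarrow> (\<And>i. i \<in> I \<Longrightarrow> smooth_on S (f i)) \<Longrightarrow> smooth_on S (\<lambda>x. \<Sum>i\<in>I. f i x)"
  by (simp add: smooth_on_def Ck_on_sum)

lemma smooth_on_compose:
  "open S \<Longrightarrow> open T \<Longrightarrow> (\<And>x. x \<in> S \<Longrightarrow> f x \<in> T) \<Longrightarrow> smooth_on S f \<Longrightarrow> smooth_on T g
    \<Longrightarrow> smooth_on S (\<lambda>x. g (f x))"
  unfolding smooth_on_def using Ck_on_compose by blast

lemma smooth_on_inverse:
  fixes f :: "_ \<Rightarrow> real"
  assumes "open S" "smooth_on S f" "\<And>x. x \<in> S \<Longrightarrow> f x \<noteq> 0"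
  shows "smooth_on S (\<lambda>x. inverse (f x))"
  using smooth_on_compose[of S "- {0}" f inverse] assms by (auto simp: smooth_on_def Ck_on_real_inverse)

lemma smooth_on_divide:
  fixes f g :: "_ \<Rightarrow> real"
  assumes "open S" "smooth_on S f" "smooth_on S g" "\<And>x. x \<in> S \<Longrightarrow> g x \<noteq> 0"
  shows "smooth_on S (\<lambda>x. f x / g x)"
  using smooth_on_mult[OF assms(1,2) smooth_on_inverse[OF assms(1,3,4)]] by (simp add: divide_inverse)

lemma smooth_on_componentwise:
  fixes f :: "'e::euclidean_space \<Rightarrow> 'b::euclidean_space"
  assumes "open S" "\<And>b. b \<in> Basis \<Longrightarrow> smooth_on S (\<lambda>x. f x \<bullet> b)"
  shows "smooth_on S f"
proof -
  have "smooth_on S (\<lambda>x. \<Sum>b\<in>Basis. (f x \<bullet> b) *\<^sub>R b)"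
    by (intro smooth_on_sum smooth_on_scaleR assms smooth_on_const)
  then show ?thesis by (simp add: euclidean_representation)
qed

lemma smooth_on_fst: "open S \<Longrightarrow> smooth_on S f \<Longrightarrow> smooth_on S (\<lambda>x. fst (f x))"
  by (rule smooth_on_bounded_linear[OF _ bounded_linear_fst])

lemma smooth_on_snd: "open S \<Longrightarrow> smooth_on S f \<Longrightarrow> smooth_on S (\<lambda>x. snd (f x))"
  by (rule smooth_on_bounded_linear[OF _ bounded_linear_snd])

lemma smooth_on_Pair:
  assumes "open S" "smooth_on S f" "smooth_on S g"
  shows "smooth_on S (\<lambda>x. (f x, g x))"
proof -
  have "smooth_on S (\<lambda>x. (f x, 0) + (0, g x))"
    by (intro smooth_on_add smooth_on_bounded_linear[OF assms(1) _ assms(2), of "\<lambda>y. (y, 0)"]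
        smooth_on_bounded_linear[OF assms(1) _ assms(3), of "\<lambda>y. (0, y)"] assms(1))
      (auto intro!: bounded_linear_intros)
  then show ?thesis by simp
qed

lemma smooth_on_Re: "open S \<Longrightarrow> smooth_on S f \<Longrightarrow> smooth_on S (\<lambda>x. Re (f x))"
  by (rule smooth_on_bounded_linear[OF _ bounded_linear_Re])

lemma smooth_on_Im: "open S \<Longrightarrow> smooth_on S f \<Longrightarrow> smooth_on S (\<lambda>x. Im (f x))"
  by (rule smooth_on_bounded_linear[OF _ bounded_linear_Im])

lemma smooth_on_of_real: "open S \<Longrightarrow> smooth_on S f \<Longrightarrow> smooth_on S (\<lambda>x. complex_of_real (f x))"
  by (rule smooth_on_bounded_linear[OF _ bounded_linear_of_real])

lemma smooth_on_nth: "open S \<Longrightarrow> smooth_on S f \<Longrightarrow> smooth_on S (\<lambda>x. f x $ i)"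
  by (rule smooth_on_bounded_linear[OF _ bounded_linear_vec_nth])

lemma smooth_on_vec:
  fixes f :: "'e::euclidean_space \<Rightarrow> 'b::euclidean_space ^ 'n"
  assumes "open S" "\<And>i. smooth_on S (\<lambda>x. f x $ i)"
  shows "smooth_on S f"
proof (rule smooth_on_componentwise[OF assms(1)])
  fix b :: "'b ^ 'n" assume "b \<in> Basis"
  then obtain i u where b: "b = axis i u" by (auto simp: Basis_vec_def)
  show "smooth_on S (\<lambda>x. f x \<bullet> b)"
    unfolding b inner_axis by (intro smooth_on_inner assms smooth_on_const)
qed

lemma smooth_on_cross3:
  assumes "open S" "smooth_on S f" "smooth_on S g"
  shows "smooth_on S (\<lambda>x. cross3 (f x) (g x))"
  by (rule smooth_on_vec[OF assms(1)], rule_tac x=i in allE[OF forall_3[THEN iffD2]])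
    (auto simp: cross_components intro!: smooth_on_diff smooth_on_mult smooth_on_nth assms)

lemma smooth_on_cis: "smooth_on UNIV cis"
proof -
  have 1: "((\<lambda>x. cis x) has_derivative (\<lambda>v. v *\<^sub>R (\<i> * cis x))) (at x)" for x
    using has_derivative_cis[of "\<lambda>x. x" "\<lambda>x. x" x UNIV] has_derivative_ident[of "at x"] by simp
  \<comment> \<open>The factor \<open>c\<close> absorbs the constant that each differentiation
    produces.\<close>
  have "Ck_on k UNIV (\<lambda>x. c * cis x)" for c k
  proof (induction k arbitrary: c)
    case 0 show ?case by (auto intro!: continuous_intros simp: cis_conv_exp)
  next
    case (Suc k)
    show ?case
    proof (rule Ck_on_SucI[OF open_UNIV])
      show "((\<lambda>x. c * cis x) has_derivative (\<lambda>v. (v *\<^sub>R c * \<i>) * cis x)) (at x)" for x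
        by (rule has_derivative_eq_rhs[OF has_derivative_mult_right[OF 1]]) (auto simp: fun_eq_iff)
    qed (rule Suc)
  qed
  from this[of _ 1] show ?thesis by (simp add: smooth_on_def)
qed

lemmas smooth_intros = smooth_on_const smooth_on_id smooth_on_add smooth_on_minus smooth_on_diff
  smooth_on_scaleR smooth_on_mult smooth_on_inner smooth_on_fst smooth_on_snd smooth_on_Pair
  smooth_on_Re smooth_on_Im smooth_on_of_real smooth_on_nth smooth_on_cross3 smooth_on_sum

subsection \<open>Integrals depending on a parameter\<close>

lemma has_derivative_partial_fst:
  "(F has_derivative F') (at (x, t)) \<Longrightarrow> ((\<lambda>x. F (x, t)) has_derivative (\<lambda>v. F' (v, 0))) (at x)"
  by (rule has_derivative_compose[OF has_derivative_Pair[OF has_derivative_ident has_derivative_const]])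

lemma has_derivative_integral_param:
  fixes F :: "'e::euclidean_space \<times> 't::euclidean_space \<Rightarrow> 'b::euclidean_space"
  assumes "open U" "U \<times> cbox a b \<subseteq> W" "Ck_on 1 W F" "x \<in> U"
  shows "((\<lambda>x. integral (cbox a b) (\<lambda>t. F (x, t))) has_derivative
    (\<lambda>v. integral (cbox a b) (\<lambda>t. frechet_derivative F (at (x, t)) (v, 0)))) (at x)"
proof -
  \<comment> \<open>\<open>leibniz_rule\<close> wants the partial derivatives as a continuous family
    of bounded linear operators, hence the \<open>Blinfun\<close>.\<close>
  define D where "D x t = Blinfun (\<lambda>v. frechet_derivative F (at (x, t)) (v, 0))" for x t
  \<comment> \<open>\<open>leibniz_rule\<close> asks for a convex parameter set, so it is applied on
    a ball.\<close>
  obtain e where e: "e > 0" "ball x e \<subseteq> U" using assms(1,4) openE by blast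
  have Fd: "(F has_derivative frechet_derivative F (at p)) (at p)" if "p \<in> W" for p
    using Ck_on_SucD(1)[of 0 W F p] assms(3) that by simp
  have part: "((\<lambda>x. F (x, t)) has_derivative (\<lambda>v. frechet_derivative F (at (y, t)) (v, 0))) (at y)"
    if "y \<in> U" "t \<in> cbox a b" for y t
    using has_derivative_partial_fst Fd that assms(2) by blast
  have D: "blinfun_apply (D y t) = (\<lambda>v. frechet_derivative F (at (y, t)) (v, 0))"
    if "y \<in> U" "t \<in> cbox a b" for y t
    unfolding D_def using part[OF that] bounded_linear_Blinfun_apply has_derivative_bounded_linear by blast
  have cF: "continuous_on W F" using assms(3) by (rule Ck_on_continuous)
  have cD: "continuous_on (U \<times> cbox a b) (\<lambda>(x, t). D x t)"
  proof (rule continuous_on_blinfun_componentwise)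
    fix i :: 'e
    have "continuous_on (U \<times> cbox a b) (\<lambda>p. frechet_derivative F (at p) (i, 0))"
      by (rule continuous_on_subset[OF _ assms(2)]) (rule Ck_on_SucD(2)[of 0 W F, unfolded Ck_on.simps(1), OF assms(3)[unfolded One_nat_def]])
    then show "continuous_on (U \<times> cbox a b) (\<lambda>p. blinfun_apply (case p of (x, t) \<Rightarrow> D x t) i)"
      by (rule continuous_on_eq) (auto simp: D)
  qed
  have int: "(\<lambda>t. F (y, t)) integrable_on cbox a b" if "y \<in> U" for y
    by (rule integrable_continuous, rule continuous_on_compose2[OF cF])
      (use that assms(2) in \<open>auto intro!: continuous_on_Pair continuous_on_const continuous_on_id\<close>)
  have "((\<lambda>x. integral (cbox a b) (\<lambda>t. F (x, t))) has_derivative integral (cbox a b) (D x))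
      (at x within ball x e)"
  proof (rule leibniz_rule)
    show "((\<lambda>x. F (x, t)) has_derivative blinfun_apply (D y t)) (at y within ball x e)"
      if "y \<in> ball x e" "t \<in> cbox a b" for y t
      using has_derivative_at_withinI[OF part[of y t]] D[of y t] that e by auto
    show "continuous_on (ball x e \<times> cbox a b) (\<lambda>(x, t). D x t)"
      by (rule continuous_on_subset[OF cD]) (use e(2) in auto)
  qed (use e int in auto)
  then have *: "((\<lambda>x. integral (cbox a b) (\<lambda>t. F (x, t))) has_derivative integral (cbox a b) (D x)) (at x)"
    using e at_within_open[of x "ball x e"] by simp
  have "continuous_on (cbox a b) (\<lambda>t. case (x, t) of (x, t) \<Rightarrow> D x t)"
    by (rule continuous_on_compose2[OF cD])
      (use assms(4) in \<open>auto intro!: continuous_on_Pair continuous_on_const continuous_on_id\<close>)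
  then have Dint: "D x integrable_on cbox a b" by (intro integrable_continuous) simp
  have "blinfun_apply (integral (cbox a b) (D x)) = (\<lambda>v. integral (cbox a b) (\<lambda>t. frechet_derivative F (at (x, t)) (v, 0)))"
  proof
    fix v
    have "blinfun_apply (integral (cbox a b) (D x)) v = integral (cbox a b) (\<lambda>t. blinfun_apply (D x t) v)"
      using integral_linear[OF Dint blinfun.bounded_linear_left[of v]] by (simp add: o_def)
    also have "\<dots> = integral (cbox a b) (\<lambda>t. frechet_derivative F (at (x, t)) (v, 0))"
      by (rule integral_cong) (simp add: D[OF assms(4)])
    finally show "blinfun_apply (integral (cbox a b) (D x)) v = \<dots>" .
  qed
  with * show ?thesis by (simp only:)
qed

text \<open>Differentiating under the integral sign gives an integral of the same kind, with
  \<open>F\<close> replaced by its smooth derivative in the direction \<open>(v, 0)\<close>; so the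
  induction runs over all smooth \<open>F\<close> on \<open>W\<close>.\<close>

lemma smooth_on_integral:
  fixes F :: "'e::euclidean_space \<times> 't::euclidean_space \<Rightarrow> 'b::euclidean_space"
  assumes "open U" "U \<times> cbox a b \<subseteq> W" "smooth_on W F"
  shows "smooth_on U (\<lambda>x. integral (cbox a b) (\<lambda>t. F (x, t)))"
proof -
  have "Ck_on k U (\<lambda>x. integral (cbox a b) (\<lambda>t. F (x, t)))" if "smooth_on W F" for k
    using that
  proof (induction k arbitrary: F)
    case 0
    have "continuous_on (U \<times> cbox a b) F"
      using smooth_on_continuous[OF 0] assms(2) continuous_on_subset by blast
    then show ?case by (auto intro!: integral_continuous_on_param simp: split_beta')
  next
    case (Suc k)
    show ?case
      by (rule Ck_on_SucI[OF assms(1) has_derivative_integral_param[OF assms(1,2) smooth_onD]])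
        (auto intro!: Suc smooth_on_derivative)
  qed
  then show ?thesis using assms(3) by (simp add: smooth_on_def)
qed

text \<open>By uniqueness of derivatives the chosen partial derivative may be replaced by a formula
  computed by hand. This is the form used for the Cauchy transform and for both primitives.\<close>

lemma has_derivative_integral_smooth:
  fixes F :: "'e::euclidean_space \<times> 't::euclidean_space \<Rightarrow> 'b::euclidean_space"
  assumes "open U" "U \<times> cbox a b \<subseteq> W" "smooth_on W F" "x \<in> U"
    "\<And>t. t \<in> cbox a b \<Longrightarrow> ((\<lambda>x. F (x, t)) has_derivative F' t) (at x)"
  shows "((\<lambda>x. integral (cbox a b) (\<lambda>t. F (x, t))) has_derivative
    (\<lambda>v. integral (cbox a b) (\<lambda>t. F' t v))) (at x)"
proof (rule has_derivative_eq_rhs[OF has_derivative_integral_param[OF assms(1,2) smooth_onD[OF assms(3)] assms(4)]])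
  have "frechet_derivative F (at (x, t)) (v, 0) = F' t v" if "t \<in> cbox a b" for t v
    using has_derivative_unique[OF has_derivative_partial_fst[OF smooth_on_has_derivative[OF assms(3)]] assms(5)[OF that]]
      that assms(2,4) by (auto simp: fun_eq_iff subset_iff)
  then show "(\<lambda>v. integral (cbox a b) (\<lambda>t. frechet_derivative F (at (x, t)) (v, 0)))
      = (\<lambda>v. integral (cbox a b) (\<lambda>t. F' t v))"
    by (intro ext integral_cong)
qed

subsection \<open>Smooth cutoff functions\<close>

text \<open>The function \<open>exp (- 1 / x)\<close>, extended by 0, together with its multiples by
  powers of \<open>1 / x\<close>: the span of this family is closed under differentiation, so
  smoothness is an induction over the whole family.\<close>

definition flat_exp :: "nat \<Rightarrow> real \<Rightarrow> real"
  where "flat_exp n x = (if 0 < x then inverse x ^ n * exp (- inverse x) else 0)"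

lemma flat_exp_tendsto_0: "(flat_exp n \<longlongrightarrow> 0) (at 0)"
proof (rule filterlim_split_at)
  show "(flat_exp n \<longlongrightarrow> 0) (at_left 0)"
    by (rule tendsto_eventually) (auto simp: eventually_at_filter flat_exp_def)
  have "((\<lambda>y. y ^ n / exp y) \<longlongrightarrow> (0::real)) at_top" by (rule tendsto_power_div_exp_0)
  then have "((\<lambda>y. flat_exp n (inverse y)) \<longlongrightarrow> 0) at_top"
    by (rule Lim_transform_eventually)
      (auto simp: flat_exp_def exp_minus divide_inverse intro!: eventually_mono[OF eventually_gt_at_top[of 0]])
  then show "(flat_exp n \<longlongrightarrow> 0) (at_right 0)" by (simp add: filterlim_at_right_to_top)
qed

lemma flat_exp_deriv:
  "(flat_exp n has_field_derivative flat_exp (n + 2) x - real n * flat_exp (n + 1) x) (at x)"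
proof -
  consider "x < 0" | "x = 0" | "x > 0" by linarith
  then show ?thesis
  proof cases
    case 1
    have "((\<lambda>x. 0) has_field_derivative 0) (at x)" by simp
    then have "(flat_exp n has_field_derivative 0) (at x)"
      by (rule has_field_derivative_transform_within_open[of _ _ _ "{..<0}"]) (use 1 in \<open>auto simp: flat_exp_def\<close>)
    then show ?thesis using 1 by (simp add: flat_exp_def)
  next
    case 2
    \<comment> \<open>The difference quotient of \<open>flat_exp n\<close> at 0 is
      \<open>flat_exp (n + 1)\<close>, whose limit is already known.\<close>
    have "((\<lambda>h. (flat_exp n (0 + h) - flat_exp n 0) / h) \<longlongrightarrow> 0) (at 0)"
      by (rule Lim_transform_eventually[OF flat_exp_tendsto_0[of "n + 1"]])
        (auto simp: eventually_at_filter flat_exp_def divide_inverse)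
    then show ?thesis using 2 by (simp add: DERIV_def flat_exp_def)
  next
    case 3
    have 1: "(inverse has_field_derivative - (inverse x * inverse x)) (at x)"
      using DERIV_inverse[of x] 3 by (simp add: power2_eq_square)
    have "((\<lambda>x. inverse x ^ n * exp (- inverse x)) has_field_derivative
       (inverse x ^ (n + 2) * exp (- inverse x) - real n * (inverse x ^ (n + 1) * exp (- inverse x)))) (at x)"
      by (rule DERIV_cong[OF DERIV_mult[OF DERIV_power[OF 1] DERIV_fun_exp[OF DERIV_minus[OF 1]]]])
        (cases n; simp add: ring_distribs mult_ac)
    then have "(flat_exp n has_field_derivative
       (inverse x ^ (n + 2) * exp (- inverse x) - real n * (inverse x ^ (n + 1) * exp (- inverse x)))) (at x)"
      by (rule has_field_derivative_transform_within_open[of _ _ _ "{0<..}"]) (use 3 in \<open>auto simp: flat_exp_def\<close>)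
    then show ?thesis using 3 by (simp add: flat_exp_def)
  qed
qed

lemma smooth_on_flat_exp: "smooth_on UNIV (flat_exp n)"
proof -
  have "Ck_on k UNIV (flat_exp n)" for k n
  proof (induction k arbitrary: n)
    case 0 show ?case
      using DERIV_isCont[OF flat_exp_deriv] by (simp add: continuous_at_imp_continuous_on)
  next
    case (Suc k)
    show ?case
    proof (rule Ck_on_SucI[OF open_UNIV has_field_derivative_imp_has_derivative[OF flat_exp_deriv]])
      have "Ck_on k UNIV (\<lambda>x. v * flat_exp (n + 2) x + (- (v * real n)) * flat_exp (n + 1) x)" for v
        by (intro Ck_on_add Ck_on_bilinear[OF _ bounded_bilinear_mult] Suc Ck_on_const) auto
      then show "Ck_on k UNIV (\<lambda>x. (flat_exp (n + 2) x - real n * flat_exp (n + 1) x) * v)" for v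
        by (simp add: algebra_simps)
    qed
  qed
  then show ?thesis by (simp add: smooth_on_def)
qed

lemma smooth_cutoff:
  fixes z0 :: "'e::euclidean_space"
  assumes "0 < a" "a < b"
  obtains \<psi> :: "'e \<Rightarrow> real" where "smooth_on UNIV \<psi>" "\<And>z. norm (z - z0) \<le> a \<Longrightarrow> \<psi> z = 1"
    "\<And>z. b \<le> norm (z - z0) \<Longrightarrow> \<psi> z = 0"
proof -
  \<comment> \<open>The squared distance is smooth at the centre, which the norm is not.
    \<open>?u\<close> vanishes exactly from radius \<open>b\<close> outwards and \<open>?v\<close>
    exactly up to radius \<open>a\<close>, so they have no common zero and the quotient is
    smooth.\<close>
  let ?q = "\<lambda>z. (z - z0) \<bullet> (z - z0)"
  let ?u = "\<lambda>z. flat_exp 0 (b\<^sup>2 - ?q z)" and ?v = "\<lambda>z. flat_exp 0 (?q z - a\<^sup>2)"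
  have ab: "a\<^sup>2 < b\<^sup>2" using assms by (simp add: power_strict_mono)
  have nz: "?u z + ?v z \<noteq> 0" for z
  proof -
    have "?u z \<ge> 0" "?v z \<ge> 0" "?u z > 0 \<or> ?v z > 0" using ab by (auto simp: flat_exp_def)
    then show ?thesis by linarith
  qed
  have su: "smooth_on UNIV ?u" "smooth_on UNIV ?v"
    by (rule smooth_on_compose[OF _ _ _ _ smooth_on_flat_exp]; auto intro!: smooth_intros)+
  show ?thesis
  proof (rule that)
    show "smooth_on UNIV (\<lambda>z. ?u z / (?u z + ?v z))"
      by (intro smooth_on_divide smooth_on_add su nz) auto
    show "?u z / (?u z + ?v z) = 1" if "norm (z - z0) \<le> a" for z
    proof -
      have "?q z \<le> a\<^sup>2" using that by (simp add: power_mono flip: power2_norm_eq_inner)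
      then have "?v z = 0" "?u z \<noteq> 0" using ab by (auto simp: flat_exp_def)
      then show ?thesis by simp
    qed
    show "?u z / (?u z + ?v z) = 0" if "b \<le> norm (z - z0)" for z
    proof -
      have "b\<^sup>2 \<le> ?q z" using that assms by (simp add: power_mono flip: power2_norm_eq_inner)
      then show ?thesis by (simp add: flat_exp_def)
    qed
  qed
qed

lemma smooth_extension:
  fixes g :: "'e::euclidean_space \<Rightarrow> 'b::euclidean_space"
  assumes "smooth_on (ball z0 r) g" "0 < a" "a < b" "b < r"
  obtains G where "smooth_on UNIV G" "\<And>z. norm (z - z0) \<le> a \<Longrightarrow> G z = g z"
    "\<And>z. b \<le> norm (z - z0) \<Longrightarrow> G z = 0"
proof -
  obtain \<psi> :: "'e \<Rightarrow> real" where \<psi>: "smooth_on UNIV \<psi>" "\<And>z. norm (z - z0) \<le> a \<Longrightarrow> \<psi> z = 1"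
    "\<And>z. b \<le> norm (z - z0) \<Longrightarrow> \<psi> z = 0"
    using smooth_cutoff[OF assms(2,3)] by blast
  define G where "G z = (if z \<in> ball z0 r then \<psi> z *\<^sub>R g z else 0)" for z
  have "smooth_on UNIV G"
  proof (rule smooth_on_local)
    fix z
    have "smooth_on (ball z0 r) (\<lambda>z. \<psi> z *\<^sub>R g z)"
      by (intro smooth_on_scaleR smooth_on_subset[OF \<psi>(1)] assms(1)) auto
    then have 1: "smooth_on (ball z0 r) G"
      by (subst smooth_on_cong[of _ G]) (auto simp: G_def)
    \<comment> \<open>Outside the closed ball of radius \<open>b\<close> both branches of
      \<open>G\<close> are 0. Since \<open>b < r\<close>, this open set and the ball of radius
      \<open>r\<close> cover the whole space.\<close>
    have 2: "smooth_on (- cball z0 b) G"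
      by (subst smooth_on_cong[of _ G "\<lambda>_. 0"])
        (auto simp: G_def \<psi>(3) dist_norm norm_minus_commute intro!: smooth_on_const)
    show "\<exists>T. open T \<and> z \<in> T \<and> smooth_on T G"
    proof (cases "z \<in> ball z0 r")
      case True with 1 show ?thesis by blast
    next
      case False
      with assms(4) have "z \<in> - cball z0 b" by auto
      with 2 show ?thesis by (metis closed_cball open_Compl)
    qed
  qed
  moreover have "G z = g z" if "norm (z - z0) \<le> a" for z
    using that assms \<psi>(2) by (auto simp: G_def dist_norm norm_minus_commute)
  moreover have "G z = 0" if "b \<le> norm (z - z0)" for z
    using that \<psi>(3) by (auto simp: G_def)
  ultimately show ?thesis using that by blast
qed

subsection \<open>The inhomogeneous Cauchy--Riemann equation\<close>

text \<open>The solution is the Cauchy transform of \<open>G\<close>. In polar coordinates around \<open>z\<close> its singular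
  kernel cancels against the area element, so the integrand \<open>F\<close> is smooth.\<close>

lemma cauchy_riemann_compact_support:
  fixes G :: "complex \<Rightarrow> complex"
  assumes G: "smooth_on UNIV G" and R: "0 < R" "\<And>z. R \<le> norm (z - z0) \<Longrightarrow> G z = 0"
  obtains k where "smooth_on UNIV k"
    "\<And>z. z \<in> ball z0 R \<Longrightarrow> frechet_derivative k (at z) 1 + \<i> * frechet_derivative k (at z) \<i> = 2 * G z"
proof -
  \<comment> \<open>The kernel \<open>1 / (pi * w)\<close> at
    \<open>w = r *\<^sub>R cis \<theta>\<close>, times the area element
    \<open>r dr d\<theta>\<close>, leaves \<open>cis (- \<theta>) / pi\<close>. The factor
    \<open>1 / pi\<close> sits in \<open>k\<close>.\<close>
  define F where "F = (\<lambda>q :: complex \<times> real \<times> real.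
    G (fst q - fst (snd q) *\<^sub>R cis (snd (snd q))) * cis (- snd (snd q)))"
  \<comment> \<open>Radius \<open>2 * R\<close> is enough: for \<open>z\<close> in the ball of
    radius \<open>R\<close>, a point at distance \<open>2 * R\<close> from \<open>z\<close> is at
    least \<open>R\<close> away from \<open>z0\<close>, where \<open>G\<close> vanishes.\<close>
  let ?a = "(0, 0) :: real \<times> real" and ?b = "(2 * R, 2 * pi)"
  let ?D = "\<lambda>z r \<theta>. frechet_derivative G (at (z - r *\<^sub>R cis \<theta>))"
  define k where "k z = (1 / pi) *\<^sub>R integral (cbox ?a ?b) (\<lambda>t. F (z, t))" for z
  have cs: "smooth_on UNIV (\<lambda>x::complex \<times> real \<times> real. cis (snd (snd x)))"
    "smooth_on UNIV (\<lambda>x::complex \<times> real \<times> real. cis (- snd (snd x)))"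
    by (rule smooth_on_compose[OF _ _ _ _ smooth_on_cis]; auto intro!: smooth_intros)+
  have sF: "smooth_on UNIV F"
    unfolding F_def
    by (intro smooth_on_mult smooth_on_compose[OF _ _ _ _ G] smooth_on_diff smooth_on_scaleR cs smooth_intros) auto
  have Gd: "(G has_derivative frechet_derivative G (at w)) (at w)" for w
    using smooth_on_has_derivative[OF G] by simp
  have lin: "linear (frechet_derivative G (at w))" for w
    using Gd has_derivative_linear by blast
  have Fd: "((\<lambda>z. F (z, t)) has_derivative (\<lambda>v. ?D z (fst t) (snd t) v * cis (- snd t))) (at z)" for z t
  proof -
    have "((\<lambda>z. z - fst t *\<^sub>R cis (snd t)) has_derivative (\<lambda>v. v)) (at z)"
      by (auto intro!: derivative_eq_intros)
    from has_derivative_compose[OF this Gd]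
    show ?thesis unfolding F_def by (auto intro!: has_derivative_mult_left)
  qed
  have kd: "(k has_derivative (\<lambda>v. (1 / pi) *\<^sub>R integral (cbox ?a ?b) (\<lambda>t. ?D z (fst t) (snd t) v * cis (- snd t)))) (at z)" for z
    unfolding k_def
    by (rule has_derivative_scaleR_right, rule has_derivative_integral_smooth[OF open_UNIV _ sF])
      (use Fd in auto)
  have ks: "smooth_on UNIV k"
    unfolding k_def by (intro smooth_on_scaleR smooth_on_const smooth_on_integral[OF _ _ sF]) auto
  have cD: "continuous_on UNIV (\<lambda>q. frechet_derivative G (at q) v)" for v
    using smooth_on_continuous[OF smooth_on_derivative[OF G]] .
  have cDv: "continuous_on S (\<lambda>t::real\<times>real. ?D z (fst t) (snd t) (w t))" if "continuous_on S w" for w S z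
  proof -
    have "continuous_on S (\<lambda>t::real\<times>real. \<Sum>b\<in>Basis. (w t \<bullet> b) *\<^sub>R ?D z (fst t) (snd t) b)"
      by (intro continuous_intros that continuous_on_compose2[OF cD]) (auto simp: cis_conv_exp intro!: continuous_intros)
    then show ?thesis by (simp flip: linear_Basis_expand[OF lin])
  qed
  have cc: "continuous_on S (\<lambda>t::real\<times>real. cis (snd t))" "continuous_on S (\<lambda>t::real\<times>real. cis (- snd t))" for S
    by (auto simp: cis_conv_exp intro!: continuous_intros)
  have main: "frechet_derivative k (at z) 1 + \<i> * frechet_derivative k (at z) \<i> = 2 * G z" if z: "z \<in> ball z0 R" for z
  proof -
    let ?A = "\<lambda>t. ?D z (fst t) (snd t) (cis (snd t))"
    let ?B = "\<lambda>t. ?D z (fst t) (snd t) (\<i> * cis (snd t))"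
    have cA: "continuous_on S ?A" and cB: "continuous_on S ?B" for S
      by (intro cDv cc continuous_intros)+
    \<comment> \<open>The Cauchy--Riemann operator in the rotating frame
      \<open>cis \<theta>\<close>, \<open>\<i> * cis \<theta>\<close>: the factor
      \<open>cis (- \<theta>)\<close> of the integrand is exactly what the rotation produces. It
      splits the integral into a radial part \<open>?A\<close> and an angular part
      \<open>?B\<close>.\<close>
    have eq: "?D z r \<theta> 1 * cis (- \<theta>) + \<i> * (?D z r \<theta> \<i> * cis (- \<theta>)) = ?D z r \<theta> (cis \<theta>) + \<i> * ?D z r \<theta> (\<i> * cis \<theta>)" for r \<theta>
    proof -
      have 1: "?D z r \<theta> (cis \<theta>) = cos \<theta> *\<^sub>R ?D z r \<theta> 1 + sin \<theta> *\<^sub>R ?D z r \<theta> \<i>"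
        by (subst linear_Basis_expand[OF lin]) (simp add: Basis_complex_def cis.simps inner_complex_def)
      have 2: "?D z r \<theta> (\<i> * cis \<theta>) = - sin \<theta> *\<^sub>R ?D z r \<theta> 1 + cos \<theta> *\<^sub>R ?D z r \<theta> \<i>"
        by (subst linear_Basis_expand[OF lin]) (simp add: Basis_complex_def cis.simps inner_complex_def)
      have c: "cis (- \<theta>) = of_real (cos \<theta>) - \<i> * of_real (sin \<theta>)" by (simp add: complex_eq_iff)
      show ?thesis unfolding 1 2 c by (simp add: scaleR_conv_of_real algebra_simps)
    qed
    \<comment> \<open>\<open>?A\<close> is minus the \<open>r\<close>-derivative of
      \<open>G (z - r *\<^sub>R cis \<theta>)\<close>. The integral over \<open>r\<close> leaves the
      value at \<open>r = 0\<close>, which is \<open>G z\<close>, and the integral over the angle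
      gives \<open>2 * pi\<close>.\<close>
    have i1: "integral (cbox ?a ?b) ?A = (2 * pi) *\<^sub>R G z"
    proof -
      have inner: "integral (cbox 0 (2 * R)) (\<lambda>r. ?A (r, \<theta>)) = G z" for \<theta>
      proof -
        have "((\<lambda>r. - G (z - r *\<^sub>R cis \<theta>)) has_vector_derivative ?A (r, \<theta>)) (at r within {0..2*R})" for r
        proof -
          have "((\<lambda>r. z - r *\<^sub>R cis \<theta>) has_derivative (\<lambda>h. - (h *\<^sub>R cis \<theta>))) (at r within {0..2*R})"
            by (auto intro!: derivative_eq_intros)
          from has_derivative_minus[OF has_derivative_compose[OF this Gd]]
          show ?thesis unfolding has_vector_derivative_def
            by (rule has_derivative_eq_rhs) (simp add: fun_eq_iff linear_neg[OF lin] linear_scale[OF lin])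
        qed
        then have "((\<lambda>r. ?A (r, \<theta>)) has_integral (- G (z - (2 * R) *\<^sub>R cis \<theta>) - - G (z - 0 *\<^sub>R cis \<theta>))) {0..2 * R}"
          using R by (intro fundamental_theorem_of_calculus) auto
        moreover have "G (z - (2 * R) *\<^sub>R cis \<theta>) = 0"
        proof (rule R(2))
          have "norm (z - z0) < R" using z by (simp add: dist_norm norm_minus_commute)
          moreover have "norm ((2 * R) *\<^sub>R cis \<theta>) = 2 * R" using R by simp
          moreover have "norm ((2 * R) *\<^sub>R cis \<theta>) - norm (z - z0) \<le> norm (z - (2 * R) *\<^sub>R cis \<theta> - z0)"
            using norm_triangle_ineq2[of "(2 * R) *\<^sub>R cis \<theta>" "z - z0"] by (simp add: norm_minus_commute algebra_simps)
          ultimately show "R \<le> norm (z - (2 * R) *\<^sub>R cis \<theta> - z0)" by linarith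
        qed
        ultimately show ?thesis by (auto simp: integral_unique)
      qed
      have "integral (cbox ?a ?b) ?A = integral (cbox 0 (2 * R)) (\<lambda>r. integral (cbox 0 (2 * pi)) (\<lambda>\<theta>. ?A (r, \<theta>)))"
        by (rule integral_prod_continuous[OF cA])
      also have "\<dots> = integral (cbox 0 (2 * pi)) (\<lambda>\<theta>. integral (cbox 0 (2 * R)) (\<lambda>r. ?A (r, \<theta>)))"
        using integral_swap_continuous[of 0 0 "2 * R" "2 * pi" "\<lambda>r \<theta>. ?A (r, \<theta>)"] cA by (simp add: split_beta')
      also have "\<dots> = (2 * pi) *\<^sub>R G z" unfolding inner by simp
      finally show ?thesis .
    qed
    \<comment> \<open>For \<open>r \<noteq> 0\<close>, \<open>?B\<close> is \<open>- 1 / r\<close>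
      times the \<open>\<theta>\<close>-derivative of a function of period \<open>2 * pi\<close>, so
      its integral over a full turn is 0. The single radius \<open>r = 0\<close> is
      negligible.\<close>
    have i2: "integral (cbox ?a ?b) ?B = 0"
    proof -
      have inner: "integral (cbox 0 (2 * pi)) (\<lambda>\<theta>. ?B (r, \<theta>)) = 0" if "r \<noteq> 0" for r
      proof -
        have "((\<lambda>\<theta>. (- 1 / r) *\<^sub>R G (z - r *\<^sub>R cis \<theta>)) has_vector_derivative ?B (r, \<theta>)) (at \<theta> within {0..2*pi})" for \<theta>
        proof -
          have c: "(cis has_derivative (\<lambda>h. h *\<^sub>R (\<i> * cis \<theta>))) (at \<theta> within {0..2*pi})"
            using has_derivative_cis[of "\<lambda>x. x" "\<lambda>x. x" \<theta>] by simp
          have "((\<lambda>\<theta>. z - r *\<^sub>R cis \<theta>) has_derivative (\<lambda>h. (h * - r) *\<^sub>R (\<i> * cis \<theta>))) (at \<theta> within {0..2*pi})"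
            by (rule has_derivative_eq_rhs[OF has_derivative_diff[OF has_derivative_const has_derivative_scaleR_right[OF c]]]) (simp add: mult_ac)
          from has_derivative_scaleR_right[OF has_derivative_compose[OF this Gd], of "- 1 / r"]
          show ?thesis unfolding has_vector_derivative_def
            by (rule has_derivative_eq_rhs) (use that in \<open>simp add: fun_eq_iff linear_scale[OF lin] linear_neg[OF lin]\<close>)
        qed
        then have "((\<lambda>\<theta>. ?B (r, \<theta>)) has_integral ((- 1 / r) *\<^sub>R G (z - r *\<^sub>R cis (2 * pi)) - (- 1 / r) *\<^sub>R G (z - r *\<^sub>R cis 0))) {0..2 * pi}"
          by (intro fundamental_theorem_of_calculus) auto
        then show ?thesis by (auto simp: integral_unique)
      qed
      have "integral (cbox ?a ?b) ?B = integral (cbox 0 (2 * R)) (\<lambda>r. integral (cbox 0 (2 * pi)) (\<lambda>\<theta>. ?B (r, \<theta>)))"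
        by (rule integral_prod_continuous[OF cB])
      also have "\<dots> = integral (cbox 0 (2 * R)) (\<lambda>r. 0)"
        by (rule integral_spike[of "{0}"]) (use inner in auto)
      finally show ?thesis by simp
    qed
    have intg: "f integrable_on cbox ?a ?b" if "continuous_on (cbox ?a ?b) f" for f :: "real \<times> real \<Rightarrow> complex"
      using integrable_continuous that by blast
    have i3: "integral (cbox ?a ?b) (\<lambda>t. ?D z (fst t) (snd t) 1 * cis (- snd t))
       + \<i> * integral (cbox ?a ?b) (\<lambda>t. ?D z (fst t) (snd t) \<i> * cis (- snd t))
       = integral (cbox ?a ?b) (\<lambda>t. ?A t + \<i> * ?B t)"
      unfolding integral_mult_right[symmetric]
      by (subst integral_add[symmetric]) (auto intro!: intg continuous_intros cDv cc simp: eq)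
    also have "\<dots> = integral (cbox ?a ?b) ?A + \<i> * integral (cbox ?a ?b) ?B"
      by (subst integral_add) (auto intro!: intg continuous_intros cDv cc)
    also have "\<dots> = (2 * pi) *\<^sub>R G z" by (simp only: i1 i2) simp
    finally have "(1 / pi) *\<^sub>R (integral (cbox ?a ?b) (\<lambda>t. ?D z (fst t) (snd t) 1 * cis (- snd t))
       + \<i> * integral (cbox ?a ?b) (\<lambda>t. ?D z (fst t) (snd t) \<i> * cis (- snd t))) = (1 / pi) *\<^sub>R ((2 * pi) *\<^sub>R G z)"
      by (rule arg_cong)
    also have "\<dots> = 2 * G z" by (simp add: scaleR_conv_of_real)
    finally show ?thesis
      unfolding frechet_derivative_eqI[OF kd] by (simp only: scaleR_right_distrib mult_scaleR_right)
  qed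
  show ?thesis using that ks main by blast
qed

text \<open>Cutting \<open>g\<close> off between the radii \<open>r / 3\<close> and
  \<open>r / 2\<close> makes it globally smooth with compact support and leaves the right-hand side
  intact on the smallest ball. The factor 2 means that \<open>g\<close> is the d-bar derivative of
  \<open>k\<close>.\<close>

lemma cauchy_riemann_solution:
  fixes g :: "complex \<Rightarrow> complex"
  assumes "smooth_on (ball z0 r) g" "0 < r"
  obtains k where "smooth_on UNIV k"
    "\<And>z. z \<in> ball z0 (r / 3) \<Longrightarrow> frechet_derivative k (at z) 1 + \<i> * frechet_derivative k (at z) \<i> = 2 * g z"
proof -
  obtain G where G: "smooth_on UNIV G" "\<And>z. norm (z - z0) \<le> r / 3 \<Longrightarrow> G z = g z"
    "\<And>z. r / 2 \<le> norm (z - z0) \<Longrightarrow> G z = 0"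
    using smooth_extension[OF assms(1), of "r / 3" "r / 2"] assms(2) by auto
  obtain k where k: "smooth_on UNIV k"
    "\<And>z. z \<in> ball z0 (r / 2) \<Longrightarrow> frechet_derivative k (at z) 1 + \<i> * frechet_derivative k (at z) \<i> = 2 * G z"
    using cauchy_riemann_compact_support[OF G(1) _ G(3)] assms(2) by (metis half_gt_zero)
  show ?thesis
  proof (rule that[OF k(1)])
    fix z assume "z \<in> ball z0 (r / 3)"
    then show "frechet_derivative k (at z) 1 + \<i> * frechet_derivative k (at z) \<i> = 2 * g z"
      using k(2)[of z] G(2)[of z] assms(2) by (simp add: dist_norm norm_minus_commute)
  qed
qed

subsection \<open>Local primitives of closed 1-forms\<close>

text \<open>The primitive is the integral of \<open>n\<close> along the segment from
  \<open>x0\<close> to \<open>x\<close>. By the symmetry of the derivative of \<open>n\<close>, the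
  integrand of its derivative in direction \<open>v\<close> is the \<open>s\<close>-derivative of
  \<open>s * (n (x0 + s *\<^sub>R (x - x0)) \<bullet> v)\<close>.\<close>

lemma poincare_1_form:
  fixes n :: "'e::euclidean_space \<Rightarrow> 'e"
  assumes n: "smooth_on (ball x0 r) n"
    and sym: "\<And>x u v. x \<in> ball x0 r \<Longrightarrow>
      frechet_derivative n (at x) u \<bullet> v = frechet_derivative n (at x) v \<bullet> u"
  obtains f where "\<And>x. x \<in> ball x0 r \<Longrightarrow> (f has_derivative (\<lambda>v. n x \<bullet> v)) (at x)"
proof -
  let ?p = "\<lambda>x s. x0 + s *\<^sub>R (x - x0)"
  define W where "W = {q :: 'e \<times> real. ?p (fst q) (snd q) \<in> ball x0 r}"
  define F where "F q = n (?p (fst q) (snd q)) \<bullet> (fst q - x0)" for q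
  have oW: "open W"
    unfolding W_def mem_ball by (rule open_Collect_less) (intro continuous_intros)+
  have mem: "?p x s \<in> ball x0 r" if "x \<in> ball x0 r" "s \<in> cbox 0 1" for x s
  proof -
    have "\<bar>s\<bar> * norm (x - x0) \<le> 1 * norm (x - x0)" using that by (intro mult_right_mono) auto
    then show ?thesis using that by (simp add: dist_norm norm_minus_commute)
  qed
  have nd: "(n has_derivative frechet_derivative n (at x)) (at x)" if "x \<in> ball x0 r" for x
    using smooth_on_has_derivative[OF n that] .
  have sF: "smooth_on W F"
    unfolding F_def
    by (intro smooth_on_inner smooth_on_compose[OF _ _ _ _ n] smooth_intros oW) (auto simp: W_def)
  show ?thesis
  proof (rule that)
    fix x assume x: "x \<in> ball x0 r"
    let ?D = "\<lambda>s. frechet_derivative n (at (?p x s))"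
    have lin: "linear (?D s)" if "s \<in> cbox 0 1" for s
      using nd[OF mem[OF x that]] has_derivative_linear by blast
    have *: "((\<lambda>x. integral (cbox 0 1) (\<lambda>s. F (x, s))) has_derivative
        (\<lambda>v. integral (cbox 0 1) (\<lambda>s. n (?p x s) \<bullet> v + ?D s (s *\<^sub>R v) \<bullet> (x - x0)))) (at x)"
    proof (rule has_derivative_integral_smooth[OF open_ball _ sF x])
      show "ball x0 r \<times> cbox 0 1 \<subseteq> W" using mem by (auto simp: W_def)
      show "((\<lambda>x. F (x, s)) has_derivative (\<lambda>v. n (?p x s) \<bullet> v + ?D s (s *\<^sub>R v) \<bullet> (x - x0))) (at x)"
        if "s \<in> cbox 0 1" for s
      proof -
        have "((\<lambda>x. ?p x s) has_derivative (\<lambda>v. s *\<^sub>R v)) (at x)" by (auto intro!: derivative_eq_intros)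
        from has_derivative_inner[OF has_derivative_compose[OF this nd[OF mem[OF x that]]]
            has_derivative_diff[OF has_derivative_ident has_derivative_const]]
        show ?thesis by (simp add: F_def)
      qed
    qed
    have "integral (cbox 0 1) (\<lambda>s. n (?p x s) \<bullet> v + ?D s (s *\<^sub>R v) \<bullet> (x - x0)) = n x \<bullet> v" for v
    proof -
      have "((\<lambda>s. s * (n (?p x s) \<bullet> v)) has_vector_derivative n (?p x s) \<bullet> v + ?D s (s *\<^sub>R v) \<bullet> (x - x0))
          (at s within {0..1})" if s: "s \<in> {0..1}" for s
      proof -
        have s': "s \<in> cbox 0 1" using s by simp
        have "((\<lambda>s. ?p x s) has_derivative (\<lambda>h. h *\<^sub>R (x - x0))) (at s within {0..1})"
          by (auto intro!: derivative_eq_intros)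
        from has_derivative_mult[OF has_derivative_ident has_derivative_inner_left[OF has_derivative_compose[OF this nd[OF mem[OF x s']]], of v]]
        show ?thesis unfolding has_vector_derivative_def
          by (rule has_derivative_eq_rhs)
            (simp add: fun_eq_iff linear_scale[OF lin[OF s']] sym[OF mem[OF x s'], of "x - x0"] distrib_left mult_ac)
      qed
      then have "((\<lambda>s. n (?p x s) \<bullet> v + ?D s (s *\<^sub>R v) \<bullet> (x - x0)) has_integral
          (1 * (n (?p x 1) \<bullet> v) - 0 * (n (?p x 0) \<bullet> v))) {0..1}"
        by (intro fundamental_theorem_of_calculus) auto
      then show ?thesis by (auto simp: integral_unique)
    qed
    then show "((\<lambda>x. integral (cbox 0 1) (\<lambda>s. F (x, s))) has_derivative (\<lambda>v. n x \<bullet> v)) (at x)"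
      using * by simp
  qed
qed

subsection \<open>Local diffeomorphisms of three-space\<close>

abbreviation det_rows :: "real^3 \<Rightarrow> real^3 \<Rightarrow> real^3 \<Rightarrow> real"
  where "det_rows a b c \<equiv> a \<bullet> cross3 b c"

text \<open>Cramer's rule: the vector whose inner products with \<open>a\<close>, \<open>b\<close>,
  \<open>c\<close> are the components of \<open>w\<close>.\<close>

definition dual_comb :: "real^3 \<Rightarrow> real^3 \<Rightarrow> real^3 \<Rightarrow> real^3 \<Rightarrow> real^3"
  where "dual_comb a b c w = (1 / det_rows a b c) *\<^sub>R
    (w $ 1 *\<^sub>R cross3 b c + w $ 2 *\<^sub>R cross3 c a + w $ 3 *\<^sub>R cross3 a b)"

definition row_map :: "real^3 \<Rightarrow> real^3 \<Rightarrow> real^3 \<Rightarrow> real^3 \<Rightarrow> real^3"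
  where "row_map a b c v = vector [a \<bullet> v, b \<bullet> v, c \<bullet> v]"

lemma row_map_nth [simp]: "row_map a b c v $ 1 = a \<bullet> v" "row_map a b c v $ 2 = b \<bullet> v"
  "row_map a b c v $ 3 = c \<bullet> v"
  by (simp_all add: row_map_def)

lemma row_map_dual_comb:
  assumes "det_rows a b c \<noteq> 0"
  shows "row_map a b c (dual_comb a b c w) = w"
proof -
  have "b \<bullet> cross3 c a = det_rows a b c" "c \<bullet> cross3 a b = det_rows a b c"
    by (simp_all add: cross3_simps)
  then show ?thesis using assms
    by (simp add: vec_eq_iff forall_3 dual_comb_def inner_add_right dot_cross_self)
qed

lemma dual_comb_row_map:
  assumes "det_rows a b c \<noteq> 0"
  shows "dual_comb a b c (row_map a b c v) = v"
proof -
  have "(a \<bullet> v) *\<^sub>R cross3 b c + (b \<bullet> v) *\<^sub>R cross3 c a + (c \<bullet> v) *\<^sub>R cross3 a b = det_rows a b c *\<^sub>R v"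
    by (simp add: vec_eq_iff forall_3 cross_components inner_vec_def sum_3 algebra_simps)
  then show ?thesis using assms by (simp add: dual_comb_def)
qed

lemma bounded_linear_row_map: "bounded_linear (row_map a b c)"
  by (intro linear_conv_bounded_linear[THEN iffD1] linearI)
    (simp_all add: vec_eq_iff forall_3 inner_add_right)

lemma bounded_linear_dual_comb: "bounded_linear (dual_comb a b c)"
  by (intro linear_conv_bounded_linear[THEN iffD1] linearI)
    (simp_all add: dual_comb_def scaleR_add_left scaleR_add_right mult_ac)

lemma has_derivative_vec3:
  fixes F :: "'e::real_normed_vector \<Rightarrow> real^3"
  assumes "((\<lambda>x. F x $ 1) has_derivative (\<lambda>v. F' v $ 1)) (at x)"
    "((\<lambda>x. F x $ 2) has_derivative (\<lambda>v. F' v $ 2)) (at x)"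
    "((\<lambda>x. F x $ 3) has_derivative (\<lambda>v. F' v $ 3)) (at x)"
  shows "(F has_derivative F') (at x)"
proof -
  have "((\<lambda>x. F x $ i) has_derivative (\<lambda>v. F' v $ i)) (at x)" for i
    using assms exhaust_3[of i] by auto
  then show ?thesis
    by (subst has_derivative_componentwise_within) (auto simp: Basis_vec_def inner_axis)
qed

lemma smooth_on_vec3:
  fixes F :: "'e::euclidean_space \<Rightarrow> real^3"
  assumes "open S" "smooth_on S (\<lambda>x. F x $ 1)" "smooth_on S (\<lambda>x. F x $ 2)" "smooth_on S (\<lambda>x. F x $ 3)"
  shows "smooth_on S F"
proof (rule smooth_on_vec[OF assms(1)])
  show "smooth_on S (\<lambda>x. F x $ i)" for i using assms exhaust_3[of i] by auto
qed

lemma smooth_on_dual_comb: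
  assumes "open S" "smooth_on S a" "smooth_on S b" "smooth_on S c"
    "\<And>x. x \<in> S \<Longrightarrow> det_rows (a x) (b x) (c x) \<noteq> 0"
  shows "smooth_on S (\<lambda>x. dual_comb (a x) (b x) (c x) w)"
  unfolding dual_comb_def by (intro smooth_intros smooth_on_divide assms) auto

text \<open>The inverse function theorem gives a local inverse \<open>G\<close> that is once
  differentiable. Its derivative is \<open>dual_comb\<close> of the rows at \<open>G y\<close>, a
  smooth function of \<open>G\<close>, so each order of smoothness of \<open>G\<close> yields the
  next one. Giving the derivative of \<open>F\<close> by its rows keeps this formula
  explicit.\<close>

lemma smooth_local_inverse:
  fixes F r1 r2 r3 :: "real^3 \<Rightarrow> real^3"
  assumes "open U" "x0 \<in> U" and sm: "smooth_on U r1" "smooth_on U r2" "smooth_on U r3"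
    and F: "\<And>x. x \<in> U \<Longrightarrow> (F has_derivative row_map (r1 x) (r2 x) (r3 x)) (at x)"
    and "det_rows (r1 x0) (r2 x0) (r3 x0) \<noteq> 0"
  obtains U' V G where "open U'" "U' \<subseteq> U" "x0 \<in> U'" "open V" "homeomorphism U' V F G" "smooth_on V G"
    "\<And>x. x \<in> U' \<Longrightarrow> det_rows (r1 x) (r2 x) (r3 x) \<noteq> 0"
    "\<And>y. y \<in> V \<Longrightarrow> (G has_derivative dual_comb (r1 (G y)) (r2 (G y)) (r3 (G y))) (at y)"
proof -
  define d where "d x = det_rows (r1 x) (r2 x) (r3 x)" for x
  define U1 where "U1 = {x \<in> U. d x \<noteq> 0}"
  have cd: "continuous_on U d"
    unfolding d_def by (intro smooth_on_continuous smooth_intros assms)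
  have U1: "open U1"
  proof -
    have "U1 = U \<inter> d -` (- {0})" by (auto simp: U1_def)
    then show ?thesis using continuous_open_preimage[OF cd assms(1), of "- {0}"] by auto
  qed
  have x0: "x0 \<in> U1" using assms by (simp add: U1_def d_def)
  have sm1: "smooth_on U1 r1" "smooth_on U1 r2" "smooth_on U1 r3"
    using sm by (auto intro: smooth_on_subset simp: U1_def)
  have dn: "det_rows (r1 x) (r2 x) (r3 x) \<noteq> 0" if "x \<in> U1" for x using that by (simp add: U1_def d_def)
  define f' where "f' x = Blinfun (row_map (r1 x) (r2 x) (r3 x))" for x
  have f': "blinfun_apply (f' x) = row_map (r1 x) (r2 x) (r3 x)" for x
    unfolding f'_def by (rule bounded_linear_Blinfun_apply[OF bounded_linear_row_map])
  have cf': "continuous_on U1 f'"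
  proof (rule continuous_on_blinfun_componentwise)
    fix i
    have "smooth_on U1 (\<lambda>x. row_map (r1 x) (r2 x) (r3 x) i)"
      by (rule smooth_on_vec3[OF U1], unfold row_map_nth) (intro smooth_intros U1 sm1)+
    then show "continuous_on U1 (\<lambda>x. blinfun_apply (f' x) i)"
      using smooth_on_continuous by (simp add: f')
  qed
  define invf where "invf = Blinfun (dual_comb (r1 x0) (r2 x0) (r3 x0))"
  have invf: "blinfun_apply invf = dual_comb (r1 x0) (r2 x0) (r3 x0)"
    unfolding invf_def by (rule bounded_linear_Blinfun_apply[OF bounded_linear_dual_comb])
  have inv1: "invf o\<^sub>L f' x0 = id_blinfun"
    by (rule blinfun_eqI) (simp add: invf f' dual_comb_row_map[OF dn[OF x0]])
  have F1: "(F has_derivative blinfun_apply (f' x)) (at x)" if "x \<in> U1" for x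
    using F that by (simp add: f' U1_def)
  obtain U' V G g' where *: "open U'" "U' \<subseteq> U1" "x0 \<in> U'" "open V" "F x0 \<in> V" "homeomorphism U' V F G"
    "\<And>y. y \<in> V \<Longrightarrow> (G has_derivative (g' y)) (at y)"
    "\<And>y. y \<in> V \<Longrightarrow> g' y = inv (blinfun_apply (f' (G y)))"
    "\<And>y. y \<in> V \<Longrightarrow> bij (blinfun_apply (f' (G y)))"
    by (rule inverse_function_theorem[OF U1 _ cf' x0 inv1, of F]) (rule F1, assumption, rule that, assumption+)
  have GV: "G y \<in> U1" if "y \<in> V" for y
    using *(2,6) that homeomorphism_image2 by blast
  have Gd: "(G has_derivative dual_comb (r1 (G y)) (r2 (G y)) (r3 (G y))) (at y)" if "y \<in> V" for y
  proof -
    have "inv (blinfun_apply (f' (G y))) = dual_comb (r1 (G y)) (r2 (G y)) (r3 (G y))"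
      by (rule inv_equality) (simp_all add: f' dual_comb_row_map row_map_dual_comb dn[OF GV[OF that]])
    then show ?thesis using *(7,8)[OF that] by simp
  qed
  have "Ck_on k V G" for k
  proof (induction k)
    case 0
    show ?case using *(6) by (simp add: homeomorphism_def)
  next
    case (Suc k)
    show ?case
      by (rule Ck_on_SucI[OF *(4) Gd], assumption,
          rule Ck_on_compose[OF *(4) U1 GV Suc, of "\<lambda>x. dual_comb (r1 x) (r2 x) (r3 x) _"], assumption)
        (intro smooth_onD smooth_on_dual_comb U1 sm1 dn, assumption)
  qed
  then have "smooth_on V G" by (simp add: smooth_on_def)
  with * Gd dn show ?thesis by (intro that[of U' V G]) (auto simp: U1_def)
qed

subsection \<open>A primitive in straightened coordinates\<close>

lemma has_derivative_complex_of_pair: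
  fixes y :: "real^3"
  shows "((\<lambda>y::real^3. Complex (y $ 1) (y $ 2)) has_derivative (\<lambda>v. Complex (v $ 1) (v $ 2))) (at y)"
proof -
  have "bounded_linear (\<lambda>v::real^3. Complex (v $ 1) (v $ 2))"
    by (intro linear_conv_bounded_linear[THEN iffD1] linearI) (simp_all add: complex_eq_iff)
  then show ?thesis by (rule bounded_linear.has_derivative[OF _ has_derivative_ident])
qed

text \<open>Put \<open>h y = k (y1 + \<i> y2) + H y\<close>, where \<open>H\<close> is the integral
  of \<open>c\<close> along the third axis from the height of \<open>y0\<close>. The third
  derivative of \<open>h\<close> is then \<open>c\<close> whatever \<open>k\<close> is. By the
  compatibility hypothesis \<open>H\<close> contributes \<open>2 * a y\<close> minus
  \<open>2 * a\<close> at the foot of the segment to the second equation, so \<open>k\<close> only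
  has to solve a Cauchy--Riemann equation on the slice through \<open>y0\<close>.\<close>

lemma straightened_primitive:
  fixes a c :: "real^3 \<Rightarrow> complex"
  assumes "open W" "y0 \<in> W" "smooth_on W a" "smooth_on W c"
    and ac: "\<And>y. y \<in> W \<Longrightarrow> 2 * frechet_derivative a (at y) (axis 3 1)
      = frechet_derivative c (at y) (axis 1 1) + \<i> * frechet_derivative c (at y) (axis 2 1)"
  obtains W' h where "open W'" "W' \<subseteq> W" "y0 \<in> W'" "smooth_on W' h"
    "\<And>y. y \<in> W' \<Longrightarrow> frechet_derivative h (at y) (axis 3 1) = c y"
    "\<And>y. y \<in> W' \<Longrightarrow> frechet_derivative h (at y) (axis 1 1) + \<i> * frechet_derivative h (at y) (axis 2 1) = 2 * a y"
proof -
  let ?q = "\<lambda>y :: real^3. Complex (y $ 1) (y $ 2)"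
  let ?e = "axis 3 1 :: real^3"
  let ?m = "y0 $ 3"
  obtain \<rho> where \<rho>: "\<rho> > 0" "ball y0 \<rho> \<subseteq> W" using assms(1,2) openE by blast
  \<comment> \<open>A cylinder of radius and half height \<open>\<rho> / 2\<close> lies inside the
    ball of radius \<open>\<rho>\<close>. The base of \<open>W'\<close> is three times smaller,
    because \<open>cauchy_riemann_solution\<close> solves the equation only there.\<close>
  define B where "B = {y. dist (?q y) (?q y0) < \<rho> / 2 \<and> \<bar>y $ 3 - ?m\<bar> < \<rho> / 2}"
  define W' where "W' = {y. dist (?q y) (?q y0) < \<rho> / 2 / 3 \<and> \<bar>y $ 3 - ?m\<bar> < \<rho> / 2}"
  have cq: "continuous_on UNIV ?q"
    using has_derivative_continuous[OF has_derivative_complex_of_pair] by (simp add: continuous_at_imp_continuous_on)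
  have sq: "smooth_on S ?q" if "open S" for S
    by (rule smooth_onI_derivative[OF that has_derivative_complex_of_pair]) (rule smooth_on_const)
  have BW: "y \<in> W" if "y \<in> B" for y
  proof -
    have "norm (y - y0)^2 = norm (?q y - ?q y0)^2 + (y $ 3 - ?m)^2"
      unfolding power2_norm_eq_inner by (simp add: inner_vec_def sum_3 inner_complex_def power2_eq_square)
    also have "\<dots> \<le> (norm (?q y - ?q y0) + \<bar>y $ 3 - ?m\<bar>)^2"
      by (simp add: power2_sum)
    finally have "norm (y - y0) \<le> norm (?q y - ?q y0) + \<bar>y $ 3 - ?m\<bar>"
      by (rule power2_le_imp_le) simp
    then have "norm (y - y0) < \<rho>" using that by (simp add: B_def dist_norm)
    then show ?thesis using \<rho>(2) by (auto simp: dist_norm norm_minus_commute)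
  qed
  have oB: "open B" and oW': "open W'"
    unfolding B_def W'_def by (intro open_Collect_conj open_Collect_less continuous_intros cq)+
  have W'B: "W' \<subseteq> B" using \<rho>(1) unfolding B_def W'_def by auto
  have scB: "smooth_on B c" "smooth_on B a" using assms BW by (auto intro: smooth_on_subset)
  define base where "base \<zeta> = (vector [Re \<zeta>, Im \<zeta>, ?m] :: real^3)" for \<zeta>
  have sbase: "smooth_on S base" if "open S" for S
    using smooth_on_Re[OF that smooth_on_id[OF that]] smooth_on_Im[OF that smooth_on_id[OF that]]
    by (intro smooth_on_vec3[OF that]) (simp_all add: base_def smooth_on_const)
  have baseB: "base \<zeta> \<in> B" if "\<zeta> \<in> ball (?q y0) (\<rho> / 2)" for \<zeta>
    using that \<rho> by (simp add: B_def base_def dist_commute)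
  have "smooth_on (ball (?q y0) (\<rho> / 2)) (\<lambda>\<zeta>. a (base \<zeta>))"
    by (rule smooth_on_compose[OF _ oB baseB sbase scB(2)]) auto
  then obtain k where k: "smooth_on UNIV k" "\<And>z. z \<in> ball (?q y0) (\<rho> / 2 / 3) \<Longrightarrow>
      frechet_derivative k (at z) 1 + \<i> * frechet_derivative k (at z) \<i> = 2 * a (base z)"
    using cauchy_riemann_solution[of "?q y0" "\<rho> / 2"] \<rho>(1) by auto
  \<comment> \<open>The vertical segment from the slice (\<open>s = 0\<close>) to \<open>y\<close>
    (\<open>s = 1\<close>). Parametrising by \<open>[0, 1]\<close> keeps the interval of integration
    independent of \<open>y\<close>; the length of the segment becomes a factor in
    \<open>F\<close>.\<close>
  let ?P = "\<lambda>y s. y + ((s - 1) * (y $ 3 - ?m)) *\<^sub>R ?e"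
  define F where "F = (\<lambda>p :: (real^3) \<times> real. (fst p $ 3 - ?m) *\<^sub>R c (?P (fst p) (snd p)))"
  define WF where "WF = {p :: (real^3) \<times> real. ?P (fst p) (snd p) \<in> B}"
  have P_nth: "?P y s $ 1 = y $ 1" "?P y s $ 2 = y $ 2" "?P y s $ 3 - ?m = s * (y $ 3 - ?m)" for y s
    by (simp_all add: axis_def algebra_simps)
  have PB: "?P y s \<in> B" if "y \<in> W'" "s \<in> cbox 0 1" for y s
  proof -
    have "\<bar>s\<bar> * \<bar>y $ 3 - ?m\<bar> \<le> 1 * \<bar>y $ 3 - ?m\<bar>" using that by (intro mult_right_mono) auto
    then show ?thesis using that W'B unfolding B_def W'_def mem_Collect_eq P_nth by (auto simp: abs_mult)
  qed
  have cP: "continuous_on UNIV (\<lambda>p :: (real^3) \<times> real. ?P (fst p) (snd p))"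
    by (intro continuous_intros)
  have oWF: "open WF"
    unfolding WF_def using continuous_open_preimage[OF cP open_UNIV oB] by (simp add: vimage_def)
  have sF: "smooth_on WF F"
    unfolding F_def
    by (intro smooth_on_scaleR smooth_on_compose[OF oWF oB _ _ scB(1)] smooth_intros oWF) (auto simp: WF_def)
  define H where "H y = integral (cbox 0 1) (\<lambda>s. F (y, s))" for y
  let ?C = "\<lambda>y s. frechet_derivative c (at (?P y s))"
  have sub: "W' \<times> cbox 0 1 \<subseteq> WF" using PB by (auto simp: WF_def)
  have cder: "(c has_derivative frechet_derivative c (at y)) (at y)"
    and ader: "(a has_derivative frechet_derivative a (at y)) (at y)" if "y \<in> B" for y
    using smooth_on_has_derivative that scB by blast+
  have Hd: "(H has_derivative (\<lambda>v. integral (cbox 0 1) (\<lambda>s.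
      (v $ 3) *\<^sub>R c (?P y s) + (y $ 3 - ?m) *\<^sub>R ?C y s (v + ((s - 1) * v $ 3) *\<^sub>R ?e)))) (at y)" if y: "y \<in> W'" for y
    unfolding H_def
  proof (rule has_derivative_integral_smooth[OF oW' sub sF y])
    fix s :: real assume s: "s \<in> cbox 0 1"
    have 1: "((\<lambda>y::real^3. y $ 3 - ?m) has_derivative (\<lambda>v. v $ 3)) (at y)"
      by (rule has_derivative_eq_rhs[OF has_derivative_diff[OF bounded_linear.has_derivative[OF bounded_linear_vec_nth has_derivative_ident] has_derivative_const]]) simp
    have "((\<lambda>y. ?P y s) has_derivative (\<lambda>v. v + ((s - 1) * v $ 3) *\<^sub>R ?e)) (at y)"
      by (intro has_derivative_add has_derivative_ident has_derivative_scaleR_left has_derivative_mult_right 1)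
    from has_derivative_scaleR[OF 1 has_derivative_compose[OF this cder[OF PB[OF y s]]]]
    show "((\<lambda>y. F (y, s)) has_derivative (\<lambda>v. (v $ 3) *\<^sub>R c (?P y s) + (y $ 3 - ?m) *\<^sub>R ?C y s (v + ((s - 1) * v $ 3) *\<^sub>R ?e))) (at y)"
      unfolding F_def by (simp add: add.commute)
  qed
  have Pd: "((\<lambda>s. ?P y s) has_derivative (\<lambda>h. h *\<^sub>R ((y $ 3 - ?m) *\<^sub>R ?e))) (at s within T)" for y s T
    by (auto intro!: derivative_eq_intros)
  have lin: "linear (?C y s)" "linear (frechet_derivative a (at (?P y s)))" if "y \<in> W'" "s \<in> cbox 0 1" for y s
    using cder ader PB[OF that] has_derivative_linear by blast+
  define h where "h y = k (?q y) + H y" for y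
  have kd: "((\<lambda>y. k (?q y)) has_derivative (\<lambda>v. frechet_derivative k (at (?q y)) (?q v))) (at y)" for y
    using has_derivative_compose[OF has_derivative_complex_of_pair smooth_on_has_derivative[OF k(1) UNIV_I]] .
  have hd: "frechet_derivative h (at y) = (\<lambda>v. frechet_derivative k (at (?q y)) (?q v) + integral (cbox 0 1) (\<lambda>s.
      (v $ 3) *\<^sub>R c (?P y s) + (y $ 3 - ?m) *\<^sub>R ?C y s (v + ((s - 1) * v $ 3) *\<^sub>R ?e)))" if "y \<in> W'" for y
    unfolding h_def by (rule frechet_derivative_eqI) (rule has_derivative_add[OF kd Hd[OF that]])
  show ?thesis
  proof (rule that[OF oW'])
    show "W' \<subseteq> W" using W'B BW by auto
    show "y0 \<in> W'" using \<rho> by (simp add: W'_def)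
    show "smooth_on W' h"
      unfolding h_def H_def
      by (intro smooth_on_add smooth_on_compose[OF _ _ _ _ k(1)] sq smooth_on_integral[OF _ sub sF] oW') auto
    fix y assume y: "y \<in> W'"
    have kl: "linear (frechet_derivative k (at (?q y)))"
      using smooth_on_has_derivative[OF k(1) UNIV_I] has_derivative_linear by blast
    have P1: "?P y 1 = y" by simp
    show "frechet_derivative h (at y) (axis 3 1) = c y"
    proof -
      \<comment> \<open>The integrand of the third derivative of \<open>H\<close> is itself an
        \<open>s\<close>-derivative, so the integral is the boundary value
        \<open>c y\<close>.\<close>
      have "((\<lambda>s. s *\<^sub>R c (?P y s)) has_vector_derivative
          c (?P y s) + (y $ 3 - ?m) *\<^sub>R ?C y s (?e + ((s - 1) * 1) *\<^sub>R ?e)) (at s within {0..1})" if s: "s \<in> {0..1}" for s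
      proof -
        have s': "s \<in> cbox 0 1" using s by simp
        have e: "?e + ((s - 1) * 1) *\<^sub>R ?e = s *\<^sub>R ?e" by (simp add: algebra_simps)
        from has_derivative_scaleR[OF has_derivative_ident has_derivative_compose[OF Pd[of y s] cder[OF PB[OF y s']]]]
        show ?thesis unfolding has_vector_derivative_def e
          by (rule has_derivative_eq_rhs)
            (simp add: fun_eq_iff linear_scale[OF lin(1)[OF y s']] scaleR_add_right mult_ac add.commute)
      qed
      then have "((\<lambda>s. c (?P y s) + (y $ 3 - ?m) *\<^sub>R ?C y s (?e + ((s - 1) * 1) *\<^sub>R ?e)) has_integral
          (1 *\<^sub>R c (?P y 1) - 0 *\<^sub>R c (?P y 0))) {0..1}"
        by (intro fundamental_theorem_of_calculus) auto
      then have "integral (cbox 0 1) (\<lambda>s. c (?P y s) + (y $ 3 - ?m) *\<^sub>R ?C y s (?e + ((s - 1) * 1) *\<^sub>R ?e)) = c y"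
        unfolding P1 by (auto simp: integral_unique)
      moreover have "?q ?e = 0" by (simp add: axis_def complex_eq_iff)
      ultimately show ?thesis unfolding hd[OF y] using linear_0[OF kl] by (simp add: axis_def)
    qed
    have int: "(\<lambda>s. ?C y s v) integrable_on cbox 0 1" for v
      by (rule integrable_continuous, rule continuous_on_compose2[OF smooth_on_continuous[OF smooth_on_derivative[OF scB(1)]]])
        (use PB[OF y] in \<open>auto intro!: continuous_intros\<close>)
    have "frechet_derivative h (at y) (axis 1 1) + \<i> * frechet_derivative h (at y) (axis 2 1)
      = (frechet_derivative k (at (?q y)) 1 + \<i> * frechet_derivative k (at (?q y)) \<i>)
        + integral (cbox 0 1) (\<lambda>s. (y $ 3 - ?m) *\<^sub>R (?C y s (axis 1 1) + \<i> * ?C y s (axis 2 1)))"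
    proof -
      have hv: "frechet_derivative h (at y) v = frechet_derivative k (at (?q y)) (?q v) + (y $ 3 - ?m) *\<^sub>R integral (cbox 0 1) (\<lambda>s. ?C y s v)"
        if "v $ 3 = 0" for v
        unfolding hd[OF y] by (simp add: that)
      have "integral (cbox 0 1) (\<lambda>s. (y $ 3 - ?m) *\<^sub>R (?C y s (axis 1 1) + \<i> * ?C y s (axis 2 1)))
        = (y $ 3 - ?m) *\<^sub>R (integral (cbox 0 1) (\<lambda>s. ?C y s (axis 1 1)) + \<i> * integral (cbox 0 1) (\<lambda>s. ?C y s (axis 2 1)))"
        unfolding integral_cmul integral_add[OF int integrable_on_mult_right[OF int]] integral_mult_right ..
      moreover have "?q (axis 1 1) = 1" "?q (axis 2 1) = \<i>" by (simp_all add: axis_def complex_eq_iff)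
      moreover have "(axis 1 1 :: real^3) $ 3 = 0" "(axis 2 1 :: real^3) $ 3 = 0" by (simp_all add: axis_def)
      ultimately show ?thesis by (simp only: hv scaleR_add_right mult_scaleR_right distrib_left add_ac)
    qed
    also have "integral (cbox 0 1) (\<lambda>s. (y $ 3 - ?m) *\<^sub>R (?C y s (axis 1 1) + \<i> * ?C y s (axis 2 1))) = 2 * a y - 2 * a (base (?q y))"
    proof -
      \<comment> \<open>Here the compatibility of \<open>a\<close> and \<open>c\<close> enters: it
        turns the horizontal Cauchy--Riemann expression of \<open>c\<close> into the vertical
        derivative of \<open>2 * a\<close>.\<close>
      have "((\<lambda>s. 2 * a (?P y s)) has_vector_derivative
          (y $ 3 - ?m) *\<^sub>R (?C y s (axis 1 1) + \<i> * ?C y s (axis 2 1))) (at s within {0..1})" if s: "s \<in> {0..1}" for s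
      proof -
        have s': "s \<in> cbox 0 1" using s by simp
        have e: "?C y s (axis 1 1) + \<i> * ?C y s (axis 2 1) = 2 * frechet_derivative a (at (?P y s)) ?e"
          using ac[OF BW[OF PB[OF y s']]] by simp
        show ?thesis
          unfolding has_vector_derivative_def e
          by (rule has_derivative_eq_rhs[OF has_derivative_mult_right[OF has_derivative_compose[OF Pd[of y s] ader[OF PB[OF y s']]], of 2]])
            (simp add: fun_eq_iff linear_scale[OF lin(2)[OF y s']])
      qed
      then have I: "((\<lambda>s. (y $ 3 - ?m) *\<^sub>R (?C y s (axis 1 1) + \<i> * ?C y s (axis 2 1))) has_integral
          (2 * a (?P y 1) - 2 * a (?P y 0))) {0..1}"
        by (intro fundamental_theorem_of_calculus) auto
      have "?P y 0 = base (?q y)"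
        by (simp add: vec_eq_iff forall_3 base_def axis_def)
      with integral_unique[OF I] show ?thesis by (simp only: P1 cbox_interval)
    qed
    also have "frechet_derivative k (at (?q y)) 1 + \<i> * frechet_derivative k (at (?q y)) \<i> = 2 * a (base (?q y))"
      by (rule k(2)) (use y in \<open>simp add: W'_def dist_commute\<close>)
    finally show "frechet_derivative h (at y) (axis 1 1) + \<i> * frechet_derivative h (at y) (axis 2 1) = 2 * a y" by simp
  qed
qed

subsection \<open>Local holomorphic coordinates\<close>

lemma has_derivative_Complex:
  assumes "(f has_derivative f') F" "(g has_derivative g') F"
  shows "((\<lambda>x. Complex (f x) (g x)) has_derivative (\<lambda>v. Complex (f' v) (g' v))) F"
  unfolding Complex_eq by (intro has_derivative_add has_derivative_mult_right has_derivative_of_real assms)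

lemma smooth_on_Complex:
  assumes "open S" "smooth_on S f" "smooth_on S g"
  shows "smooth_on S (\<lambda>x. Complex (f x) (g x))"
  unfolding Complex_eq by (intro smooth_intros assms)

lemma bounded_bilinear_cross3: "bounded_bilinear cross3"
  using bilinear_cross bilinear_conv_bounded_bilinear by blast

text \<open>Differentiating the constant \<open>n (G z) \<bullet> DG u\<close> in direction
  \<open>w\<close> expresses \<open>n \<bullet> D(DG u) w\<close> through the derivative of
  \<open>n\<close>, which is symmetric by \<open>curl\<close>. Three covectors of this kind with
  nonzero determinant give the symmetry of the second derivative of \<open>G\<close> itself.\<close>

lemma second_derivative_symmetric_component:
  fixes G n :: "real^3 \<Rightarrow> real^3"
  assumes "open W" "y \<in> W" "smooth_on W G" "smooth_on U n" "G y \<in> U"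
    and curl: "\<And>u v. frechet_derivative n (at (G y)) u \<bullet> v = frechet_derivative n (at (G y)) v \<bullet> u"
    and const: "\<And>z u. z \<in> W \<Longrightarrow> n (G z) \<bullet> frechet_derivative G (at z) u = l u"
  shows "n (G y) \<bullet> frechet_derivative (\<lambda>z. frechet_derivative G (at z) u) (at y) w
    = n (G y) \<bullet> frechet_derivative (\<lambda>z. frechet_derivative G (at z) w) (at y) u"
proof -
  have *: "frechet_derivative n (at (G y)) (frechet_derivative G (at y) w) \<bullet> frechet_derivative G (at y) u
     + n (G y) \<bullet> frechet_derivative (\<lambda>z. frechet_derivative G (at z) u) (at y) w = 0" for u w
  proof -
    have "((\<lambda>z. n (G z) \<bullet> frechet_derivative G (at z) u) has_derivative
       (\<lambda>h. n (G y) \<bullet> frechet_derivative (\<lambda>z. frechet_derivative G (at z) u) (at y) h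
         + frechet_derivative n (at (G y)) (frechet_derivative G (at y) h) \<bullet> frechet_derivative G (at y) u)) (at y)"
      by (intro has_derivative_inner has_derivative_compose[OF smooth_on_has_derivative[OF assms(3,2)] smooth_on_has_derivative[OF assms(4,5)]]
          smooth_on_has_derivative[OF smooth_on_derivative[OF assms(3)] assms(2)])
    moreover have "((\<lambda>z. n (G z) \<bullet> frechet_derivative G (at z) u) has_derivative (\<lambda>h. 0)) (at y)"
      by (rule has_derivative_transform_within_open[OF has_derivative_const assms(1,2)]) (simp add: const)
    ultimately have "(\<lambda>h. n (G y) \<bullet> frechet_derivative (\<lambda>z. frechet_derivative G (at z) u) (at y) h
         + frechet_derivative n (at (G y)) (frechet_derivative G (at y) h) \<bullet> frechet_derivative G (at y) u) = (\<lambda>h. 0)"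
      by (rule has_derivative_unique)
    from fun_cong[OF this, of w] show ?thesis by (simp add: add.commute)
  qed
  show ?thesis using *[of u w] *[of w u] curl[of "frechet_derivative G (at y) w" "frechet_derivative G (at y) u"] by simp
qed

text \<open>\<open>B u v\<close> is the coefficient of the pullback under \<open>G\<close> of the
  2-form with vector \<open>V\<close>. In its exterior derivative the second derivatives of
  \<open>G\<close> cancel by symmetry, and the rest is the exterior derivative of the original form
  on transported vectors.\<close>

lemma pullback_closed:
  fixes G V :: "real^3 \<Rightarrow> real^3"
  assumes "y \<in> W" "smooth_on W G" "smooth_on U V" "G y \<in> U"
    and cl: "\<And>u v w. frechet_derivative V (at (G y)) u \<bullet> cross3 v w - frechet_derivative V (at (G y)) v \<bullet> cross3 u w
      + frechet_derivative V (at (G y)) w \<bullet> cross3 u v = 0"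
    and sym: "\<And>u w. frechet_derivative (\<lambda>z. frechet_derivative G (at z) u) (at y) w
      = frechet_derivative (\<lambda>z. frechet_derivative G (at z) w) (at y) u"
  defines "B \<equiv> \<lambda>u v z. V (G z) \<bullet> cross3 (frechet_derivative G (at z) u) (frechet_derivative G (at z) v)"
  shows "frechet_derivative (B v w) (at y) u - frechet_derivative (B u w) (at y) v + frechet_derivative (B u v) (at y) w = 0"
proof -
  let ?D = "frechet_derivative G (at y)"
  let ?S = "\<lambda>u. frechet_derivative (\<lambda>z. frechet_derivative G (at z) u) (at y)"
  have D: "frechet_derivative (B u v) (at y) = (\<lambda>h. V (G y) \<bullet> (cross3 (?D u) (?S v h) + cross3 (?S u h) (?D v))
      + frechet_derivative V (at (G y)) (?D h) \<bullet> cross3 (?D u) (?D v))" for u v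
    unfolding B_def
    by (rule frechet_derivative_eqI)
      (intro has_derivative_inner has_derivative_compose[OF smooth_on_has_derivative[OF assms(2,1)] smooth_on_has_derivative[OF assms(3,4)]]
        bounded_bilinear.FDERIV[OF bounded_bilinear_cross3] smooth_on_has_derivative[OF smooth_on_derivative[OF assms(2)] assms(1)])
  show ?thesis
    unfolding D using cl[of "?D u" "?D v" "?D w"] sym[of u v] sym[of u w] sym[of v w]
      cross_skew[of "?D v" "?S w u"] cross_skew[of "?D u" "?S w v"] cross_skew[of "?D u" "?S v w"]
    by (simp add: inner_add_right inner_diff_right)
qed

text \<open>In the straightened coordinates the coordinate fields are
  \<open>dual_comb a b c (axis i 1)\<close>. The two cross products that involve the third field are
  multiples of \<open>b\<close> and \<open>a\<close>, so the coefficients 13 and 23 of a 2-form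
  \<open>V\<close> are \<open>V \<bullet> b\<close> and \<open>V \<bullet> a\<close> up to sign and
  a common factor.\<close>

lemma dual_comb_cross:
  assumes "det_rows a b c \<noteq> 0"
  shows "cross3 (dual_comb a b c (axis 1 1)) (dual_comb a b c (axis 3 1)) = - (1 / det_rows a b c) *\<^sub>R b"
    "cross3 (dual_comb a b c (axis 2 1)) (dual_comb a b c (axis 3 1)) = (1 / det_rows a b c) *\<^sub>R a"
proof -
  have e: "dual_comb a b c (axis 1 1) = (1 / det_rows a b c) *\<^sub>R cross3 b c"
    "dual_comb a b c (axis 2 1) = (1 / det_rows a b c) *\<^sub>R cross3 c a"
    "dual_comb a b c (axis 3 1) = (1 / det_rows a b c) *\<^sub>R cross3 a b"
    by (simp_all add: dual_comb_def axis_def)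
  have "cross3 (cross3 b c) (cross3 a b) = - det_rows a b c *\<^sub>R b"
    "cross3 (cross3 c a) (cross3 a b) = det_rows a b c *\<^sub>R a"
    by (simp_all add: vec_eq_iff forall_3 cross_components inner_vec_def sum_3 algebra_simps)
  then show "cross3 (dual_comb a b c (axis 1 1)) (dual_comb a b c (axis 3 1)) = - (1 / det_rows a b c) *\<^sub>R b"
    "cross3 (dual_comb a b c (axis 2 1)) (dual_comb a b c (axis 3 1)) = (1 / det_rows a b c) *\<^sub>R a"
    unfolding e cross_mult_left cross_mult_right using assms by simp_all
qed

lemma linear3_expand:
  assumes "linear (L :: real^3 \<Rightarrow> 'b::real_vector)"
  shows "L w = w $ 1 *\<^sub>R L (axis 1 1) + w $ 2 *\<^sub>R L (axis 2 1) + w $ 3 *\<^sub>R L (axis 3 1)"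
proof -
  have "w = w $ 1 *\<^sub>R axis 1 1 + w $ 2 *\<^sub>R axis 2 1 + w $ 3 *\<^sub>R axis 3 1"
    by (simp add: vec_eq_iff forall_3 axis_def)
  then have "L w = L (w $ 1 *\<^sub>R axis 1 1 + w $ 2 *\<^sub>R axis 2 1 + w $ 3 *\<^sub>R axis 3 1)" by simp
  then show ?thesis by (simp add: linear_add[OF assms] linear_scale[OF assms])
qed

lemma cross3_linear_expand:
  assumes "linear (L :: real^3 \<Rightarrow> real^3)"
  shows "cross3 (L w) (L z) = (w $ 1 * z $ 2 - w $ 2 * z $ 1) *\<^sub>R cross3 (L (axis 1 1)) (L (axis 2 1))
    + (w $ 1 * z $ 3 - w $ 3 * z $ 1) *\<^sub>R cross3 (L (axis 1 1)) (L (axis 3 1))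
    + (w $ 2 * z $ 3 - w $ 3 * z $ 2) *\<^sub>R cross3 (L (axis 2 1)) (L (axis 3 1))"
  unfolding linear3_expand[OF assms, of w] linear3_expand[OF assms, of z]
  by (simp add: vec_eq_iff forall_3 cross_components algebra_simps)

text \<open>By the Binet--Cauchy identity and the two equations, \<open>cross3 n1 n2 \<bullet>
  cross3 V1 V2 = (n1 \<bullet> V1)\<^sup>2 + (n2 \<bullet> V1)\<^sup>2\<close>. Thus primitives of
  \<open>n1\<close> and \<open>n2\<close> can serve as two coordinates.\<close>

lemma taut_cross_nonzero:
  fixes n1 n2 V1 V2 :: "real^3"
  assumes "n1 \<bullet> V1 = n2 \<bullet> V2" "n1 \<bullet> V1 \<noteq> 0" "n1 \<bullet> V2 = - (n2 \<bullet> V1)"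
  shows "cross3 n1 n2 \<noteq> 0"
proof
  assume "cross3 n1 n2 = 0"
  then have "cross3 n1 n2 \<bullet> cross3 V1 V2 = 0" by simp
  then have "(n1 \<bullet> V1)\<^sup>2 + (n2 \<bullet> V1)\<^sup>2 = 0"
    using assms(1,3) by (simp add: dot_cross power2_eq_square)
  then show False using assms(2) by (simp add: sum_power2_eq_zero_iff)
qed

text \<open>The primitives \<open>f1, f2\<close> of \<open>n1, n2\<close> and a linear function straighten \<open>f = f1 + \<i> f2\<close> to a
  coordinate. In these coordinates, finding \<open>h\<close> with \<open>V1 + \<i> V2 = df \<and> dh\<close> is the equation solved
  in \<open>straightened_primitive\<close>.\<close>

lemma local_holomorphic_coordinates:
  fixes n1 n2 V1 V2 :: "real^3 \<Rightarrow> real^3"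
  assumes U: "open U" "x0 \<in> U"
    and sm: "smooth_on U n1" "smooth_on U n2" "smooth_on U V1" "smooth_on U V2"
    and curl1: "\<And>x u v. x \<in> U \<Longrightarrow> frechet_derivative n1 (at x) u \<bullet> v = frechet_derivative n1 (at x) v \<bullet> u"
    and curl2: "\<And>x u v. x \<in> U \<Longrightarrow> frechet_derivative n2 (at x) u \<bullet> v = frechet_derivative n2 (at x) v \<bullet> u"
    and cl1: "\<And>x u v w. x \<in> U \<Longrightarrow> frechet_derivative V1 (at x) u \<bullet> cross3 v w
      - frechet_derivative V1 (at x) v \<bullet> cross3 u w + frechet_derivative V1 (at x) w \<bullet> cross3 u v = 0"
    and cl2: "\<And>x u v w. x \<in> U \<Longrightarrow> frechet_derivative V2 (at x) u \<bullet> cross3 v w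
      - frechet_derivative V2 (at x) v \<bullet> cross3 u w + frechet_derivative V2 (at x) w \<bullet> cross3 u v = 0"
    and taut: "\<And>x. x \<in> U \<Longrightarrow> n1 x \<bullet> V1 x = n2 x \<bullet> V2 x" "\<And>x. x \<in> U \<Longrightarrow> n1 x \<bullet> V1 x \<noteq> 0"
      "\<And>x. x \<in> U \<Longrightarrow> n1 x \<bullet> V2 x = - (n2 x \<bullet> V1 x)"
  obtains U' f h V' \<Psi> where "open U'" "x0 \<in> U'" "U' \<subseteq> U" "smooth_on U' f" "smooth_on U' h"
    "\<And>x. x \<in> U' \<Longrightarrow> (f has_derivative (\<lambda>v. Complex (n1 x \<bullet> v) (n2 x \<bullet> v))) (at x)"
    "\<And>x u v. x \<in> U' \<Longrightarrow> Complex (V1 x \<bullet> cross3 u v) (V2 x \<bullet> cross3 u v)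
       = Complex (n1 x \<bullet> u) (n2 x \<bullet> u) * frechet_derivative h (at x) v
         - Complex (n1 x \<bullet> v) (n2 x \<bullet> v) * frechet_derivative h (at x) u"
    "open V'" "homeomorphism U' V' (\<lambda>x. vector [Re (f x), Im (f x), Im (h x)] :: real^3) \<Psi>" "smooth_on V' \<Psi>"
proof -
  obtain r where r: "r > 0" "ball x0 r \<subseteq> U" using U openE by blast
  let ?U = "ball x0 r"
  have smr: "smooth_on ?U n1" "smooth_on ?U n2" "smooth_on ?U V1" "smooth_on ?U V2"
    using sm r(2) smooth_on_subset by blast+
  obtain f1 where f1: "\<And>x. x \<in> ?U \<Longrightarrow> (f1 has_derivative (\<lambda>v. n1 x \<bullet> v)) (at x)"
    using poincare_1_form[OF smr(1)] curl1 r(2) by blast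
  obtain f2 where f2: "\<And>x. x \<in> ?U \<Longrightarrow> (f2 has_derivative (\<lambda>v. n2 x \<bullet> v)) (at x)"
    using poincare_1_form[OF smr(2)] curl2 r(2) by blast
  \<comment> \<open>With this choice the determinant of \<open>n1\<close>, \<open>n2\<close>,
    \<open>e\<close> at \<open>x0\<close> is the squared norm of \<open>e\<close>, so the linear
    function \<open>e \<bullet> x\<close> completes the coordinates.\<close>
  define e where "e = cross3 (n1 x0) (n2 x0)"
  have e: "e \<noteq> 0" unfolding e_def using taut_cross_nonzero taut U(2) by blast
  have det0: "det_rows (n1 x0) (n2 x0) e \<noteq> 0"
  proof -
    have "det_rows (n1 x0) (n2 x0) e = e \<bullet> e" 
      using cross_triple[of "n1 x0" "n2 x0" e] by (simp add: inner_commute flip: e_def)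
    then show ?thesis using e by simp
  qed
  define F where "F x = (vector [f1 x, f2 x, e \<bullet> x] :: real^3)" for x
  have Fd: "(F has_derivative row_map (n1 x) (n2 x) e) (at x)" if "x \<in> ?U" for x
    by (rule has_derivative_vec3)
      (use f1[OF that] f2[OF that] in \<open>simp_all add: F_def bounded_linear.has_derivative[OF bounded_linear_inner_right has_derivative_ident]\<close>)
  have x0U: "x0 \<in> ?U" using r by simp
  obtain U1 W G where G: "open U1" "U1 \<subseteq> ?U" "x0 \<in> U1" "open W" "homeomorphism U1 W F G" "smooth_on W G"
    "\<And>x. x \<in> U1 \<Longrightarrow> det_rows (n1 x) (n2 x) e \<noteq> 0"
    "\<And>y. y \<in> W \<Longrightarrow> (G has_derivative dual_comb (n1 (G y)) (n2 (G y)) e) (at y)"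
    by (rule smooth_local_inverse[OF open_ball x0U smr(1,2) smooth_on_const Fd det0], assumption, rule that, assumption+)
  have GU1: "G y \<in> U1" if "y \<in> W" for y using G(5) that homeomorphism_image2 by blast
  have GU: "G y \<in> U" if "y \<in> W" for y using GU1[OF that] G(2) r(2) by auto
  have dG: "frechet_derivative G (at y) = dual_comb (n1 (G y)) (n2 (G y)) e" if "y \<in> W" for y
    by (rule frechet_derivative_eqI[OF G(8)[OF that]])
  have row: "row_map (n1 (G y)) (n2 (G y)) e (frechet_derivative G (at y) u) = u" if "y \<in> W" for y u
    unfolding dG[OF that] by (rule row_map_dual_comb[OF G(7)[OF GU1[OF that]]])
  \<comment> \<open>Tested against the covectors \<open>n1\<close>, \<open>n2\<close>,
    \<open>e\<close>: each has symmetric derivative, and its pairing with \<open>DG u\<close> is the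
    constant component \<open>u $ i\<close>.\<close>
  have sym: "frechet_derivative (\<lambda>z. frechet_derivative G (at z) u) (at y) w
      = frechet_derivative (\<lambda>z. frechet_derivative G (at z) w) (at y) u" if y: "y \<in> W" for y u w
  proof -
    let ?s = "frechet_derivative (\<lambda>z. frechet_derivative G (at z) u) (at y) w"
    let ?t = "frechet_derivative (\<lambda>z. frechet_derivative G (at z) w) (at y) u"
    have 1: "n1 (G z) \<bullet> frechet_derivative G (at z) u = u $ 1"
      and 2: "n2 (G z) \<bullet> frechet_derivative G (at z) u = u $ 2"
      and 3: "e \<bullet> frechet_derivative G (at z) u = u $ 3" if "z \<in> W" for z u
      using row[OF that, of u] row_map_nth by metis+
    have "n1 (G y) \<bullet> ?s = n1 (G y) \<bullet> ?t"
      by (rule second_derivative_symmetric_component[OF G(4) y G(6) sm(1) GU[OF y] curl1[OF GU[OF y]] 1])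
    moreover have "n2 (G y) \<bullet> ?s = n2 (G y) \<bullet> ?t"
      by (rule second_derivative_symmetric_component[OF G(4) y G(6) sm(2) GU[OF y] curl2[OF GU[OF y]] 2])
    moreover have "e \<bullet> ?s = e \<bullet> ?t"
      by (rule second_derivative_symmetric_component[OF G(4) y G(6) smooth_on_const[of UNIV e] UNIV_I _ 3])
        (simp_all add: frechet_derivative_const)
    ultimately have "row_map (n1 (G y)) (n2 (G y)) e ?s = row_map (n1 (G y)) (n2 (G y)) e ?t"
      by (simp add: row_map_def)
    then show ?thesis using dual_comb_row_map[OF G(7)[OF GU1[OF y]]] by metis
  qed
  let ?X = "\<lambda>i y. frechet_derivative G (at y) (axis i 1)"
  define B where "B V i j = (\<lambda>y. V (G y) \<bullet> cross3 (?X i y) (?X j y))" for V i j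
  define b where "b i j = (\<lambda>y. Complex (B V1 i j y) (B V2 i j y))" for i j
  \<comment> \<open>With \<open>f = y1 + \<i> y2\<close>, comparing coefficients in
    \<open>\<Omega> = df \<and> dh\<close> gives \<open>h_3 = b 1 3\<close> and
    \<open>h_2 - \<i> * h_1 = b 1 2\<close>. The second equation reads
    \<open>h_1 + \<i> * h_2 = 2 * a\<close>.\<close>
  define a where "a = (\<lambda>y. \<i> / 2 * b 1 2 y)"
  have sB: "smooth_on W (B V1 i j)" "smooth_on W (B V2 i j)" for i j
    unfolding B_def
    by (intro smooth_on_inner smooth_on_cross3 smooth_on_derivative G(6) G(4) smooth_on_compose[OF G(4) U(1) GU G(6)] sm; assumption)+
  have sb: "smooth_on W (b i j)" for i j
    unfolding b_def by (intro smooth_on_Complex sB G(4))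
  have sa: "smooth_on W a"
    unfolding a_def by (intro smooth_on_mult smooth_on_const sb G(4))
  have db: "frechet_derivative (b i j) (at y) u = Complex (frechet_derivative (B V1 i j) (at y) u) (frechet_derivative (B V2 i j) (at y) u)"
    if "y \<in> W" for y i j u
    unfolding b_def
    by (subst frechet_derivative_eqI[OF has_derivative_Complex[OF smooth_on_has_derivative[OF sB(1) that] smooth_on_has_derivative[OF sB(2) that]]]) simp
  \<comment> \<open>The equation \<open>df \<and> (\<Omega>1 + \<i> \<Omega>2) = 0\<close> in
    straightened coordinates. It makes the coefficient 23 of \<open>df \<and> dh\<close> agree as
    soon as the coefficient 13 does.\<close>
  have b23: "b 2 3 y = \<i> * b 1 3 y" if "y \<in> W" for y
    using taut(1,3)[OF GU[OF that]]
    by (simp add: b_def B_def dG[OF that] dual_comb_cross[OF G(7)[OF GU1[OF that]]] complex_eq_iff inner_commute)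
  \<comment> \<open>Closedness relates the three coefficients of the pullback; eliminating
    \<open>b 2 3\<close> leaves the compatibility condition for \<open>a\<close> and
    \<open>b 1 3\<close>.\<close>
  have ac: "2 * frechet_derivative a (at y) (axis 3 1)
      = frechet_derivative (b 1 3) (at y) (axis 1 1) + \<i> * frechet_derivative (b 1 3) (at y) (axis 2 1)" if y: "y \<in> W" for y
  proof -
    have bd: "(b i j has_derivative frechet_derivative (b i j) (at y)) (at y)" for i j
      using smooth_on_has_derivative[OF sb y] .
    have "frechet_derivative (b 2 3) (at y) = frechet_derivative (\<lambda>y. \<i> * b 1 3 y) (at y)"
      by (rule frechet_derivative_cong_open[OF G(4) y b23])
    also have "\<dots> = (\<lambda>u. \<i> * frechet_derivative (b 1 3) (at y) u)"
      by (rule frechet_derivative_eqI[OF has_derivative_mult_right[OF bd]])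
    finally have 23: "frechet_derivative (b 2 3) (at y) = (\<lambda>u. \<i> * frechet_derivative (b 1 3) (at y) u)" .
    have 12: "frechet_derivative a (at y) = (\<lambda>u. \<i> / 2 * frechet_derivative (b 1 2) (at y) u)"
      unfolding a_def by (rule frechet_derivative_eqI[OF has_derivative_mult_right[OF bd]])
    have "frechet_derivative (b 2 3) (at y) (axis 1 1) - frechet_derivative (b 1 3) (at y) (axis 2 1)
        + frechet_derivative (b 1 2) (at y) (axis 3 1) = 0"
      unfolding db[OF y] B_def
      using pullback_closed[OF y G(6) sm(3) GU[OF y] cl1[OF GU[OF y]] sym[OF y]]
        pullback_closed[OF y G(6) sm(4) GU[OF y] cl2[OF GU[OF y]] sym[OF y]]
      by (simp add: complex_eq_iff)
    then have "frechet_derivative (b 1 2) (at y) (axis 3 1)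
        = frechet_derivative (b 1 3) (at y) (axis 2 1) - \<i> * frechet_derivative (b 1 3) (at y) (axis 1 1)"
      unfolding 23 by (simp add: algebra_simps add_eq_0_iff)
    then show ?thesis unfolding 12 by (simp add: complex_eq_iff)
  qed
  have y0: "F x0 \<in> W" using G(3,5) homeomorphism_image1 by blast
  obtain W' k where k: "open W'" "W' \<subseteq> W" "F x0 \<in> W'" "smooth_on W' k"
    "\<And>y. y \<in> W' \<Longrightarrow> frechet_derivative k (at y) (axis 3 1) = b 1 3 y"
    "\<And>y. y \<in> W' \<Longrightarrow> frechet_derivative k (at y) (axis 1 1) + \<i> * frechet_derivative k (at y) (axis 2 1) = 2 * a y"
    by (rule straightened_primitive[OF G(4) y0 sa sb ac]) (assumption, rule that, assumption+)
  define U2 where "U2 = U1 \<inter> F -` W'"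
  have cF: "continuous_on U1 F" using G(5) by (simp add: homeomorphism_def)
  have oU2: "open U2" unfolding U2_def by (rule continuous_open_preimage[OF cF G(1) k(1)])
  have U2U: "U2 \<subseteq> ?U" "x0 \<in> U2" using G(2,3) k(3) by (auto simp: U2_def)
  have smF: "smooth_on U2 F"
  proof (rule smooth_onI_derivative[OF oU2 Fd])
    show "x \<in> ?U" if "x \<in> U2" for x using that U2U by blast
    show "smooth_on U2 (\<lambda>x. row_map (n1 x) (n2 x) e v)" for v
      by (rule smooth_on_vec3[OF oU2], unfold row_map_nth)
        (intro smooth_intros oU2 smooth_on_subset[OF smr(1)] smooth_on_subset[OF smr(2)] U2U)+
  qed
  define h where "h x = k (F x)" for x
  define f where "f x = Complex (f1 x) (f2 x)" for x
  have sh: "smooth_on U2 h"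
    unfolding h_def by (rule smooth_on_compose[OF oU2 k(1) _ smF k(4)]) (simp add: U2_def)
  have fd: "(f has_derivative (\<lambda>v. Complex (n1 x \<bullet> v) (n2 x \<bullet> v))) (at x)" if "x \<in> U2" for x
    unfolding f_def using that U2U by (intro has_derivative_Complex f1 f2) auto
  have sf: "smooth_on U2 f"
    by (rule smooth_onI_derivative[OF oU2 fd], assumption)
      (intro smooth_on_Complex smooth_intros oU2 smooth_on_subset[OF smr(1)] smooth_on_subset[OF smr(2)] U2U)
  have main: "Complex (V1 x \<bullet> cross3 u v) (V2 x \<bullet> cross3 u v)
       = Complex (n1 x \<bullet> u) (n2 x \<bullet> u) * frechet_derivative h (at x) v
         - Complex (n1 x \<bullet> v) (n2 x \<bullet> v) * frechet_derivative h (at x) u" if x: "x \<in> U2" for x u v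
  proof -
    let ?R = "row_map (n1 x) (n2 x) e"
    have y: "F x \<in> W'" "F x \<in> W" and x1: "x \<in> U1" using x k(2) by (auto simp: U2_def)
    have GF: "G (F x) = x" using G(5) x1 homeomorphism_apply1 by blast
    have kd: "(k has_derivative frechet_derivative k (at (F x))) (at (F x))"
      using smooth_on_has_derivative[OF k(4) y(1)] .
    have hd: "frechet_derivative h (at x) v = frechet_derivative k (at (F x)) (?R v)" for v
      unfolding h_def using frechet_derivative_eqI[OF has_derivative_compose[OF Fd kd]] x U2U by auto
    have kl: "frechet_derivative k (at (F x)) w = w $ 1 *\<^sub>R frechet_derivative k (at (F x)) (axis 1 1)
        + w $ 2 *\<^sub>R frechet_derivative k (at (F x)) (axis 2 1) + w $ 3 *\<^sub>R b 1 3 (F x)" for w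
      unfolding k(5)[OF y(1), symmetric] by (rule linear3_expand[OF has_derivative_linear[OF kd]])
    have Gl: "linear (frechet_derivative G (at (F x)))"
      using has_derivative_linear[OF smooth_on_has_derivative[OF G(6) y(2)]] .
    have dGR: "frechet_derivative G (at (F x)) (?R u) = u" for u
      unfolding dG[OF y(2)] GF by (rule dual_comb_row_map[OF G(7)[OF x1]])
    have b12: "b 1 2 (F x) = frechet_derivative k (at (F x)) (axis 2 1) - \<i> * frechet_derivative k (at (F x)) (axis 1 1)"
      using k(6)[OF y(1)] by (simp add: a_def complex_eq_iff)
    have "Complex (V1 x \<bullet> cross3 u v) (V2 x \<bullet> cross3 u v)
        = (?R u $ 1 * ?R v $ 2 - ?R u $ 2 * ?R v $ 1) *\<^sub>R b 1 2 (F x)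
         + (?R u $ 1 * ?R v $ 3 - ?R u $ 3 * ?R v $ 1) *\<^sub>R b 1 3 (F x)
         + (?R u $ 2 * ?R v $ 3 - ?R u $ 3 * ?R v $ 2) *\<^sub>R b 2 3 (F x)"
      using cross3_linear_expand[OF Gl, of "?R u" "?R v"]
      by (simp add: dGR b_def B_def GF complex_eq_iff inner_add_right)
    also have "\<dots> = Complex (n1 x \<bullet> u) (n2 x \<bullet> u) * frechet_derivative h (at x) v
         - Complex (n1 x \<bullet> v) (n2 x \<bullet> v) * frechet_derivative h (at x) u"
      unfolding hd kl[of "?R u"] kl[of "?R v"] b12 b23[OF y(2)]
      by (simp add: complex_eq_iff algebra_simps)
    finally show ?thesis .
  qed
  define m where "m x = (vector [Im (frechet_derivative h (at x) (axis 1 1)), Im (frechet_derivative h (at x) (axis 2 1)),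
    Im (frechet_derivative h (at x) (axis 3 1))] :: real^3)" for x
  have smm: "smooth_on U2 m"
    by (rule smooth_on_vec3[OF oU2], unfold m_def vector_3)
      (intro smooth_on_Im smooth_on_derivative oU2 sh)+
  have md: "((\<lambda>x. Im (h x)) has_derivative (\<lambda>v. m x \<bullet> v)) (at x)" if "x \<in> U2" for x
  proof -
    note hx = smooth_on_has_derivative[OF sh that]
    have "Im (frechet_derivative h (at x) v) = m x \<bullet> v" for v
      by (subst linear3_expand[OF has_derivative_linear[OF hx]]) (simp add: m_def inner_vec_def sum_3)
    then show ?thesis
      using bounded_linear.has_derivative[OF bounded_linear_Im hx] by simp
  qed
  have det: "det_rows (n1 x) (n2 x) (m x) \<noteq> 0" if x: "x \<in> U2" for x
  proof -
    have V: "V1 x \<bullet> cross3 u v = (n1 x \<bullet> u) * Re (frechet_derivative h (at x) v) - (n2 x \<bullet> u) * Im (frechet_derivative h (at x) v)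
        - (n1 x \<bullet> v) * Re (frechet_derivative h (at x) u) + (n2 x \<bullet> v) * Im (frechet_derivative h (at x) u)" for u v
      using main[OF x, of u v] by (simp add: complex_eq_iff)
    have V': "V1 x $ 1 = V1 x \<bullet> cross3 (axis 2 1) (axis 3 1)" "V1 x $ 2 = V1 x \<bullet> cross3 (axis 3 1) (axis 1 1)"
      "V1 x $ 3 = V1 x \<bullet> cross3 (axis 1 1) (axis 2 1)"
      by (simp_all add: cross_basis inner_axis)
    \<comment> \<open>The real part of \<open>main\<close> says that \<open>V1\<close> is
      \<open>n1\<close> crossed with the gradient of \<open>Re h\<close> minus \<open>n2\<close>
      crossed with \<open>m\<close>, the gradient of \<open>Im h\<close>. Pairing with
      \<open>n1\<close> removes the first term.\<close>
    have "n1 x \<bullet> V1 x = - det_rows (n1 x) (n2 x) (m x)"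
      unfolding inner_vec_def[of "n1 x" "V1 x"] sum_3 V'
      unfolding V
      by (simp add: axis_def m_def inner_vec_def sum_3 cross_components algebra_simps)
    then show ?thesis using taut(2)[of x] x U2U r(2) by auto
  qed
  have Phd: "((\<lambda>x. vector [Re (f x), Im (f x), Im (h x)]) has_derivative row_map (n1 x) (n2 x) (m x)) (at x)"
    if "x \<in> U2" for x
    by (rule has_derivative_vec3)
      (use f1[of x] f2[of x] md[OF that] that U2U in \<open>auto simp: f_def\<close>)
  have smn: "smooth_on U2 n1" "smooth_on U2 n2" using smr U2U smooth_on_subset by blast+
  obtain U3 V' \<Psi> where P: "open U3" "U3 \<subseteq> U2" "x0 \<in> U3" "open V'"
    "homeomorphism U3 V' (\<lambda>x. vector [Re (f x), Im (f x), Im (h x)]) \<Psi>" "smooth_on V' \<Psi>"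
    "\<And>x. x \<in> U3 \<Longrightarrow> det_rows (n1 x) (n2 x) (m x) \<noteq> 0"
    "\<And>y. y \<in> V' \<Longrightarrow> (\<Psi> has_derivative dual_comb (n1 (\<Psi> y)) (n2 (\<Psi> y)) (m (\<Psi> y))) (at y)"
    by (rule smooth_local_inverse[OF oU2 U2U(2) smn smm Phd det[OF U2U(2)]], assumption, rule that, assumption+)
  have U3: "U3 \<subseteq> U" "\<And>x. x \<in> U3 \<Longrightarrow> x \<in> U2" using P(2) U2U r(2) by auto
  show ?thesis
    by (rule that[OF P(1,3) U3(1) smooth_on_subset[OF sf P(2)] smooth_on_subset[OF sh P(2)] fd[OF U3(2)] main[OF U3(2)] P(4-6)])
qed

section \<open>Manifolds in coordinates\<close>

subsection \<open>Charts\<close>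

lemma is_chartD:
  assumes "is_chart X c"
  shows "inj_on (snd c) (fst c)" "fst c \<subseteq> topspace X" "open (snd c ` fst c)" "openin X (fst c)"
    "homeomorphic_map (subtopology X (fst c)) (top_of_set (snd c ` fst c)) (snd c)"
proof -
  show o: "openin X (fst c)" and h: "homeomorphic_map (subtopology X (fst c)) (top_of_set (snd c ` fst c)) (snd c)"
    and "open (snd c ` fst c)"
    using assms by (auto simp: is_chart_def)
  show s: "fst c \<subseteq> topspace X" using o openin_subset by blast
  show "inj_on (snd c) (fst c)"
    using homeomorphic_imp_injective_map[OF h] s by (simp add: Int_absorb1)
qed

lemma chart_open_image:
  assumes "is_chart X c" "openin X S" "S \<subseteq> fst c"
  shows "open (snd c ` S)"
proof -
  have "openin (subtopology X (fst c)) S" using assms(2,3) by (metis openin_subtopology inf.absorb1)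
  then have "openin (top_of_set (snd c ` fst c)) (snd c ` S)"
    using homeomorphic_imp_open_map[OF is_chartD(5)[OF assms(1)]] unfolding open_map_def by blast
  then show ?thesis using is_chartD(3)[OF assms(1)] openin_open_trans by blast
qed

lemma cinv_chart: "is_chart X c \<Longrightarrow> p \<in> fst c \<Longrightarrow> cinv c (snd c p) = p"
  by (rule inv_into_f_f[OF is_chartD(1)])

lemma cinv_in: "x \<in> snd c ` fst c \<Longrightarrow> cinv c x \<in> fst c" "x \<in> snd c ` fst c \<Longrightarrow> snd c (cinv c x) = x"
  by (simp_all add: inv_into_into f_inv_into_f)

lemma chart_homeomorphic_maps:
  assumes "is_chart X c"
  shows "homeomorphic_maps (subtopology X (fst c)) (top_of_set (snd c ` fst c)) (snd c) (cinv c)"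
proof -
  obtain g where g: "homeomorphic_maps (subtopology X (fst c)) (top_of_set (snd c ` fst c)) (snd c) g"
    using is_chartD(5)[OF assms] homeomorphic_map_maps by blast
  then have "g x = cinv c x" if "x \<in> snd c ` fst c" for x
    using that cinv_chart[OF assms] is_chartD(2)[OF assms] by (force simp: homeomorphic_maps_def)
  then show ?thesis
    using g by (auto intro: homeomorphic_maps_eq)
qed

text \<open>Provides the holomorphic charts: a chart of the manifold followed by a homeomorphism
  \<open>Z\<close> between open sets of two model spaces. The last claim gives their inverses, in
  which smooth compatibility is stated.\<close>

lemma is_chart_compose:
  assumes c: "is_chart X c" and O: "open O1" "O1 \<subseteq> snd c ` fst c" "open O2" and Z: "homeomorphism O1 O2 Z Z'"
  shows "is_chart X (cinv c ` O1, Z \<circ> snd c)"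
    "(Z \<circ> snd c) ` (cinv c ` O1) = O2" "cinv c ` O1 \<subseteq> fst c"
    "\<And>y. y \<in> O2 \<Longrightarrow> cinv (cinv c ` O1, Z \<circ> snd c) y = cinv c (Z' y)"
proof -
  let ?S = "cinv c ` O1"
  have e: "?S = {p \<in> fst c. snd c p \<in> O1}"
  proof (intro set_eqI iffI)
    fix p assume "p \<in> ?S"
    then obtain x where "x \<in> O1" "p = cinv c x" by blast
    then show "p \<in> {p \<in> fst c. snd c p \<in> O1}" using cinv_in[of x c] O(2) by auto
  next
    fix p assume "p \<in> {p \<in> fst c. snd c p \<in> O1}"
    then show "p \<in> ?S" using cinv_chart[OF c, of p] by (metis (mono_tags, lifting) image_eqI mem_Collect_eq)
  qed
  then show sub: "?S \<subseteq> fst c" by auto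
  have "snd c (cinv c x) = x" if "x \<in> O1" for x using cinv_in(2)[of x c] O(2) that by blast
  then have im: "snd c ` ?S = O1" by (simp add: image_image)
  have ZO: "Z ` O1 = O2" "Z' ` O2 = O1" using Z by (auto simp: homeomorphism_def)
  show im2: "(Z \<circ> snd c) ` ?S = O2" by (simp only: image_comp[symmetric] im ZO)
  have "continuous_map (subtopology X (fst c)) (top_of_set (snd c ` fst c)) (snd c)"
    by (rule homeomorphic_imp_continuous_map[OF is_chartD(5)[OF c]])
  then have "openin (subtopology X (fst c)) {p \<in> topspace (subtopology X (fst c)). snd c p \<in> O1}"
    by (rule openin_continuous_map_preimage[OF _ open_subset[OF O(2,1)]])
  moreover have "{p \<in> topspace (subtopology X (fst c)). snd c p \<in> O1} = ?S"
    using e is_chartD(2)[OF c] by auto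
  ultimately have "openin (subtopology X (fst c)) ?S" by simp
  then have oS: "openin X ?S" using is_chartD(4)[OF c] openin_trans_full by blast
  have "homeomorphic_map (subtopology (subtopology X (fst c)) ?S) (subtopology (top_of_set (snd c ` fst c)) O1) (snd c)"
    by (rule homeomorphic_map_subtopologies[OF is_chartD(5)[OF c]])
      (use im O(2) sub is_chartD(2)[OF c] in \<open>simp add: Int_absorb1 Int_absorb2\<close>)
  then have "homeomorphic_map (subtopology X ?S) (top_of_set O1) (snd c)"
    using sub O(2) by (simp add: subtopology_subtopology Int_absorb1)
  moreover have "homeomorphic_map (top_of_set O1) (top_of_set O2) Z"
    by (rule homeomorphic_maps_imp_map[of _ _ _ Z'])
      (use Z in \<open>auto simp: homeomorphic_maps_def homeomorphism_def\<close>)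
  ultimately have "homeomorphic_map (subtopology X ?S) (top_of_set O2) (Z \<circ> snd c)"
    by (rule homeomorphic_map_compose)
  then show ch: "is_chart X (?S, Z \<circ> snd c)"
    using oS O(3) im2 by (simp add: is_chart_def)
  fix y assume y: "y \<in> O2"
  then have "Z' y \<in> O1" "Z (Z' y) = y" using Z by (auto simp: homeomorphism_def)
  then have "snd (?S, Z \<circ> snd c) (cinv c (Z' y)) = y" "cinv c (Z' y) \<in> fst (?S, Z \<circ> snd c)"
    using O(2) cinv_in(2)[of "Z' y" c] by auto
  then show "cinv (?S, Z \<circ> snd c) y = cinv c (Z' y)"
    using cinv_chart[OF ch, of "cinv c (Z' y)"] by (simp only:)
qed

subsection \<open>Tangent vectors\<close>

locale smooth_atlas =
  fixes X :: "'a topology" and A :: "('a, 'e::euclidean_space) chart set"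
  assumes charts: "c \<in> A \<Longrightarrow> is_chart X c"
    and compat: "c \<in> A \<Longrightarrow> d \<in> A \<Longrightarrow> smooth_compat c d"
begin

lemma chart_cinv [simp]: "c \<in> A \<Longrightarrow> p \<in> fst c \<Longrightarrow> cinv c (snd c p) = p"
  by (rule cinv_chart[OF charts])

lemma open_overlap: "c \<in> A \<Longrightarrow> d \<in> A \<Longrightarrow> open (snd c ` (fst c \<inter> fst d))"
  by (rule chart_open_image[OF charts openin_Int[OF is_chartD(4)[OF charts] is_chartD(4)[OF charts]]]) auto

lemma open_chart_image: "c \<in> A \<Longrightarrow> open (snd c ` fst c)"
  by (rule is_chartD(3)[OF charts])

lemma smooth_transition: "c \<in> A \<Longrightarrow> d \<in> A \<Longrightarrow> smooth_on (snd c ` (fst c \<inter> fst d)) (snd d \<circ> cinv c)"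
  using compat[of c d] by (simp add: smooth_compat_def)

lemma trans_deriv:
  assumes "c \<in> A" "d \<in> A" "p \<in> fst c" "p \<in> fst d"
  shows "((snd d \<circ> cinv c) has_derivative trans_deriv c d p) (at (snd c p))"
  unfolding trans_deriv_def
  by (rule smooth_on_has_derivative[OF smooth_transition]) (use assms in auto)

lemma trans_deriv_linear:
  "c \<in> A \<Longrightarrow> d \<in> A \<Longrightarrow> p \<in> fst c \<Longrightarrow> p \<in> fst d \<Longrightarrow> linear (trans_deriv c d p)"
  by (rule has_derivative_linear[OF trans_deriv])

lemma has_derivative_chart_change:
  assumes "c \<in> A" "d \<in> A" "p \<in> fst c" "p \<in> fst d"
    and "((f \<circ> cinv d) has_derivative f') (at (snd d p))"
  shows "((f \<circ> cinv c) has_derivative f' \<circ> trans_deriv c d p) (at (snd c p))"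
proof -
  have "((f \<circ> cinv d) \<circ> (snd d \<circ> cinv c) has_derivative f' \<circ> trans_deriv c d p) (at (snd c p))"
    by (rule diff_chain_at[OF trans_deriv]) (use assms in auto)
  then show ?thesis
    by (rule has_derivative_transform_within_open[OF _ open_overlap[of c d]]) (use assms in auto)
qed

lemma trans_deriv_comp:
  assumes "c \<in> A" "d \<in> A" "b \<in> A" "p \<in> fst c" "p \<in> fst d" "p \<in> fst b"
  shows "trans_deriv d b p (trans_deriv c d p v) = trans_deriv c b p v"
  using has_derivative_unique[OF has_derivative_chart_change[OF assms(1,2,4,5) trans_deriv[OF assms(2,3,5,6)]]
      trans_deriv[OF assms(1,3,4,6)]]
  by (simp add: o_def fun_eq_iff)

lemma trans_deriv_id:
  assumes "c \<in> A" "p \<in> fst c"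
  shows "trans_deriv c c p v = v"
proof -
  have "((snd c \<circ> cinv c) has_derivative (\<lambda>v. v)) (at (snd c p))"
    by (rule has_derivative_transform_within_open[OF has_derivative_ident open_chart_image[OF assms(1)]])
      (use assms cinv_in in auto)
  from has_derivative_unique[OF trans_deriv[OF assms(1,1,2,2)] this] show ?thesis by simp
qed

lemma coord_vec_tangent:
  assumes "c \<in> A" "p \<in> fst c"
  shows "coord_vec A c p e \<in> tangent_space A p"
proof -
  have "trans_deriv d b p (trans_deriv c d p e) = trans_deriv c b p e" if "d \<in> A" "b \<in> A" "p \<in> fst d" "p \<in> fst b" for b d
    by (rule trans_deriv_comp) (use assms that in auto)
  then show ?thesis unfolding tangent_space_def coord_vec_def by simp
qed

lemma coord_vec_apply [simp]: "c \<in> A \<Longrightarrow> p \<in> fst c \<Longrightarrow> coord_vec A c p e c = e"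
  by (simp add: coord_vec_def trans_deriv_id)

lemma tangent_spaceD:
  assumes "u \<in> tangent_space A p"
  shows "c \<in> A \<Longrightarrow> d \<in> A \<Longrightarrow> p \<in> fst c \<Longrightarrow> p \<in> fst d \<Longrightarrow> trans_deriv c d p (u c) = u d"
    "c \<notin> A \<or> p \<notin> fst c \<Longrightarrow> u c = 0"
proof -
  have *: "\<forall>c\<in>A. \<forall>d\<in>A. p \<in> fst c \<inter> fst d \<longrightarrow> u d = trans_deriv c d p (u c)"
    "\<forall>c. c \<notin> A \<or> p \<notin> fst c \<longrightarrow> u c = 0"
    using assms unfolding tangent_space_def mem_Collect_eq by (rule conjunct1, rule conjunct2)
  show "trans_deriv c d p (u c) = u d" if "c \<in> A" "d \<in> A" "p \<in> fst c" "p \<in> fst d"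
    by (rule *(1)[rule_format, symmetric]) (use that in simp_all)
  show "u c = 0" if "c \<notin> A \<or> p \<notin> fst c" using *(2) that by blast
qed

lemma coord_vec_coords:
  assumes "c \<in> A" "p \<in> fst c" "u \<in> tangent_space A p"
  shows "coord_vec A c p (u c) = u"
proof
  fix d show "coord_vec A c p (u c) d = u d"
    using tangent_spaceD(1)[OF assms(3,1) _ assms(2), of d] tangent_spaceD(2)[OF assms(3), of d]
    by (cases "d \<in> A \<and> p \<in> fst d") (auto simp: coord_vec_def)
qed

lemma tangent_eqI:
  assumes "c \<in> A" "p \<in> fst c" "u \<in> tangent_space A p" "w \<in> tangent_space A p" "u c = w c"
  shows "u = w"
proof -
  have "u = coord_vec A c p (u c)" by (rule coord_vec_coords[OF assms(1,2,3), symmetric])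
  also have "\<dots> = coord_vec A c p (w c)" by (simp only: assms(5))
  also have "\<dots> = w" by (rule coord_vec_coords[OF assms(1,2,4)])
  finally show ?thesis .
qed

lemma tcomb_tangent:
  assumes "u \<in> tangent_space A p" "w \<in> tangent_space A p"
  shows "tcomb a u b w \<in> tangent_space A p"
proof -
  have "trans_deriv c d p (a *\<^sub>R u c + b *\<^sub>R w c) = a *\<^sub>R u d + b *\<^sub>R w d"
    if "c \<in> A" "d \<in> A" "p \<in> fst c" "p \<in> fst d" for c d
    using tangent_spaceD(1)[OF assms(1) that] tangent_spaceD(1)[OF assms(2) that] trans_deriv_linear[OF that]
    by (simp add: linear_add linear_scale)
  then show ?thesis
    using tangent_spaceD(2)[OF assms(1)] tangent_spaceD(2)[OF assms(2)]
    unfolding tangent_space_def tcomb_def by simp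
qed

lemma coord_vec_tcomb:
  assumes "c \<in> A" "p \<in> fst c"
  shows "coord_vec A c p (a *\<^sub>R e + b *\<^sub>R f) = tcomb a (coord_vec A c p e) b (coord_vec A c p f)"
proof (rule tangent_eqI[OF assms])
  show "coord_vec A c p (a *\<^sub>R e + b *\<^sub>R f) \<in> tangent_space A p"
    by (rule coord_vec_tangent[OF assms])
  show "tcomb a (coord_vec A c p e) b (coord_vec A c p f) \<in> tangent_space A p"
    by (intro tcomb_tangent coord_vec_tangent assms)
  show "coord_vec A c p (a *\<^sub>R e + b *\<^sub>R f) c = tcomb a (coord_vec A c p e) b (coord_vec A c p f) c"
    unfolding tcomb_def coord_vec_apply[OF assms] ..
qed

lemma in_pts: "c \<in> A \<Longrightarrow> p \<in> fst c \<Longrightarrow> p \<in> pts A"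
  unfolding pts_def by blast

lemma ptsE:
  assumes "p \<in> pts A"
  obtains c where "c \<in> A" "p \<in> fst c"
  using assms unfolding pts_def by blast

text \<open>\<open>differential\<close> is computed in a chart selected by \<open>SOME\<close>. The
  chain rule for the chart change, together with the transformation of \<open>u\<close>, moves the
  computation to the chart at hand.\<close>

lemma differential_chart:
  assumes "c \<in> A" "p \<in> fst c" "u \<in> tangent_space A p"
    and f: "((f \<circ> cinv c) has_derivative f') (at (snd c p))"
  shows "differential A f p u = f' (u c)"
proof -
  define d where "d = (SOME c. c \<in> A \<and> p \<in> fst c)"
  have d: "d \<in> A" "p \<in> fst d"
    using someI[of "\<lambda>c. c \<in> A \<and> p \<in> fst c" c] assms(1,2) by (auto simp: d_def)
  have "frechet_derivative (f \<circ> cinv d) (at (snd d p)) = f' \<circ> trans_deriv d c p"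
    by (rule frechet_derivative_eqI[OF has_derivative_chart_change[OF d(1) assms(1) d(2) assms(2) f]])
  moreover have "trans_deriv d c p (u d) = u c"
    using tangent_spaceD(1)[OF assms(3) d(1) assms(1) d(2) assms(2)] .
  ultimately show ?thesis
    unfolding differential_def d_def[symmetric] Let_def by simp
qed

text \<open>Compatibility with an arbitrary chart \<open>d\<close> is obtained by passing through
  the transition between \<open>d\<close> and \<open>c\<close>.\<close>

lemma smooth_compat_compose:
  fixes Z :: "'e \<Rightarrow> 'f::euclidean_space"
  assumes c: "c \<in> A" and d: "d \<in> A" and O: "open O1" "O1 \<subseteq> snd c ` fst c" "open O2"
    and Z: "homeomorphism O1 O2 Z Z'" "smooth_on O1 Z" "smooth_on O2 Z'"
  shows "smooth_compat d (cinv c ` O1, Z \<circ> snd c)"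
proof -
  let ?z = "(cinv c ` O1, Z \<circ> snd c)"
  note ic = is_chart_compose[of X c O1 O2 Z Z', OF charts[OF c] O Z(1)]
  let ?S = "fst d \<inter> cinv c ` O1"
  have op: "openin X ?S"
    using openin_Int[OF is_chartD(4)[OF charts[OF d]] is_chartD(4)[OF ic(1)]] by simp
  have od: "open (snd d ` ?S)"
    by (rule chart_open_image[OF charts[OF d] op]) auto
  have oz: "open ((Z \<circ> snd c) ` ?S)"
    using chart_open_image[OF ic(1) op] by simp
  have subO: "(Z \<circ> snd c) ` ?S \<subseteq> O2"
    unfolding ic(2)[symmetric] by (rule image_mono) simp
  have cO: "snd c (cinv c x) = x" if "x \<in> O1" for x using that O(2) cinv_in(2)[of x c] by blast
  have Z': "Z' (Z x) = x" if "x \<in> O1" for x using Z(1) that by (simp add: homeomorphism_def)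
  have S: "snd c p \<in> O1" "p \<in> fst c" "p \<in> fst d" if "p \<in> ?S" for p
    using that ic(3) by (auto simp: cO)
  have "smooth_on (snd d ` ?S) (\<lambda>x. Z ((snd c \<circ> cinv d) x))"
  proof (rule smooth_on_compose[where f = "snd c \<circ> cinv d", OF od O(1) _ _ Z(2)])
    fix x assume "x \<in> snd d ` ?S"
    then obtain p where p: "p \<in> ?S" "x = snd d p" by blast
    show "(snd c \<circ> cinv d) x \<in> O1"
      unfolding o_def p(2) chart_cinv[OF d S(3)[OF p(1)]] by (rule S(1)[OF p(1)])
  next
    show "smooth_on (snd d ` ?S) (snd c \<circ> cinv d)"
      by (rule smooth_on_subset[OF smooth_transition[OF d c]]) (use ic(3) in auto)
  qed
  moreover have "smooth_on ((Z \<circ> snd c) ` ?S) (\<lambda>y. (snd d \<circ> cinv c) (Z' y))"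
  proof (rule smooth_on_compose[where f = Z' and g = "snd d \<circ> cinv c", OF oz open_overlap[OF c d]])
    fix y assume "y \<in> (Z \<circ> snd c) ` ?S"
    then obtain p where p: "p \<in> ?S" "y = Z (snd c p)" by auto
    show "Z' y \<in> snd c ` (fst c \<inter> fst d)"
      unfolding p(2) Z'[OF S(1)[OF p(1)]] using S[OF p(1)] by blast
  next
    show "smooth_on ((Z \<circ> snd c) ` ?S) Z'"
      by (rule smooth_on_subset[OF Z(3) subO])
  qed (rule smooth_transition[OF c d])
  moreover have "(snd d \<circ> cinv c) (Z' y) = (snd d \<circ> cinv ?z) y" if "y \<in> (Z \<circ> snd c) ` ?S" for y
  proof -
    have "y \<in> O2" using that subO by blast
    then show ?thesis by (simp only: comp_apply ic(4)[of y])
  qed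
  then have "smooth_on ((Z \<circ> snd c) ` ?S) (\<lambda>y. (snd d \<circ> cinv c) (Z' y)) \<longleftrightarrow> smooth_on ((Z \<circ> snd c) ` ?S) (snd d \<circ> cinv ?z)"
    by (rule smooth_on_cong[OF oz])
  moreover have "(Z \<circ> snd c) \<circ> cinv d = (\<lambda>x. Z ((snd c \<circ> cinv d) x))" by (simp add: fun_eq_iff)
  ultimately show ?thesis
    unfolding smooth_compat_def fst_conv snd_conv by (simp only: simp_thms)
qed

end

subsection \<open>Forms of low degree\<close>

text \<open>A form takes an infinite sequence but depends only on its first entries.
  \<open>form1\<close> and \<open>form2\<close> fix the tail, which makes low-degree forms ordinary
  functions of one or two tangent vectors; the tail of \<open>form2\<close> matches the sequences in
  \<open>nondegenerate\<close> and \<open>type_2_0\<close>.\<close>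

definition form1 :: "('a, 'e, 'b) form \<Rightarrow> 'a \<Rightarrow> ('a, 'e) tvec \<Rightarrow> 'b"
  where "form1 \<alpha> p u = \<alpha> p (\<lambda>_. u)"

definition form2 :: "('a, 'e, 'b) form \<Rightarrow> 'a \<Rightarrow> ('a, 'e) tvec \<Rightarrow> ('a, 'e) tvec \<Rightarrow> 'b"
  where "form2 \<alpha> p u w = \<alpha> p (case_nat u (\<lambda>_. w))"

context smooth_atlas
begin

lemma alternating_1:
  assumes "alternating_at A 1 \<alpha> p"
  shows "v \<in> tuples A 1 p \<Longrightarrow> \<alpha> p v = form1 \<alpha> p (v 0)"
    "u \<in> tangent_space A p \<Longrightarrow> w \<in> tangent_space A p \<Longrightarrow>
      form1 \<alpha> p (tcomb a u b w) = a *\<^sub>R form1 \<alpha> p u + b *\<^sub>R form1 \<alpha> p w"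
proof -
  have 3: "\<alpha> p v = \<alpha> p v'" if "v \<in> tuples A 1 p" "v 0 = v' 0" for v v'
    using assms that by (simp add: alternating_at_def)
  have 1: "\<alpha> p v = form1 \<alpha> p (v 0)" if "v \<in> tuples A 1 p" for v
    unfolding form1_def by (rule 3) (use that in auto)
  show "\<alpha> p v = form1 \<alpha> p (v 0)" if "v \<in> tuples A 1 p" by (rule 1[OF that])
  assume t: "u \<in> tangent_space A p" "w \<in> tangent_space A p"
  have "(\<lambda>_. u) \<in> tuples A 1 p" using t by (simp add: tuples_def)
  moreover have "\<forall>v\<in>tuples A 1 p. \<forall>i<1. \<forall>u\<in>tangent_space A p. \<forall>w\<in>tangent_space A p. \<forall>a b.
      \<alpha> p (v(i := tcomb a u b w)) = a *\<^sub>R \<alpha> p (v(i := u)) + b *\<^sub>R \<alpha> p (v(i := w))"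
    using assms unfolding alternating_at_def by (elim conjE)
  ultimately have "\<alpha> p ((\<lambda>_. u)(0 := tcomb a u b w)) = a *\<^sub>R \<alpha> p ((\<lambda>_. u)(0 := u)) + b *\<^sub>R \<alpha> p ((\<lambda>_. u)(0 := w))"
    using t by simp
  moreover have "\<alpha> p ((\<lambda>_. u)(0 := x)) = form1 \<alpha> p x" if "x \<in> tangent_space A p" for x
    using 1[of "(\<lambda>_. u)(0 := x)"] that by (simp add: tuples_def)
  ultimately show "form1 \<alpha> p (tcomb a u b w) = a *\<^sub>R form1 \<alpha> p u + b *\<^sub>R form1 \<alpha> p w"
    using t by (simp only: tcomb_tangent[OF t])
qed

lemma alternating_2:
  assumes "alternating_at A 2 \<alpha> p"
  shows "v \<in> tuples A 2 p \<Longrightarrow> \<alpha> p v = form2 \<alpha> p (v 0) (v 1)"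
    "u \<in> tangent_space A p \<Longrightarrow> w \<in> tangent_space A p \<Longrightarrow> x \<in> tangent_space A p \<Longrightarrow>
      form2 \<alpha> p (tcomb a u b w) x = a *\<^sub>R form2 \<alpha> p u x + b *\<^sub>R form2 \<alpha> p w x"
    "u \<in> tangent_space A p \<Longrightarrow> w \<in> tangent_space A p \<Longrightarrow> x \<in> tangent_space A p \<Longrightarrow>
      form2 \<alpha> p x (tcomb a u b w) = a *\<^sub>R form2 \<alpha> p x u + b *\<^sub>R form2 \<alpha> p x w"
    "u \<in> tangent_space A p \<Longrightarrow> form2 \<alpha> p u u = 0"
    "u \<in> tangent_space A p \<Longrightarrow> w \<in> tangent_space A p \<Longrightarrow> form2 \<alpha> p u w = - form2 \<alpha> p w u"
proof -
  have less2: "(\<forall>i<2. P i) \<longleftrightarrow> P 0 \<and> P 1" for P :: "nat \<Rightarrow> bool" by (auto simp: less_2_cases_iff)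
  have 3: "\<alpha> p v = \<alpha> p v'" if "v \<in> tuples A 2 p" "v 0 = v' 0" "v 1 = v' 1" for v v'
    using assms that by (simp add: alternating_at_def less2)
  have pair: "case_nat u (\<lambda>_. w) \<in> tuples A 2 p" if "u \<in> tangent_space A p" "w \<in> tangent_space A p" for u w
    using that by (simp add: tuples_def less2)
  have 1: "\<alpha> p v = form2 \<alpha> p (v 0) (v 1)" if "v \<in> tuples A 2 p" for v
    unfolding form2_def by (rule 3) (use that in auto)
  show "\<alpha> p v = form2 \<alpha> p (v 0) (v 1)" if "v \<in> tuples A 2 p" by (rule 1[OF that])
  have upd: "\<alpha> p ((case_nat u (\<lambda>_. w))(0 := x)) = form2 \<alpha> p x w" "\<alpha> p ((case_nat u (\<lambda>_. w))(Suc 0 := x)) = form2 \<alpha> p u x"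
    if "u \<in> tangent_space A p" "w \<in> tangent_space A p" "x \<in> tangent_space A p" for u w x
    using 1[of "(case_nat u (\<lambda>_. w))(0 := x)"] 1[of "(case_nat u (\<lambda>_. w))(1 := x)"] that
    by (simp_all add: tuples_def less2)
  have lin: "\<alpha> p (v(i := tcomb a u b w)) = a *\<^sub>R \<alpha> p (v(i := u)) + b *\<^sub>R \<alpha> p (v(i := w))"
    if "v \<in> tuples A 2 p" "i < 2" "u \<in> tangent_space A p" "w \<in> tangent_space A p" for v i u w a b
    using assms that unfolding alternating_at_def by blast
  have l: "form2 \<alpha> p (tcomb a u b w) x = a *\<^sub>R form2 \<alpha> p u x + b *\<^sub>R form2 \<alpha> p w x"
    and r: "form2 \<alpha> p x (tcomb a u b w) = a *\<^sub>R form2 \<alpha> p x u + b *\<^sub>R form2 \<alpha> p x w"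
    if "u \<in> tangent_space A p" "w \<in> tangent_space A p" "x \<in> tangent_space A p" for a b u w x
    using lin[OF pair[OF that(3,3)], of 0 u w a b] lin[OF pair[OF that(3,3)], of 1 u w a b] that tcomb_tangent
    by (simp_all add: upd)
  show "form2 \<alpha> p (tcomb a u b w) x = a *\<^sub>R form2 \<alpha> p u x + b *\<^sub>R form2 \<alpha> p w x"
    if "u \<in> tangent_space A p" "w \<in> tangent_space A p" "x \<in> tangent_space A p"
    by (rule l[OF that])
  show "form2 \<alpha> p x (tcomb a u b w) = a *\<^sub>R form2 \<alpha> p x u + b *\<^sub>R form2 \<alpha> p x w"
    if "u \<in> tangent_space A p" "w \<in> tangent_space A p" "x \<in> tangent_space A p"
    by (rule r[OF that])
  have z: "form2 \<alpha> p u u = 0" if "u \<in> tangent_space A p" for u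
  proof -
    have "\<alpha> p v = 0" if "v \<in> tuples A 2 p" "v 0 = v 1" for v
    proof -
      have "\<forall>v\<in>tuples A 2 p. \<forall>i j. i < j \<and> j < 2 \<and> v i = v j \<longrightarrow> \<alpha> p v = 0"
        using assms unfolding alternating_at_def by (elim conjE)
      from bspec[OF this that(1), rule_format, of 0 1] that(2) show ?thesis by simp
    qed
    from this[OF pair[OF that that]] show ?thesis by (simp add: form2_def)
  qed
  show "form2 \<alpha> p u u = 0" if "u \<in> tangent_space A p" by (rule z[OF that])
  show "form2 \<alpha> p u w = - form2 \<alpha> p w u" if t: "u \<in> tangent_space A p" "w \<in> tangent_space A p"
  proof -
    \<comment> \<open>Polarisation: expand the vanishing value of the form on the pair of equal
      vectors \<open>u + w\<close>.\<close>
    let ?s = "tcomb 1 u 1 w"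
    have s: "?s \<in> tangent_space A p" using t by (rule tcomb_tangent)
    have "0 = form2 \<alpha> p u u + form2 \<alpha> p u w + (form2 \<alpha> p w u + form2 \<alpha> p w w)"
      using z[OF s] l[OF t s, of 1 1] r[OF t t(1), of 1 1] r[OF t t(2), of 1 1] by simp
    then show ?thesis using z t by (simp add: eq_neg_iff_add_eq_0)
  qed
qed

lemma alternating_2I:
  assumes v: "\<And>v. v \<in> tuples A 2 p \<Longrightarrow> \<alpha> p v = \<beta> (v 0) (v 1)"
    and "\<And>u w x a b. u \<in> tangent_space A p \<Longrightarrow> w \<in> tangent_space A p \<Longrightarrow> x \<in> tangent_space A p \<Longrightarrow>
      \<beta> (tcomb a u b w) x = a *\<^sub>R \<beta> u x + b *\<^sub>R \<beta> w x"
    and "\<And>u w x a b. u \<in> tangent_space A p \<Longrightarrow> w \<in> tangent_space A p \<Longrightarrow> x \<in> tangent_space A p \<Longrightarrow>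
      \<beta> x (tcomb a u b w) = a *\<^sub>R \<beta> x u + b *\<^sub>R \<beta> x w"
    and "\<And>u. u \<in> tangent_space A p \<Longrightarrow> \<beta> u u = 0"
  shows "alternating_at A 2 \<alpha> p"
proof -
  have less2: "(\<forall>i<2. P i) \<longleftrightarrow> P 0 \<and> P 1" for P :: "nat \<Rightarrow> bool" by (auto simp: less_2_cases_iff)
  have pair: "(i < j \<and> j < 2 \<and> w i = w j) \<longleftrightarrow> (i = 0 \<and> j = 1 \<and> w 0 = w 1)" for i j :: nat and w :: "nat \<Rightarrow> 'z"
    by (auto simp: less_2_cases_iff)
  have t: "w \<in> tuples A 2 p \<longleftrightarrow> w 0 \<in> tangent_space A p \<and> w 1 \<in> tangent_space A p" for w
    by (simp add: tuples_def less2)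
  show ?thesis
    unfolding alternating_at_def less2 pair using assms by (auto simp: t tcomb_tangent)
qed

end

subsection \<open>Wedge products as explicit sums\<close>

text \<open>The nested \<open>insert\<close> is the shape from which
  \<open>sum_over_permutations_insert\<close> peels off one index at a time.\<close>

lemma lessThan_numerals:
  "{..<2::nat} = insert 0 {1}" "{..<3::nat} = insert 0 (insert 1 {2})"
  "{..<4::nat} = insert 0 (insert 1 (insert 2 {3}))"
  by auto

lemmas permutation_sum_simps = sign_swap_id permutation_swap_id sign_compose sign_id transpose_def
  permutation_compose

lemma sum_permutes_2:
  fixes h :: "nat \<Rightarrow> nat \<Rightarrow> real"
  shows "(\<Sum>\<sigma> | \<sigma> permutes {..<2::nat}. of_int (sign \<sigma>) * h (\<sigma> 0) (\<sigma> 1)) = h 0 1 - h 1 0"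
proof -
  have 1: "finite {1::nat}" "0 \<notin> {1::nat}" by auto
  show ?thesis
    unfolding lessThan_numerals sum_over_permutations_insert[OF 1] permutes_sing
    by (simp add: permutation_sum_simps)
qed

lemma sum_permutes_3:
  fixes h :: "nat \<Rightarrow> nat \<Rightarrow> nat \<Rightarrow> real"
  shows "(\<Sum>\<sigma> | \<sigma> permutes {..<3::nat}. of_int (sign \<sigma>) * h (\<sigma> 0) (\<sigma> 1) (\<sigma> 2))
    = h 0 1 2 - h 0 2 1 - h 1 0 2 + h 1 2 0 + h 2 0 1 - h 2 1 0"
proof -
  have 1: "finite {1::nat, 2}" "0 \<notin> {1::nat, 2}" by auto
  have 2: "finite {2::nat}" "1 \<notin> {2::nat}" by auto
  show ?thesis
    unfolding lessThan_numerals sum_over_permutations_insert[OF 1] sum_over_permutations_insert[OF 2] permutes_sing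
    by (simp add: permutation_sum_simps)
qed

lemma sum_permutes_4:
  fixes h :: "nat \<Rightarrow> nat \<Rightarrow> nat \<Rightarrow> nat \<Rightarrow> real"
  shows "(\<Sum>\<sigma> | \<sigma> permutes {..<4::nat}. of_int (sign \<sigma>) * h (\<sigma> 0) (\<sigma> 1) (\<sigma> 2) (\<sigma> 3))
    = h 0 1 2 3 - h 0 1 3 2 - h 0 2 1 3 + h 0 2 3 1 + h 0 3 1 2 - h 0 3 2 1
    - h 1 0 2 3 + h 1 0 3 2 + h 1 2 0 3 - h 1 2 3 0 - h 1 3 0 2 + h 1 3 2 0
    + h 2 0 1 3 - h 2 0 3 1 - h 2 1 0 3 + h 2 1 3 0 + h 2 3 0 1 - h 2 3 1 0
    - h 3 0 1 2 + h 3 0 2 1 + h 3 1 0 2 - h 3 1 2 0 - h 3 2 0 1 + h 3 2 1 0"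
proof -
  have 1: "finite {1::nat, 2, 3}" "0 \<notin> {1::nat, 2, 3}" by auto
  have 2: "finite {2::nat, 3}" "1 \<notin> {2::nat, 3}" by auto
  have 3: "finite {3::nat}" "2 \<notin> {3::nat}" by auto
  show ?thesis
    unfolding lessThan_numerals sum_over_permutations_insert[OF 1] sum_over_permutations_insert[OF 2]
      sum_over_permutations_insert[OF 3] permutes_sing
    by (simp add: permutation_sum_simps)
qed

context smooth_atlas
begin

lemma tuples_permute:
  assumes "\<sigma> permutes {..<k}" "v \<in> tuples A k p" "\<And>i. i < m \<Longrightarrow> f i < k"
  shows "(\<lambda>i. v (\<sigma> (f i))) \<in> tuples A m p"
  using assms permutes_in_image[OF assms(1)] by (auto simp: tuples_def)

lemma pair_tuple: "u \<in> tangent_space A p \<Longrightarrow> w \<in> tangent_space A p \<Longrightarrow> case_nat u (\<lambda>_. w) \<in> tuples A 2 p"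
  by (simp add: tuples_def less_2_cases_iff all_conj_distrib)

lemma tuplesD: "v \<in> tuples A k p \<Longrightarrow> i < k \<Longrightarrow> v i \<in> tangent_space A p"
  by (simp add: tuples_def)

lemma wedge_1_1:
  assumes a: "alternating_at A 1 \<alpha> p" and b: "alternating_at A 1 \<beta> p" and v: "v \<in> tuples A 2 p"
  shows "wedge 1 1 \<alpha> \<beta> p v = form1 \<alpha> p (v 0) * form1 \<beta> p (v 1) - form1 \<alpha> p (v 1) * form1 \<beta> p (v 0)"
proof -
  have "(\<Sum>\<sigma> | \<sigma> permutes {..<2}. of_int (sign \<sigma>) * \<alpha> p (\<lambda>i. v (\<sigma> i)) * \<beta> p (\<lambda>i. v (\<sigma> (1 + i))))
     = (\<Sum>\<sigma> | \<sigma> permutes {..<2}. of_int (sign \<sigma>) * (form1 \<alpha> p (v (\<sigma> 0)) * form1 \<beta> p (v (\<sigma> 1))))"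
  proof (rule sum.cong)
    fix \<sigma> :: "nat \<Rightarrow> nat" assume "\<sigma> \<in> {\<sigma>. \<sigma> permutes {..<2}}"
    then have s: "\<sigma> permutes {..<2}" by simp
    have t: "(\<lambda>i. v (\<sigma> i)) \<in> tuples A 1 p" "(\<lambda>i. v (\<sigma> (1 + i))) \<in> tuples A 1 p"
      by (rule tuples_permute[OF s v]; simp)+
    show "of_int (sign \<sigma>) * \<alpha> p (\<lambda>i. v (\<sigma> i)) * \<beta> p (\<lambda>i. v (\<sigma> (1 + i)))
      = of_int (sign \<sigma>) * (form1 \<alpha> p (v (\<sigma> 0)) * form1 \<beta> p (v (\<sigma> 1)))"
      unfolding alternating_1(1)[OF a t(1)] alternating_1(1)[OF b t(2)] by simp
  qed simp
  then show ?thesis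
    unfolding wedge_def one_add_one sum_permutes_2[of "\<lambda>i j. form1 \<alpha> p (v i) * form1 \<beta> p (v j)"] by simp
qed

text \<open>By antisymmetry of \<open>\<beta>\<close> the six permutations pair off into equal
  terms, which cancels the denominator \<open>fact 1 * fact 2\<close>.\<close>

lemma wedge_1_2:
  assumes a: "alternating_at A 1 \<alpha> p" and b: "alternating_at A 2 \<beta> p" and v: "v \<in> tuples A 3 p"
  shows "wedge 1 2 \<alpha> \<beta> p v = form1 \<alpha> p (v 0) * form2 \<beta> p (v 1) (v 2)
    - form1 \<alpha> p (v 1) * form2 \<beta> p (v 0) (v 2) + form1 \<alpha> p (v 2) * form2 \<beta> p (v 0) (v 1)"
proof -
  have 3: "1 + 2 = (3::nat)" by simp
  have *: "(\<Sum>\<sigma> | \<sigma> permutes {..<3}. of_int (sign \<sigma>) * \<alpha> p (\<lambda>i. v (\<sigma> i)) * \<beta> p (\<lambda>i. v (\<sigma> (1 + i))))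
     = (\<Sum>\<sigma> | \<sigma> permutes {..<3}. of_int (sign \<sigma>) * (form1 \<alpha> p (v (\<sigma> 0)) * form2 \<beta> p (v (\<sigma> 1)) (v (\<sigma> 2))))"
  proof (rule sum.cong)
    fix \<sigma> :: "nat \<Rightarrow> nat" assume "\<sigma> \<in> {\<sigma>. \<sigma> permutes {..<3}}"
    then have s: "\<sigma> permutes {..<3}" by simp
    have t: "(\<lambda>i. v (\<sigma> i)) \<in> tuples A 1 p" "(\<lambda>i. v (\<sigma> (1 + i))) \<in> tuples A 2 p"
      by (rule tuples_permute[OF s v]; simp)+
    show "of_int (sign \<sigma>) * \<alpha> p (\<lambda>i. v (\<sigma> i)) * \<beta> p (\<lambda>i. v (\<sigma> (1 + i)))
      = of_int (sign \<sigma>) * (form1 \<alpha> p (v (\<sigma> 0)) * form2 \<beta> p (v (\<sigma> 1)) (v (\<sigma> 2)))"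
      unfolding alternating_1(1)[OF a t(1)] alternating_2(1)[OF b t(2)] by (simp add: numeral_2_eq_2)
  qed simp
  have anti: "form2 \<beta> p (v 1) (v 0) = - form2 \<beta> p (v 0) (v 1)"
    "form2 \<beta> p (v 2) (v 0) = - form2 \<beta> p (v 0) (v 2)" "form2 \<beta> p (v 2) (v 1) = - form2 \<beta> p (v 1) (v 2)"
    by (rule alternating_2(5)[OF b tuplesD[OF v] tuplesD[OF v]]; simp)+
  show ?thesis
    unfolding wedge_def 3 * sum_permutes_3[of "\<lambda>i j k. form1 \<alpha> p (v i) * form2 \<beta> p (v j) (v k)"] anti
    by (simp add: fact_2)
qed

text \<open>The 3-form enters through a function \<open>g\<close> of three vectors because it will
  itself be a wedge product, known only by an explicit formula. Antisymmetry collects the 24 terms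
  into four groups of \<open>fact 3\<close> equal ones.\<close>

lemma wedge_1_3:
  assumes a: "alternating_at A 1 \<alpha> p" and b: "\<And>v. v \<in> tuples A 3 p \<Longrightarrow> \<beta> p v = g (v 0) (v 1) (v 2)"
    and g: "\<And>x y z. g y x z = - g x y z" "\<And>x y z. g x z y = - g x y z" and v: "v \<in> tuples A 4 p"
  shows "wedge 1 3 \<alpha> \<beta> p v = form1 \<alpha> p (v 0) * g (v 1) (v 2) (v 3) - form1 \<alpha> p (v 1) * g (v 0) (v 2) (v 3)
    + form1 \<alpha> p (v 2) * g (v 0) (v 1) (v 3) - form1 \<alpha> p (v 3) * g (v 0) (v 1) (v 2)"
proof -
  have 4: "1 + 3 = (4::nat)" by simp
  have *: "(\<Sum>\<sigma> | \<sigma> permutes {..<4}. of_int (sign \<sigma>) * \<alpha> p (\<lambda>i. v (\<sigma> i)) * \<beta> p (\<lambda>i. v (\<sigma> (1 + i))))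
     = (\<Sum>\<sigma> | \<sigma> permutes {..<4}. of_int (sign \<sigma>) * (form1 \<alpha> p (v (\<sigma> 0)) * g (v (\<sigma> 1)) (v (\<sigma> 2)) (v (\<sigma> 3))))"
  proof (rule sum.cong)
    fix \<sigma> :: "nat \<Rightarrow> nat" assume "\<sigma> \<in> {\<sigma>. \<sigma> permutes {..<4}}"
    then have s: "\<sigma> permutes {..<4}" by simp
    have t: "(\<lambda>i. v (\<sigma> i)) \<in> tuples A 1 p" "(\<lambda>i. v (\<sigma> (1 + i))) \<in> tuples A 3 p"
      by (rule tuples_permute[OF s v]; simp)+
    show "of_int (sign \<sigma>) * \<alpha> p (\<lambda>i. v (\<sigma> i)) * \<beta> p (\<lambda>i. v (\<sigma> (1 + i)))
      = of_int (sign \<sigma>) * (form1 \<alpha> p (v (\<sigma> 0)) * g (v (\<sigma> 1)) (v (\<sigma> 2)) (v (\<sigma> 3)))"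
      unfolding alternating_1(1)[OF a t(1)] b[OF t(2)] by (simp add: numeral_2_eq_2 numeral_3_eq_3)
  qed simp
  have g': "g x z y = - g x y z" "g y x z = - g x y z" "g y z x = g x y z" "g z x y = g x y z" "g z y x = - g x y z" for x y z
    using g[of x y z] g[of x z y] g[of y x z] g[of y z x] g[of z x y] g[of z y x] by linarith+
  show ?thesis
    unfolding wedge_def 4 * sum_permutes_4[of "\<lambda>i j k l. form1 \<alpha> p (v i) * g (v j) (v k) (v l)"]
      g'[where x = "v 0" and y = "v 1" and z = "v 2"] g'[where x = "v 0" and y = "v 1" and z = "v 3"]
      g'[where x = "v 0" and y = "v 2" and z = "v 3"] g'[where x = "v 1" and y = "v 2" and z = "v 3"]
    by (simp add: fact_numeral)
qed

text \<open>The 24 permutations fall into six classes of four equal terms, one class for each way to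
  choose which two vectors go to \<open>\<alpha>\<close>.\<close>

lemma wedge_2_2:
  assumes a: "alternating_at A 2 \<alpha> p" and b: "alternating_at A 2 \<beta> p" and v: "v \<in> tuples A 4 p"
  shows "wedge 2 2 \<alpha> \<beta> p v = form2 \<alpha> p (v 0) (v 1) * form2 \<beta> p (v 2) (v 3)
    - form2 \<alpha> p (v 0) (v 2) * form2 \<beta> p (v 1) (v 3) + form2 \<alpha> p (v 0) (v 3) * form2 \<beta> p (v 1) (v 2)
    + form2 \<alpha> p (v 1) (v 2) * form2 \<beta> p (v 0) (v 3) - form2 \<alpha> p (v 1) (v 3) * form2 \<beta> p (v 0) (v 2)
    + form2 \<alpha> p (v 2) (v 3) * form2 \<beta> p (v 0) (v 1)"
proof -
  have 4: "2 + 2 = (4::nat)" by simp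
  have *: "(\<Sum>\<sigma> | \<sigma> permutes {..<4}. of_int (sign \<sigma>) * \<alpha> p (\<lambda>i. v (\<sigma> i)) * \<beta> p (\<lambda>i. v (\<sigma> (2 + i))))
     = (\<Sum>\<sigma> | \<sigma> permutes {..<4}. of_int (sign \<sigma>) * (form2 \<alpha> p (v (\<sigma> 0)) (v (\<sigma> 1)) * form2 \<beta> p (v (\<sigma> 2)) (v (\<sigma> 3))))"
  proof (rule sum.cong)
    fix \<sigma> :: "nat \<Rightarrow> nat" assume "\<sigma> \<in> {\<sigma>. \<sigma> permutes {..<4}}"
    then have s: "\<sigma> permutes {..<4}" by simp
    have t: "(\<lambda>i. v (\<sigma> i)) \<in> tuples A 2 p" "(\<lambda>i. v (\<sigma> (2 + i))) \<in> tuples A 2 p"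
      by (rule tuples_permute[OF s v]; simp)+
    show "of_int (sign \<sigma>) * \<alpha> p (\<lambda>i. v (\<sigma> i)) * \<beta> p (\<lambda>i. v (\<sigma> (2 + i)))
      = of_int (sign \<sigma>) * (form2 \<alpha> p (v (\<sigma> 0)) (v (\<sigma> 1)) * form2 \<beta> p (v (\<sigma> 2)) (v (\<sigma> 3)))"
      unfolding alternating_2(1)[OF a t(1)] alternating_2(1)[OF b t(2)] by simp
  qed simp
  have anti: "form2 \<gamma> p (v 1) (v 0) = - form2 \<gamma> p (v 0) (v 1)"
    "form2 \<gamma> p (v 2) (v 0) = - form2 \<gamma> p (v 0) (v 2)" "form2 \<gamma> p (v 2) (v 1) = - form2 \<gamma> p (v 1) (v 2)"
    "form2 \<gamma> p (v 3) (v 0) = - form2 \<gamma> p (v 0) (v 3)" "form2 \<gamma> p (v 3) (v 1) = - form2 \<gamma> p (v 1) (v 3)"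
    "form2 \<gamma> p (v 3) (v 2) = - form2 \<gamma> p (v 2) (v 3)" if "alternating_at A 2 \<gamma> p" for \<gamma>
    by (rule alternating_2(5)[OF that tuplesD[OF v] tuplesD[OF v]]; simp)+
  show ?thesis
    unfolding wedge_def 4 * sum_permutes_4[of "\<lambda>i j k l. form2 \<alpha> p (v i) (v j) * form2 \<beta> p (v k) (v l)"]
      anti[OF a] anti[OF b]
    by (simp add: fact_2)
qed

lemma alternating_1I:
  assumes v: "\<And>v. v \<in> tuples A 1 p \<Longrightarrow> \<alpha> p v = \<beta> (v 0)"
    and "\<And>u w a b. u \<in> tangent_space A p \<Longrightarrow> w \<in> tangent_space A p \<Longrightarrow>
      \<beta> (tcomb a u b w) = a *\<^sub>R \<beta> u + b *\<^sub>R \<beta> w"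
  shows "alternating_at A 1 \<alpha> p"
proof -
  have t: "w \<in> tuples A (Suc 0) p \<longleftrightarrow> w 0 \<in> tangent_space A p" for w
    by (simp add: tuples_def)
  show ?thesis
    unfolding alternating_at_def using assms by (auto simp: t tcomb_tangent)
qed

lemma linear_form1:
  fixes \<alpha> :: "('a, 'e, 'b::real_normed_vector) form"
  assumes "c \<in> A" "p \<in> fst c" "alternating_at A 1 \<alpha> p"
  shows "linear (\<lambda>e. form1 \<alpha> p (coord_vec A c p e))"
proof (rule linearI)
  note ct = coord_vec_tangent[OF assms(1,2)]
  have l: "form1 \<alpha> p (coord_vec A c p (a *\<^sub>R e + b *\<^sub>R f)) = a *\<^sub>R form1 \<alpha> p (coord_vec A c p e) + b *\<^sub>R form1 \<alpha> p (coord_vec A c p f)" for a b e f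
    unfolding coord_vec_tcomb[OF assms(1,2)] by (rule alternating_1(2)[OF assms(3) ct ct])
  show "form1 \<alpha> p (coord_vec A c p (e + f)) = form1 \<alpha> p (coord_vec A c p e) + form1 \<alpha> p (coord_vec A c p f)" for e f
    using l[of 1 e 1 f] by simp
  show "form1 \<alpha> p (coord_vec A c p (r *\<^sub>R e)) = r *\<^sub>R form1 \<alpha> p (coord_vec A c p e)" for r e
    using l[of r e 0 e] by simp
qed

lemma linear_form2:
  fixes \<alpha> :: "('a, 'e, 'b::real_normed_vector) form"
  assumes "c \<in> A" "p \<in> fst c" "alternating_at A 2 \<alpha> p"
  shows "linear (\<lambda>e. form2 \<alpha> p (coord_vec A c p e) (coord_vec A c p f))"
    "linear (\<lambda>e. form2 \<alpha> p (coord_vec A c p f) (coord_vec A c p e))"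
proof -
  note ct = coord_vec_tangent[OF assms(1,2)]
  have l: "form2 \<alpha> p (coord_vec A c p (a *\<^sub>R e + b *\<^sub>R e')) (coord_vec A c p f)
      = a *\<^sub>R form2 \<alpha> p (coord_vec A c p e) (coord_vec A c p f) + b *\<^sub>R form2 \<alpha> p (coord_vec A c p e') (coord_vec A c p f)"
    and r: "form2 \<alpha> p (coord_vec A c p f) (coord_vec A c p (a *\<^sub>R e + b *\<^sub>R e'))
      = a *\<^sub>R form2 \<alpha> p (coord_vec A c p f) (coord_vec A c p e) + b *\<^sub>R form2 \<alpha> p (coord_vec A c p f) (coord_vec A c p e')" for a b e e'
    unfolding coord_vec_tcomb[OF assms(1,2)]
    by (rule alternating_2(2)[OF assms(3) ct ct ct], rule alternating_2(3)[OF assms(3) ct ct ct])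
  show "linear (\<lambda>e. form2 \<alpha> p (coord_vec A c p e) (coord_vec A c p f))"
  proof (rule linearI)
    show "form2 \<alpha> p (coord_vec A c p (x + y)) (coord_vec A c p f)
      = form2 \<alpha> p (coord_vec A c p x) (coord_vec A c p f) + form2 \<alpha> p (coord_vec A c p y) (coord_vec A c p f)" for x y
      using l[of 1 x 1 y] by simp
    show "form2 \<alpha> p (coord_vec A c p (s *\<^sub>R x)) (coord_vec A c p f) = s *\<^sub>R form2 \<alpha> p (coord_vec A c p x) (coord_vec A c p f)" for s x
      using l[of s x 0 x] by simp
  qed
  show "linear (\<lambda>e. form2 \<alpha> p (coord_vec A c p f) (coord_vec A c p e))"
  proof (rule linearI)
    show "form2 \<alpha> p (coord_vec A c p f) (coord_vec A c p (x + y))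
      = form2 \<alpha> p (coord_vec A c p f) (coord_vec A c p x) + form2 \<alpha> p (coord_vec A c p f) (coord_vec A c p y)" for x y
      using r[of 1 x 1 y] by simp
    show "form2 \<alpha> p (coord_vec A c p f) (coord_vec A c p (s *\<^sub>R x)) = s *\<^sub>R form2 \<alpha> p (coord_vec A c p f) (coord_vec A c p x)" for s x
      using r[of s x 0 x] by simp
  qed
qed

lemma coord_tuple: "c \<in> A \<Longrightarrow> p \<in> fst c \<Longrightarrow> (\<lambda>i. coord_vec A c p (e i)) \<in> tuples A k p"
  by (simp add: tuples_def coord_vec_tangent)

lemma local_form_1:
  assumes "c \<in> A" "p \<in> fst c" "alternating_at A 1 \<alpha> p"
  shows "local_form A c \<alpha> (snd c p) e = form1 \<alpha> p (coord_vec A c p (e 0))"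
  using alternating_1(1)[OF assms(3) coord_tuple[OF assms(1,2)], of e] assms(1,2) by (simp add: local_form_def)

lemma local_form_2:
  assumes "c \<in> A" "p \<in> fst c" "alternating_at A 2 \<alpha> p"
  shows "local_form A c \<alpha> (snd c p) e = form2 \<alpha> p (coord_vec A c p (e 0)) (coord_vec A c p (e 1))"
  using alternating_2(1)[OF assms(3) coord_tuple[OF assms(1,2)], of e] assms(1,2) by (simp add: local_form_def)

lemma smooth_form_alternating: "smooth_form A k \<alpha> \<Longrightarrow> c \<in> A \<Longrightarrow> p \<in> fst c \<Longrightarrow> alternating_at A k \<alpha> p"
  by (simp add: smooth_form_def in_pts)

end

subsection \<open>Forms on three-manifolds as vector fields\<close>

definition form1_field :: "('a, real^3) chart set \<Rightarrow> ('a, real^3) chart \<Rightarrow> ('a, real^3, real) form \<Rightarrow> real^3 \<Rightarrow> real^3"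
  where "form1_field A c \<alpha> x = vector [local_form A c \<alpha> x (\<lambda>_. axis 1 1), local_form A c \<alpha> x (\<lambda>_. axis 2 1),
    local_form A c \<alpha> x (\<lambda>_. axis 3 1)]"

definition form2_field :: "('a, real^3) chart set \<Rightarrow> ('a, real^3) chart \<Rightarrow> ('a, real^3, real) form \<Rightarrow> real^3 \<Rightarrow> real^3"
  where "form2_field A c \<alpha> x = vector [local_form A c \<alpha> x (case_nat (axis 2 1) (\<lambda>_. axis 3 1)),
    local_form A c \<alpha> x (case_nat (axis 3 1) (\<lambda>_. axis 1 1)), local_form A c \<alpha> x (case_nat (axis 1 1) (\<lambda>_. axis 2 1))]"

lemma alternating_cross3:
  fixes B :: "real^3 \<Rightarrow> real^3 \<Rightarrow> real"
  assumes l: "\<And>f. linear (\<lambda>e. B e f)" and r: "\<And>f. linear (\<lambda>e. B f e)" and z: "\<And>e. B e e = 0" "\<And>e f. B e f = - B f e"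
  shows "B e f = vector [B (axis 2 1) (axis 3 1), B (axis 3 1) (axis 1 1), B (axis 1 1) (axis 2 1)] \<bullet> cross3 e f"
proof -
  have a: "B (axis 3 1) (axis 2 1) = - B (axis 2 1) (axis 3 1)" "B (axis 1 1) (axis 3 1) = - B (axis 3 1) (axis 1 1)"
    "B (axis 2 1) (axis 1 1) = - B (axis 1 1) (axis 2 1)"
    by (rule z(2))+
  have "B e f = e $ 1 * B (axis 1 1) f + e $ 2 * B (axis 2 1) f + e $ 3 * B (axis 3 1) f"
    using linear3_expand[OF l[of f], of e] by simp
  also have "\<dots> = (vector [B (axis 2 1) (axis 3 1), B (axis 3 1) (axis 1 1), B (axis 1 1) (axis 2 1)] :: real^3) \<bullet> cross3 e f"
    unfolding linear3_expand[OF r[of "axis 1 1"], of f] linear3_expand[OF r[of "axis 2 1"], of f] linear3_expand[OF r[of "axis 3 1"], of f]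
    by (simp add: z(1) a inner_vec_def sum_3 cross_components algebra_simps)
  finally show ?thesis .
qed

locale smooth_atlas3 = smooth_atlas X A for X :: "'a topology" and A :: "('a, real^3) chart set"
begin

lemma form1_coord:
  assumes "c \<in> A" "p \<in> fst c" "alternating_at A 1 \<alpha> p" "u \<in> tangent_space A p"
  shows "form1 \<alpha> p u = form1_field A c \<alpha> (snd c p) \<bullet> u c"
  using linear3_expand[OF linear_form1[OF assms(1-3)], of "u c"]
  by (simp add: coord_vec_coords[OF assms(1,2,4)] form1_field_def local_form_1[OF assms(1-3)] inner_vec_def sum_3 mult.commute)

lemma form2_coord:
  assumes "c \<in> A" "p \<in> fst c" "alternating_at A 2 \<alpha> p" "u \<in> tangent_space A p" "w \<in> tangent_space A p"
  shows "form2 \<alpha> p u w = form2_field A c \<alpha> (snd c p) \<bullet> cross3 (u c) (w c)"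
proof -
  note ct = coord_vec_tangent[OF assms(1,2)]
  have "form2 \<alpha> p (coord_vec A c p (u c)) (coord_vec A c p (w c)) = form2_field A c \<alpha> (snd c p) \<bullet> cross3 (u c) (w c)"
    unfolding form2_field_def local_form_2[OF assms(1-3)]
    using alternating_cross3[where B = "\<lambda>e f. form2 \<alpha> p (coord_vec A c p e) (coord_vec A c p f)" and e = "u c" and f = "w c",
      OF linear_form2(1)[OF assms(1-3)] linear_form2(2)[OF assms(1-3)] alternating_2(4)[OF assms(3) ct] alternating_2(5)[OF assms(3) ct ct]]
    by simp
  then show ?thesis by (simp only: coord_vec_coords[OF assms(1,2,4)] coord_vec_coords[OF assms(1,2,5)])
qed

lemma smooth_form1_field: "smooth_form A 1 \<alpha> \<Longrightarrow> c \<in> A \<Longrightarrow> smooth_on (snd c ` fst c) (form1_field A c \<alpha>)"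
  by (rule smooth_on_vec3[OF open_chart_image]) (simp_all add: form1_field_def smooth_form_def)

lemma smooth_form2_field: "smooth_form A 2 \<alpha> \<Longrightarrow> c \<in> A \<Longrightarrow> smooth_on (snd c ` fst c) (form2_field A c \<alpha>)"
  by (rule smooth_on_vec3[OF open_chart_image]) (simp_all add: form2_field_def smooth_form_def)

lemma local_form1_field:
  assumes "smooth_form A 1 \<alpha>" "c \<in> A" "x \<in> snd c ` fst c"
  shows "local_form A c \<alpha> x e = form1_field A c \<alpha> x \<bullet> e 0"
proof -
  obtain p where p: "p \<in> fst c" "x = snd c p" using assms(3) by blast
  note al = smooth_form_alternating[OF assms(1,2) p(1)]
  show ?thesis
    unfolding p(2) local_form_1[OF assms(2) p(1) al] form1_coord[OF assms(2) p(1) al coord_vec_tangent[OF assms(2) p(1)]]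
    by (simp only: coord_vec_apply[OF assms(2) p(1)])
qed

lemma local_form2_field:
  assumes "smooth_form A 2 \<alpha>" "c \<in> A" "x \<in> snd c ` fst c"
  shows "local_form A c \<alpha> x e = form2_field A c \<alpha> x \<bullet> cross3 (e 0) (e 1)"
proof -
  obtain p where p: "p \<in> fst c" "x = snd c p" using assms(3) by blast
  note al = smooth_form_alternating[OF assms(1,2) p(1)]
  note ct = coord_vec_tangent[OF assms(2) p(1)]
  show ?thesis
    unfolding p(2) local_form_2[OF assms(2) p(1) al] form2_coord[OF assms(2) p(1) al ct ct]
    by (simp only: coord_vec_apply[OF assms(2) p(1)])
qed

lemma closed_form1_field:
  assumes "smooth_form A 1 \<alpha>" "closed_form A 1 \<alpha>" "c \<in> A" "x \<in> snd c ` fst c"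
  shows "frechet_derivative (form1_field A c \<alpha>) (at x) u \<bullet> v = frechet_derivative (form1_field A c \<alpha>) (at x) v \<bullet> u"
proof -
  note d = smooth_on_has_derivative[OF smooth_form1_field[OF assms(1,3)] assms(4)]
  have D: "frechet_derivative (\<lambda>y. local_form A c \<alpha> y e) (at x) = (\<lambda>h. frechet_derivative (form1_field A c \<alpha>) (at x) h \<bullet> e 0)" for e
  proof -
    have "frechet_derivative (\<lambda>y. local_form A c \<alpha> y e) (at x) = frechet_derivative (\<lambda>y. form1_field A c \<alpha> y \<bullet> e 0) (at x)"
      by (rule frechet_derivative_cong_open[OF open_chart_image[OF assms(3)] assms(4) local_form1_field[OF assms(1,3)]])
    then show ?thesis by (simp only: frechet_derivative_eqI[OF has_derivative_inner_left[OF d]])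
  qed
  have "ext_deriv 1 (local_form A c \<alpha>) x (case_nat u (\<lambda>_. v)) = 0"
    using assms(2)[unfolded closed_form_def] assms(3,4) by blast
  then show ?thesis unfolding ext_deriv_def D by simp
qed

lemma closed_form2_field:
  assumes "smooth_form A 2 \<alpha>" "closed_form A 2 \<alpha>" "c \<in> A" "x \<in> snd c ` fst c"
  shows "frechet_derivative (form2_field A c \<alpha>) (at x) u \<bullet> cross3 v w - frechet_derivative (form2_field A c \<alpha>) (at x) v \<bullet> cross3 u w
    + frechet_derivative (form2_field A c \<alpha>) (at x) w \<bullet> cross3 u v = 0"
proof -
  note d = smooth_on_has_derivative[OF smooth_form2_field[OF assms(1,3)] assms(4)]
  have D: "frechet_derivative (\<lambda>y. local_form A c \<alpha> y e) (at x) = (\<lambda>h. frechet_derivative (form2_field A c \<alpha>) (at x) h \<bullet> cross3 (e 0) (e 1))" for e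
  proof -
    have "frechet_derivative (\<lambda>y. local_form A c \<alpha> y e) (at x) = frechet_derivative (\<lambda>y. form2_field A c \<alpha> y \<bullet> cross3 (e 0) (e 1)) (at x)"
      by (rule frechet_derivative_cong_open[OF open_chart_image[OF assms(3)] assms(4) local_form2_field[OF assms(1,3)]])
    then show ?thesis by (simp only: frechet_derivative_eqI[OF has_derivative_inner_left[OF d]])
  qed
  have "ext_deriv 2 (local_form A c \<alpha>) x (case_nat u (case_nat v (\<lambda>_. w))) = 0"
    using assms(2)[unfolded closed_form_def] assms(3,4) by blast
  moreover have "{..2::nat} = {0, 1, 2}" by auto
  ultimately show ?thesis unfolding ext_deriv_def D by simp
qed

text \<open>The factor in front of the determinant is the only pointwise invariant of the pair.
  Nonvanishing of the wedge product becomes nonvanishing of this inner product, and equality of two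
  such 3-forms becomes equality of two numbers in a chart.\<close>

lemma wedge_1_2_coord:
  assumes "c \<in> A" "p \<in> fst c" "alternating_at A 1 \<alpha> p" "alternating_at A 2 \<beta> p" "v \<in> tuples A 3 p"
  shows "wedge 1 2 \<alpha> \<beta> p v = (form1_field A c \<alpha> (snd c p) \<bullet> form2_field A c \<beta> (snd c p)) * det_rows (v 0 c) (v 1 c) (v 2 c)"
proof -
  have v: "v 0 \<in> tangent_space A p" "v 1 \<in> tangent_space A p" "v 2 \<in> tangent_space A p"
    by (rule tuplesD[OF assms(5)]; simp)+
  show ?thesis
    unfolding wedge_1_2[OF assms(3-5)] form1_coord[OF assms(1-3) v(1)] form1_coord[OF assms(1-3) v(2)] form1_coord[OF assms(1-3) v(3)]
      form2_coord[OF assms(1,2,4) v(1,2)] form2_coord[OF assms(1,2,4) v(1,3)] form2_coord[OF assms(1,2,4) v(2,3)]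
    by (simp add: inner_vec_def sum_3 cross_components algebra_simps)
qed

end

subsection \<open>Smoothness of wedge products\<close>

lemma smooth_on_eqI: "open S \<Longrightarrow> (\<And>x. x \<in> S \<Longrightarrow> f x = g x) \<Longrightarrow> smooth_on S g \<Longrightarrow> smooth_on S f"
  using smooth_on_cong[of S f g] by simp

context smooth_atlas
begin

text \<open>\<open>volume_form\<close> asks for a smooth form, and thus for an alternating one; the
  six-term formula reduces this to bilinearity and antisymmetry of the two factors.\<close>

lemma alternating_wedge_2_2:
  assumes a: "alternating_at A 2 \<alpha> p" and b: "alternating_at A 2 \<beta> p"
  shows "alternating_at A 4 (wedge 2 2 \<alpha> \<beta>) p"
proof -
  have cases4: "i = 0 \<or> i = Suc 0 \<or> i = 2 \<or> i = 3" if "i < 4" for i :: nat using that by auto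
  have tT: "v 0 \<in> tangent_space A p" "v (Suc 0) \<in> tangent_space A p" "v 2 \<in> tangent_space A p" "v 3 \<in> tangent_space A p"
    if "v \<in> tuples A 4 p" for v
    by (rule tuplesD[OF that]; simp)+
  have 1: "wedge 2 2 \<alpha> \<beta> p (v(i := tcomb x u y w)) = x *\<^sub>R wedge 2 2 \<alpha> \<beta> p (v(i := u)) + y *\<^sub>R wedge 2 2 \<alpha> \<beta> p (v(i := w))"
    if v: "v \<in> tuples A 4 p" and i: "i < 4" and u: "u \<in> tangent_space A p" and w: "w \<in> tangent_space A p" for v i u w x y
  proof -
    note t = tT[OF v]
    have upd: "v(i := z) \<in> tuples A 4 p" if "z \<in> tangent_space A p" for z
      using v that by (simp add: tuples_def)
    note la = alternating_2(2)[OF a u w] alternating_2(3)[OF a u w]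
    note lb = alternating_2(2)[OF b u w] alternating_2(3)[OF b u w]
    show ?thesis
      unfolding wedge_2_2[OF a b upd[OF tcomb_tangent[OF u w]]] wedge_2_2[OF a b upd[OF u]] wedge_2_2[OF a b upd[OF w]]
      using cases4[OF i]
      by (elim disjE; simp add: la[OF t(1)] la[OF t(2)] la[OF t(3)] la[OF t(4)]
          lb[OF t(1)] lb[OF t(2)] lb[OF t(3)] lb[OF t(4)] algebra_simps)
  qed
  have 2: "wedge 2 2 \<alpha> \<beta> p v = 0" if v: "v \<in> tuples A 4 p" and ij: "i < j" "j < 4" "v i = v j" for v i j
  proof -
    note t = tT[OF v]
    note z = alternating_2(4)[OF a t(1)] alternating_2(4)[OF a t(2)] alternating_2(4)[OF a t(3)]
      alternating_2(4)[OF a t(4)] alternating_2(4)[OF b t(1)] alternating_2(4)[OF b t(2)]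
      alternating_2(4)[OF b t(3)] alternating_2(4)[OF b t(4)]
    have anti: "form2 \<gamma> p (v (Suc 0)) (v 0) = - form2 \<gamma> p (v 0) (v (Suc 0))"
      "form2 \<gamma> p (v 2) (v 0) = - form2 \<gamma> p (v 0) (v 2)" "form2 \<gamma> p (v 2) (v (Suc 0)) = - form2 \<gamma> p (v (Suc 0)) (v 2)"
      "form2 \<gamma> p (v 3) (v 0) = - form2 \<gamma> p (v 0) (v 3)" "form2 \<gamma> p (v 3) (v (Suc 0)) = - form2 \<gamma> p (v (Suc 0)) (v 3)"
      "form2 \<gamma> p (v 3) (v 2) = - form2 \<gamma> p (v 2) (v 3)" if "alternating_at A 2 \<gamma> p" for \<gamma> :: "('a, 'e, real) form"
      by (rule alternating_2(5)[OF that tuplesD[OF v] tuplesD[OF v]]; simp)+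
    have "(i = 0 \<and> j = Suc 0) \<or> (i = 0 \<and> j = 2) \<or> (i = 0 \<and> j = 3) \<or> (i = Suc 0 \<and> j = 2)
        \<or> (i = Suc 0 \<and> j = 3) \<or> (i = 2 \<and> j = 3)"
      using ij(1,2) cases4[of i] cases4[of j] by auto
    then show ?thesis
      using ij(3) unfolding wedge_2_2[OF a b v] One_nat_def
      by (elim disjE conjE; simp add: z anti[OF a] anti[OF b])
  qed
  have 3: "wedge 2 2 \<alpha> \<beta> p v = wedge 2 2 \<alpha> \<beta> p v'" if v: "v \<in> tuples A 4 p" and e: "\<forall>i<4. v i = v' i" for v v'
  proof -
    have v': "v' \<in> tuples A 4 p" using v e by (simp add: tuples_def)
    show ?thesis unfolding wedge_2_2[OF a b v] wedge_2_2[OF a b v'] using e by simp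
  qed
  show ?thesis unfolding alternating_at_def
    by (intro conjI ballI allI impI; (elim conjE)?; rule 1 2 3; assumption)
qed

lemma local_form_wedge_2_2:
  assumes "smooth_form A 2 \<alpha>" "smooth_form A 2 \<beta>" "c \<in> A" "x \<in> snd c ` fst c"
  shows "local_form A c (wedge 2 2 \<alpha> \<beta>) x e =
    (let L = (\<lambda>\<gamma> i j. local_form A c \<gamma> x (case_nat (e i) (\<lambda>_. e j))) in
      L \<alpha> 0 1 * L \<beta> 2 3 - L \<alpha> 0 2 * L \<beta> 1 3 + L \<alpha> 0 3 * L \<beta> 1 2
      + L \<alpha> 1 2 * L \<beta> 0 3 - L \<alpha> 1 3 * L \<beta> 0 2 + L \<alpha> 2 3 * L \<beta> 0 1)"
proof -
  obtain p where p: "p \<in> fst c" "x = snd c p" using assms(4) by blast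
  note a = smooth_form_alternating[OF assms(1,3) p(1)] and b = smooth_form_alternating[OF assms(2,3) p(1)]
  have "local_form A c (wedge 2 2 \<alpha> \<beta>) x e = wedge 2 2 \<alpha> \<beta> p (\<lambda>i. coord_vec A c p (e i))"
    by (simp add: local_form_def p assms(3))
  then show ?thesis
    unfolding p(2) Let_def wedge_2_2[OF a b coord_tuple[OF assms(3) p(1)]]
      local_form_2[OF assms(3) p(1) a] local_form_2[OF assms(3) p(1) b] by simp
qed

lemma smooth_form_local: "smooth_form A k \<alpha> \<Longrightarrow> c \<in> A \<Longrightarrow> smooth_on (snd c ` fst c) (\<lambda>x. local_form A c \<alpha> x e)"
  by (simp add: smooth_form_def)

lemma smooth_form_wedge_2_2:
  assumes "smooth_form A 2 \<alpha>" "smooth_form A 2 \<beta>"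
  shows "smooth_form A 4 (wedge 2 2 \<alpha> \<beta>)"
proof -
  have "smooth_on (snd c ` fst c) (\<lambda>x. local_form A c (wedge 2 2 \<alpha> \<beta>) x e)" if c: "c \<in> A" for c e
    by (rule smooth_on_eqI[OF open_chart_image[OF c]], rule local_form_wedge_2_2[OF assms c], assumption, unfold Let_def)
      (intro smooth_on_add smooth_on_diff smooth_on_mult smooth_form_local[OF assms(1) c] smooth_form_local[OF assms(2) c] open_chart_image c)
  moreover have "alternating_at A 4 (wedge 2 2 \<alpha> \<beta>) p" if "p \<in> pts A" for p
    using alternating_wedge_2_2 assms that by (simp add: smooth_form_def)
  ultimately show ?thesis by (simp add: smooth_form_def)
qed

end

context smooth_atlas3
begin

text \<open>A chart around \<open>p\<close> turns the product into a multiple of the determinant,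
  from which all three conditions are read off.\<close>

lemma alternating_wedge_1_2:
  assumes a: "alternating_at A 1 \<alpha> p" and b: "alternating_at A 2 \<beta> p" and c: "c \<in> A" "p \<in> fst c"
  shows "alternating_at A 3 (wedge 1 2 \<alpha> \<beta>) p"
proof -
  have cases3: "i = 0 \<or> i = Suc 0 \<or> i = 2" if "i < 3" for i :: nat using that by auto
  note W = wedge_1_2_coord[OF c a b]
  have 1: "wedge 1 2 \<alpha> \<beta> p (v(i := tcomb x u y w)) = x *\<^sub>R wedge 1 2 \<alpha> \<beta> p (v(i := u)) + y *\<^sub>R wedge 1 2 \<alpha> \<beta> p (v(i := w))"
    if v: "v \<in> tuples A 3 p" and i: "i < 3" and u: "u \<in> tangent_space A p" and w: "w \<in> tangent_space A p" for v i u w x y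
  proof -
    have upd: "v(i := z) \<in> tuples A 3 p" if "z \<in> tangent_space A p" for z
      using v that by (simp add: tuples_def)
    show ?thesis
      unfolding W[OF upd[OF tcomb_tangent[OF u w]]] W[OF upd[OF u]] W[OF upd[OF w]]
      using cases3[OF i]
      by (elim disjE; simp add: tcomb_def cross_add_left cross_add_right cross_mult_left cross_mult_right
          inner_add_left inner_add_right algebra_simps)
  qed
  have 2: "wedge 1 2 \<alpha> \<beta> p v = 0" if v: "v \<in> tuples A 3 p" and ij: "i < j" "j < 3" "v i = v j" for v i j
  proof -
    have "(i = 0 \<and> j = Suc 0) \<or> (i = 0 \<and> j = 2) \<or> (i = Suc 0 \<and> j = 2)"
      using ij(1,2) cases3[of i] cases3[of j] by auto
    then have "det_rows (v 0 c) (v 1 c) (v 2 c) = 0"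
      using ij(3) by (elim disjE conjE; simp add: dot_cross_self)
    then show ?thesis unfolding W[OF v] by simp
  qed
  have 3: "wedge 1 2 \<alpha> \<beta> p v = wedge 1 2 \<alpha> \<beta> p v'" if v: "v \<in> tuples A 3 p" and e: "\<forall>i<3. v i = v' i" for v v'
  proof -
    have v': "v' \<in> tuples A 3 p" using v e by (simp add: tuples_def)
    show ?thesis unfolding W[OF v] W[OF v'] using e by simp
  qed
  show ?thesis unfolding alternating_at_def
    by (intro conjI ballI allI impI; (elim conjE)?; rule 1 2 3; assumption)
qed

lemma smooth_form_wedge_1_2:
  assumes "smooth_form A 1 \<alpha>" "smooth_form A 2 \<beta>"
  shows "smooth_form A 3 (wedge 1 2 \<alpha> \<beta>)"
proof -
  have "smooth_on (snd c ` fst c) (\<lambda>x. local_form A c (wedge 1 2 \<alpha> \<beta>) x e)" if c: "c \<in> A" for c e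
  proof -
    have e: "local_form A c (wedge 1 2 \<alpha> \<beta>) x e = (form1_field A c \<alpha> x \<bullet> form2_field A c \<beta> x) * det_rows (e 0) (e 1) (e 2)"
      if x: "x \<in> snd c ` fst c" for x
    proof -
      obtain p where p: "p \<in> fst c" "x = snd c p" using x by blast
      show ?thesis
        using wedge_1_2_coord[OF c p(1) smooth_form_alternating[OF assms(1) c p(1)] smooth_form_alternating[OF assms(2) c p(1)] coord_tuple[OF c p(1)], of e]
        by (simp add: local_form_def p c)
    qed
    show ?thesis
      by (rule smooth_on_eqI[OF open_chart_image[OF c] e], assumption)
        (intro smooth_on_mult smooth_on_inner smooth_form1_field[OF assms(1) c] smooth_form2_field[OF assms(2) c] smooth_on_const open_chart_image c)
  qed
  moreover have "alternating_at A 3 (wedge 1 2 \<alpha> \<beta>) p" if "p \<in> pts A" for p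
  proof -
    obtain c where c: "c \<in> A" "p \<in> fst c" using \<open>p \<in> pts A\<close> ptsE by metis
    show ?thesis
      by (rule alternating_wedge_1_2[OF smooth_form_alternating[OF assms(1) c] smooth_form_alternating[OF assms(2) c] c])
  qed
  ultimately show ?thesis by (simp add: smooth_form_def)
qed

end

section \<open>The cylinder\<close>

definition cyl_chart :: "('a, real^3) chart \<Rightarrow> ('a \<times> real, (real^3) \<times> real) chart"
  where "cyl_chart c = (fst c \<times> UNIV, map_prod (snd c) id)"

lemma cyl_eq: "cyl A = cyl_chart ` A"
proof -
  have "cyl A = {(fst c \<times> UNIV, map_prod (snd c) id) | c. c \<in> A}"
    by (simp add: cyl_def prod_atlas_def line_atlas_def)
  then show ?thesis unfolding image_def cyl_chart_def by blast
qed

lemma fst_cyl_chart [simp]: "fst (cyl_chart c) = fst c \<times> UNIV"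
  and snd_cyl_chart [simp]: "snd (cyl_chart c) (p, t) = (snd c p, t)"
  by (simp_all add: cyl_chart_def)

lemma cyl_chart_image: "snd (cyl_chart c) ` (S \<times> UNIV) = (snd c ` S) \<times> UNIV"
  by (force simp: cyl_chart_def)

lemma is_chart_cyl:
  assumes "is_chart X c"
  shows "is_chart (prod_topology X euclideanreal) (cyl_chart c)"
proof -
  have "homeomorphic_maps (prod_topology (subtopology X (fst c)) euclideanreal)
      (prod_topology (top_of_set (snd c ` fst c)) euclideanreal)
      (\<lambda>(x, y). (snd c x, id y)) (\<lambda>(x, y). (cinv c x, id y))"
    using chart_homeomorphic_maps[OF assms] by (subst homeomorphic_maps_prod) (simp add: homeomorphic_maps_def)
  then have "homeomorphic_map (prod_topology (subtopology X (fst c)) euclideanreal)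
      (prod_topology (top_of_set (snd c ` fst c)) euclideanreal) (\<lambda>(x, y). (snd c x, id y))"
    by (rule homeomorphic_maps_imp_map)
  moreover have "prod_topology (subtopology X (fst c)) euclideanreal = subtopology (prod_topology X euclideanreal) (fst c \<times> UNIV)"
    by (simp add: prod_topology_subtopology)
  moreover have "prod_topology (top_of_set (snd c ` fst c)) euclideanreal = top_of_set ((snd c ` fst c) \<times> UNIV)"
    using prod_topology_subtopology(1)[of euclidean "snd c ` fst c" euclideanreal] by simp
  moreover have "snd (cyl_chart c) = (\<lambda>(x, y). (snd c x, id y))"
    by (auto simp: cyl_chart_def)
  ultimately show ?thesis
    using is_chartD(3,4)[OF assms] unfolding is_chart_def fst_cyl_chart cyl_chart_image
    by (simp add: openin_prod_Times_iff open_Times)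
qed

section \<open>Charts, tangent vectors and lifted forms on the product with the line\<close>

context smooth_atlas3
begin

lemma cinv_cyl_chart: "c \<in> A \<Longrightarrow> x \<in> snd c ` fst c \<Longrightarrow> cinv (cyl_chart c) (x, t) = (cinv c x, t)"
  using cinv_chart[OF is_chart_cyl[OF charts], of c "(cinv c x, t)"] cinv_in[of x c] by simp

lemmas cinv_cyl_chart' = cinv_cyl_chart[unfolded fst_cyl_chart]

lemma smooth_cyl_transition:
  assumes "c \<in> A" "d \<in> A"
  shows "smooth_on (snd (cyl_chart c) ` (fst (cyl_chart c) \<inter> fst (cyl_chart d))) (snd (cyl_chart d) \<circ> cinv (cyl_chart c))"
proof -
  let ?S = "snd c ` (fst c \<inter> fst d)"
  have im: "snd (cyl_chart c) ` (fst (cyl_chart c) \<inter> fst (cyl_chart d)) = ?S \<times> UNIV"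
    by (simp add: Times_Int_Times cyl_chart_image)
  have o: "open (?S \<times> (UNIV :: real set))" by (intro open_Times open_overlap assms) simp
  have "(snd (cyl_chart d) \<circ> cinv (cyl_chart c)) y = ((snd d \<circ> cinv c) (fst y), snd y)" if "y \<in> ?S \<times> UNIV" for y
    using that assms by (cases y) (auto simp: cinv_cyl_chart')
  then show ?thesis
    unfolding im
    by (subst smooth_on_cong[OF o])
      (auto intro!: smooth_on_Pair o smooth_on_snd smooth_on_id smooth_on_compose[where g = "snd d \<circ> cinv c" and f = fst, OF o open_overlap[OF assms] _ _ smooth_transition[OF assms], simplified]
        smooth_on_fst[OF o smooth_on_id[OF o]])
qed

sublocale cyl: smooth_atlas "prod_topology X euclideanreal" "cyl A"
proof
  fix C D assume "C \<in> cyl A" "D \<in> cyl A"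
  then obtain c d where "c \<in> A" "d \<in> A" "C = cyl_chart c" "D = cyl_chart d"
    by (auto simp: cyl_eq)
  then show "smooth_compat C D"
    unfolding smooth_compat_def using smooth_cyl_transition[of c d] smooth_cyl_transition[of d c] by (simp add: inf_commute)
next
  fix C assume "C \<in> cyl A"
  then obtain c where "c \<in> A" "C = cyl_chart c" unfolding cyl_eq by blast
  then show "is_chart (prod_topology X euclideanreal) C" using is_chart_cyl[OF charts] by simp
qed

lemma cyl_chart_in: "c \<in> A \<Longrightarrow> cyl_chart c \<in> cyl A"
  by (simp add: cyl_eq)

lemma cyl_ptsE:
  assumes "P \<in> pts (cyl A)"
  obtains c p t where "c \<in> A" "p \<in> fst c" "P = (p, t)"
  using assms by (auto simp: pts_def cyl_eq)

lemma cyl_chart_mem: "p \<in> fst c \<Longrightarrow> (p, t) \<in> fst (cyl_chart c)"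
  by simp

lemma trans_deriv_cyl:
  assumes "c \<in> A" "d \<in> A" "p \<in> fst c" "p \<in> fst d"
  shows "trans_deriv (cyl_chart c) (cyl_chart d) (p, t) v = (trans_deriv c d p (fst v), snd v)"
proof -
  let ?S = "snd c ` (fst c \<inter> fst d)"
  have o: "open (?S \<times> (UNIV :: real set))" by (intro open_Times open_overlap assms) simp
  have "((\<lambda>y. ((snd d \<circ> cinv c) (fst y), snd y)) has_derivative (\<lambda>v. (trans_deriv c d p (fst v), snd v))) (at (snd c p, t))"
    by (intro has_derivative_Pair has_derivative_compose[where g = "snd d \<circ> cinv c" and f = fst] has_derivative_snd has_derivative_ident has_derivative_fst)
      (use trans_deriv[OF assms] in simp)
  then have "((snd (cyl_chart d) \<circ> cinv (cyl_chart c)) has_derivative (\<lambda>v. (trans_deriv c d p (fst v), snd v))) (at (snd c p, t))"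
    by (rule has_derivative_transform_within_open[OF _ o]) (use assms in \<open>auto simp: cinv_cyl_chart'\<close>)
  with cyl.trans_deriv[OF cyl_chart_in[OF assms(1)] cyl_chart_in[OF assms(2)] cyl_chart_mem[OF assms(3)] cyl_chart_mem[OF assms(4)], of t]
  have "trans_deriv (cyl_chart c) (cyl_chart d) (p, t) = (\<lambda>v. (trans_deriv c d p (fst v), snd v))"
    unfolding snd_cyl_chart by (rule has_derivative_unique)
  then show ?thesis by simp
qed

lemma tangent_map_fst:
  assumes u: "u \<in> tangent_space (cyl A) (p, t)" and c: "c \<in> A" "p \<in> fst c"
  shows "tangent_map (cyl A) A fst (p, t) u c = fst (u (cyl_chart c))"
proof -
  have o: "open ((snd c ` fst c) \<times> (UNIV :: real set))" by (intro open_Times open_chart_image c) simp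
  have "((snd c \<circ> fst \<circ> cinv (cyl_chart c)) has_derivative fst) (at (snd (cyl_chart c) (p, t)))"
    unfolding snd_cyl_chart
    by (rule has_derivative_transform_within_open[OF has_derivative_fst[OF has_derivative_ident] o])
      (use c in \<open>auto simp: cinv_cyl_chart'\<close>)
  from cyl.differential_chart[OF cyl_chart_in[OF c(1)] cyl_chart_mem[OF c(2)] u this]
  show ?thesis using c by (simp add: tangent_map_def)
qed

lemma tangent_map_fst_tangent:
  assumes u: "u \<in> tangent_space (cyl A) (p, t)"
  shows "tangent_map (cyl A) A fst (p, t) u \<in> tangent_space A p"
proof -
  have "trans_deriv c d p (tangent_map (cyl A) A fst (p, t) u c) = tangent_map (cyl A) A fst (p, t) u d"
    if "c \<in> A" "d \<in> A" "p \<in> fst c" "p \<in> fst d" for c d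
    using cyl.tangent_spaceD(1)[OF u cyl_chart_in[OF that(1)] cyl_chart_in[OF that(2)] cyl_chart_mem[OF that(3)] cyl_chart_mem[OF that(4)]]
    unfolding tangent_map_fst[OF u that(1,3)] tangent_map_fst[OF u that(2,4)] trans_deriv_cyl[OF that]
    by (metis fst_conv)
  then show ?thesis unfolding tangent_space_def by (auto simp: tangent_map_def)
qed

lemma differential_snd:
  assumes u: "u \<in> tangent_space (cyl A) (p, t)" and c: "c \<in> A" "p \<in> fst c"
  shows "differential (cyl A) snd (p, t) u = snd (u (cyl_chart c))"
proof -
  have o: "open ((snd c ` fst c) \<times> (UNIV :: real set))" by (intro open_Times open_chart_image c) simp
  have "((snd \<circ> cinv (cyl_chart c)) has_derivative snd) (at (snd (cyl_chart c) (p, t)))"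
    unfolding snd_cyl_chart
    by (rule has_derivative_transform_within_open[OF has_derivative_snd[OF has_derivative_ident] o])
      (use c in \<open>auto simp: cinv_cyl_chart'\<close>)
  from cyl.differential_chart[OF cyl_chart_in[OF c(1)] cyl_chart_mem[OF c(2)] u this]
  show ?thesis .
qed

lemma cyl_tcomb: "tcomb a u b w C = a *\<^sub>R u C + b *\<^sub>R w C"
  by (simp add: tcomb_def)

lemma dt_coord:
  assumes c: "c \<in> A" "p \<in> fst c"
  shows "alternating_at (cyl A) 1 (dt A) (p, t)"
    "u \<in> tangent_space (cyl A) (p, t) \<Longrightarrow> form1 (dt A) (p, t) u = snd (u (cyl_chart c))"
proof -
  show "alternating_at (cyl A) 1 (dt A) (p, t)"
    by (rule cyl.alternating_1I[where \<beta> = "\<lambda>u. snd (u (cyl_chart c))"])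
      (simp_all add: dt_def differential_snd[OF cyl.tuplesD c] cyl_tcomb)
  show "form1 (dt A) (p, t) u = snd (u (cyl_chart c))" if "u \<in> tangent_space (cyl A) (p, t)"
    unfolding form1_def dt_def by (rule differential_snd[OF that c])
qed

lemma lift_tuple: "v \<in> tuples (cyl A) k (p, t) \<Longrightarrow> (\<lambda>i. tangent_map (cyl A) A fst (p, t) (v i)) \<in> tuples A k p"
  by (simp add: tuples_def tangent_map_fst_tangent)

lemma lift1_coord:
  assumes c: "c \<in> A" "p \<in> fst c" and a: "alternating_at A 1 \<alpha> p"
  shows "alternating_at (cyl A) 1 (lift A \<alpha>) (p, t)"
    "u \<in> tangent_space (cyl A) (p, t) \<Longrightarrow> form1 (lift A \<alpha>) (p, t) u = form1_field A c \<alpha> (snd c p) \<bullet> fst (u (cyl_chart c))"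
proof -
  have *: "lift A \<alpha> (p, t) v = form1_field A c \<alpha> (snd c p) \<bullet> fst (v 0 (cyl_chart c))" if v: "v \<in> tuples (cyl A) 1 (p, t)" for v
  proof -
    have v0: "v 0 \<in> tangent_space (cyl A) (p, t)" using cyl.tuplesD[OF v] by simp
    show ?thesis
      unfolding pullback_def fst_conv alternating_1(1)[OF a lift_tuple[OF v]] form1_coord[OF c a tangent_map_fst_tangent[OF v0]]
        tangent_map_fst[OF v0 c] ..
  qed
  show al: "alternating_at (cyl A) 1 (lift A \<alpha>) (p, t)"
    by (rule cyl.alternating_1I[where \<beta> = "\<lambda>u. form1_field A c \<alpha> (snd c p) \<bullet> fst (u (cyl_chart c))"], erule *)
      (simp_all add: cyl_tcomb inner_add_right)
  show "form1 (lift A \<alpha>) (p, t) u = form1_field A c \<alpha> (snd c p) \<bullet> fst (u (cyl_chart c))" if "u \<in> tangent_space (cyl A) (p, t)"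
    unfolding form1_def by (rule *) (use that in \<open>simp add: tuples_def\<close>)
qed

lemma lift2_coord:
  assumes c: "c \<in> A" "p \<in> fst c" and a: "alternating_at A 2 \<alpha> p"
  shows "alternating_at (cyl A) 2 (lift A \<alpha>) (p, t)"
    "u \<in> tangent_space (cyl A) (p, t) \<Longrightarrow> w \<in> tangent_space (cyl A) (p, t) \<Longrightarrow>
      form2 (lift A \<alpha>) (p, t) u w = form2_field A c \<alpha> (snd c p) \<bullet> cross3 (fst (u (cyl_chart c))) (fst (w (cyl_chart c)))"
proof -
  have *: "lift A \<alpha> (p, t) v = form2_field A c \<alpha> (snd c p) \<bullet> cross3 (fst (v 0 (cyl_chart c))) (fst (v 1 (cyl_chart c)))"
    if v: "v \<in> tuples (cyl A) 2 (p, t)" for v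
  proof -
    have v0: "v 0 \<in> tangent_space (cyl A) (p, t)" "v 1 \<in> tangent_space (cyl A) (p, t)" by (rule cyl.tuplesD[OF v]; simp)+
    show ?thesis
      unfolding pullback_def fst_conv alternating_2(1)[OF a lift_tuple[OF v]]
        form2_coord[OF c a tangent_map_fst_tangent[OF v0(1)] tangent_map_fst_tangent[OF v0(2)]]
        tangent_map_fst[OF v0(1) c] tangent_map_fst[OF v0(2) c] ..
  qed
  show al: "alternating_at (cyl A) 2 (lift A \<alpha>) (p, t)"
    by (rule cyl.alternating_2I[where \<beta> = "\<lambda>u w. form2_field A c \<alpha> (snd c p) \<bullet> cross3 (fst (u (cyl_chart c))) (fst (w (cyl_chart c)))"], erule *)
      (simp_all add: cyl_tcomb inner_add_right cross_add_left cross_add_right cross_mult_left cross_mult_right)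
  show "form2 (lift A \<alpha>) (p, t) u w = form2_field A c \<alpha> (snd c p) \<bullet> cross3 (fst (u (cyl_chart c))) (fst (w (cyl_chart c)))"
    if "u \<in> tangent_space (cyl A) (p, t)" "w \<in> tangent_space (cyl A) (p, t)"
    using *[OF cyl.pair_tuple[OF that]] by (simp add: form2_def)
qed

end

text \<open>The 2-form \<open>dt \<and> n + V\<close> on \<open>(real^3) \<times> real\<close> at a
  point, with \<open>t\<close> the last coordinate and \<open>V\<close> acting through
  \<open>cross3\<close>.\<close>

definition cyl_pairing :: "real^3 \<Rightarrow> real^3 \<Rightarrow> (real^3) \<times> real \<Rightarrow> (real^3) \<times> real \<Rightarrow> real"
  where "cyl_pairing n V a b = snd a * (n \<bullet> fst b) - snd b * (n \<bullet> fst a) + V \<bullet> cross3 (fst a) (fst b)"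

text \<open>The determinant expanded along the \<open>t\<close>-coordinates, with \<open>t\<close>
  counted as the first coordinate: it is \<open>dt\<close> wedge the volume form of
  \<open>real^3\<close>.\<close>

definition det4 :: "(real^3) \<times> real \<Rightarrow> (real^3) \<times> real \<Rightarrow> (real^3) \<times> real \<Rightarrow> (real^3) \<times> real \<Rightarrow> real"
  where "det4 a b c d = snd a * det_rows (fst b) (fst c) (fst d) - snd b * det_rows (fst a) (fst c) (fst d)
    + snd c * det_rows (fst a) (fst b) (fst d) - snd d * det_rows (fst a) (fst b) (fst c)"

text \<open>\<open>(dt \<and> n + V) \<and> (dt \<and> m + U) = dt \<and> (n \<and> U + m \<and>
  V)\<close>. The term with two \<open>dt\<close> cancels, and \<open>V \<and> U\<close> is a 4-form
  on three-space, which vanishes by \<open>Q\<close>; \<open>T\<close> evaluates the wedge of a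
  covector and a 2-form.\<close>

lemma cyl_pairing_wedge:
  "cyl_pairing n V a b * cyl_pairing m U c d - cyl_pairing n V a c * cyl_pairing m U b d + cyl_pairing n V a d * cyl_pairing m U b c
    + cyl_pairing n V b c * cyl_pairing m U a d - cyl_pairing n V b d * cyl_pairing m U a c + cyl_pairing n V c d * cyl_pairing m U a b
    = (n \<bullet> U + m \<bullet> V) * det4 a b c d"
proof -
  have T: "(k \<bullet> Y) * det_rows x y z = (k \<bullet> x) * (Y \<bullet> cross3 y z) - (k \<bullet> y) * (Y \<bullet> cross3 x z) + (k \<bullet> z) * (Y \<bullet> cross3 x y)"
    for k Y x y z :: "real^3"
    by (simp add: inner_vec_def sum_3 cross_components algebra_simps)
  have Q: "(V \<bullet> cross3 x y) * (U \<bullet> cross3 z w) - (V \<bullet> cross3 x z) * (U \<bullet> cross3 y w) + (V \<bullet> cross3 x w) * (U \<bullet> cross3 y z)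
    + (V \<bullet> cross3 y z) * (U \<bullet> cross3 x w) - (V \<bullet> cross3 y w) * (U \<bullet> cross3 x z) + (V \<bullet> cross3 z w) * (U \<bullet> cross3 x y) = 0" for x y z w
    by (simp add: inner_vec_def sum_3 cross_components algebra_simps)
  have "(n \<bullet> U + m \<bullet> V) * det4 a b c d = snd a * ((n \<bullet> U) * det_rows (fst b) (fst c) (fst d) + (m \<bullet> V) * det_rows (fst b) (fst c) (fst d))
    - snd b * ((n \<bullet> U) * det_rows (fst a) (fst c) (fst d) + (m \<bullet> V) * det_rows (fst a) (fst c) (fst d))
    + snd c * ((n \<bullet> U) * det_rows (fst a) (fst b) (fst d) + (m \<bullet> V) * det_rows (fst a) (fst b) (fst d))
    - snd d * ((n \<bullet> U) * det_rows (fst a) (fst b) (fst c) + (m \<bullet> V) * det_rows (fst a) (fst b) (fst c))"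
    unfolding det4_def by (simp add: algebra_simps)
  then show ?thesis
    unfolding T[of n U "fst b" "fst c" "fst d"] T[of m V "fst b" "fst c" "fst d"]
      T[of n U "fst a" "fst c" "fst d"] T[of m V "fst a" "fst c" "fst d"]
      T[of n U "fst a" "fst b" "fst d"] T[of m V "fst a" "fst b" "fst d"]
      T[of n U "fst a" "fst b" "fst c"] T[of m V "fst a" "fst b" "fst c"] cyl_pairing_def
    using Q[of "fst a" "fst b" "fst c" "fst d"] by (simp add: algebra_simps)
qed

section \<open>Linear operations on forms\<close>

context smooth_atlas
begin

lemma alternating_atD:
  assumes "alternating_at A k \<alpha> p"
  shows "v \<in> tuples A k p \<Longrightarrow> i < k \<Longrightarrow> u \<in> tangent_space A p \<Longrightarrow> w \<in> tangent_space A p \<Longrightarrow>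
      \<alpha> p (v(i := tcomb r u s w)) = r *\<^sub>R \<alpha> p (v(i := u)) + s *\<^sub>R \<alpha> p (v(i := w))"
    "v \<in> tuples A k p \<Longrightarrow> i < j \<Longrightarrow> j < k \<Longrightarrow> v i = v j \<Longrightarrow> \<alpha> p v = 0"
    "v \<in> tuples A k p \<Longrightarrow> \<forall>i<k. v i = v' i \<Longrightarrow> \<alpha> p v = \<alpha> p v'"
  using assms unfolding alternating_at_def by blast+

text \<open>Covers real multiples, real and imaginary parts, and the passage from real to complex
  values in one statement.\<close>

lemma smooth_form_bounded_linear:
  fixes \<alpha> :: "('a, 'e, 'b::real_normed_vector) form" and L :: "'b \<Rightarrow> 'd::real_normed_vector"
  assumes "smooth_form A k \<alpha>" "bounded_linear L"
  shows "smooth_form A k (\<lambda>p v. L (\<alpha> p v))"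
proof -
  interpret L: bounded_linear L by (rule assms(2))
  have "alternating_at A k (\<lambda>p v. L (\<alpha> p v)) p" if "p \<in> pts A" for p
  proof -
    have a: "alternating_at A k \<alpha> p" using assms(1) that by (simp add: smooth_form_def)
    show ?thesis
      unfolding alternating_at_def
    proof (intro conjI ballI allI impI)
      fix v i u w r s assume h: "v \<in> tuples A k p" "i < k" "u \<in> tangent_space A p" "w \<in> tangent_space A p"
      have "\<alpha> p (v(i := tcomb r u s w)) = r *\<^sub>R \<alpha> p (v(i := u)) + s *\<^sub>R \<alpha> p (v(i := w))"
        by (rule alternating_atD(1)[OF a h])
      then show "L (\<alpha> p (v(i := tcomb r u s w))) = r *\<^sub>R L (\<alpha> p (v(i := u))) + s *\<^sub>R L (\<alpha> p (v(i := w)))"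
        by (simp add: L.add L.scaleR)
    next
      fix v i j assume h: "v \<in> tuples A k p" "i < j \<and> j < k \<and> v i = v j"
      have "\<alpha> p v = 0" using alternating_atD(2)[OF a h(1), of i j] h(2) by simp
      then show "L (\<alpha> p v) = 0" by (simp add: L.zero)
    next
      fix v v' assume h: "v \<in> tuples A k p" "\<forall>i<k. v i = v' i"
      have "\<alpha> p v = \<alpha> p v'" by (rule alternating_atD(3)[OF a h])
      then show "L (\<alpha> p v) = L (\<alpha> p v')" by simp
    qed
  qed
  moreover have "smooth_on (snd c ` fst c) (\<lambda>x. local_form A c (\<lambda>p v. L (\<alpha> p v)) x e)" if c: "c \<in> A" for c e
    using smooth_on_bounded_linear[OF open_chart_image[OF c] assms(2) smooth_form_local[OF assms(1) c], of e]
    by (simp add: local_form_def)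
  ultimately show ?thesis by (simp add: smooth_form_def)
qed

lemma smooth_form_add:
  fixes \<alpha> \<beta> :: "('a, 'e, 'b::real_normed_vector) form"
  assumes "smooth_form A k \<alpha>" "smooth_form A k \<beta>"
  shows "smooth_form A k (\<lambda>p v. \<alpha> p v + \<beta> p v)"
proof -
  have "alternating_at A k (\<lambda>p v. \<alpha> p v + \<beta> p v) p" if "p \<in> pts A" for p
  proof -
    have ab: "alternating_at A k \<alpha> p" "alternating_at A k \<beta> p" using assms that by (simp_all add: smooth_form_def)
    show ?thesis
      unfolding alternating_at_def
    proof (intro conjI ballI allI impI)
      fix v i u w r s assume h: "v \<in> tuples A k p" "i < k" "u \<in> tangent_space A p" "w \<in> tangent_space A p"
      have "\<alpha> p (v(i := tcomb r u s w)) = r *\<^sub>R \<alpha> p (v(i := u)) + s *\<^sub>R \<alpha> p (v(i := w))"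
        "\<beta> p (v(i := tcomb r u s w)) = r *\<^sub>R \<beta> p (v(i := u)) + s *\<^sub>R \<beta> p (v(i := w))"
        by (rule alternating_atD(1)[OF ab(1) h], rule alternating_atD(1)[OF ab(2) h])
      then show "\<alpha> p (v(i := tcomb r u s w)) + \<beta> p (v(i := tcomb r u s w))
          = r *\<^sub>R (\<alpha> p (v(i := u)) + \<beta> p (v(i := u))) + s *\<^sub>R (\<alpha> p (v(i := w)) + \<beta> p (v(i := w)))"
        by (simp add: algebra_simps)
    next
      fix v i j assume h: "v \<in> tuples A k p" "i < j \<and> j < k \<and> v i = v j"
      have "\<alpha> p v = 0" "\<beta> p v = 0"
        using alternating_atD(2)[OF ab(1) h(1), of i j] alternating_atD(2)[OF ab(2) h(1), of i j] h(2) by simp_all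
      then show "\<alpha> p v + \<beta> p v = 0" by simp
    next
      fix v v' assume h: "v \<in> tuples A k p" "\<forall>i<k. v i = v' i"
      have "\<alpha> p v = \<alpha> p v'" "\<beta> p v = \<beta> p v'"
        by (rule alternating_atD(3)[OF ab(1) h], rule alternating_atD(3)[OF ab(2) h])
      then show "\<alpha> p v + \<beta> p v = \<alpha> p v' + \<beta> p v'" by simp
    qed
  qed
  moreover have "smooth_on (snd c ` fst c) (\<lambda>x. local_form A c (\<lambda>p v. \<alpha> p v + \<beta> p v) x e)" if c: "c \<in> A" for c e
    using smooth_on_add[OF open_chart_image[OF c] smooth_form_local[OF assms(1) c] smooth_form_local[OF assms(2) c], of e e]
    by (simp add: local_form_def)
  ultimately show ?thesis by (simp add: smooth_form_def)
qed

lemma smooth_form_lin_comb: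
  assumes "smooth_form A k \<alpha>" "smooth_form A k \<beta>"
  shows "smooth_form A k (lin_comb x \<alpha> y \<beta>)"
  unfolding lin_comb_def
  by (intro smooth_form_add smooth_form_bounded_linear[OF assms(1) bounded_linear_mult_right]
      smooth_form_bounded_linear[OF assms(2) bounded_linear_mult_right])

lemma closed_form_lin_comb:
  assumes "smooth_form A k \<alpha>" "smooth_form A k \<beta>" "closed_form A k \<alpha>" "closed_form A k \<beta>"
  shows "closed_form A k (lin_comb x \<alpha> y \<beta>)"
  unfolding closed_form_def
proof (intro ballI allI)
  fix c z e assume c: "c \<in> A" and z: "z \<in> snd c ` fst c"
  have D: "frechet_derivative (\<lambda>q. local_form A c (lin_comb x \<alpha> y \<beta>) q f) (at z) h
     = x * frechet_derivative (\<lambda>q. local_form A c \<alpha> q f) (at z) h + y * frechet_derivative (\<lambda>q. local_form A c \<beta> q f) (at z) h" for f h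
  proof -
    have d: "((\<lambda>q. x * local_form A c \<alpha> q f + y * local_form A c \<beta> q f) has_derivative
        (\<lambda>h. x * frechet_derivative (\<lambda>q. local_form A c \<alpha> q f) (at z) h + y * frechet_derivative (\<lambda>q. local_form A c \<beta> q f) (at z) h)) (at z)"
      by (intro has_derivative_add has_derivative_mult_right smooth_on_has_derivative[OF smooth_form_local[OF assms(1) c] z]
          smooth_on_has_derivative[OF smooth_form_local[OF assms(2) c] z])
    show ?thesis
      using frechet_derivative_eqI[OF d] by (simp add: local_form_def lin_comb_def)
  qed
  have "ext_deriv k (local_form A c (lin_comb x \<alpha> y \<beta>)) z e
      = x * ext_deriv k (local_form A c \<alpha>) z e + y * ext_deriv k (local_form A c \<beta>) z e"
    unfolding ext_deriv_def D by (simp add: sum_distrib_left sum.distrib algebra_simps)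
  also have "\<dots> = 0"
  proof -
    have "ext_deriv k (local_form A c \<alpha>) z e = 0" "ext_deriv k (local_form A c \<beta>) z e = 0"
      using assms(3,4)[unfolded closed_form_def] c z by blast+
    then show ?thesis by simp
  qed
  finally show "ext_deriv k (local_form A c (lin_comb x \<alpha> y \<beta>)) z e = 0" .
qed

end

lemma form_field_lin_comb:
  "form1_field A c (lin_comb x \<alpha> y \<beta>) z = x *\<^sub>R form1_field A c \<alpha> z + y *\<^sub>R form1_field A c \<beta> z"
  "form2_field A c (lin_comb x \<alpha> y \<beta>) z = x *\<^sub>R form2_field A c \<alpha> z + y *\<^sub>R form2_field A c \<beta> z"
  by (simp_all add: form1_field_def form2_field_def vec_eq_iff forall_3 local_form_def lin_comb_def)

text \<open>Let \<open>a = (u, s)\<close>. Pairing with the \<open>t\<close>-direction gives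
  \<open>n \<bullet> u = 0\<close>, pairing with the directions of three-space gives
  \<open>s *\<^sub>R n + cross3 V u = 0\<close>. The inner product with \<open>V\<close> yields
  \<open>s = 0\<close>, and then the cross product with \<open>n\<close> yields
  \<open>(n \<bullet> V) *\<^sub>R u = 0\<close>.\<close>

lemma cyl_pairing_nondegenerate:
  assumes "\<And>b. cyl_pairing n V a b = 0" "n \<bullet> V \<noteq> 0"
  shows "a = 0"
proof -
  obtain u s where a: "a = (u, s)" by (cases a)
  have nu: "n \<bullet> u = 0" using assms(1)[of "(0, 1)"] by (simp add: a cyl_pairing_def)
  have "(s *\<^sub>R n + cross3 V u) \<bullet> x = 0" for x
    using assms(1)[of "(x, 0)"] cross_triple[of V u x]
    by (simp add: a cyl_pairing_def inner_add_left inner_commute) (simp add: inner_vec_def sum_3 cross_components algebra_simps)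
  then have e: "s *\<^sub>R n + cross3 V u = 0" by (metis inner_eq_zero_iff)
  have "(s *\<^sub>R n + cross3 V u) \<bullet> V = s * (n \<bullet> V)" by (simp add: inner_add_left dot_cross_self)
  then have s: "s = 0" using e assms(2) by simp
  then have "cross3 n (cross3 V u) = 0" using e by simp
  then have "(n \<bullet> V) *\<^sub>R u = 0" using nu by (simp add: Lagrange)
  then show ?thesis using a s assms(2) by (simp add: zero_prod_def)
qed

section \<open>The forms on the cylinder in coordinates\<close>

context smooth_atlas3
begin

lemma cyl_form_coord:
  assumes c: "c \<in> A" "p \<in> fst c" and a: "alternating_at A 1 \<eta> p" "alternating_at A 2 \<Omega> p"
  defines "N \<equiv> form1_field A c \<eta> (snd c p)" and "V \<equiv> form2_field A c \<Omega> (snd c p)"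
  shows "alternating_at (cyl A) 2 (cyl_form A \<eta> \<Omega>) (p, t)"
    "u \<in> tangent_space (cyl A) (p, t) \<Longrightarrow> w \<in> tangent_space (cyl A) (p, t) \<Longrightarrow>
      form2 (cyl_form A \<eta> \<Omega>) (p, t) u w = cyl_pairing N V (u (cyl_chart c)) (w (cyl_chart c))"
proof -
  note dt = dt_coord[OF c, where t = t] and l1 = lift1_coord[OF c a(1), where t = t] and l2 = lift2_coord[OF c a(2), where t = t]
  have *: "cyl_form A \<eta> \<Omega> (p, t) v = cyl_pairing N V (v 0 (cyl_chart c)) (v 1 (cyl_chart c))" if v: "v \<in> tuples (cyl A) 2 (p, t)" for v
  proof -
    have v': "v 0 \<in> tangent_space (cyl A) (p, t)" "v 1 \<in> tangent_space (cyl A) (p, t)" by (rule cyl.tuplesD[OF v]; simp)+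
    show ?thesis
      unfolding cyl_form_def lin_comb_def cyl.wedge_1_1[OF dt(1) l1(1) v] cyl.alternating_2(1)[OF l2(1) v]
        dt(2)[OF v'(1)] dt(2)[OF v'(2)] l1(2)[OF v'(1)] l1(2)[OF v'(2)] l2(2)[OF v']
      by (simp add: cyl_pairing_def N_def V_def)
  qed
  show "alternating_at (cyl A) 2 (cyl_form A \<eta> \<Omega>) (p, t)"
    by (rule cyl.alternating_2I[where \<beta> = "\<lambda>u w. cyl_pairing N V (u (cyl_chart c)) (w (cyl_chart c))"], erule *)
      (simp_all add: cyl_tcomb cyl_pairing_def inner_add_right cross_add_left cross_add_right cross_mult_left cross_mult_right algebra_simps)
  show "form2 (cyl_form A \<eta> \<Omega>) (p, t) u w = cyl_pairing N V (u (cyl_chart c)) (w (cyl_chart c))"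
    if "u \<in> tangent_space (cyl A) (p, t)" "w \<in> tangent_space (cyl A) (p, t)"
    using *[OF cyl.pair_tuple[OF that]] by (simp add: form2_def)
qed

lemma local_cyl_form:
  assumes sm: "smooth_form A 1 \<eta>" "smooth_form A 2 \<Omega>" and c: "c \<in> A" and y: "y \<in> (snd c ` fst c) \<times> UNIV"
  shows "local_form (cyl A) (cyl_chart c) (cyl_form A \<eta> \<Omega>) y e
    = cyl_pairing (form1_field A c \<eta> (fst y)) (form2_field A c \<Omega> (fst y)) (e 0) (e 1)"
proof -
  obtain p t where p: "p \<in> fst c" "y = (snd c p, t)" using y by auto
  note al = smooth_form_alternating[OF sm(1) c p(1)] smooth_form_alternating[OF sm(2) c p(1)]
  note C = cyl_chart_in[OF c] cyl_chart_mem[OF p(1), where t = t]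
  note cf = cyl_form_coord[OF c p(1) al, where t = t]
  note ct = cyl.coord_vec_tangent[OF C]
  have y': "y = snd (cyl_chart c) (p, t)" by (simp add: p)
  show ?thesis
    unfolding y' cyl.local_form_2[OF C cf(1)] cf(2)[OF ct ct] cyl.coord_vec_apply[OF C] by simp
qed

lemma open_cyl_image: "c \<in> A \<Longrightarrow> open ((snd c ` fst c) \<times> (UNIV :: real set))"
  by (intro open_Times open_chart_image) auto

lemma cyl_image: "snd (cyl_chart c) ` fst (cyl_chart c) = (snd c ` fst c) \<times> UNIV"
  by (simp add: cyl_chart_image)

lemma smooth_on_lift_field:
  "c \<in> A \<Longrightarrow> smooth_on (snd c ` fst c) f \<Longrightarrow> smooth_on ((snd c ` fst c) \<times> (UNIV :: real set)) (\<lambda>y. f (fst y))"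
  by (rule smooth_on_compose[OF open_cyl_image open_chart_image])
    (auto intro!: smooth_on_fst smooth_on_id open_cyl_image)

lemma smooth_cyl_form:
  assumes sm: "smooth_form A 1 \<eta>" "smooth_form A 2 \<Omega>"
  shows "smooth_form (cyl A) 2 (cyl_form A \<eta> \<Omega>)"
proof -
  have "smooth_on (snd C ` fst C) (\<lambda>y. local_form (cyl A) C (cyl_form A \<eta> \<Omega>) y e)" if C: "C \<in> cyl A" for C e
  proof -
    obtain c where c: "c \<in> A" "C = cyl_chart c" using C unfolding cyl_eq by blast
    note o = open_cyl_image[OF c(1)]
    show ?thesis
      unfolding c(2) cyl_image
      by (rule smooth_on_eqI[OF o], rule local_cyl_form[OF sm c(1)], assumption, unfold cyl_pairing_def)
        (intro smooth_on_add smooth_on_diff smooth_on_mult smooth_on_inner smooth_on_const o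
          smooth_on_lift_field[OF c(1) smooth_form1_field[OF sm(1) c(1)]] smooth_on_lift_field[OF c(1) smooth_form2_field[OF sm(2) c(1)]])
  qed
  moreover have "alternating_at (cyl A) 2 (cyl_form A \<eta> \<Omega>) P" if P: "P \<in> pts (cyl A)" for P
  proof -
    obtain c p t where c: "c \<in> A" "p \<in> fst c" "P = (p, t)" using P cyl_ptsE by metis
    show ?thesis
      unfolding c(3) by (rule cyl_form_coord(1)[OF c(1,2) smooth_form_alternating[OF sm(1) c(1,2)] smooth_form_alternating[OF sm(2) c(1,2)]])
  qed
  ultimately show ?thesis by (simp add: smooth_form_def)
qed

text \<open>\<open>d (dt \<and> \<eta> + \<Omega>) = - dt \<and> d\<eta> + d\<Omega>\<close>. In
  coordinates the coefficients depend only on \<open>fst y\<close>; the \<open>dt\<close> terms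
  cancel by \<open>curl\<close> and the remaining ones by \<open>closed_form2_field\<close>.\<close>

lemma closed_cyl_form:
  assumes sm: "smooth_form A 1 \<eta>" "smooth_form A 2 \<Omega>" and cl: "closed_form A 1 \<eta>" "closed_form A 2 \<Omega>"
  shows "closed_form (cyl A) 2 (cyl_form A \<eta> \<Omega>)"
  unfolding closed_form_def
proof (intro ballI allI)
  fix C y e assume C: "C \<in> cyl A" and y: "y \<in> snd C ` fst C"
  obtain c where c: "c \<in> A" "C = cyl_chart c" using C unfolding cyl_eq by blast
  note y' = y[unfolded c(2) cyl_image]
  let ?N = "form1_field A c \<eta>" and ?V = "form2_field A c \<Omega>"
  have x: "fst y \<in> snd c ` fst c" using y' by auto
  have dN: "((\<lambda>y. ?N (fst y)) has_derivative (\<lambda>h. frechet_derivative ?N (at (fst y)) (fst h))) (at y)"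
    by (rule has_derivative_compose[OF has_derivative_fst[OF has_derivative_ident] smooth_on_has_derivative[OF smooth_form1_field[OF sm(1) c(1)] x]])
  have dV: "((\<lambda>y. ?V (fst y)) has_derivative (\<lambda>h. frechet_derivative ?V (at (fst y)) (fst h))) (at y)"
    by (rule has_derivative_compose[OF has_derivative_fst[OF has_derivative_ident] smooth_on_has_derivative[OF smooth_form2_field[OF sm(2) c(1)] x]])
  have D: "frechet_derivative (\<lambda>y. local_form (cyl A) C (cyl_form A \<eta> \<Omega>) y f) (at y)
      = (\<lambda>h. cyl_pairing (frechet_derivative ?N (at (fst y)) (fst h)) (frechet_derivative ?V (at (fst y)) (fst h)) (f 0) (f 1))" for f
  proof -
    have "frechet_derivative (\<lambda>y. local_form (cyl A) C (cyl_form A \<eta> \<Omega>) y f) (at y)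
      = frechet_derivative (\<lambda>y. cyl_pairing (?N (fst y)) (?V (fst y)) (f 0) (f 1)) (at y)"
      unfolding c(2) by (rule frechet_derivative_cong_open[OF open_cyl_image[OF c(1)] y']) (rule local_cyl_form[OF sm c(1)])
    also have "\<dots> = (\<lambda>h. cyl_pairing (frechet_derivative ?N (at (fst y)) (fst h)) (frechet_derivative ?V (at (fst y)) (fst h)) (f 0) (f 1))"
      unfolding cyl_pairing_def
      by (rule frechet_derivative_eqI)
        (intro has_derivative_add has_derivative_diff has_derivative_mult_right has_derivative_inner_left dN dV)
    finally show ?thesis .
  qed
  have s: "{..2::nat} = {0, 1, 2}" by auto
  have curl: "frechet_derivative ?N (at (fst y)) u \<bullet> v = frechet_derivative ?N (at (fst y)) v \<bullet> u" for u v
    by (rule closed_form1_field[OF sm(1) cl(1) c(1) x])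
  show "ext_deriv 2 (local_form (cyl A) C (cyl_form A \<eta> \<Omega>)) y e = 0"
    unfolding ext_deriv_def D s
    using closed_form2_field[OF sm(2) cl(2) c(1) x, of "fst (e 0)" "fst (e 1)" "fst (e 2)"]
      curl[of "fst (e 0)" "fst (e 1)"] curl[of "fst (e 0)" "fst (e 2)"] curl[of "fst (e 1)" "fst (e 2)"]
    by (simp add: cyl_pairing_def numeral_2_eq_2 algebra_simps)
qed

lemma wedge_cyl_forms:
  assumes c: "c \<in> A" "p \<in> fst c" and a: "alternating_at A 1 \<eta>1 p" "alternating_at A 2 \<Omega>1 p"
    "alternating_at A 1 \<eta>2 p" "alternating_at A 2 \<Omega>2 p" and v: "v \<in> tuples (cyl A) 4 (p, t)"
  shows "wedge 2 2 (cyl_form A \<eta>1 \<Omega>1) (cyl_form A \<eta>2 \<Omega>2) (p, t) v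
    = (form1_field A c \<eta>1 (snd c p) \<bullet> form2_field A c \<Omega>2 (snd c p) + form1_field A c \<eta>2 (snd c p) \<bullet> form2_field A c \<Omega>1 (snd c p))
      * det4 (v 0 (cyl_chart c)) (v 1 (cyl_chart c)) (v 2 (cyl_chart c)) (v 3 (cyl_chart c))"
proof -
  note c1 = cyl_form_coord[OF c a(1,2), where t = t] and c2 = cyl_form_coord[OF c a(3,4), where t = t]
  have t: "v 0 \<in> tangent_space (cyl A) (p, t)" "v 1 \<in> tangent_space (cyl A) (p, t)"
    "v 2 \<in> tangent_space (cyl A) (p, t)" "v 3 \<in> tangent_space (cyl A) (p, t)"
    by (rule cyl.tuplesD[OF v]; simp)+
  show ?thesis
    unfolding cyl.wedge_2_2[OF c1(1) c2(1) v] c1(2)[OF t(1,2)] c1(2)[OF t(1,3)] c1(2)[OF t(1,4)] c1(2)[OF t(2,3)] c1(2)[OF t(2,4)] c1(2)[OF t(3,4)]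
      c2(2)[OF t(1,2)] c2(2)[OF t(1,3)] c2(2)[OF t(1,4)] c2(2)[OF t(2,3)] c2(2)[OF t(2,4)] c2(2)[OF t(3,4)]
    by (rule cyl_pairing_wedge)
qed

lemma cyl_orientation_coord:
  assumes c: "c \<in> A" "p \<in> fst c" and a: "alternating_at A 1 \<eta> p" "alternating_at A 2 \<Omega> p"
    and v: "v \<in> tuples (cyl A) 4 (p, t)"
  shows "cyl_orientation A \<eta> \<Omega> (p, t) v = (form1_field A c \<eta> (snd c p) \<bullet> form2_field A c \<Omega> (snd c p))
      * det4 (v 0 (cyl_chart c)) (v 1 (cyl_chart c)) (v 2 (cyl_chart c)) (v 3 (cyl_chart c))"
proof -
  let ?C = "cyl_chart c"
  let ?N = "form1_field A c \<eta> (snd c p)" and ?V = "form2_field A c \<Omega> (snd c p)"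
  note dt = dt_coord[OF c, where t = t] and l1 = lift1_coord[OF c a(1), where t = t] and l2 = lift2_coord[OF c a(2), where t = t]
  define g where "g x y z = (?N \<bullet> ?V) * det_rows (fst (x ?C)) (fst (y ?C)) (fst (z ?C))" for x y z :: "('a \<times> real, (real^3) \<times> real) tvec"
  have b: "wedge 1 2 (lift A \<eta>) (lift A \<Omega>) (p, t) w = g (w 0) (w 1) (w 2)" if w: "w \<in> tuples (cyl A) 3 (p, t)" for w
  proof -
    have t: "w 0 \<in> tangent_space (cyl A) (p, t)" "w 1 \<in> tangent_space (cyl A) (p, t)" "w 2 \<in> tangent_space (cyl A) (p, t)"
      by (rule cyl.tuplesD[OF w]; simp)+
    show ?thesis
      unfolding cyl.wedge_1_2[OF l1(1) l2(1) w] l1(2)[OF t(1)] l1(2)[OF t(2)] l1(2)[OF t(3)] l2(2)[OF t(2,3)] l2(2)[OF t(1,3)] l2(2)[OF t(1,2)] g_def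
      by (simp add: inner_vec_def sum_3 cross_components algebra_simps)
  qed
  have g: "g y x z = - g x y z" "g x z y = - g x y z" for x y z
    unfolding g_def using cross_skew[of "fst (z ?C)" "fst (y ?C)"] cross_triple[of "fst (x ?C)" "fst (y ?C)" "fst (z ?C)"]
    by (simp_all add: inner_vec_def sum_3 cross_components algebra_simps)
  have t: "v 0 \<in> tangent_space (cyl A) (p, t)" "v 1 \<in> tangent_space (cyl A) (p, t)"
    "v 2 \<in> tangent_space (cyl A) (p, t)" "v 3 \<in> tangent_space (cyl A) (p, t)"
    by (rule cyl.tuplesD[OF v]; simp)+
  have w: "wedge 1 3 (dt A) (wedge 1 2 (lift A \<eta>) (lift A \<Omega>)) (p, t) v
    = form1 (dt A) (p, t) (v 0) * g (v 1) (v 2) (v 3) - form1 (dt A) (p, t) (v 1) * g (v 0) (v 2) (v 3)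
    + form1 (dt A) (p, t) (v 2) * g (v 0) (v 1) (v 3) - form1 (dt A) (p, t) (v 3) * g (v 0) (v 1) (v 2)"
  proof (rule cyl.wedge_1_3[OF dt(1) _ _ _ v])
    show "wedge 1 2 (lift A \<eta>) (lift A \<Omega>) (p, t) w = g (w 0) (w 1) (w 2)" if "w \<in> tuples (cyl A) 3 (p, t)" for w
      by (rule b[OF that])
  qed (rule g)+
  show ?thesis
    unfolding cyl_orientation_def w dt(2)[OF t(1)] dt(2)[OF t(2)] dt(2)[OF t(3)] dt(2)[OF t(4)]
    by (simp add: g_def det4_def algebra_simps)
qed

lemma nondegenerate_cyl_form:
  assumes sm: "smooth_form A 1 \<eta>" "smooth_form A 2 \<Omega>"
    and nz: "\<And>c p. c \<in> A \<Longrightarrow> p \<in> fst c \<Longrightarrow> form1_field A c \<eta> (snd c p) \<bullet> form2_field A c \<Omega> (snd c p) \<noteq> 0"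
  shows "nondegenerate (cyl A) (cyl_form A \<eta> \<Omega>)"
  unfolding nondegenerate_def
proof (intro ballI impI, rule ccontr)
  fix P u assume P: "P \<in> pts (cyl A)" and u: "u \<in> tangent_space (cyl A) P" and u0: "u \<noteq> tzero"
    and n: "\<not> (\<exists>w\<in>tangent_space (cyl A) P. cyl_form A \<eta> \<Omega> P (case_nat u (\<lambda>_. w)) \<noteq> 0)"
  obtain c p t where c: "c \<in> A" "p \<in> fst c" "P = (p, t)" using P cyl_ptsE by metis
  note C = cyl_chart_in[OF c(1)] cyl_chart_mem[OF c(2), where t = t]
  note cf = cyl_form_coord[OF c(1,2) smooth_form_alternating[OF sm(1) c(1,2)] smooth_form_alternating[OF sm(2) c(1,2)], where t = t]
  note u' = u[unfolded c(3)]
  have "cyl_pairing (form1_field A c \<eta> (snd c p)) (form2_field A c \<Omega> (snd c p)) (u (cyl_chart c)) b = 0" for b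
  proof -
    have w: "coord_vec (cyl A) (cyl_chart c) (p, t) b \<in> tangent_space (cyl A) (p, t)" by (rule cyl.coord_vec_tangent[OF C])
    have "form2 (cyl_form A \<eta> \<Omega>) (p, t) u (coord_vec (cyl A) (cyl_chart c) (p, t) b) = 0"
      using n w unfolding c(3) form2_def by blast
    then show ?thesis unfolding cf(2)[OF u' w] cyl.coord_vec_apply[OF C] .
  qed
  then have "u (cyl_chart c) = 0" by (rule cyl_pairing_nondegenerate) (rule nz[OF c(1,2)])
  then have "u = tzero"
    using cyl.coord_vec_coords[OF C u'] cyl.coord_vec_tcomb[OF C, of 0 0 0 0] by (simp add: tcomb_def tzero_def)
  then show False using u0 by simp
qed

section \<open>Tautness and conformal couples as the same pointwise condition\<close>

definition taut_fields where
  "taut_fields \<eta>1 \<Omega>1 \<eta>2 \<Omega>2 \<longleftrightarrow> (\<forall>c\<in>A. \<forall>p\<in>fst c.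
    form1_field A c \<eta>1 (snd c p) \<bullet> form2_field A c \<Omega>1 (snd c p) \<noteq> 0 \<and>
    form1_field A c \<eta>1 (snd c p) \<bullet> form2_field A c \<Omega>1 (snd c p) = form1_field A c \<eta>2 (snd c p) \<bullet> form2_field A c \<Omega>2 (snd c p) \<and>
    form1_field A c \<eta>1 (snd c p) \<bullet> form2_field A c \<Omega>2 (snd c p) = - (form1_field A c \<eta>2 (snd c p) \<bullet> form2_field A c \<Omega>1 (snd c p)))"

lemma cosymplectic_nonzero:
  assumes "cosymplectic A \<eta> \<Omega>" and c: "c \<in> A" "p \<in> fst c"
  shows "form1_field A c \<eta> (snd c p) \<bullet> form2_field A c \<Omega> (snd c p) \<noteq> 0"
proof -
  have sm: "smooth_form A 1 \<eta>" "smooth_form A 2 \<Omega>" and "nowhere_vanishing A 3 (wedge 1 2 \<eta> \<Omega>)"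
    using assms(1) by (simp_all add: cosymplectic_def volume_form_def)
  then obtain v where v: "v \<in> tuples A 3 p" "wedge 1 2 \<eta> \<Omega> p v \<noteq> 0"
    using in_pts[OF c] unfolding nowhere_vanishing_def by blast
  then show ?thesis
    unfolding wedge_1_2_coord[OF c smooth_form_alternating[OF sm(1) c] smooth_form_alternating[OF sm(2) c] v(1)] by auto
qed

definition basis_tuple where
  "basis_tuple c p = (\<lambda>i::nat. coord_vec A c p (if i = 0 then axis 1 1 else if i = 1 then axis 2 1 else axis 3 1))"

lemma basis_tuple:
  assumes "c \<in> A" "p \<in> fst c"
  shows "basis_tuple c p \<in> tuples A 3 p"
    "det_rows (basis_tuple c p 0 c) (basis_tuple c p 1 c) (basis_tuple c p 2 c) = 1"
  unfolding basis_tuple_def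
  by (rule coord_tuple[OF assms]) (simp add: assms cross_basis inner_axis_axis)

text \<open>The \<open>t\<close>-direction comes first, as \<open>dt\<close> does in
  \<open>cyl_orientation\<close>, so that \<open>det4\<close> of the tuple is 1.\<close>

definition cyl_basis_tuple where
  "cyl_basis_tuple c P = (\<lambda>i::nat. coord_vec (cyl A) (cyl_chart c) P
    (if i = 0 then (0, 1) else if i = 1 then (axis 1 1, 0) else if i = 2 then (axis 2 1, 0) else (axis 3 1, 0)))"

lemma cyl_basis_tuple:
  assumes "c \<in> A" "p \<in> fst c"
  shows "cyl_basis_tuple c (p, t) \<in> tuples (cyl A) 4 (p, t)"
    "det4 (cyl_basis_tuple c (p, t) 0 (cyl_chart c)) (cyl_basis_tuple c (p, t) 1 (cyl_chart c))
      (cyl_basis_tuple c (p, t) 2 (cyl_chart c)) (cyl_basis_tuple c (p, t) 3 (cyl_chart c)) = 1"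
proof -
  note C = cyl_chart_in[OF assms(1)] cyl_chart_mem[OF assms(2), where t = t]
  show "cyl_basis_tuple c (p, t) \<in> tuples (cyl A) 4 (p, t)"
    unfolding cyl_basis_tuple_def by (rule cyl.coord_tuple[OF C])
  show "det4 (cyl_basis_tuple c (p, t) 0 (cyl_chart c)) (cyl_basis_tuple c (p, t) 1 (cyl_chart c))
      (cyl_basis_tuple c (p, t) 2 (cyl_chart c)) (cyl_basis_tuple c (p, t) 3 (cyl_chart c)) = 1"
    unfolding cyl_basis_tuple_def cyl.coord_vec_apply[OF C] by (simp add: det4_def cross_basis inner_axis_axis)
qed

lemma taut_circle_imp_taut_fields:
  assumes cs: "cosymplectic A \<eta>1 \<Omega>1" "cosymplectic A \<eta>2 \<Omega>2" and taut: "taut_cosymplectic_circle A \<eta>1 \<Omega>1 \<eta>2 \<Omega>2"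
  shows "taut_fields \<eta>1 \<Omega>1 \<eta>2 \<Omega>2"
  unfolding taut_fields_def
proof (intro ballI)
  fix c p assume c: "c \<in> A" "p \<in> fst c"
  let ?n1 = "form1_field A c \<eta>1 (snd c p)" and ?n2 = "form1_field A c \<eta>2 (snd c p)"
  let ?V1 = "form2_field A c \<Omega>1 (snd c p)" and ?V2 = "form2_field A c \<Omega>2 (snd c p)"
  have sm: "smooth_form A 1 \<eta>1" "smooth_form A 2 \<Omega>1" "smooth_form A 1 \<eta>2" "smooth_form A 2 \<Omega>2"
    using cs by (simp_all add: cosymplectic_def)
  have K: "wedge 1 2 (lin_comb a \<eta>1 b \<eta>2) (lin_comb a \<Omega>1 b \<Omega>2) p (basis_tuple c p)
     = (a *\<^sub>R ?n1 + b *\<^sub>R ?n2) \<bullet> (a *\<^sub>R ?V1 + b *\<^sub>R ?V2)" for a b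
    using wedge_1_2_coord[OF c smooth_form_alternating[OF smooth_form_lin_comb[OF sm(1,3)] c]
        smooth_form_alternating[OF smooth_form_lin_comb[OF sm(2,4)] c] basis_tuple(1)[OF c], of a b a b]
    unfolding form_field_lin_comb basis_tuple(2)[OF c] by simp
  have "form_eq A 3 (wedge 1 2 (lin_comb a \<eta>1 b \<eta>2) (lin_comb a \<Omega>1 b \<Omega>2))
      (wedge 1 2 (lin_comb a' \<eta>1 b' \<eta>2) (lin_comb a' \<Omega>1 b' \<Omega>2))" if "a\<^sup>2 + b\<^sup>2 = 1" "a'\<^sup>2 + b'\<^sup>2 = 1" for a b a' b'
    using taut that unfolding taut_cosymplectic_circle_def by blast
  then have E: "(a *\<^sub>R ?n1 + b *\<^sub>R ?n2) \<bullet> (a *\<^sub>R ?V1 + b *\<^sub>R ?V2) = (a' *\<^sub>R ?n1 + b' *\<^sub>R ?n2) \<bullet> (a' *\<^sub>R ?V1 + b' *\<^sub>R ?V2)"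
    if "a\<^sup>2 + b\<^sup>2 = 1" "a'\<^sup>2 + b'\<^sup>2 = 1" for a b a' b'
    unfolding K[symmetric] using in_pts[OF c] basis_tuple(1)[OF c] that unfolding form_eq_def by blast
  have 1: "?n1 \<bullet> ?V1 = ?n2 \<bullet> ?V2" using E[of 1 0 0 1] by simp
  \<comment> \<open>A rational point of the circle with both coordinates nonzero. The points
    \<open>(1, 0)\<close> and \<open>(0, 1)\<close> see only the diagonal products; here the mixed
    ones enter with the nonzero factor \<open>12/25\<close>.\<close>
  have "((3/5) *\<^sub>R ?n1 + (4/5) *\<^sub>R ?n2) \<bullet> ((3/5) *\<^sub>R ?V1 + (4/5) *\<^sub>R ?V2) = ?n1 \<bullet> ?V1"
    using E[of "3/5" "4/5" 1 0] by (simp add: power2_eq_square)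
  then have "?n1 \<bullet> ?V2 = - (?n2 \<bullet> ?V1)"
    using 1 by (simp add: inner_add_left inner_add_right field_simps)
  with 1 cosymplectic_nonzero[OF cs(1) c] show "?n1 \<bullet> ?V1 \<noteq> 0 \<and> ?n1 \<bullet> ?V1 = ?n2 \<bullet> ?V2 \<and> ?n1 \<bullet> ?V2 = - (?n2 \<bullet> ?V1)" by simp
qed

lemma taut_fields_imp_taut_circle:
  assumes cs: "cosymplectic A \<eta>1 \<Omega>1" "cosymplectic A \<eta>2 \<Omega>2" and taut: "taut_fields \<eta>1 \<Omega>1 \<eta>2 \<Omega>2"
  shows "taut_cosymplectic_circle A \<eta>1 \<Omega>1 \<eta>2 \<Omega>2"
proof -
  have sm: "smooth_form A 1 \<eta>1" "smooth_form A 2 \<Omega>1" "smooth_form A 1 \<eta>2" "smooth_form A 2 \<Omega>2"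
    and cl: "closed_form A 1 \<eta>1" "closed_form A 2 \<Omega>1" "closed_form A 1 \<eta>2" "closed_form A 2 \<Omega>2"
    using cs by (simp_all add: cosymplectic_def)
  have K: "wedge 1 2 (lin_comb a \<eta>1 b \<eta>2) (lin_comb a \<Omega>1 b \<Omega>2) p v
     = (form1_field A c \<eta>1 (snd c p) \<bullet> form2_field A c \<Omega>1 (snd c p)) * det_rows (v 0 c) (v 1 c) (v 2 c)"
    if c: "c \<in> A" "p \<in> fst c" and v: "v \<in> tuples A 3 p" and ab: "a\<^sup>2 + b\<^sup>2 = 1" for c p v a b
  proof -
    let ?n1 = "form1_field A c \<eta>1 (snd c p)" and ?n2 = "form1_field A c \<eta>2 (snd c p)"
    let ?V1 = "form2_field A c \<Omega>1 (snd c p)" and ?V2 = "form2_field A c \<Omega>2 (snd c p)"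
    have t: "?n2 \<bullet> ?V2 = ?n1 \<bullet> ?V1" "?n1 \<bullet> ?V2 = - (?n2 \<bullet> ?V1)" using taut c by (simp_all add: taut_fields_def)
    \<comment> \<open>The mixed products cancel and the diagonal ones agree, so the point of the
      circle enters only through \<open>a\<^sup>2 + b\<^sup>2\<close>.\<close>
    have "(a *\<^sub>R ?n1 + b *\<^sub>R ?n2) \<bullet> (a *\<^sub>R ?V1 + b *\<^sub>R ?V2) = (a\<^sup>2 + b\<^sup>2) * (?n1 \<bullet> ?V1)"
      by (simp add: inner_add_left inner_add_right t algebra_simps power2_eq_square)
    then show ?thesis
      unfolding wedge_1_2_coord[OF c smooth_form_alternating[OF smooth_form_lin_comb[OF sm(1,3)] c]
        smooth_form_alternating[OF smooth_form_lin_comb[OF sm(2,4)] c] v] form_field_lin_comb ab by simp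
  qed
  have "cosymplectic A (lin_comb a \<eta>1 b \<eta>2) (lin_comb a \<Omega>1 b \<Omega>2)" if ab: "a\<^sup>2 + b\<^sup>2 = 1" for a b
  proof -
    have "\<exists>v\<in>tuples A 3 p. wedge 1 2 (lin_comb a \<eta>1 b \<eta>2) (lin_comb a \<Omega>1 b \<Omega>2) p v \<noteq> 0" if p: "p \<in> pts A" for p
    proof -
      obtain c where c: "c \<in> A" "p \<in> fst c" using p ptsE by metis
      have "wedge 1 2 (lin_comb a \<eta>1 b \<eta>2) (lin_comb a \<Omega>1 b \<Omega>2) p (basis_tuple c p) \<noteq> 0"
        unfolding K[OF c basis_tuple(1)[OF c] ab] basis_tuple(2)[OF c] using cosymplectic_nonzero[OF cs(1) c] by simp
      then show ?thesis using basis_tuple(1)[OF c] by blast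
    qed
    then show ?thesis
      unfolding cosymplectic_def volume_form_def nowhere_vanishing_def
      using smooth_form_lin_comb[OF sm(1,3)] smooth_form_lin_comb[OF sm(2,4)]
        closed_form_lin_comb[OF sm(1,3) cl(1,3)] closed_form_lin_comb[OF sm(2,4) cl(2,4)]
        smooth_form_wedge_1_2[OF smooth_form_lin_comb[OF sm(1,3)] smooth_form_lin_comb[OF sm(2,4)]]
      by simp
  qed
  moreover have "form_eq A 3 (wedge 1 2 (lin_comb a \<eta>1 b \<eta>2) (lin_comb a \<Omega>1 b \<Omega>2))
      (wedge 1 2 (lin_comb a' \<eta>1 b' \<eta>2) (lin_comb a' \<Omega>1 b' \<Omega>2))" if ab: "a\<^sup>2 + b\<^sup>2 = 1" "a'\<^sup>2 + b'\<^sup>2 = 1" for a b a' b'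
    unfolding form_eq_def
  proof (intro ballI)
    fix p v assume p: "p \<in> pts A" and v: "v \<in> tuples A 3 p"
    obtain c where c: "c \<in> A" "p \<in> fst c" using p ptsE by metis
    show "wedge 1 2 (lin_comb a \<eta>1 b \<eta>2) (lin_comb a \<Omega>1 b \<Omega>2) p v = wedge 1 2 (lin_comb a' \<eta>1 b' \<eta>2) (lin_comb a' \<Omega>1 b' \<Omega>2) p v"
      unfolding K[OF c v ab(1)] K[OF c v ab(2)] ..
  qed
  ultimately show ?thesis unfolding taut_cosymplectic_circle_def cosymplectic_circle_def by simp
qed

lemma taut_fields_imp_couple:
  assumes cs: "cosymplectic A \<eta>1 \<Omega>1" "cosymplectic A \<eta>2 \<Omega>2" and taut: "taut_fields \<eta>1 \<Omega>1 \<eta>2 \<Omega>2"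
  shows "conformal_symplectic_couple (cyl A) (cyl_orientation A \<eta>1 \<Omega>1) (cyl_form A \<eta>1 \<Omega>1) (cyl_form A \<eta>2 \<Omega>2)"
proof -
  let ?w1 = "cyl_form A \<eta>1 \<Omega>1" and ?w2 = "cyl_form A \<eta>2 \<Omega>2" and ?\<mu> = "cyl_orientation A \<eta>1 \<Omega>1"
  have sm: "smooth_form A 1 \<eta>1" "smooth_form A 2 \<Omega>1" "smooth_form A 1 \<eta>2" "smooth_form A 2 \<Omega>2"
    and cl: "closed_form A 1 \<eta>1" "closed_form A 2 \<Omega>1" "closed_form A 1 \<eta>2" "closed_form A 2 \<Omega>2"
    using cs by (simp_all add: cosymplectic_def)
  note sw = smooth_cyl_form[OF sm(1,2)] smooth_cyl_form[OF sm(3,4)]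
  have al: "alternating_at A 1 \<eta>1 p" "alternating_at A 2 \<Omega>1 p" "alternating_at A 1 \<eta>2 p" "alternating_at A 2 \<Omega>2 p"
    if "c \<in> A" "p \<in> fst c" for c p
    by (rule smooth_form_alternating[OF sm(1) that], rule smooth_form_alternating[OF sm(2) that],
        rule smooth_form_alternating[OF sm(3) that], rule smooth_form_alternating[OF sm(4) that])
  \<comment> \<open>Everything about the couple follows from these values. The factor in
    \<open>2 * ?\<mu>\<close> arises because both mixed terms of \<open>cyl_pairing_wedge\<close>
    coincide for a square; being positive, it settles the orientation.\<close>
  have W: "wedge 2 2 ?w1 ?w2 P v = 0" "wedge 2 2 ?w2 ?w2 P v = wedge 2 2 ?w1 ?w1 P v" "wedge 2 2 ?w1 ?w1 P v = 2 * ?\<mu> P v"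
    if P: "P \<in> pts (cyl A)" and v: "v \<in> tuples (cyl A) 4 P" for P v
  proof -
    obtain c p t where c: "c \<in> A" "p \<in> fst c" "P = (p, t)" using P cyl_ptsE by metis
    note a = al[OF c(1,2)]
    note v' = v[unfolded c(3)]
    have tt: "form1_field A c \<eta>2 (snd c p) \<bullet> form2_field A c \<Omega>2 (snd c p) = form1_field A c \<eta>1 (snd c p) \<bullet> form2_field A c \<Omega>1 (snd c p)"
      "form1_field A c \<eta>1 (snd c p) \<bullet> form2_field A c \<Omega>2 (snd c p) = - (form1_field A c \<eta>2 (snd c p) \<bullet> form2_field A c \<Omega>1 (snd c p))"
      using taut c by (simp_all add: taut_fields_def)
    show "wedge 2 2 ?w1 ?w2 P v = 0" "wedge 2 2 ?w2 ?w2 P v = wedge 2 2 ?w1 ?w1 P v" "wedge 2 2 ?w1 ?w1 P v = 2 * ?\<mu> P v"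
      unfolding c(3) wedge_cyl_forms[OF c(1,2) a(1,2,3,4) v'] wedge_cyl_forms[OF c(1,2) a(3,4,3,4) v'] wedge_cyl_forms[OF c(1,2) a(1,2,1,2) v']
        cyl_orientation_coord[OF c(1,2) a(1,2) v'] by (simp_all add: tt)
  qed
  have nv: "\<exists>v\<in>tuples (cyl A) 4 P. ?\<mu> P v \<noteq> 0" if P: "P \<in> pts (cyl A)" for P
  proof -
    obtain c p t where c: "c \<in> A" "p \<in> fst c" "P = (p, t)" using P cyl_ptsE by metis
    note b = cyl_basis_tuple[OF c(1,2), where t = t]
    have "?\<mu> P (cyl_basis_tuple c (p, t)) \<noteq> 0"
      unfolding c(3) cyl_orientation_coord[OF c(1,2) al(1,2)[OF c(1,2)] b(1)] b(2) using cosymplectic_nonzero[OF cs(1) c(1,2)] by simp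
    then show ?thesis using b(1) unfolding c(3) by blast
  qed
  have vol: "volume_form (cyl A) (wedge 2 2 ?w1 ?w1)" "volume_form (cyl A) (wedge 2 2 ?w2 ?w2)"
    using nv W cyl.smooth_form_wedge_2_2[OF sw(1,1)] cyl.smooth_form_wedge_2_2[OF sw(2,2)]
    by (auto simp: volume_form_def nowhere_vanishing_def)
  have pos: "positive_wrt (cyl A) ?\<mu> (wedge 2 2 ?w1 ?w1)" "positive_wrt (cyl A) ?\<mu> (wedge 2 2 ?w2 ?w2)"
    using W by (auto simp: positive_wrt_def)
  have nd: "nondegenerate (cyl A) ?w1" "nondegenerate (cyl A) ?w2"
    by (rule nondegenerate_cyl_form[OF sm(1,2) cosymplectic_nonzero[OF cs(1)]], assumption+,
        rule nondegenerate_cyl_form[OF sm(3,4) cosymplectic_nonzero[OF cs(2)]], assumption+)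
  show ?thesis
    unfolding conformal_symplectic_couple_def conformal_couple_def couple_def symplectic_def
    using sw nd vol pos closed_cyl_form[OF sm(1,2) cl(1,2)] closed_cyl_form[OF sm(3,4) cl(3,4)] W
    by (simp add: form_eq_def)
qed

lemma couple_imp_taut_fields:
  assumes cs: "cosymplectic A \<eta>1 \<Omega>1" "cosymplectic A \<eta>2 \<Omega>2"
    and cc: "conformal_couple (cyl A) \<mu> (cyl_form A \<eta>1 \<Omega>1) (cyl_form A \<eta>2 \<Omega>2)"
  shows "taut_fields \<eta>1 \<Omega>1 \<eta>2 \<Omega>2"
  unfolding taut_fields_def
proof (intro ballI)
  fix c p assume c: "c \<in> A" "p \<in> fst c"
  have sm: "smooth_form A 1 \<eta>1" "smooth_form A 2 \<Omega>1" "smooth_form A 1 \<eta>2" "smooth_form A 2 \<Omega>2"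
    using cs by (simp_all add: cosymplectic_def)
  have a: "alternating_at A 1 \<eta>1 p" "alternating_at A 2 \<Omega>1 p" "alternating_at A 1 \<eta>2 p" "alternating_at A 2 \<Omega>2 p"
    by (rule smooth_form_alternating[OF sm(1) c], rule smooth_form_alternating[OF sm(2) c],
        rule smooth_form_alternating[OF sm(3) c], rule smooth_form_alternating[OF sm(4) c])
  \<comment> \<open>The coefficients of both forms are constant in \<open>t\<close>, so one slice of
    the cylinder shows the condition on \<open>M\<close>.\<close>
  note b = cyl_basis_tuple[OF c, where t = 0]
  have P: "(p, 0) \<in> pts (cyl A)" by (rule cyl.in_pts[OF cyl_chart_in[OF c(1)] cyl_chart_mem[OF c(2)]])
  let ?w1 = "cyl_form A \<eta>1 \<Omega>1" and ?w2 = "cyl_form A \<eta>2 \<Omega>2"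
  have "wedge 2 2 ?w1 ?w2 (p, 0) (cyl_basis_tuple c (p, 0)) = 0"
    "wedge 2 2 ?w1 ?w1 (p, 0) (cyl_basis_tuple c (p, 0)) = wedge 2 2 ?w2 ?w2 (p, 0) (cyl_basis_tuple c (p, 0))"
    using cc P b(1) unfolding conformal_couple_def couple_def form_eq_def by blast+
  then show "form1_field A c \<eta>1 (snd c p) \<bullet> form2_field A c \<Omega>1 (snd c p) \<noteq> 0 \<and>
    form1_field A c \<eta>1 (snd c p) \<bullet> form2_field A c \<Omega>1 (snd c p) = form1_field A c \<eta>2 (snd c p) \<bullet> form2_field A c \<Omega>2 (snd c p) \<and>
    form1_field A c \<eta>1 (snd c p) \<bullet> form2_field A c \<Omega>2 (snd c p) = - (form1_field A c \<eta>2 (snd c p) \<bullet> form2_field A c \<Omega>1 (snd c p))"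
    unfolding wedge_cyl_forms[OF c a(1,2,3,4) b(1)] wedge_cyl_forms[OF c a(3,4,3,4) b(1)] wedge_cyl_forms[OF c a(1,2,1,2) b(1)] b(2)
    using cosymplectic_nonzero[OF cs(1) c] by simp
qed

end

section \<open>The complex structure\<close>

subsection \<open>Linear algebra at a point\<close>

locale taut_point =
  fixes n1 n2 V1 V2 :: "real^3"
  assumes nz: "n1 \<bullet> V1 \<noteq> 0" and eq: "n1 \<bullet> V1 = n2 \<bullet> V2" and anti: "n1 \<bullet> V2 = - (n2 \<bullet> V1)"
begin

abbreviation "P1 \<equiv> cyl_pairing n1 V1"
abbreviation "P2 \<equiv> cyl_pairing n2 V2"

text \<open>The solution \<open>x = J a\<close> of \<open>P1 a b = P2 x b\<close> for all \<open>b\<close>.\<close>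

definition J :: "(real^3) \<times> real \<Rightarrow> (real^3) \<times> real"
  where "J a = ((1 / (n2 \<bullet> V2)) *\<^sub>R ((n1 \<bullet> fst a) *\<^sub>R V2 - cross3 n2 (snd a *\<^sub>R n1 + cross3 V1 (fst a))),
    (1 / (n2 \<bullet> V2)) * (snd a * (n1 \<bullet> V2) + V2 \<bullet> cross3 V1 (fst a)))"

definition W :: "(real^3) \<times> real \<Rightarrow> (real^3) \<times> real \<Rightarrow> complex"
  where "W a b = Complex (P1 a b) (P2 a b)"

lemma pairing_alt: "cyl_pairing n V a b = (snd a *\<^sub>R n + cross3 V (fst a)) \<bullet> fst b - snd b * (n \<bullet> fst a)"
proof -
  have "cross3 V (fst a) \<bullet> fst b = V \<bullet> cross3 (fst a) (fst b)"
    by (simp add: inner_vec_def sum_3 cross_components algebra_simps)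
  then show ?thesis by (simp add: cyl_pairing_def inner_add_left)
qed

lemma nz2: "n2 \<bullet> V2 \<noteq> 0"
  using nz eq by simp

text \<open>By \<open>pairing_alt\<close> the covector \<open>cyl_pairing n V a\<close> has spatial
  part \<open>snd a *\<^sub>R n + cross3 V (fst a)\<close> and \<open>t\<close>-part
  \<open>- (n \<bullet> fst a)\<close>. The two equations match these parts for
  \<open>P2 (J a)\<close> and \<open>P1 a\<close>.\<close>

lemma J_covector2:
  "n2 \<bullet> fst (J a) = n1 \<bullet> fst a"
  "snd (J a) *\<^sub>R n2 + cross3 V2 (fst (J a)) = snd a *\<^sub>R n1 + cross3 V1 (fst a)"
proof -
  let ?x = "snd a *\<^sub>R n1 + cross3 V1 (fst a)"
  show "n2 \<bullet> fst (J a) = n1 \<bullet> fst a"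
    using nz2 by (simp add: J_def inner_diff_right dot_cross_self)
  have "cross3 V2 (fst (J a)) = (1 / (n2 \<bullet> V2)) *\<^sub>R (- cross3 V2 (cross3 n2 ?x))"
    by (simp add: J_def cross_mult_right Cross3.right_diff_distrib)
  also have "\<dots> = (1 / (n2 \<bullet> V2)) *\<^sub>R ((n2 \<bullet> V2) *\<^sub>R ?x - (V2 \<bullet> ?x) *\<^sub>R n2)"
    unfolding Lagrange[of V2 n2 ?x] by (simp add: inner_commute)
  also have "\<dots> = ?x - ((1 / (n2 \<bullet> V2)) * (V2 \<bullet> ?x)) *\<^sub>R n2"
    using nz2 by (simp add: scaleR_diff_right)
  also have "(1 / (n2 \<bullet> V2)) * (V2 \<bullet> ?x) = snd (J a)"
    by (simp add: J_def inner_add_right inner_commute)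
  finally show "snd (J a) *\<^sub>R n2 + cross3 V2 (fst (J a)) = ?x" by simp
qed

text \<open>Matches the parts of \<open>P1 (J a)\<close> with those of \<open>- P2 a\<close>. This
  is where the two tautness equations are used; together with \<open>J_covector2\<close> it makes
  \<open>J\<close> a square root of minus the identity.\<close>

lemma J_covector1:
  "n1 \<bullet> fst (J a) = - (n2 \<bullet> fst a)"
  "snd (J a) *\<^sub>R n1 + cross3 V1 (fst (J a)) = - (snd a *\<^sub>R n2 + cross3 V2 (fst a))"
proof -
  let ?u = "fst a" and ?s = "snd a" and ?k = "1 / (n2 \<bullet> V2)"
  let ?x = "?s *\<^sub>R n1 + cross3 V1 ?u"
  have e: "n1 \<bullet> cross3 n2 ?x = (n2 \<bullet> ?u) * (n1 \<bullet> V1) - (n2 \<bullet> V1) * (n1 \<bullet> ?u)"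
    by (simp add: inner_vec_def sum_3 cross_components algebra_simps)
  have "n1 \<bullet> fst (J a) = ?k * ((n1 \<bullet> ?u) * (n1 \<bullet> V2) - n1 \<bullet> cross3 n2 ?x)"
    by (simp add: J_def inner_diff_right)
  also have "\<dots> = ?k * (- (n2 \<bullet> V2) * (n2 \<bullet> ?u))"
    unfolding e anti eq by (simp add: algebra_simps)
  finally show "n1 \<bullet> fst (J a) = - (n2 \<bullet> ?u)" using nz2 by simp
  \<comment> \<open>The expansion of \<open>n1\<close> along the three cross products of
    \<open>V1\<close>, \<open>V2\<close> and \<open>?u\<close>, cleared of the denominator
    \<open>V2 \<bullet> cross3 V1 ?u\<close>.\<close>
  have I: "(V2 \<bullet> cross3 V1 ?u) *\<^sub>R n1 + (n1 \<bullet> ?u) *\<^sub>R cross3 V1 V2 - (n1 \<bullet> V2) *\<^sub>R cross3 V1 ?u = - (n1 \<bullet> V1) *\<^sub>R cross3 V2 ?u"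
    by (simp add: vec_eq_iff forall_3 inner_vec_def sum_3 cross_components algebra_simps)
  have x: "V1 \<bullet> ?x = ?s * (n2 \<bullet> V2)"
    using eq by (simp add: inner_add_right dot_cross_self inner_commute)
  have "cross3 V1 (fst (J a)) = ?k *\<^sub>R ((n1 \<bullet> ?u) *\<^sub>R cross3 V1 V2 - cross3 V1 (cross3 n2 ?x))"
    by (simp add: J_def cross_mult_right Cross3.right_diff_distrib)
  also have "cross3 V1 (cross3 n2 ?x) = (?s * (n2 \<bullet> V2)) *\<^sub>R n2 + (n1 \<bullet> V2) *\<^sub>R ?x"
    unfolding Lagrange[of V1 n2 ?x] x using anti by (simp add: inner_commute)
  finally have "snd (J a) *\<^sub>R n1 + cross3 V1 (fst (J a))
     = ?k *\<^sub>R ((?s * (n1 \<bullet> V2) + V2 \<bullet> cross3 V1 ?u) *\<^sub>R n1)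
       + ?k *\<^sub>R ((n1 \<bullet> ?u) *\<^sub>R cross3 V1 V2 - ((?s * (n2 \<bullet> V2)) *\<^sub>R n2 + (n1 \<bullet> V2) *\<^sub>R ?x))"
    by (simp add: J_def)
  also have "\<dots> = ?k *\<^sub>R (((V2 \<bullet> cross3 V1 ?u) *\<^sub>R n1 + (n1 \<bullet> ?u) *\<^sub>R cross3 V1 V2 - (n1 \<bullet> V2) *\<^sub>R cross3 V1 ?u) - (?s * (n2 \<bullet> V2)) *\<^sub>R n2)"
    unfolding scaleR_add_right[symmetric] by (rule arg_cong[where f = "scaleR ?k"]) (simp add: algebra_simps)
  also have "\<dots> = ?k *\<^sub>R ((n2 \<bullet> V2) *\<^sub>R (- (?s *\<^sub>R n2 + cross3 V2 ?u)))"
    unfolding I eq by (rule arg_cong[where f = "scaleR ?k"]) (simp add: algebra_simps)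
  finally show "snd (J a) *\<^sub>R n1 + cross3 V1 (fst (J a)) = - (?s *\<^sub>R n2 + cross3 V2 ?u)" using nz2 by simp
qed

lemma P2_J: "P2 (J a) b = P1 a b"
  unfolding pairing_alt[of n2] pairing_alt[of n1] J_covector2 ..

lemma P1_J: "P1 (J a) b = - P2 a b"
  unfolding pairing_alt[of n1] pairing_alt[of n2] J_covector1 by (simp add: inner_add_left inner_diff_left)

lemma W_J: "W (J a) b = \<i> * W a b"
  by (simp add: W_def P1_J P2_J complex_eq_iff)

lemma pairing_comb: "cyl_pairing n V (r *\<^sub>R a + s *\<^sub>R b) d = r * cyl_pairing n V a d + s * cyl_pairing n V b d"
  by (simp add: cyl_pairing_def inner_add_right cross_add_left cross_mult_left algebra_simps)

lemma pairing_eqI: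
  assumes "\<And>d. P2 a d = P2 b d"
  shows "a = b"
proof -
  have "P2 (1 *\<^sub>R a + (-1) *\<^sub>R b) d = 0" for d
    unfolding pairing_comb using assms by simp
  then have "1 *\<^sub>R a + (-1) *\<^sub>R b = 0" by (rule cyl_pairing_nondegenerate) (rule nz2)
  then show ?thesis by simp
qed

lemma J_J: "J (J a) = - a"
proof (rule pairing_eqI)
  fix d
  have "P2 (- a) d = - P2 a d" using pairing_comb[of n2 V2 "-1" a 0 a d] by simp
  then show "P2 (J (J a)) d = P2 (- a) d" by (simp add: P2_J P1_J)
qed

lemma J_comb: "J (r *\<^sub>R a + s *\<^sub>R b) = r *\<^sub>R J a + s *\<^sub>R J b"
  by (rule pairing_eqI) (simp only: P2_J pairing_comb)

text \<open>\<open>r * P1 + s * P2\<close> is \<open>P2\<close> applied to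
  \<open>(r J + s) a\<close>. As \<open>J\<close> squares to minus the identity,
  \<open>r J + s\<close> acts like a nonzero complex number and is invertible.\<close>

lemma rotation_nondegenerate:
  assumes "\<And>d. r * P1 a d + s * P2 a d = 0" "r\<^sup>2 + s\<^sup>2 \<noteq> 0"
  shows "a = 0"
proof -
  have "P2 (r *\<^sub>R J a + s *\<^sub>R a) d = P2 0 d" for d
    unfolding pairing_comb P2_J assms(1) by (simp add: cyl_pairing_def)
  then have 1: "r *\<^sub>R J a + s *\<^sub>R a = 0" by (rule pairing_eqI)
  have "J (r *\<^sub>R J a + s *\<^sub>R a) = - (r *\<^sub>R a) + s *\<^sub>R J a"
    unfolding J_comb J_J by simp
  moreover have "J 0 = 0" using J_comb[of 0 0 0 0] by simp
  ultimately have 2: "- (r *\<^sub>R a) + s *\<^sub>R J a = 0" using 1 by simp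
  have "(r\<^sup>2 + s\<^sup>2) *\<^sub>R a = s *\<^sub>R (r *\<^sub>R J a + s *\<^sub>R a) - r *\<^sub>R (- (r *\<^sub>R a) + s *\<^sub>R J a)"
    by (simp add: algebra_simps power2_eq_square)
  then have "(r\<^sup>2 + s\<^sup>2) *\<^sub>R a = 0" unfolding 1 2 by simp
  with assms(2) show ?thesis by (simp only: scaleR_eq_0_iff simp_thms)
qed

text \<open>\<open>T\<close> is the direction of \<open>t\<close>, and \<open>S\<close> spans the
  kernel of the 2-form with vector \<open>V1\<close> in three-space. They are chosen so that the
  real part of \<open>W T S\<close> is \<open>n1 \<bullet> V1\<close>.\<close>

definition T :: "(real^3) \<times> real" where "T = (0, 1)"
definition S :: "(real^3) \<times> real" where "S = (V1, 0)"

lemma W_T_S: "W T S \<noteq> 0"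
  using nz by (simp add: W_def T_def S_def cyl_pairing_def complex_eq_iff)

text \<open>This is half of \<open>W \<and> W\<close>. Its real part vanishes because
  \<open>P1\<close> and \<open>P2\<close> have equal squares, its imaginary part because their
  product is 0.\<close>

lemma pluecker: "W a b * W c d - W a c * W b d + W a d * W b c = 0"
proof -
  note w = cyl_pairing_wedge[of n1 V1 a b n1 V1 c d] cyl_pairing_wedge[of n2 V2 a b n2 V2 c d]
    cyl_pairing_wedge[of n1 V1 a b n2 V2 c d]
  show ?thesis using w eq anti by (simp add: W_def complex_eq_iff algebra_simps)
qed

text \<open>\<open>W\<close> spans the alternating 2-forms that are complex bilinear for \<open>J\<close>, because \<open>T\<close> and \<open>S\<close>
  form a complex basis.\<close>

lemma complex_bilinear_multiple:
  fixes A :: "(real^3) \<times> real \<Rightarrow> (real^3) \<times> real \<Rightarrow> complex"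
  assumes lin: "\<And>b. linear (\<lambda>a. A a b)" and alt: "\<And>a. A a a = 0" "\<And>a b. A a b = - A b a"
    and AJ: "\<And>a b. A (J a) b = \<i> * A a b"
  shows "A a b = A T S / W T S * W a b"
proof -
  \<comment> \<open>\<open>m\<close> is multiplication by complex numbers for the complex structure
    \<open>J\<close>; \<open>x\<close> and \<open>y\<close> will be the complex coordinates with
    respect to \<open>T\<close> and \<open>S\<close>.\<close>
  define m where "m z a = Re z *\<^sub>R a + Im z *\<^sub>R J a" for z a
  define x where "x a = W a S / W T S" for a
  define y where "y a = W T a / W T S" for a
  have Wm: "W (m z a) b = z * W a b" for z a b
  proof -
    have "W (m z a) b = of_real (Re z) * W a b + of_real (Im z) * W (J a) b"
      by (simp add: W_def m_def pairing_comb complex_eq_iff)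
    then show ?thesis unfolding W_J by (simp add: complex_eq_iff)
  qed
  have Wa: "W (a + a') b = W a b + W a' b" for a a' b
    using pairing_comb[of n1 V1 1 a 1 a' b] pairing_comb[of n2 V2 1 a 1 a' b] by (simp add: W_def complex_eq_iff)
  have Am: "A (m z a) b = z * A a b" for z a b
  proof -
    have "A (m z a) b = Re z *\<^sub>R A a b + Im z *\<^sub>R A (J a) b"
      unfolding m_def using linear_add[OF lin] linear_scale[OF lin] by simp
    then show ?thesis unfolding AJ by (simp add: complex_eq_iff)
  qed
  \<comment> \<open>Both sides have the same pairing under \<open>W\<close> with every
    \<open>d\<close>, by the Pluecker relation for \<open>T\<close>, \<open>S\<close>,
    \<open>a\<close>, \<open>d\<close>; the imaginary part \<open>P2\<close> of \<open>W\<close> is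
    nondegenerate.\<close>
  have span: "a = m (x a) T + m (y a) S" for a
  proof (rule sym, rule pairing_eqI)
    fix d
    have "W (m (x a) T + m (y a) S) d = x a * W T d + y a * W S d"
      by (simp add: Wa Wm)
    also have "\<dots> = (W a S * W T d + W T a * W S d) / W T S"
      by (simp add: x_def y_def add_divide_distrib)
    also have "W a S * W T d + W T a * W S d = W T S * W a d"
    proof -
      have "W a S = - W S a" by (simp add: W_def cyl_pairing_def complex_eq_iff cross_skew[of "fst a"])
      moreover have "W T S * W a d - W T a * W S d + W T d * W S a = 0" by (rule pluecker)
      ultimately show ?thesis by (simp add: algebra_simps)
    qed
    finally have "W (m (x a) T + m (y a) S) d = W a d" using W_T_S by simp
    then show "P2 (m (x a) T + m (y a) S) d = P2 a d" by (simp add: W_def)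
  qed
  have Ab: "A a b = x a * A T b + y a * A S b" for a b
    by (subst span[of a]) (simp add: linear_add[OF lin] Am)
  have "A T b = - (x b * A T T + y b * A S T)" "A S b = - (x b * A T S + y b * A S S)"
    using alt(2)[of T b] alt(2)[of S b] Ab[of b T] Ab[of b S] by simp_all
  then have 1: "A a b = (x a * y b - y a * x b) * A T S"
    using Ab[of a b] alt(1) alt(2)[of S T] by (simp add: algebra_simps)
  have "W a b = x a * W T b + y a * W S b"
    by (subst span[of a]) (simp add: Wa Wm)
  moreover have "W S b = - x b * W T S" "W T b = y b * W T S"
    using W_T_S by (simp_all add: x_def y_def W_def cyl_pairing_def complex_eq_iff cross_skew[of "fst S"])
  ultimately have 2: "W a b = (x a * y b - y a * x b) * W T S" by (simp add: algebra_simps)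
  show ?thesis unfolding 1 2 using W_T_S by simp
qed

text \<open>Complex bilinearity of \<open>f \<and> g\<close> ties the deviations of \<open>f\<close>
  and \<open>g\<close> from complex linearity together. Testing on \<open>T\<close>, where
  \<open>f\<close> vanishes and \<open>g\<close> does not, removes the deviation of
  \<open>f\<close>; testing on \<open>S\<close> then removes that of \<open>g\<close>.\<close>

lemma holomorphic_covectors:
  assumes W: "\<And>a b. W a b = f a * g b - f b * g a" and T: "f T = 0" "g T \<noteq> 0" and S: "f S \<noteq> 0"
  shows "f (J a) = \<i> * f a" "g (J a) = \<i> * g a"
proof -
  have e: "(f (J a) - \<i> * f a) * g b = f b * (g (J a) - \<i> * g a)" for b
    using W_J[of a b] unfolding W by (simp add: algebra_simps)
  show 1: "f (J a) = \<i> * f a" using e[of T] T by simp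
  show "g (J a) = \<i> * g a" using e[of S] S 1 by simp
qed

end

text \<open>Two orthogonal rows of equal length and positive determinant form a rotation times a
  scalar. By Lagrange's identity the determinant equals \<open>a\<^sup>2 + b\<^sup>2\<close>, and
  then the squared distance of \<open>(c, d)\<close> from \<open>(- b, a)\<close> is 0.\<close>

lemma conformal_matrix:
  fixes a b c d :: real
  assumes "a * c + b * d = 0" "a\<^sup>2 + b\<^sup>2 = c\<^sup>2 + d\<^sup>2" "0 < a * d - b * c"
  shows "c = - b" "d = a"
proof -
  have "(a * d - b * c)\<^sup>2 = (a\<^sup>2 + b\<^sup>2)\<^sup>2 - (a * c + b * d)\<^sup>2"
    using assms(2) by (simp add: power2_eq_square) algebra
  then have "(a * d - b * c)\<^sup>2 = (a\<^sup>2 + b\<^sup>2)\<^sup>2" using assms(1) by simp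
  then have D: "a * d - b * c = a\<^sup>2 + b\<^sup>2" using assms(3) by (simp add: power2_eq_iff_nonneg)
  have "(d - a)\<^sup>2 + (c + b)\<^sup>2 = (c\<^sup>2 + d\<^sup>2) + (a\<^sup>2 + b\<^sup>2) - 2 * (a * d - b * c)"
    by (simp add: power2_eq_square algebra_simps)
  then have "(d - a)\<^sup>2 + (c + b)\<^sup>2 = 0" using D assms(2) by simp
  then show "c = - b" "d = a" by (simp_all add: sum_power2_eq_zero_iff)
qed

subsection \<open>Real and imaginary parts of complex forms\<close>

context smooth_atlas
begin

lemma smooth_complex_form:
  assumes "smooth_form A k \<alpha>" "smooth_form A k \<beta>"
  shows "smooth_form A k (complex_form \<alpha> \<beta>)"
  unfolding complex_form_def
  by (intro smooth_form_add smooth_form_bounded_linear[OF assms(1) bounded_linear_of_real]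
      smooth_form_bounded_linear[OF assms(2) bounded_linear_compose[OF bounded_linear_mult_right bounded_linear_of_real]])

lemma equivalent_couples_refl: "equivalent_couples A \<alpha> \<beta> \<alpha> \<beta>"
  unfolding equivalent_couples_def
proof
  fix p
  show "\<exists>a b c d. 0 < a * d - b * c \<and>
      (\<forall>v\<in>tuples A 2 p. \<alpha> p v = lin_comb a \<alpha> b \<beta> p v \<and> \<beta> p v = lin_comb c \<alpha> d \<beta> p v)"
    by (rule exI[of _ 1], rule exI[of _ 0], rule exI[of _ 0], rule exI[of _ 1]) (simp add: lin_comb_def)
qed

end

lemma has_derivative_vec:
  fixes F :: "'e::real_normed_vector \<Rightarrow> 'b::euclidean_space ^ 'n"
  assumes "\<And>i. ((\<lambda>x. F x $ i) has_derivative (\<lambda>v. F' v $ i)) (at x)"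
  shows "(F has_derivative F') (at x)"
  by (subst has_derivative_componentwise_within)
    (auto simp: Basis_vec_def inner_axis intro!: has_derivative_inner_left assms)

subsection \<open>The endomorphism intertwining the two forms\<close>

locale taut_pair = smooth_atlas3 X A for X :: "'a topology" and A :: "('a, real^3) chart set" +
  fixes \<eta>1 \<Omega>1 \<eta>2 \<Omega>2 :: "('a, real^3, real) form"
  assumes cs1: "cosymplectic A \<eta>1 \<Omega>1" and cs2: "cosymplectic A \<eta>2 \<Omega>2"
    and taut: "taut_fields \<eta>1 \<Omega>1 \<eta>2 \<Omega>2"
begin

abbreviation "\<omega>1 \<equiv> cyl_form A \<eta>1 \<Omega>1"
abbreviation "\<omega>2 \<equiv> cyl_form A \<eta>2 \<Omega>2"
abbreviation "\<mu> \<equiv> cyl_orientation A \<eta>1 \<Omega>1"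
abbreviation "N1 c \<equiv> form1_field A c \<eta>1"
abbreviation "N2 c \<equiv> form1_field A c \<eta>2"
abbreviation "V1 c \<equiv> form2_field A c \<Omega>1"
abbreviation "V2 c \<equiv> form2_field A c \<Omega>2"
abbreviation "Jc c x \<equiv> taut_point.J (N1 c x) (N2 c x) (V1 c x) (V2 c x)"

lemma smooth_forms: "smooth_form A 1 \<eta>1" "smooth_form A 2 \<Omega>1" "smooth_form A 1 \<eta>2" "smooth_form A 2 \<Omega>2"
  and closed_forms: "closed_form A 1 \<eta>1" "closed_form A 2 \<Omega>1" "closed_form A 1 \<eta>2" "closed_form A 2 \<Omega>2"
  using cs1 cs2 by (simp_all add: cosymplectic_def)

lemma taut_point: "c \<in> A \<Longrightarrow> p \<in> fst c \<Longrightarrow> taut_point (N1 c (snd c p)) (N2 c (snd c p)) (V1 c (snd c p)) (V2 c (snd c p))"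
  using taut[unfolded taut_fields_def, rule_format, of c p] by (intro taut_point.intro) auto

lemma alternating:
  assumes "c \<in> A" "p \<in> fst c"
  shows "alternating_at A 1 \<eta>1 p" "alternating_at A 2 \<Omega>1 p" "alternating_at A 1 \<eta>2 p" "alternating_at A 2 \<Omega>2 p"
  by (rule smooth_form_alternating[OF smooth_forms(1) assms], rule smooth_form_alternating[OF smooth_forms(2) assms],
      rule smooth_form_alternating[OF smooth_forms(3) assms], rule smooth_form_alternating[OF smooth_forms(4) assms])

lemma smooth_\<omega>: "smooth_form (cyl A) 2 \<omega>1" "smooth_form (cyl A) 2 \<omega>2"
  by (rule smooth_cyl_form[OF smooth_forms(1,2)], rule smooth_cyl_form[OF smooth_forms(3,4)])

lemma form2_\<omega>:
  assumes "c \<in> A" "p \<in> fst c" "u \<in> tangent_space (cyl A) (p, t)" "w \<in> tangent_space (cyl A) (p, t)"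
  shows "form2 \<omega>1 (p, t) u w = cyl_pairing (N1 c (snd c p)) (V1 c (snd c p)) (u (cyl_chart c)) (w (cyl_chart c))"
    "form2 \<omega>2 (p, t) u w = cyl_pairing (N2 c (snd c p)) (V2 c (snd c p)) (u (cyl_chart c)) (w (cyl_chart c))"
  by (rule cyl_form_coord(2)[OF assms(1,2) alternating(1,2)[OF assms(1,2)] assms(3,4)],
      rule cyl_form_coord(2)[OF assms(1,2) alternating(3,4)[OF assms(1,2)] assms(3,4)])

lemma form2_\<omega>_coord:
  assumes "c \<in> A" "p \<in> fst c" "u \<in> tangent_space (cyl A) (p, t)"
  shows "form2 \<omega>1 (p, t) u (coord_vec (cyl A) (cyl_chart c) (p, t) b) = cyl_pairing (N1 c (snd c p)) (V1 c (snd c p)) (u (cyl_chart c)) b"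
    "form2 \<omega>2 (p, t) u (coord_vec (cyl A) (cyl_chart c) (p, t) b) = cyl_pairing (N2 c (snd c p)) (V2 c (snd c p)) (u (cyl_chart c)) b"
proof -
  note C = cyl_chart_in[OF assms(1)] cyl_chart_mem[OF assms(2), of t]
  show "form2 \<omega>1 (p, t) u (coord_vec (cyl A) (cyl_chart c) (p, t) b) = cyl_pairing (N1 c (snd c p)) (V1 c (snd c p)) (u (cyl_chart c)) b"
    "form2 \<omega>2 (p, t) u (coord_vec (cyl A) (cyl_chart c) (p, t) b) = cyl_pairing (N2 c (snd c p)) (V2 c (snd c p)) (u (cyl_chart c)) b"
    unfolding form2_\<omega>[OF assms cyl.coord_vec_tangent[OF C]] cyl.coord_vec_apply[OF C] by simp_all
qed

text \<open>Defined by its intrinsic property, so that its value does not refer to a chart;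
  \<open>J_cyl_coord\<close> then shows that the formula of \<open>taut_point.J\<close> computes it
  in every chart.\<close>

definition J_cyl :: "('a \<times> real, (real^3) \<times> real) endo"
  where "J_cyl P u = (THE w. w \<in> tangent_space (cyl A) P \<and>
    (\<forall>x\<in>tangent_space (cyl A) P. form2 \<omega>2 P w x = form2 \<omega>1 P u x))"

lemma form2_\<omega>2_eqI:
  assumes "P \<in> pts (cyl A)" "w \<in> tangent_space (cyl A) P" "w' \<in> tangent_space (cyl A) P"
    and w_eq: "\<And>x. x \<in> tangent_space (cyl A) P \<Longrightarrow> form2 \<omega>2 P w x = form2 \<omega>2 P w' x"
  shows "w = w'"
proof -
  obtain c p t where c: "c \<in> A" "p \<in> fst c" "P = (p, t)" using assms(1) cyl_ptsE by metis
  note C = cyl_chart_in[OF c(1)] cyl_chart_mem[OF c(2), of t]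
  note w = assms(2,3)[unfolded c(3)]
  interpret taut_point "N1 c (snd c p)" "N2 c (snd c p)" "V1 c (snd c p)" "V2 c (snd c p)"
    by (rule taut_point[OF c(1,2)])
  have "w (cyl_chart c) = w' (cyl_chart c)"
  proof (rule pairing_eqI)
    fix d
    show "P2 (w (cyl_chart c)) d = P2 (w' (cyl_chart c)) d"
      using w_eq[of "coord_vec (cyl A) (cyl_chart c) (p, t) d"] cyl.coord_vec_tangent[OF C]
      unfolding c(3) form2_\<omega>_coord(2)[OF c(1,2) w(1)] form2_\<omega>_coord(2)[OF c(1,2) w(2)] by simp
  qed
  then show ?thesis by (rule cyl.tangent_eqI[OF C w])
qed

lemma J_cyl_coord:
  assumes c: "c \<in> A" "p \<in> fst c" and u: "u \<in> tangent_space (cyl A) (p, t)"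
  shows "J_cyl (p, t) u = coord_vec (cyl A) (cyl_chart c) (p, t) (Jc c (snd c p) (u (cyl_chart c)))"
  unfolding J_cyl_def
proof (rule the_equality)
  note C = cyl_chart_in[OF c(1)] cyl_chart_mem[OF c(2), of t]
  interpret taut_point "N1 c (snd c p)" "N2 c (snd c p)" "V1 c (snd c p)" "V2 c (snd c p)"
    by (rule taut_point[OF c(1,2)])
  let ?w = "coord_vec (cyl A) (cyl_chart c) (p, t) (J (u (cyl_chart c)))"
  have w: "?w \<in> tangent_space (cyl A) (p, t)" by (rule cyl.coord_vec_tangent[OF C])
  have e: "form2 \<omega>2 (p, t) ?w x = form2 \<omega>1 (p, t) u x" if "x \<in> tangent_space (cyl A) (p, t)" for x
    unfolding form2_\<omega>(2)[OF c w that] form2_\<omega>(1)[OF c u that] cyl.coord_vec_apply[OF C] by (rule P2_J)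
  show "?w \<in> tangent_space (cyl A) (p, t) \<and> (\<forall>x\<in>tangent_space (cyl A) (p, t). form2 \<omega>2 (p, t) ?w x = form2 \<omega>1 (p, t) u x)"
    using w e by blast
  fix w' assume w': "w' \<in> tangent_space (cyl A) (p, t) \<and> (\<forall>x\<in>tangent_space (cyl A) (p, t). form2 \<omega>2 (p, t) w' x = form2 \<omega>1 (p, t) u x)"
  show "w' = ?w"
    by (rule form2_\<omega>2_eqI[OF cyl.in_pts[OF C]]) (use w w' e in simp_all)
qed

lemma J_cyl:
  assumes c: "c \<in> A" "p \<in> fst c" and u: "u \<in> tangent_space (cyl A) (p, t)"
  shows "J_cyl (p, t) u \<in> tangent_space (cyl A) (p, t)" "J_cyl (p, t) u (cyl_chart c) = Jc c (snd c p) (u (cyl_chart c))"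
proof -
  note C = cyl_chart_in[OF c(1)] cyl_chart_mem[OF c(2), of t]
  show "J_cyl (p, t) u \<in> tangent_space (cyl A) (p, t)" "J_cyl (p, t) u (cyl_chart c) = Jc c (snd c p) (u (cyl_chart c))"
    unfolding J_cyl_coord[OF c u] by (rule cyl.coord_vec_tangent[OF C], rule cyl.coord_vec_apply[OF C])
qed

lemma J_cyl_tangent:
  assumes "P \<in> pts (cyl A)" "u \<in> tangent_space (cyl A) P"
  shows "J_cyl P u \<in> tangent_space (cyl A) P"
proof -
  obtain c p t where c: "c \<in> A" "p \<in> fst c" "P = (p, t)" using assms(1) cyl_ptsE by metis
  show ?thesis using J_cyl(1)[OF c(1,2)] assms(2) unfolding c(3) by blast
qed

lemma form2_J_cyl:
  assumes P: "P \<in> pts (cyl A)" and u: "u \<in> tangent_space (cyl A) P" and w: "w \<in> tangent_space (cyl A) P"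
  shows "form2 \<omega>2 P (J_cyl P u) w = form2 \<omega>1 P u w" "form2 \<omega>1 P (J_cyl P u) w = - form2 \<omega>2 P u w"
proof -
  obtain c p t where c: "c \<in> A" "p \<in> fst c" "P = (p, t)" using P cyl_ptsE by metis
  note u' = u[unfolded c(3)] and w' = w[unfolded c(3)]
  interpret taut_point "N1 c (snd c p)" "N2 c (snd c p)" "V1 c (snd c p)" "V2 c (snd c p)"
    by (rule taut_point[OF c(1,2)])
  show "form2 \<omega>2 P (J_cyl P u) w = form2 \<omega>1 P u w" "form2 \<omega>1 P (J_cyl P u) w = - form2 \<omega>2 P u w"
    unfolding c(3) form2_\<omega>[OF c(1,2) J_cyl(1)[OF c(1,2) u'] w'] form2_\<omega>[OF c(1,2) u' w'] J_cyl(2)[OF c(1,2) u']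
    by (rule P2_J, rule P1_J)
qed

lemma smooth_J_cyl:
  assumes c: "c \<in> A"
  shows "smooth_on ((snd c ` fst c) \<times> UNIV) (\<lambda>y. J_cyl (cinv (cyl_chart c) y) (coord_vec (cyl A) (cyl_chart c) (cinv (cyl_chart c) y) e) (cyl_chart c))"
proof -
  note o = open_cyl_image[OF c]
  note sN = smooth_on_lift_field[OF c smooth_form1_field[OF smooth_forms(1) c]] smooth_on_lift_field[OF c smooth_form1_field[OF smooth_forms(3) c]]
    smooth_on_lift_field[OF c smooth_form2_field[OF smooth_forms(2) c]] smooth_on_lift_field[OF c smooth_form2_field[OF smooth_forms(4) c]]
  have e: "J_cyl (cinv (cyl_chart c) y) (coord_vec (cyl A) (cyl_chart c) (cinv (cyl_chart c) y) e) (cyl_chart c)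
     = ((1 / (N2 c (fst y) \<bullet> V2 c (fst y))) *\<^sub>R ((N1 c (fst y) \<bullet> fst e) *\<^sub>R V2 c (fst y) - cross3 (N2 c (fst y)) (snd e *\<^sub>R N1 c (fst y) + cross3 (V1 c (fst y)) (fst e))),
    (1 / (N2 c (fst y) \<bullet> V2 c (fst y))) * (snd e * (N1 c (fst y) \<bullet> V2 c (fst y)) + V2 c (fst y) \<bullet> cross3 (V1 c (fst y)) (fst e)))"
    and nz: "N2 c (fst y) \<bullet> V2 c (fst y) \<noteq> 0"
    if y: "y \<in> (snd c ` fst c) \<times> UNIV" for y
  proof -
    obtain p t where p: "p \<in> fst c" "y = (snd c p, t)" using y by auto
    note C = cyl_chart_in[OF c] cyl_chart_mem[OF p(1), of t]
    have i: "cinv (cyl_chart c) y = (p, t)" using c p cinv_cyl_chart[OF c, of "snd c p" t] by simp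
    show "J_cyl (cinv (cyl_chart c) y) (coord_vec (cyl A) (cyl_chart c) (cinv (cyl_chart c) y) e) (cyl_chart c)
     = ((1 / (N2 c (fst y) \<bullet> V2 c (fst y))) *\<^sub>R ((N1 c (fst y) \<bullet> fst e) *\<^sub>R V2 c (fst y) - cross3 (N2 c (fst y)) (snd e *\<^sub>R N1 c (fst y) + cross3 (V1 c (fst y)) (fst e))),
    (1 / (N2 c (fst y) \<bullet> V2 c (fst y))) * (snd e * (N1 c (fst y) \<bullet> V2 c (fst y)) + V2 c (fst y) \<bullet> cross3 (V1 c (fst y)) (fst e)))"
      unfolding i J_cyl(2)[OF c p(1) cyl.coord_vec_tangent[OF C]] cyl.coord_vec_apply[OF C] taut_point.J_def[OF taut_point[OF c p(1)]]
      by (simp add: p)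
    show "N2 c (fst y) \<bullet> V2 c (fst y) \<noteq> 0"
      using taut_point.nz2[OF taut_point[OF c p(1)]] by (simp add: p)
  qed
  show ?thesis
    by (rule smooth_on_eqI[OF o e], assumption)
      (intro smooth_on_Pair smooth_on_scaleR smooth_on_mult smooth_on_divide smooth_on_add smooth_on_diff smooth_on_cross3 smooth_on_inner smooth_on_const sN o nz)
qed

lemma endomorphism_J_cyl: "endomorphism (cyl A) J_cyl"
  unfolding endomorphism_def
proof (intro conjI ballI allI)
  show "J_cyl P u \<in> tangent_space (cyl A) P" if "P \<in> pts (cyl A)" "u \<in> tangent_space (cyl A) P" for P u
    by (rule J_cyl_tangent[OF that])
  show "J_cyl P (tcomb a u b w) = tcomb a (J_cyl P u) b (J_cyl P w)"
    if P: "P \<in> pts (cyl A)" and u: "u \<in> tangent_space (cyl A) P" and w: "w \<in> tangent_space (cyl A) P" for P u w a b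
  proof -
    obtain c p t where c: "c \<in> A" "p \<in> fst c" "P = (p, t)" using P cyl_ptsE by metis
    note C = cyl_chart_in[OF c(1)] cyl_chart_mem[OF c(2), of t]
    note u' = u[unfolded c(3)] and w' = w[unfolded c(3)]
    note uw = cyl.tcomb_tangent[OF u' w', of a b]
    show ?thesis
      unfolding c(3)
    proof (rule cyl.tangent_eqI[OF C J_cyl(1)[OF c(1,2) uw] cyl.tcomb_tangent[OF J_cyl(1)[OF c(1,2) u'] J_cyl(1)[OF c(1,2) w']]])
      show "J_cyl (p, t) (tcomb a u b w) (cyl_chart c) = tcomb a (J_cyl (p, t) u) b (J_cyl (p, t) w) (cyl_chart c)"
        unfolding J_cyl(2)[OF c(1,2) uw] cyl_tcomb J_cyl(2)[OF c(1,2) u'] J_cyl(2)[OF c(1,2) w']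
        by (rule taut_point.J_comb[OF taut_point[OF c(1,2)]])
    qed
  qed
  fix C e assume "C \<in> cyl A"
  then obtain c where c: "c \<in> A" "C = cyl_chart c" unfolding cyl_eq by blast
  show "smooth_on (snd C ` fst C) (\<lambda>x. J_cyl (cinv C x) (coord_vec (cyl A) C (cinv C x) e) C)"
    unfolding c(2) cyl_image by (rule smooth_J_cyl[OF c(1)])
qed

lemma almost_complex_J_cyl: "almost_complex (cyl A) J_cyl"
  unfolding almost_complex_def
proof (intro conjI ballI allI endomorphism_J_cyl)
  fix P u d assume P: "P \<in> pts (cyl A)" and u: "u \<in> tangent_space (cyl A) P"
  obtain c p t where c: "c \<in> A" "p \<in> fst c" "P = (p, t)" using P cyl_ptsE by metis
  note C = cyl_chart_in[OF c(1)] cyl_chart_mem[OF c(2), of t]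
  note u' = u[unfolded c(3)]
  note Ju = J_cyl(1)[OF c(1,2) u']
  have "J_cyl (p, t) (J_cyl (p, t) u) = tcomb (- 1) u 0 u"
  proof (rule cyl.tangent_eqI[OF C J_cyl(1)[OF c(1,2) Ju] cyl.tcomb_tangent[OF u' u']])
    show "J_cyl (p, t) (J_cyl (p, t) u) (cyl_chart c) = tcomb (- 1) u 0 u (cyl_chart c)"
      unfolding J_cyl(2)[OF c(1,2) Ju] J_cyl(2)[OF c(1,2) u'] taut_point.J_J[OF taut_point[OF c(1,2)]] by (simp add: tcomb_def)
  qed
  then show "J_cyl P (J_cyl P u) d = - u d" unfolding c(3) by (simp add: tcomb_def)
qed

lemma intertwines_iff:
  assumes J': "\<And>P u. P \<in> pts (cyl A) \<Longrightarrow> u \<in> tangent_space (cyl A) P \<Longrightarrow> J' P u \<in> tangent_space (cyl A) P"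
  shows "intertwines (cyl A) \<omega>1 \<omega>2 J' \<longleftrightarrow> (\<forall>P\<in>pts (cyl A). \<forall>u\<in>tangent_space (cyl A) P. \<forall>w\<in>tangent_space (cyl A) P.
    form2 \<omega>1 P u w = form2 \<omega>2 P (J' P u) w)"
proof -
  \<comment> \<open>The 1-tuples in \<open>intertwines\<close> have arbitrary entries beyond the
    first one; alternating 2-forms ignore them.\<close>
  have e: "interior_prod u \<alpha> P v = form2 \<alpha> P u (v 0)"
    if "smooth_form (cyl A) 2 \<alpha>" "P \<in> pts (cyl A)" "u \<in> tangent_space (cyl A) P" "v \<in> tuples (cyl A) 1 P"
    for \<alpha> :: "('a \<times> real, (real^3) \<times> real, real) form" and P u v
  proof -
    have al: "alternating_at (cyl A) 2 \<alpha> P" using that by (simp add: smooth_form_def)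
    have "case_nat u v \<in> tuples (cyl A) 2 P" using that by (auto simp: tuples_def less_Suc_eq numeral_2_eq_2)
    from cyl.alternating_2(1)[OF al this] show ?thesis by (simp add: interior_prod_def)
  qed
  show ?thesis
  proof
    assume i: "intertwines (cyl A) \<omega>1 \<omega>2 J'"
    show "\<forall>P\<in>pts (cyl A). \<forall>u\<in>tangent_space (cyl A) P. \<forall>w\<in>tangent_space (cyl A) P. form2 \<omega>1 P u w = form2 \<omega>2 P (J' P u) w"
    proof (intro ballI)
      fix P u w assume h: "P \<in> pts (cyl A)" "u \<in> tangent_space (cyl A) P" "w \<in> tangent_space (cyl A) P"
      have t: "(\<lambda>_. w) \<in> tuples (cyl A) 1 P" using h by (simp add: tuples_def)
      have "interior_prod u \<omega>1 P (\<lambda>_. w) = interior_prod (J' P u) \<omega>2 P (\<lambda>_. w)"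
        using i h t unfolding intertwines_def by blast
      then show "form2 \<omega>1 P u w = form2 \<omega>2 P (J' P u) w"
        unfolding e[OF smooth_\<omega>(1) h(1,2) t] e[OF smooth_\<omega>(2) h(1) J'[OF h(1,2)] t] .
    qed
  next
    assume i: "\<forall>P\<in>pts (cyl A). \<forall>u\<in>tangent_space (cyl A) P. \<forall>w\<in>tangent_space (cyl A) P. form2 \<omega>1 P u w = form2 \<omega>2 P (J' P u) w"
    show "intertwines (cyl A) \<omega>1 \<omega>2 J'"
      unfolding intertwines_def
    proof (intro ballI)
      fix P u v assume h: "P \<in> pts (cyl A)" "u \<in> tangent_space (cyl A) P" "v \<in> tuples (cyl A) 1 P"
      have "v 0 \<in> tangent_space (cyl A) P" using cyl.tuplesD[OF h(3)] by simp
      then show "interior_prod u \<omega>1 P v = interior_prod (J' P u) \<omega>2 P v"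
        unfolding e[OF smooth_\<omega>(1) h] e[OF smooth_\<omega>(2) h(1) J'[OF h(1,2)] h(3)] using i h by blast
    qed
  qed
qed

lemma intertwines_J_cyl: "intertwines (cyl A) \<omega>1 \<omega>2 J_cyl"
proof (subst intertwines_iff)
  show "J_cyl P u \<in> tangent_space (cyl A) P" if "P \<in> pts (cyl A)" "u \<in> tangent_space (cyl A) P" for P u
    by (rule J_cyl_tangent[OF that])
qed (simp add: form2_J_cyl(1))

lemma endo_eq_J_cylI:
  assumes "endomorphism (cyl A) J'"
    and "\<And>P u w. P \<in> pts (cyl A) \<Longrightarrow> u \<in> tangent_space (cyl A) P \<Longrightarrow> w \<in> tangent_space (cyl A) P \<Longrightarrow>
      form2 \<omega>1 P u w = form2 \<omega>2 P (J' P u) w"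
  shows "endo_eq (cyl A) J' J_cyl"
  unfolding endo_eq_def
proof (intro ballI)
  fix P u assume h: "P \<in> pts (cyl A)" "u \<in> tangent_space (cyl A) P"
  have J': "J' P u \<in> tangent_space (cyl A) P" using assms(1) h unfolding endomorphism_def by blast
  show "J' P u = J_cyl P u"
    by (rule form2_\<omega>2_eqI[OF h(1) J' J_cyl_tangent[OF h]])
      (simp only: form2_J_cyl(1)[OF h] assms(2)[OF h])
qed

lemma endo_eq_of_intertwines:
  assumes "endomorphism (cyl A) J'" "intertwines (cyl A) \<omega>1 \<omega>2 J'"
  shows "endo_eq (cyl A) J' J_cyl"
proof (rule endo_eq_J_cylI[OF assms(1)])
  have "J' P u \<in> tangent_space (cyl A) P" if "P \<in> pts (cyl A)" "u \<in> tangent_space (cyl A) P" for P u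
    using assms(1) that unfolding endomorphism_def by blast
  then show "form2 \<omega>1 P u w = form2 \<omega>2 P (J' P u) w" if "P \<in> pts (cyl A)" "u \<in> tangent_space (cyl A) P" "w \<in> tangent_space (cyl A) P" for P u w
    using intertwines_iff[THEN iffD1, OF _ assms(2)] that by blast
qed

subsection \<open>Conformal couples and forms of type (2,0)\<close>

text \<open>On the plane spanned by the two forms, the wedge product is \<open>2 * \<mu>\<close>
  times the standard inner product of the coefficients. Conformality of a couple thus becomes
  orthogonality and equal length of two coefficient vectors.\<close>

lemma wedge_combinations:
  assumes P: "P \<in> pts (cyl A)" and v: "v \<in> tuples (cyl A) 4 P"
    and al: "alternating_at (cyl A) 2 \<alpha> P" "alternating_at (cyl A) 2 \<beta> P"
    and ab: "\<And>u w. u \<in> tangent_space (cyl A) P \<Longrightarrow> w \<in> tangent_space (cyl A) P \<Longrightarrow> form2 \<alpha> P u w = a * form2 \<omega>1 P u w + b * form2 \<omega>2 P u w"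
    and cd: "\<And>u w. u \<in> tangent_space (cyl A) P \<Longrightarrow> w \<in> tangent_space (cyl A) P \<Longrightarrow> form2 \<beta> P u w = c * form2 \<omega>1 P u w + d * form2 \<omega>2 P u w"
  shows "wedge 2 2 \<alpha> \<beta> P v = (a * c + b * d) * (2 * \<mu> P v)"
proof -
  obtain k p t where k: "k \<in> A" "p \<in> fst k" "P = (p, t)" using P cyl_ptsE by metis
  note v' = v[unfolded k(3)]
  have t: "v 0 \<in> tangent_space (cyl A) P" "v 1 \<in> tangent_space (cyl A) P" "v 2 \<in> tangent_space (cyl A) P" "v 3 \<in> tangent_space (cyl A) P"
    by (rule cyl.tuplesD[OF v]; simp)+
  have alw: "alternating_at (cyl A) 2 \<omega>1 P" "alternating_at (cyl A) 2 \<omega>2 P"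
    using smooth_\<omega> P by (simp_all add: smooth_form_def)
  have n: "N2 k (snd k p) \<bullet> V2 k (snd k p) = N1 k (snd k p) \<bullet> V1 k (snd k p)"
    "N1 k (snd k p) \<bullet> V2 k (snd k p) = - (N2 k (snd k p) \<bullet> V1 k (snd k p))"
    using taut k by (simp_all add: taut_fields_def)
  have w: "wedge 2 2 \<omega>1 \<omega>1 P v = 2 * \<mu> P v" "wedge 2 2 \<omega>2 \<omega>2 P v = 2 * \<mu> P v" "wedge 2 2 \<omega>1 \<omega>2 P v = 0" "wedge 2 2 \<omega>2 \<omega>1 P v = 0"
    unfolding k(3) wedge_cyl_forms[OF k(1,2) alternating(1,2,1,2)[OF k(1,2)] v'] wedge_cyl_forms[OF k(1,2) alternating(3,4,3,4)[OF k(1,2)] v']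
      wedge_cyl_forms[OF k(1,2) alternating(1,2,3,4)[OF k(1,2)] v'] wedge_cyl_forms[OF k(1,2) alternating(3,4,1,2)[OF k(1,2)] v']
      cyl_orientation_coord[OF k(1,2) alternating(1,2)[OF k(1,2)] v'] by (simp_all add: n)
  have "wedge 2 2 \<alpha> \<beta> P v = a * c * wedge 2 2 \<omega>1 \<omega>1 P v + a * d * wedge 2 2 \<omega>1 \<omega>2 P v + b * c * wedge 2 2 \<omega>2 \<omega>1 P v + b * d * wedge 2 2 \<omega>2 \<omega>2 P v"
    unfolding cyl.wedge_2_2[OF al v] cyl.wedge_2_2[OF alw(1) alw(1) v] cyl.wedge_2_2[OF alw v] cyl.wedge_2_2[OF alw(2) alw(1) v] cyl.wedge_2_2[OF alw(2) alw(2) v]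
      ab[OF t(1,2)] ab[OF t(1,3)] ab[OF t(1,4)] ab[OF t(2,3)] ab[OF t(2,4)] ab[OF t(3,4)]
      cd[OF t(1,2)] cd[OF t(1,3)] cd[OF t(1,4)] cd[OF t(2,3)] cd[OF t(2,4)] cd[OF t(3,4)]
    by (simp add: algebra_simps)
  then show ?thesis unfolding w by (simp add: algebra_simps)
qed

lemma \<mu>_nonvanishing:
  assumes "P \<in> pts (cyl A)"
  obtains v where "v \<in> tuples (cyl A) 4 P" "\<mu> P v \<noteq> 0"
proof -
  obtain c p t where c: "c \<in> A" "p \<in> fst c" "P = (p, t)" using assms cyl_ptsE by metis
  note b = cyl_basis_tuple[OF c(1,2), of t]
  have "\<mu> P (cyl_basis_tuple c (p, t)) \<noteq> 0"
    unfolding c(3) cyl_orientation_coord[OF c(1,2) alternating(1,2)[OF c(1,2)] b(1)] b(2)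
    using cosymplectic_nonzero[OF cs1 c(1,2)] by simp
  then show ?thesis using that b(1) unfolding c(3) by blast
qed

lemma combination_nondegenerate:
  assumes P: "P \<in> pts (cyl A)" and u: "u \<in> tangent_space (cyl A) P" and ab: "a\<^sup>2 + b\<^sup>2 \<noteq> 0"
    and z: "\<And>w. w \<in> tangent_space (cyl A) P \<Longrightarrow> a * form2 \<omega>1 P u w + b * form2 \<omega>2 P u w = 0"
  shows "u = tzero"
proof -
  obtain c p t where c: "c \<in> A" "p \<in> fst c" "P = (p, t)" using P cyl_ptsE by metis
  note C = cyl_chart_in[OF c(1)] cyl_chart_mem[OF c(2), of t]
  note u' = u[unfolded c(3)]
  have "u (cyl_chart c) = 0"
  proof (rule taut_point.rotation_nondegenerate[OF taut_point[OF c(1,2)] _ ab])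
    fix d
    show "a * cyl_pairing (N1 c (snd c p)) (V1 c (snd c p)) (u (cyl_chart c)) d + b * cyl_pairing (N2 c (snd c p)) (V2 c (snd c p)) (u (cyl_chart c)) d = 0"
      using z[unfolded c(3), OF cyl.coord_vec_tangent[OF C, of d]] unfolding form2_\<omega>_coord[OF c(1,2) u'] .
  qed
  then show ?thesis
    using cyl.coord_vec_coords[OF C u'] cyl.coord_vec_tcomb[OF C, of 0 0 0 0] by (simp add: tcomb_def tzero_def)
qed

text \<open>The equation \<open>\<alpha>1 + \<i> \<alpha>2 = (a - \<i> b) (\<omega>1 + \<i>
  \<omega>2)\<close> at \<open>P\<close> with a nonzero complex factor, split into real and
  imaginary part.\<close>

definition conformal_multiple where
  "conformal_multiple \<alpha>1 \<alpha>2 P \<longleftrightarrow> (\<exists>a b. a\<^sup>2 + b\<^sup>2 \<noteq> (0::real) \<and> (\<forall>u\<in>tangent_space (cyl A) P. \<forall>w\<in>tangent_space (cyl A) P.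
    form2 \<alpha>1 P u w = a * form2 \<omega>1 P u w + b * form2 \<omega>2 P u w \<and> form2 \<alpha>2 P u w = (- b) * form2 \<omega>1 P u w + a * form2 \<omega>2 P u w))"

lemma conformal_couple_if_multiple:
  assumes sm: "smooth_form (cyl A) 2 \<alpha>1" "smooth_form (cyl A) 2 \<alpha>2"
    and cm: "\<And>P. P \<in> pts (cyl A) \<Longrightarrow> conformal_multiple \<alpha>1 \<alpha>2 P"
  shows "conformal_couple (cyl A) \<mu> \<alpha>1 \<alpha>2" "equivalent_couples (cyl A) \<alpha>1 \<alpha>2 \<omega>1 \<omega>2"
proof -
  have al: "alternating_at (cyl A) 2 \<alpha>1 P" "alternating_at (cyl A) 2 \<alpha>2 P" "alternating_at (cyl A) 2 \<omega>1 P" "alternating_at (cyl A) 2 \<omega>2 P"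
    if "P \<in> pts (cyl A)" for P
    using sm smooth_\<omega> that by (simp_all add: smooth_form_def)
  have W: "\<exists>r>0. (\<forall>v\<in>tuples (cyl A) 4 P. wedge 2 2 \<alpha>1 \<alpha>1 P v = r * \<mu> P v \<and> wedge 2 2 \<alpha>2 \<alpha>2 P v = r * \<mu> P v \<and> wedge 2 2 \<alpha>1 \<alpha>2 P v = 0)"
    if P: "P \<in> pts (cyl A)" for P
  proof -
    obtain a b where ab: "a\<^sup>2 + b\<^sup>2 \<noteq> (0::real)"
      "\<And>u w. u \<in> tangent_space (cyl A) P \<Longrightarrow> w \<in> tangent_space (cyl A) P \<Longrightarrow> form2 \<alpha>1 P u w = a * form2 \<omega>1 P u w + b * form2 \<omega>2 P u w"
      "\<And>u w. u \<in> tangent_space (cyl A) P \<Longrightarrow> w \<in> tangent_space (cyl A) P \<Longrightarrow> form2 \<alpha>2 P u w = (- b) * form2 \<omega>1 P u w + a * form2 \<omega>2 P u w"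
      using cm[OF P] unfolding conformal_multiple_def by blast
    have "wedge 2 2 \<alpha>1 \<alpha>1 P v = (2 * (a\<^sup>2 + b\<^sup>2)) * \<mu> P v" "wedge 2 2 \<alpha>2 \<alpha>2 P v = (2 * (a\<^sup>2 + b\<^sup>2)) * \<mu> P v" "wedge 2 2 \<alpha>1 \<alpha>2 P v = 0"
      if v: "v \<in> tuples (cyl A) 4 P" for v
      using wedge_combinations[OF P v al(1)[OF P] al(1)[OF P] ab(2) ab(2)] wedge_combinations[OF P v al(2)[OF P] al(2)[OF P] ab(3) ab(3)]
        wedge_combinations[OF P v al(1)[OF P] al(2)[OF P] ab(2) ab(3)] by (simp_all add: power2_eq_square algebra_simps)
    moreover have "a\<^sup>2 + b\<^sup>2 > 0" using ab(1) sum_power2_ge_zero[of a b] by (metis order_le_less)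
    then have "2 * (a\<^sup>2 + b\<^sup>2) > 0" by (rule mult_pos_pos[OF zero_less_numeral])
    ultimately show ?thesis by blast
  qed
  have nd: "nondegenerate (cyl A) \<alpha>1" "nondegenerate (cyl A) \<alpha>2"
    unfolding nondegenerate_def
  proof (safe)
    fix P u assume P: "P \<in> pts (cyl A)" and u: "u \<in> tangent_space (cyl A) P" and u0: "u \<noteq> tzero"
    obtain a b where ab: "a\<^sup>2 + b\<^sup>2 \<noteq> (0::real)"
      "\<And>u w. u \<in> tangent_space (cyl A) P \<Longrightarrow> w \<in> tangent_space (cyl A) P \<Longrightarrow> form2 \<alpha>1 P u w = a * form2 \<omega>1 P u w + b * form2 \<omega>2 P u w"
      "\<And>u w. u \<in> tangent_space (cyl A) P \<Longrightarrow> w \<in> tangent_space (cyl A) P \<Longrightarrow> form2 \<alpha>2 P u w = (- b) * form2 \<omega>1 P u w + a * form2 \<omega>2 P u w"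
      using cm[OF P] unfolding conformal_multiple_def by blast
    have ab': "(- b)\<^sup>2 + a\<^sup>2 \<noteq> 0" using ab(1) by (simp add: add.commute)
    show "\<exists>w\<in>tangent_space (cyl A) P. \<alpha>1 P (case_nat u (\<lambda>_. w)) \<noteq> 0"
    proof (rule ccontr)
      assume "\<not> (\<exists>w\<in>tangent_space (cyl A) P. \<alpha>1 P (case_nat u (\<lambda>_. w)) \<noteq> 0)"
      then have "a * form2 \<omega>1 P u w + b * form2 \<omega>2 P u w = 0" if "w \<in> tangent_space (cyl A) P" for w
        using that ab(2)[OF u that] by (simp add: form2_def)
      then show False using combination_nondegenerate[OF P u ab(1)] u0 by blast
    qed
    show "\<exists>w\<in>tangent_space (cyl A) P. \<alpha>2 P (case_nat u (\<lambda>_. w)) \<noteq> 0"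
    proof (rule ccontr)
      assume "\<not> (\<exists>w\<in>tangent_space (cyl A) P. \<alpha>2 P (case_nat u (\<lambda>_. w)) \<noteq> 0)"
      then have "(- b) * form2 \<omega>1 P u w + a * form2 \<omega>2 P u w = 0" if "w \<in> tangent_space (cyl A) P" for w
        using that ab(3)[OF u that] by (simp add: form2_def)
      then show False using combination_nondegenerate[OF P u ab'] u0 by blast
    qed
  qed
  have nv: "\<exists>v\<in>tuples (cyl A) 4 P. wedge 2 2 \<alpha>1 \<alpha>1 P v \<noteq> 0 \<and> wedge 2 2 \<alpha>2 \<alpha>2 P v \<noteq> 0" if P: "P \<in> pts (cyl A)" for P
  proof -
    obtain v where v: "v \<in> tuples (cyl A) 4 P" "\<mu> P v \<noteq> 0" using \<mu>_nonvanishing[OF P] by blast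
    obtain r where "r > 0" "wedge 2 2 \<alpha>1 \<alpha>1 P v = r * \<mu> P v" "wedge 2 2 \<alpha>2 \<alpha>2 P v = r * \<mu> P v" using W[OF P] v(1) by blast
    then show ?thesis using v by (intro bexI[of _ v]) simp_all
  qed
  have vol: "volume_form (cyl A) (wedge 2 2 \<alpha>1 \<alpha>1)" "volume_form (cyl A) (wedge 2 2 \<alpha>2 \<alpha>2)"
    using nv cyl.smooth_form_wedge_2_2[OF sm(1,1)] cyl.smooth_form_wedge_2_2[OF sm(2,2)]
    unfolding volume_form_def nowhere_vanishing_def by simp_all blast+
  have pos: "0 < wedge 2 2 \<alpha>1 \<alpha>1 P v" "0 < wedge 2 2 \<alpha>2 \<alpha>2 P v"
    if P: "P \<in> pts (cyl A)" and v: "v \<in> tuples (cyl A) 4 P" and m: "0 < \<mu> P v" for P v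
  proof -
    obtain r where "r > 0" "wedge 2 2 \<alpha>1 \<alpha>1 P v = r * \<mu> P v" "wedge 2 2 \<alpha>2 \<alpha>2 P v = r * \<mu> P v" using W[OF P] v by blast
    then show "0 < wedge 2 2 \<alpha>1 \<alpha>1 P v" "0 < wedge 2 2 \<alpha>2 \<alpha>2 P v" using m by simp_all
  qed
  have eq: "wedge 2 2 \<alpha>1 \<alpha>1 P v = wedge 2 2 \<alpha>2 \<alpha>2 P v" "wedge 2 2 \<alpha>1 \<alpha>2 P v = 0"
    if P: "P \<in> pts (cyl A)" and v: "v \<in> tuples (cyl A) 4 P" for P v
  proof -
    obtain r where "wedge 2 2 \<alpha>1 \<alpha>1 P v = r * \<mu> P v" "wedge 2 2 \<alpha>2 \<alpha>2 P v = r * \<mu> P v" "wedge 2 2 \<alpha>1 \<alpha>2 P v = 0"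
      using W[OF P] v by blast
    then show "wedge 2 2 \<alpha>1 \<alpha>1 P v = wedge 2 2 \<alpha>2 \<alpha>2 P v" "wedge 2 2 \<alpha>1 \<alpha>2 P v = 0" by simp_all
  qed
  show "conformal_couple (cyl A) \<mu> \<alpha>1 \<alpha>2"
    unfolding conformal_couple_def couple_def
    using sm nd vol pos eq by (simp add: form_eq_def positive_wrt_def)
  show "equivalent_couples (cyl A) \<alpha>1 \<alpha>2 \<omega>1 \<omega>2"
    unfolding equivalent_couples_def
  proof
    fix P assume P: "P \<in> pts (cyl A)"
    obtain a b where ab: "a\<^sup>2 + b\<^sup>2 \<noteq> (0::real)"
      "\<And>u w. u \<in> tangent_space (cyl A) P \<Longrightarrow> w \<in> tangent_space (cyl A) P \<Longrightarrow> form2 \<alpha>1 P u w = a * form2 \<omega>1 P u w + b * form2 \<omega>2 P u w"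
      "\<And>u w. u \<in> tangent_space (cyl A) P \<Longrightarrow> w \<in> tangent_space (cyl A) P \<Longrightarrow> form2 \<alpha>2 P u w = (- b) * form2 \<omega>1 P u w + a * form2 \<omega>2 P u w"
      using cm[OF P] unfolding conformal_multiple_def by blast
    have "a\<^sup>2 + b\<^sup>2 > 0" using ab(1) sum_power2_ge_zero[of a b] by (metis order_le_less)
    then have "0 < a * a - b * (- b)" by (simp add: power2_eq_square)
    moreover have "\<alpha>1 P v = lin_comb a \<omega>1 b \<omega>2 P v \<and> \<alpha>2 P v = lin_comb (- b) \<omega>1 a \<omega>2 P v" if v: "v \<in> tuples (cyl A) 2 P" for v
    proof -
      have t: "v 0 \<in> tangent_space (cyl A) P" "v 1 \<in> tangent_space (cyl A) P" by (rule cyl.tuplesD[OF v]; simp)+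
      show ?thesis
        unfolding lin_comb_def cyl.alternating_2(1)[OF al(1)[OF P] v] cyl.alternating_2(1)[OF al(2)[OF P] v]
          cyl.alternating_2(1)[OF al(3)[OF P] v] cyl.alternating_2(1)[OF al(4)[OF P] v] ab(2)[OF t] ab(3)[OF t] by simp
    qed
    ultimately show "\<exists>a b c d. 0 < a * d - b * c \<and> (\<forall>v\<in>tuples (cyl A) 2 P. \<alpha>1 P v = lin_comb a \<omega>1 b \<omega>2 P v \<and> \<alpha>2 P v = lin_comb c \<omega>1 d \<omega>2 P v)"
      by blast
  qed
qed

text \<open>Equivalence gives a real matrix of positive determinant at \<open>P\<close>. Evaluating
  the wedge products where \<open>\<mu>\<close> does not vanish makes its rows orthogonal and of
  equal length, so \<open>conformal_matrix\<close> applies.\<close>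

lemma multiple_if_conformal_couple:
  assumes cc: "conformal_couple (cyl A) \<mu> \<alpha>1 \<alpha>2" and eqv: "equivalent_couples (cyl A) \<alpha>1 \<alpha>2 \<omega>1 \<omega>2" and P: "P \<in> pts (cyl A)"
  shows "conformal_multiple \<alpha>1 \<alpha>2 P"
proof -
  have al: "alternating_at (cyl A) 2 \<alpha>1 P" "alternating_at (cyl A) 2 \<alpha>2 P"
    using cc P by (simp_all add: conformal_couple_def couple_def smooth_form_def)
  obtain a b c d where m: "0 < a * d - b * c"
    "\<And>v. v \<in> tuples (cyl A) 2 P \<Longrightarrow> \<alpha>1 P v = lin_comb a \<omega>1 b \<omega>2 P v \<and> \<alpha>2 P v = lin_comb c \<omega>1 d \<omega>2 P v"
    using eqv P unfolding equivalent_couples_def by blast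
  have f: "form2 \<alpha>1 P u w = a * form2 \<omega>1 P u w + b * form2 \<omega>2 P u w" "form2 \<alpha>2 P u w = c * form2 \<omega>1 P u w + d * form2 \<omega>2 P u w"
    if "u \<in> tangent_space (cyl A) P" "w \<in> tangent_space (cyl A) P" for u w
    using m(2)[OF cyl.pair_tuple[OF that]] by (simp_all add: form2_def lin_comb_def)
  obtain v where v: "v \<in> tuples (cyl A) 4 P" "\<mu> P v \<noteq> 0" using \<mu>_nonvanishing[OF P] by blast
  have "wedge 2 2 \<alpha>1 \<alpha>2 P v = 0" "wedge 2 2 \<alpha>1 \<alpha>1 P v = wedge 2 2 \<alpha>2 \<alpha>2 P v"
    using cc P v(1) unfolding conformal_couple_def couple_def form_eq_def by blast+
  then have "(a * c + b * d) * (2 * \<mu> P v) = 0" "(a * a + b * b) * (2 * \<mu> P v) = (c * c + d * d) * (2 * \<mu> P v)"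
    using wedge_combinations[OF P v(1) al(1) al(2) f(1) f(2)] wedge_combinations[OF P v(1) al(1) al(1) f(1) f(1)]
      wedge_combinations[OF P v(1) al(2) al(2) f(2) f(2)] by simp_all
  then have "a * c + b * d = 0" "a\<^sup>2 + b\<^sup>2 = c\<^sup>2 + d\<^sup>2" using v(2) by (simp_all add: power2_eq_square)
  then have cd: "c = - b" "d = a" using conformal_matrix[OF _ _ m(1)] by simp_all
  have "a * a - b * (- b) = a\<^sup>2 + b\<^sup>2" by (simp add: power2_eq_square)
  then have "a\<^sup>2 + b\<^sup>2 \<noteq> 0" using m(1) unfolding cd by (metis less_irrefl)
  then show ?thesis
    unfolding conformal_multiple_def using f[unfolded cd] by (intro exI[of _ a] exI[of _ b]) simp
qed

lemma conformal_couple_\<omega>: "conformal_couple (cyl A) \<mu> \<omega>1 \<omega>2"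
  using taut_fields_imp_couple[OF cs1 cs2 taut] by (simp add: conformal_symplectic_couple_def)

lemma type_2_0_multiple:
  assumes ty: "type_2_0 (cyl A) J_cyl \<alpha>" and nv: "nowhere_vanishing (cyl A) 2 \<alpha>" and P: "P \<in> pts (cyl A)"
  shows "conformal_multiple (\<lambda>P v. Re (\<alpha> P v)) (\<lambda>P v. Im (\<alpha> P v)) P"
proof -
  obtain c p t where c: "c \<in> A" "p \<in> fst c" "P = (p, t)" using P cyl_ptsE by metis
  note C = cyl_chart_in[OF c(1)] cyl_chart_mem[OF c(2), of t]
  interpret tp: taut_point "N1 c (snd c p)" "N2 c (snd c p)" "V1 c (snd c p)" "V2 c (snd c p)"
    by (rule taut_point[OF c(1,2)])
  have al: "alternating_at (cyl A) 2 \<alpha> (p, t)" using ty P by (simp add: type_2_0_def smooth_form_def c(3))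
  let ?v = "coord_vec (cyl A) (cyl_chart c) (p, t)"
  have tv: "?v a \<in> tangent_space (cyl A) (p, t)" for a by (rule cyl.coord_vec_tangent[OF C])
  define B where "B a b = form2 \<alpha> (p, t) (?v a) (?v b)" for a b
  \<comment> \<open>The condition of type (2,0), multiplied by \<open>\<i>\<close>, is complex
    linearity in the first argument.\<close>
  have BJ: "B (tp.J a) b = \<i> * B a b" for a b
  proof -
    have "\<alpha> (p, t) (case_nat (?v a) (\<lambda>_. ?v b)) + \<i> * \<alpha> (p, t) (case_nat (J_cyl (p, t) (?v a)) (\<lambda>_. ?v b)) = 0"
      using ty P tv unfolding type_2_0_def c(3) by blast
    then have "B a b + \<i> * B (tp.J a) b = 0"
      unfolding J_cyl_coord[OF c(1,2) tv] cyl.coord_vec_apply[OF C] B_def form2_def .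
    then have "\<i> * (B a b + \<i> * B (tp.J a) b) = 0" by simp
    then show ?thesis by (simp add: algebra_simps)
  qed
  define \<phi> where "\<phi> = B tp.T tp.S / tp.W tp.T tp.S"
  have B: "B a b = \<phi> * tp.W a b" for a b
    unfolding \<phi>_def
  proof (rule tp.complex_bilinear_multiple)
    show "linear (\<lambda>a. B a b)" for b unfolding B_def by (rule cyl.linear_form2(1)[OF C al])
    show "B a a = 0" for a unfolding B_def by (rule cyl.alternating_2(4)[OF al tv])
    show "B a b = - B b a" for a b unfolding B_def by (rule cyl.alternating_2(5)[OF al tv tv])
  qed (rule BJ)
  have f: "form2 \<alpha> (p, t) u w = \<phi> * Complex (form2 \<omega>1 (p, t) u w) (form2 \<omega>2 (p, t) u w)"
    if u: "u \<in> tangent_space (cyl A) (p, t)" and w: "w \<in> tangent_space (cyl A) (p, t)" for u w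
    using B[of "u (cyl_chart c)" "w (cyl_chart c)"]
    unfolding B_def tp.W_def form2_\<omega>[OF c(1,2) u w] cyl.coord_vec_coords[OF C u] cyl.coord_vec_coords[OF C w] .
  have "\<phi> \<noteq> 0"
  proof
    assume z: "\<phi> = 0"
    obtain v where v: "v \<in> tuples (cyl A) 2 (p, t)" "\<alpha> (p, t) v \<noteq> 0"
      using nv P unfolding nowhere_vanishing_def c(3) by blast
    have "v 0 \<in> tangent_space (cyl A) (p, t)" "v 1 \<in> tangent_space (cyl A) (p, t)" by (rule cyl.tuplesD[OF v(1)]; simp)+
    from f[OF this] v(2) show False unfolding cyl.alternating_2(1)[OF al v(1)] z by simp
  qed
  \<comment> \<open>\<open>conformal_multiple\<close> writes the complex factor as
    \<open>a - \<i> b\<close>, hence \<open>a = Re \<phi>\<close> and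
    \<open>b = - Im \<phi>\<close>.\<close>
  then have "(Re \<phi>)\<^sup>2 + (- Im \<phi>)\<^sup>2 \<noteq> 0" by (simp add: complex_eq_iff sum_power2_eq_zero_iff)
  moreover have "form2 (\<lambda>P v. Re (\<alpha> P v)) (p, t) u w = Re \<phi> * form2 \<omega>1 (p, t) u w + (- Im \<phi>) * form2 \<omega>2 (p, t) u w"
    "form2 (\<lambda>P v. Im (\<alpha> P v)) (p, t) u w = (- (- Im \<phi>)) * form2 \<omega>1 (p, t) u w + Re \<phi> * form2 \<omega>2 (p, t) u w"
    if u: "u \<in> tangent_space (cyl A) (p, t)" and w: "w \<in> tangent_space (cyl A) (p, t)" for u w
  proof -
    have "form2 (\<lambda>P v. Re (\<alpha> P v)) (p, t) u w = Re (form2 \<alpha> (p, t) u w)" "form2 (\<lambda>P v. Im (\<alpha> P v)) (p, t) u w = Im (form2 \<alpha> (p, t) u w)"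
      by (simp_all add: form2_def)
    then show "form2 (\<lambda>P v. Re (\<alpha> P v)) (p, t) u w = Re \<phi> * form2 \<omega>1 (p, t) u w + (- Im \<phi>) * form2 \<omega>2 (p, t) u w"
      "form2 (\<lambda>P v. Im (\<alpha> P v)) (p, t) u w = (- (- Im \<phi>)) * form2 \<omega>1 (p, t) u w + Re \<phi> * form2 \<omega>2 (p, t) u w"
      unfolding f[OF u w] by simp_all
  qed
  ultimately show ?thesis unfolding conformal_multiple_def c(3) by blast
qed

lemma forms_2_0_J_cyl: "forms_2_0_from_couple (cyl A) \<mu> \<omega>1 \<omega>2 J_cyl"
  unfolding forms_2_0_from_couple_def
proof (intro allI impI iffI)
  fix \<alpha> :: "('a \<times> real, (real^3) \<times> real, complex) form"
  assume sm: "smooth_form (cyl A) 2 \<alpha>" and ty: "type_2_0 (cyl A) J_cyl \<alpha> \<and> nowhere_vanishing (cyl A) 2 \<alpha>"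
  let ?a1 = "\<lambda>P v. Re (\<alpha> P v)" and ?a2 = "\<lambda>P v. Im (\<alpha> P v)"
  have s: "smooth_form (cyl A) 2 ?a1" "smooth_form (cyl A) 2 ?a2"
    by (rule cyl.smooth_form_bounded_linear[OF sm bounded_linear_Re], rule cyl.smooth_form_bounded_linear[OF sm bounded_linear_Im])
  have cm: "conformal_multiple ?a1 ?a2 P" if "P \<in> pts (cyl A)" for P
    using type_2_0_multiple[OF _ _ that] ty by simp
  have "form_eq (cyl A) 2 \<alpha> (complex_form ?a1 ?a2)"
    by (simp add: form_eq_def complex_form_def complex_eq_iff)
  then show "\<exists>\<alpha>1 \<alpha>2. conformal_couple (cyl A) \<mu> \<alpha>1 \<alpha>2 \<and> equivalent_couples (cyl A) \<alpha>1 \<alpha>2 \<omega>1 \<omega>2 \<and> form_eq (cyl A) 2 \<alpha> (complex_form \<alpha>1 \<alpha>2)"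
    using conformal_couple_if_multiple[OF s cm] by blast
next
  fix \<alpha> :: "('a \<times> real, (real^3) \<times> real, complex) form"
  assume sm: "smooth_form (cyl A) 2 \<alpha>" and "\<exists>\<alpha>1 \<alpha>2. conformal_couple (cyl A) \<mu> \<alpha>1 \<alpha>2 \<and> equivalent_couples (cyl A) \<alpha>1 \<alpha>2 \<omega>1 \<omega>2 \<and> form_eq (cyl A) 2 \<alpha> (complex_form \<alpha>1 \<alpha>2)"
  then obtain \<alpha>1 \<alpha>2 where a: "conformal_couple (cyl A) \<mu> \<alpha>1 \<alpha>2" "equivalent_couples (cyl A) \<alpha>1 \<alpha>2 \<omega>1 \<omega>2" "form_eq (cyl A) 2 \<alpha> (complex_form \<alpha>1 \<alpha>2)"
    by blast
  have m: "\<exists>z. z \<noteq> 0 \<and> (\<forall>u\<in>tangent_space (cyl A) P. \<forall>w\<in>tangent_space (cyl A) P.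
      form2 \<alpha> P u w = z * Complex (form2 \<omega>1 P u w) (form2 \<omega>2 P u w))" if P: "P \<in> pts (cyl A)" for P
  proof -
    obtain x y where xy: "x\<^sup>2 + y\<^sup>2 \<noteq> (0::real)"
      "\<And>u w. u \<in> tangent_space (cyl A) P \<Longrightarrow> w \<in> tangent_space (cyl A) P \<Longrightarrow> form2 \<alpha>1 P u w = x * form2 \<omega>1 P u w + y * form2 \<omega>2 P u w"
      "\<And>u w. u \<in> tangent_space (cyl A) P \<Longrightarrow> w \<in> tangent_space (cyl A) P \<Longrightarrow> form2 \<alpha>2 P u w = (- y) * form2 \<omega>1 P u w + x * form2 \<omega>2 P u w"
      using multiple_if_conformal_couple[OF a(1,2) P] unfolding conformal_multiple_def by blast
    have "form2 \<alpha> P u w = Complex x (- y) * Complex (form2 \<omega>1 P u w) (form2 \<omega>2 P u w)"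
      if u: "u \<in> tangent_space (cyl A) P" and w: "w \<in> tangent_space (cyl A) P" for u w
    proof -
      have "form2 \<alpha> P u w = Complex (form2 \<alpha>1 P u w) (form2 \<alpha>2 P u w)"
        using a(3) P cyl.pair_tuple[OF u w] unfolding form_eq_def by (simp add: form2_def complex_form_def complex_eq_iff)
      then show ?thesis unfolding xy(2)[OF u w] xy(3)[OF u w] by (simp add: complex_eq_iff algebra_simps)
    qed
    moreover have "Complex x (- y) \<noteq> 0" using xy(1) by (auto simp: complex_eq_iff)
    ultimately show ?thesis by blast
  qed
  have "type_2_0 (cyl A) J_cyl \<alpha>"
    unfolding type_2_0_def
  proof (intro conjI sm ballI)
    fix P u w assume h: "P \<in> pts (cyl A)" "u \<in> tangent_space (cyl A) P" "w \<in> tangent_space (cyl A) P"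
    obtain z where z: "\<forall>u\<in>tangent_space (cyl A) P. \<forall>w\<in>tangent_space (cyl A) P.
      form2 \<alpha> P u w = z * Complex (form2 \<omega>1 P u w) (form2 \<omega>2 P u w)" using m[OF h(1)] by blast
    have "form2 \<alpha> P u w + \<i> * form2 \<alpha> P (J_cyl P u) w = 0"
      unfolding z[rule_format, OF h(2,3)] z[rule_format, OF J_cyl_tangent[OF h(1,2)] h(3)] form2_J_cyl[OF h]
      by (simp add: complex_eq_iff)
    then show "\<alpha> P (case_nat u (\<lambda>_. w)) + \<i> * \<alpha> P (case_nat (J_cyl P u) (\<lambda>_. w)) = 0"
      by (simp add: form2_def)
  qed
  moreover have "nowhere_vanishing (cyl A) 2 \<alpha>"
    unfolding nowhere_vanishing_def
  proof
    fix P assume P: "P \<in> pts (cyl A)"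
    obtain z where z: "z \<noteq> 0" "\<forall>u\<in>tangent_space (cyl A) P. \<forall>w\<in>tangent_space (cyl A) P.
      form2 \<alpha> P u w = z * Complex (form2 \<omega>1 P u w) (form2 \<omega>2 P u w)" using m[OF P] by blast
    obtain c p t where c: "c \<in> A" "p \<in> fst c" "P = (p, t)" using P cyl_ptsE by metis
    note C = cyl_chart_in[OF c(1)] cyl_chart_mem[OF c(2), of t]
    interpret tp: taut_point "N1 c (snd c p)" "N2 c (snd c p)" "V1 c (snd c p)" "V2 c (snd c p)"
      by (rule taut_point[OF c(1,2)])
    let ?v = "coord_vec (cyl A) (cyl_chart c) (p, t)"
    have tv: "?v a \<in> tangent_space (cyl A) (p, t)" for a by (rule cyl.coord_vec_tangent[OF C])
    have "form2 \<alpha> (p, t) (?v tp.T) (?v tp.S) = z * tp.W tp.T tp.S"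
      using z(2)[unfolded c(3), rule_format, OF tv tv]
      unfolding tp.W_def form2_\<omega>[OF c(1,2) tv tv] cyl.coord_vec_apply[OF C] .
    then have "\<alpha> (p, t) (case_nat (?v tp.T) (\<lambda>_. ?v tp.S)) \<noteq> 0" using z(1) tp.W_T_S by (simp add: form2_def)
    then show "\<exists>v\<in>tuples (cyl A) 2 P. \<alpha> P v \<noteq> 0" using cyl.pair_tuple[OF tv tv] unfolding c(3) by blast
  qed
  ultimately show "type_2_0 (cyl A) J_cyl \<alpha> \<and> nowhere_vanishing (cyl A) 2 \<alpha>" ..
qed

text \<open>A single form determines the endomorphism: the couple
  \<open>(\<omega>1, \<omega>2)\<close> is equivalent to itself, so
  \<open>\<omega>1 + \<i> \<omega>2\<close> must be of type (2,0) for \<open>J'\<close>.\<close>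

lemma endo_eq_of_forms_2_0:
  assumes J': "endomorphism (cyl A) J'" and f: "forms_2_0_from_couple (cyl A) \<mu> \<omega>1 \<omega>2 J'"
  shows "endo_eq (cyl A) J' J_cyl"
proof (rule endo_eq_J_cylI[OF J'])
  have s: "smooth_form (cyl A) 2 (complex_form \<omega>1 \<omega>2)" by (rule cyl.smooth_complex_form[OF smooth_\<omega>])
  have "form_eq (cyl A) 2 (complex_form \<omega>1 \<omega>2) (complex_form \<omega>1 \<omega>2)" by (simp add: form_eq_def)
  then have ty: "type_2_0 (cyl A) J' (complex_form \<omega>1 \<omega>2)"
    using f s conformal_couple_\<omega> cyl.equivalent_couples_refl unfolding forms_2_0_from_couple_def by blast
  fix P u w assume h: "P \<in> pts (cyl A)" "u \<in> tangent_space (cyl A) P" "w \<in> tangent_space (cyl A) P"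
  have "complex_form \<omega>1 \<omega>2 P (case_nat u (\<lambda>_. w)) + \<i> * complex_form \<omega>1 \<omega>2 P (case_nat (J' P u) (\<lambda>_. w)) = 0"
    using ty h unfolding type_2_0_def by blast
  \<comment> \<open>The real part of the preceding equation is the intertwining relation.\<close>
  then show "form2 \<omega>1 P u w = form2 \<omega>2 P (J' P u) w"
    by (simp add: complex_form_def form2_def complex_eq_iff)
qed

end

subsection \<open>Holomorphic charts\<close>

lemma smooth_on_vec2:
  fixes F :: "'e::euclidean_space \<Rightarrow> 'b::euclidean_space ^ 2"
  assumes "open S" "smooth_on S (\<lambda>x. F x $ 1)" "smooth_on S (\<lambda>x. F x $ 2)"
  shows "smooth_on S F"
proof (rule smooth_on_vec[OF assms(1)])
  show "smooth_on S (\<lambda>x. F x $ i)" for i using assms exhaust_2[of i] by auto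
qed

lemma has_derivative_vec2:
  fixes F :: "'e::real_normed_vector \<Rightarrow> 'b::euclidean_space ^ 2"
  assumes "((\<lambda>x. F x $ 1) has_derivative (\<lambda>v. F' v $ 1)) (at x)" "((\<lambda>x. F x $ 2) has_derivative (\<lambda>v. F' v $ 2)) (at x)"
  shows "(F has_derivative F') (at x)"
proof (rule has_derivative_vec)
  show "((\<lambda>x. F x $ i) has_derivative (\<lambda>v. F' v $ i)) (at x)" for i using assms exhaust_2[of i] by auto
qed

context taut_pair
begin

text \<open>The chart is \<open>(f, h - t)\<close> in coordinates of \<open>M\<close>. Its
  components are complex linear for \<open>J_cyl\<close> because the wedge product of their
  differentials is \<open>\<omega>1 + \<i> \<omega>2\<close>, which is complex bilinear.\<close>

lemma holomorphic_chart_exists: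
  assumes P: "P \<in> pts (cyl A)"
  obtains z :: "('a \<times> real, complex ^ 2) chart"
  where "P \<in> fst z" "holomorphic_chart (prod_topology X euclideanreal) (cyl A) J_cyl z"
proof -
  obtain c p0 t0 where c: "c \<in> A" "p0 \<in> fst c" "P = (p0, t0)" using P cyl_ptsE by metis
  let ?U = "snd c ` fst c"
  note oU = open_chart_image[OF c(1)]
  have x0: "snd c p0 \<in> ?U" using c(2) by blast
  have tf: "N1 c x \<bullet> V1 c x = N2 c x \<bullet> V2 c x" "N1 c x \<bullet> V1 c x \<noteq> 0" "N1 c x \<bullet> V2 c x = - (N2 c x \<bullet> V1 c x)"
    if x: "x \<in> ?U" for x
  proof -
    obtain q where "q \<in> fst c" "x = snd c q" using x by blast
    then show "N1 c x \<bullet> V1 c x = N2 c x \<bullet> V2 c x" "N1 c x \<bullet> V1 c x \<noteq> 0" "N1 c x \<bullet> V2 c x = - (N2 c x \<bullet> V1 c x)"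
      using taut_point[OF c(1), of q] by (simp_all add: taut_point_def)
  qed
  obtain U' f h V' \<Psi> where L: "open U'" "snd c p0 \<in> U'" "U' \<subseteq> ?U" "smooth_on U' f" "smooth_on U' h"
    "\<And>x. x \<in> U' \<Longrightarrow> (f has_derivative (\<lambda>v. Complex (N1 c x \<bullet> v) (N2 c x \<bullet> v))) (at x)"
    "\<And>x u v. x \<in> U' \<Longrightarrow> Complex (V1 c x \<bullet> cross3 u v) (V2 c x \<bullet> cross3 u v)
       = Complex (N1 c x \<bullet> u) (N2 c x \<bullet> u) * frechet_derivative h (at x) v
         - Complex (N1 c x \<bullet> v) (N2 c x \<bullet> v) * frechet_derivative h (at x) u"
    "open V'" "homeomorphism U' V' (\<lambda>x. vector [Re (f x), Im (f x), Im (h x)] :: real^3) \<Psi>" "smooth_on V' \<Psi>"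
  proof (rule local_holomorphic_coordinates[OF oU x0 smooth_form1_field[OF smooth_forms(1) c(1)] smooth_form1_field[OF smooth_forms(3) c(1)]
        smooth_form2_field[OF smooth_forms(2) c(1)] smooth_form2_field[OF smooth_forms(4) c(1)]])
    show "frechet_derivative (N1 c) (at x) u \<bullet> v = frechet_derivative (N1 c) (at x) v \<bullet> u" if "x \<in> ?U" for x u v
      by (rule closed_form1_field[OF smooth_forms(1) closed_forms(1) c(1) that])
    show "frechet_derivative (N2 c) (at x) u \<bullet> v = frechet_derivative (N2 c) (at x) v \<bullet> u" if "x \<in> ?U" for x u v
      by (rule closed_form1_field[OF smooth_forms(3) closed_forms(3) c(1) that])
    show "frechet_derivative (V1 c) (at x) u \<bullet> cross3 v w - frechet_derivative (V1 c) (at x) v \<bullet> cross3 u w + frechet_derivative (V1 c) (at x) w \<bullet> cross3 u v = 0"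
      if "x \<in> ?U" for x u v w
      by (rule closed_form2_field[OF smooth_forms(2) closed_forms(2) c(1) that])
    show "frechet_derivative (V2 c) (at x) u \<bullet> cross3 v w - frechet_derivative (V2 c) (at x) v \<bullet> cross3 u w + frechet_derivative (V2 c) (at x) w \<bullet> cross3 u v = 0"
      if "x \<in> ?U" for x u v w
      by (rule closed_form2_field[OF smooth_forms(4) closed_forms(4) c(1) that])
  qed (rule tf, assumption, rule tf, assumption, rule tf, assumption, rule that, assumption+)
  let ?\<Phi> = "\<lambda>x. vector [Re (f x), Im (f x), Im (h x)] :: real^3"
  let ?O1 = "U' \<times> (UNIV :: real set)"
  \<comment> \<open>The three real components of \<open>(f, h - t)\<close> that are independent of
    \<open>t\<close>, since \<open>t\<close> is real. They are the coordinates of the point of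
    \<open>M\<close> under the diffeomorphism inverted by \<open>\<Psi>\<close>.\<close>
  define K where "K \<zeta> = (vector [Re (\<zeta> $ 1), Im (\<zeta> $ 1), Im (\<zeta> $ 2)] :: real^3)" for \<zeta> :: "complex ^ 2"
  define Z where "Z y = (vector [f (fst y), h (fst y) - of_real (snd y)] :: complex ^ 2)" for y :: "(real^3) \<times> real"
  \<comment> \<open>Once the point of \<open>M\<close> is recovered, \<open>t\<close> is
    \<open>Re h\<close> at this point minus the real part of the second complex coordinate.\<close>
  define Z' where "Z' \<zeta> = (\<Psi> (K \<zeta>), Re (h (\<Psi> (K \<zeta>))) - Re (\<zeta> $ 2))" for \<zeta> :: "complex ^ 2"
  define O2 where "O2 = {\<zeta>. K \<zeta> \<in> V'}"
  have sK: "smooth_on S K" if "open S" for S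
    by (rule smooth_on_vec3[OF that]) (simp_all add: K_def smooth_on_Re smooth_on_Im smooth_on_nth smooth_on_id that)
  have oO1: "open ?O1" using L(1) by (simp add: open_Times)
  have oO2: "open O2"
    unfolding O2_def using continuous_open_preimage[OF smooth_on_continuous[OF sK[OF open_UNIV]] open_UNIV L(8)] by (simp add: vimage_def)
  have O1: "?O1 \<subseteq> snd (cyl_chart c) ` fst (cyl_chart c)" unfolding cyl_image using L(3) by blast
  have hom: "\<Psi> (?\<Phi> x) = x" "?\<Phi> x \<in> V'" if "x \<in> U'" for x
    using L(9) that unfolding homeomorphism_def by blast+
  have hom': "?\<Phi> (\<Psi> y) = y" "\<Psi> y \<in> U'" if "y \<in> V'" for y
    using L(9) that unfolding homeomorphism_def by blast+
  have KZ: "K (Z y) = ?\<Phi> (fst y)" for y by (simp add: K_def Z_def)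
  have ZZ': "Z (Z' \<zeta>) = \<zeta>" if "\<zeta> \<in> O2" for \<zeta>
  proof -
    have "?\<Phi> (\<Psi> (K \<zeta>)) = K \<zeta>" using that hom'(1) by (simp add: O2_def)
    then have "?\<Phi> (\<Psi> (K \<zeta>)) $ i = K \<zeta> $ i" for i by simp
    from this[of 1] this[of 2] this[of 3]
    have "Re (f (\<Psi> (K \<zeta>))) = Re (\<zeta> $ 1)" "Im (f (\<Psi> (K \<zeta>))) = Im (\<zeta> $ 1)" "Im (h (\<Psi> (K \<zeta>))) = Im (\<zeta> $ 2)"
      by (simp_all add: K_def)
    then show ?thesis by (simp add: vec_eq_iff forall_2 Z_def Z'_def complex_eq_iff)
  qed
  have Z'Z: "Z' (Z y) = y" if "y \<in> ?O1" for y
  proof -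
    have "fst y \<in> U'" using that by auto
    then show ?thesis unfolding Z'_def KZ hom(1)[OF \<open>fst y \<in> U'\<close>] by (simp add: Z_def)
  qed
  have Zin: "Z y \<in> O2" if "y \<in> ?O1" for y
    unfolding O2_def mem_Collect_eq KZ by (rule hom(2)) (use that in auto)
  have Z'in: "Z' \<zeta> \<in> ?O1" if "\<zeta> \<in> O2" for \<zeta>
    using that hom'(2) by (simp add: O2_def Z'_def)
  have sZ: "smooth_on ?O1 Z"
  proof (rule smooth_on_vec2[OF oO1])
    note s = smooth_on_compose[where f = fst, OF oO1 L(1) _ smooth_on_fst[OF oO1 smooth_on_id[OF oO1]]]
    have "smooth_on ?O1 (\<lambda>y. f (fst y))" "smooth_on ?O1 (\<lambda>y. h (fst y))"
      by (rule s[OF _ L(4)], force, rule s[OF _ L(5)], force)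
    then show "smooth_on ?O1 (\<lambda>y. Z y $ 1)" "smooth_on ?O1 (\<lambda>y. Z y $ 2)"
      by (simp_all add: Z_def smooth_on_diff smooth_on_of_real smooth_on_snd smooth_on_id oO1)
  qed
  have sZ': "smooth_on O2 Z'"
  proof -
    have s1: "smooth_on O2 (\<lambda>\<zeta>. \<Psi> (K \<zeta>))"
      by (rule smooth_on_compose[where f = K, OF oO2 L(8) _ sK[OF oO2] L(10)]) (simp add: O2_def)
    have "smooth_on O2 (\<lambda>\<zeta>. h (\<Psi> (K \<zeta>)))"
      by (rule smooth_on_compose[where f = "\<lambda>\<zeta>. \<Psi> (K \<zeta>)", OF oO2 L(1) _ s1 L(5)]) (simp add: O2_def hom'(2))
    then show ?thesis
      unfolding Z'_def
      by (intro smooth_on_Pair s1 smooth_on_diff smooth_on_Re smooth_on_nth smooth_on_id oO2)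
  qed
  have Zh: "homeomorphism ?O1 O2 Z Z'"
  proof (rule homeomorphismI)
    show "continuous_on ?O1 Z" "continuous_on O2 Z'" by (rule smooth_on_continuous[OF sZ], rule smooth_on_continuous[OF sZ'])
    show "Z ` ?O1 \<subseteq> O2" by (rule image_subsetI) (rule Zin)
    show "Z' ` O2 \<subseteq> ?O1" by (rule image_subsetI) (rule Z'in)
    show "Z' (Z y) = y" if "y \<in> ?O1" for y by (rule Z'Z[OF that])
    show "Z (Z' \<zeta>) = \<zeta>" if "\<zeta> \<in> O2" for \<zeta> by (rule ZZ'[OF that])
  qed
  note C = cyl_chart_in[OF c(1)]
  let ?C = "cyl_chart c"
  define z where "z = (cinv ?C ` ?O1, Z \<circ> snd ?C)"
  note ic = is_chart_compose[of "prod_topology X euclideanreal" ?C ?O1 O2 Z Z', OF cyl.charts[OF C] oO1 O1 oO2 Zh]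
  have cinvC: "cinv ?C (x, r) = (cinv c x, r)" if "x \<in> U'" for x r
    by (rule cinv_cyl_chart[OF c(1)]) (use that L(3) in blast)
  have mem: "(q, s) \<in> fst z \<longleftrightarrow> q \<in> fst c \<and> snd c q \<in> U'" for q s
  proof
    assume "(q, s) \<in> fst z"
    then have "(q, s) \<in> cinv ?C ` ?O1" unfolding z_def fst_conv .
    then obtain y where y: "(q, s) = cinv ?C y" "y \<in> ?O1" by (rule imageE)
    obtain x r where xr: "y = (x, r)" "x \<in> U'" using y(2) by (cases y) simp
    have q: "q = cinv c x" using y(1) unfolding xr(1) cinvC[OF xr(2)] by simp
    have "x \<in> ?U" using xr(2) L(3) by blast
    from cinv_in[OF this] show "q \<in> fst c \<and> snd c q \<in> U'" unfolding q using xr(2) by simp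
  next
    assume q: "q \<in> fst c \<and> snd c q \<in> U'"
    show "(q, s) \<in> fst z"
      unfolding z_def fst_conv
    proof (rule image_eqI)
      show "(q, s) = cinv ?C (snd c q, s)" unfolding cinvC[OF conjunct2[OF q]] using q by (simp add: cinv_chart[OF charts[OF c(1)]])
      show "(snd c q, s) \<in> ?O1" using q by simp
    qed
  qed
  have "holomorphic_chart (prod_topology X euclideanreal) (cyl A) J_cyl z"
    unfolding holomorphic_chart_def
  proof (intro conjI ballI)
    show "is_chart (prod_topology X euclideanreal) z" unfolding z_def by (rule ic(1))
    show "smooth_compat d z" if "d \<in> cyl A" for d
      unfolding z_def by (rule cyl.smooth_compat_compose[OF C that oO1 O1 oO2 Zh sZ sZ'])
    fix Q u assume Q: "Q \<in> fst z" and u: "u \<in> tangent_space (cyl A) Q"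
    obtain q s where qs: "Q = (q, s)" by (cases Q)
    have q: "q \<in> fst c" "snd c q \<in> U'" using Q unfolding qs mem by auto
    note u' = u[unfolded qs]
    note Cq = C cyl_chart_mem[OF q(1), of s]
    let ?x = "snd c q"
    interpret tp: taut_point "N1 c ?x" "N2 c ?x" "V1 c ?x" "V2 c ?x" by (rule taut_point[OF c(1) q(1)])
    define F where "F a = Complex (N1 c ?x \<bullet> fst a) (N2 c ?x \<bullet> fst a)" for a :: "(real^3) \<times> real"
    define G where "G a = frechet_derivative h (at ?x) (fst a) - of_real (snd a)" for a :: "(real^3) \<times> real"
    have hd: "(h has_derivative frechet_derivative h (at ?x)) (at ?x)" by (rule smooth_on_has_derivative[OF L(5) q(2)])
    have Zd: "(Z has_derivative (\<lambda>a. vector [F a, G a])) (at (?x, s))"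
    proof (rule has_derivative_vec2)
      have fs: "((\<lambda>y. fst y) has_derivative (\<lambda>a. fst a)) (at (?x, s))" by (rule has_derivative_fst[OF has_derivative_ident])
      have "((\<lambda>y. f (fst y)) has_derivative F) (at (?x, s))"
        unfolding F_def by (rule has_derivative_compose[OF fs]) (simp add: L(6)[OF q(2)])
      then show "((\<lambda>y. Z y $ 1) has_derivative (\<lambda>a. (vector [F a, G a] :: complex ^ 2) $ 1)) (at (?x, s))"
        by (simp add: Z_def)
      have "((\<lambda>y. h (fst y)) has_derivative (\<lambda>a. frechet_derivative h (at ?x) (fst a))) (at (?x, s))"
        by (rule has_derivative_compose[OF fs]) (simp add: hd)
      from has_derivative_diff[OF this has_derivative_of_real[OF has_derivative_snd[OF has_derivative_ident]]]
      show "((\<lambda>y. Z y $ 2) has_derivative (\<lambda>a. (vector [F a, G a] :: complex ^ 2) $ 2)) (at (?x, s))"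
        by (simp add: Z_def G_def)
    qed
    have zd: "((snd z \<circ> cinv ?C) has_derivative (\<lambda>a. vector [F a, G a])) (at (snd ?C (q, s)))"
      unfolding snd_cyl_chart
    proof (rule has_derivative_transform_within_open[OF Zd oO1])
      show "(?x, s) \<in> ?O1" using q by simp
      show "Z y = (snd z \<circ> cinv ?C) y" if "y \<in> ?O1" for y
      proof -
        have "snd ?C (cinv ?C y) = y" by (rule cinv_in(2)) (use that O1 in blast)
        then show ?thesis by (simp add: z_def)
      qed
    qed
    \<comment> \<open>\<open>dt \<and> df + df \<and> dh = df \<and> d (h - t)\<close>, where
      \<open>F\<close> and \<open>G\<close> are the differentials of \<open>f\<close> and
      \<open>h - t\<close>.\<close>
    have W: "tp.W a b = F a * G b - F b * G a" for a b
    proof -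
      have "tp.W a b = of_real (snd a) * F b - of_real (snd b) * F a
          + Complex (V1 c ?x \<bullet> cross3 (fst a) (fst b)) (V2 c ?x \<bullet> cross3 (fst a) (fst b))"
        by (simp add: tp.W_def cyl_pairing_def F_def complex_eq_iff)
      then show ?thesis unfolding L(7)[OF q(2)] by (simp add: F_def G_def algebra_simps)
    qed
    \<comment> \<open>\<open>f\<close> does not depend on \<open>t\<close>, \<open>h - t\<close> has
      \<open>t\<close>-derivative \<open>- 1\<close>, and the real part of \<open>F tp.S\<close> is
      \<open>n1 \<bullet> V1\<close>: these are the test values required by
      \<open>holomorphic_covectors\<close>.\<close>
    have FT: "F tp.T = 0" by (simp add: F_def tp.T_def complex_eq_iff)
    have GT: "G tp.T \<noteq> 0" using linear_0[OF has_derivative_linear[OF hd]] by (simp add: G_def tp.T_def)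
    have FS: "F tp.S \<noteq> 0" using tp.nz by (simp add: F_def tp.S_def complex_eq_iff)
    note hol = tp.holomorphic_covectors[OF W FT GT FS]
    have "differential (cyl A) (snd z) (q, s) u = vector [F (u ?C), G (u ?C)]"
      by (rule cyl.differential_chart[OF Cq u' zd])
    moreover have "differential (cyl A) (snd z) (q, s) (J_cyl (q, s) u) = vector [F (tp.J (u ?C)), G (tp.J (u ?C))]"
      using cyl.differential_chart[OF Cq J_cyl(1)[OF c(1) q(1) u'] zd] unfolding J_cyl(2)[OF c(1) q(1) u'] .
    ultimately show "differential (cyl A) (snd z) Q (J_cyl Q u) = \<i> *s differential (cyl A) (snd z) Q u"
      unfolding qs hol by (simp add: vec_eq_iff forall_2)
  qed
  moreover have "P \<in> fst z" unfolding c(3) mem using c(2) L(2) by blast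
  ultimately show ?thesis using that by blast
qed

lemma complex_structure_J_cyl: "complex_structure (prod_topology X euclideanreal) (cyl A) J_cyl"
  unfolding complex_structure_def
proof (intro conjI ballI almost_complex_J_cyl)
  fix P assume "P \<in> pts (cyl A)"
  from holomorphic_chart_exists[OF this]
  show "\<exists>z :: ('a \<times> real, complex ^ 2) chart. P \<in> fst z \<and> holomorphic_chart (prod_topology X euclideanreal) (cyl A) J_cyl z"
    by metis
qed

end

section \<open>The theorem\<close>

theorem mainTheorem3:
  fixes X :: "'a topology"
    and A :: "('a, real ^ 3) chart set"
    and \<eta>1 \<eta>2 \<Omega>1 \<Omega>2 :: "('a, real ^ 3, real) form"
    and \<omega>1 \<omega>2 \<mu> :: "('a \<times> real, (real ^ 3) \<times> real, real) form"
  assumes "smooth_manifold X A"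
    and "cosymplectic A \<eta>1 \<Omega>1"
    and "cosymplectic A \<eta>2 \<Omega>2"
    and "\<omega>1 = cyl_form A \<eta>1 \<Omega>1"
    and "\<omega>2 = cyl_form A \<eta>2 \<Omega>2"
    and "\<mu> = cyl_orientation A \<eta>1 \<Omega>1"
  shows
    "(conformal_symplectic_couple (cyl A) \<mu> \<omega>1 \<omega>2
        \<longleftrightarrow> taut_cosymplectic_circle A \<eta>1 \<Omega>1 \<eta>2 \<Omega>2) \<and>
     (taut_cosymplectic_circle A \<eta>1 \<Omega>1 \<eta>2 \<Omega>2 \<longrightarrow>
       (\<exists>J. complex_structure (prod_topology X euclideanreal) (cyl A) J \<and>
            forms_2_0_from_couple (cyl A) \<mu> \<omega>1 \<omega>2 J \<and>
            (\<forall>J'. complex_structure (prod_topology X euclideanreal) (cyl A) J' \<and>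
                  forms_2_0_from_couple (cyl A) \<mu> \<omega>1 \<omega>2 J' \<longrightarrow> endo_eq (cyl A) J' J) \<and>
            endomorphism (cyl A) J \<and> intertwines (cyl A) \<omega>1 \<omega>2 J \<and>
            (\<forall>J'. endomorphism (cyl A) J' \<and> intertwines (cyl A) \<omega>1 \<omega>2 J' \<longrightarrow>
                  endo_eq (cyl A) J' J)))"
proof -
  interpret smooth_atlas3 X A
    by unfold_locales (use assms(1) in \<open>simp_all add: smooth_manifold_def\<close>)
  have "conformal_symplectic_couple (cyl A) \<mu> \<omega>1 \<omega>2 \<longleftrightarrow> taut_cosymplectic_circle A \<eta>1 \<Omega>1 \<eta>2 \<Omega>2"
  proof
    assume "conformal_symplectic_couple (cyl A) \<mu> \<omega>1 \<omega>2"
    then have "conformal_couple (cyl A) \<mu> (cyl_form A \<eta>1 \<Omega>1) (cyl_form A \<eta>2 \<Omega>2)"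
      unfolding assms(4,5) conformal_symplectic_couple_def by (elim conjE)
    from couple_imp_taut_fields[OF assms(2,3) this]
    show "taut_cosymplectic_circle A \<eta>1 \<Omega>1 \<eta>2 \<Omega>2" by (rule taut_fields_imp_taut_circle[OF assms(2,3)])
  next
    assume "taut_cosymplectic_circle A \<eta>1 \<Omega>1 \<eta>2 \<Omega>2"
    from taut_fields_imp_couple[OF assms(2,3) taut_circle_imp_taut_fields[OF assms(2,3) this]]
    show "conformal_symplectic_couple (cyl A) \<mu> \<omega>1 \<omega>2" unfolding assms(4-6) .
  qed
  moreover have "\<exists>J. complex_structure (prod_topology X euclideanreal) (cyl A) J \<and>
            forms_2_0_from_couple (cyl A) \<mu> \<omega>1 \<omega>2 J \<and>
            (\<forall>J'. complex_structure (prod_topology X euclideanreal) (cyl A) J' \<and>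
                  forms_2_0_from_couple (cyl A) \<mu> \<omega>1 \<omega>2 J' \<longrightarrow> endo_eq (cyl A) J' J) \<and>
            endomorphism (cyl A) J \<and> intertwines (cyl A) \<omega>1 \<omega>2 J \<and>
            (\<forall>J'. endomorphism (cyl A) J' \<and> intertwines (cyl A) \<omega>1 \<omega>2 J' \<longrightarrow>
                  endo_eq (cyl A) J' J)"
    if t: "taut_cosymplectic_circle A \<eta>1 \<Omega>1 \<eta>2 \<Omega>2"
  proof -
    interpret tp: taut_pair X A \<eta>1 \<Omega>1 \<eta>2 \<Omega>2
      by (unfold_locales) (rule assms(2), rule assms(3), rule taut_circle_imp_taut_fields[OF assms(2,3) t])
    have endo: "endomorphism (cyl A) J'" if "complex_structure (prod_topology X euclideanreal) (cyl A) J'" for J'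
      using that by (simp add: complex_structure_def almost_complex_def)
    show ?thesis
      unfolding assms(4-6)
      using tp.complex_structure_J_cyl tp.forms_2_0_J_cyl tp.endomorphism_J_cyl tp.intertwines_J_cyl
        tp.endo_eq_of_forms_2_0[OF endo] tp.endo_eq_of_intertwines
      by (intro exI[of _ tp.J_cyl]) simp
  qed
  ultimately show ?thesis by blast
qed

end
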